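(* For every $b\in{\mathbb R}$ the operator $\mathcal W_b$ extends from $\mathcal D$ to a unitary operator on $L^2({\mathbb T}^d)$, and $(\mathcal W_b)_{b\in{\mathbb R}}$ is a strongly continuous one-parameter group of unitaries. Its generator $\widehat A=\frac1\imath\partial_b\mathcal W_b|_{b=0}$ is self-adjoint, $\mathcal D$ is a core for $\widehat A$, on $\mathcal D$ it acts as $\widehat A\phi=\frac1\imath\big(\langle\widehat X,\nabla\phi\rangle+\frac12\mathrm{div}(\widehat X)\phi\big)$, and $$\imath[\widehat A,\widehat H_0]=F(\widehat H_0),\qquad \imath[\widehat A,f(\widehat H_0)]=\mathbf 1$$ (as identities on $\mathcal D$).
   Context: Let $d\ge1$ and ${\mathbb T}^d={\mathbb R}^d/(2\pi{\mathbb Z}^d)$. Let ${\mathcal E}:{\mathbb T}^d\to{\mathbb R}$ be real-analytic and a Morse function (every critical point has invertible Hessian); let $\mathcal C$ be its finite set of critical points. Assume exactly two critical points have definite Hessian: the global minimum $k_-^*$ with value $E_-$ and the global maximum $k_+^*$ with value $E_+>E_-$; all other critical points have indefinite Hessian and critical values in $(E_-,E_+)$. Let $\widehat H_0$ be the operator of multiplication by ${\mathcal E}$ on $L^2({\mathbb T}^d)$. Let $F:[E_-,E_+]\to[0,\infty)$ be real-analytic, vanishing only at $E_\pm$, and vanishing linearly there ($F(E)\le C|E-E_-|$, $F(E)\le C|E_+-E|$). Let $E_r\in(E_-,E_+)$ and $f(E)=\int_{E_r}^E\frac{de}{F(e)}$ for $E\in(E_-,E_+)$ (with $f(\widehat H_0)$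 defined by functional calculus). Define the vector field $\widehat X(k)=F({\mathcal E}(k))\nabla{\mathcal E}(k)/|\nabla{\mathcal E}(k)|^2$ on ${\mathbb T}^d\setminus\mathcal C$ with flow $\theta_b$ ($\partial_b\theta_b=\widehat X\circ\theta_b$, $\theta_0=\mathrm{id}$). Let $\mathcal C_M$ be the union of $\mathcal C$ with the set of points whose orbit reaches $\mathcal C$ in finite positive or negative time; the flow is complete on ${\mathbb T}^d\setminus\mathcal C_M$. Let $\mathcal D$ be the set of smooth functions on ${\mathbb T}^d$ vanishing on a neighborhood of $\mathcal C_M$. For $\phi\in\mathcal D$ define $(\mathcal W_b\phi)(k)=\exp\big(\frac12\int_0^b\mathrm{div}(\widehat X)(\theta_u(k))\,du\big)\,\phi(\theta_b(k))$ for $k\notin\mathcal C_M$ and $(\mathcal W_b\phi)(k)=0$ for $k\in\mathcal C_M$. *)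

theory Defs
  imports "HOL-Analysis.Analysis"
begin

definition lattice_vec :: "('d::finite \<Rightarrow> int) \<Rightarrow> real^'d" where
  "lattice_vec n = (\<chi> i. 2 * pi * of_int (n i))"

definition periodic_T :: "(real^'d::finite \<Rightarrow> 'b) \<Rightarrow> bool" where
  "periodic_T g \<longleftrightarrow> (\<forall>k n. g (k + lattice_vec n) = g k)"

definition lat_eq :: "real^'d::finite \<Rightarrow> real^'d \<Rightarrow> bool" where
  "lat_eq k k' \<longleftrightarrow> (\<exists>n. k' = k + lattice_vec n)"

definition torus_box :: "(real^'d::finite) set" where
  "torus_box = {k. \<forall>i. 0 \<le> k$i \<and> k$i \<le> 2 * pi}"

definition real_analytic_R :: "(real \<Rightarrow> real) \<Rightarrow> real set \<Rightarrow> bool" where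
  "real_analytic_R F S \<longleftrightarrow> (\<forall>x\<in>S. \<exists>r>0. \<exists>c::nat \<Rightarrow> real.
      \<forall>y\<in>ball x r. (\<lambda>n. c n * (y - x) ^ n) sums F y)"

definition real_analytic_Rd :: "(real^'d::finite \<Rightarrow> real) \<Rightarrow> bool" where
  "real_analytic_Rd E \<longleftrightarrow> (\<forall>x. \<exists>r>0. \<exists>c::('d \<Rightarrow> nat) \<Rightarrow> real.
      \<forall>y\<in>ball x r. ((\<lambda>\<alpha>. c \<alpha> * (\<Prod>i\<in>UNIV. (y$i - x$i) ^ \<alpha> i)) has_sum E y) UNIV)"

fun iter_dd :: "(real^'d::finite) list \<Rightarrow> (real^'d \<Rightarrow> complex) \<Rightarrow> real^'d \<Rightarrow> complex" where
  "iter_dd [] \<phi> = \<phi>"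
| "iter_dd (v # vs) \<phi> = (\<lambda>x. frechet_derivative (iter_dd vs \<phi>) (at x) v)"

definition smooth_fun :: "(real^'d::finite \<Rightarrow> complex) \<Rightarrow> bool" where
  "smooth_fun \<phi> \<longleftrightarrow> (\<forall>vs x. iter_dd vs \<phi> differentiable (at x))"

definition gradient :: "(real^'d::finite \<Rightarrow> real) \<Rightarrow> real^'d \<Rightarrow> real^'d" where
  "gradient E k = (\<chi> i. frechet_derivative E (at k) (axis i 1))"

definition hessian :: "(real^'d::finite \<Rightarrow> real) \<Rightarrow> real^'d \<Rightarrow> real^'d \<Rightarrow> real^'d" where
  "hessian E k = frechet_derivative (gradient E) (at k)"

definition crit :: "(real^'d::finite \<Rightarrow> real) \<Rightarrow> (real^'d) set" where
  "crit E = {k. gradient E k = 0}"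

definition definite :: "(real^'d::finite \<Rightarrow> real^'d) \<Rightarrow> bool" where
  "definite H \<longleftrightarrow> (\<forall>v. v \<noteq> 0 \<longrightarrow> v \<bullet> H v > 0) \<or> (\<forall>v. v \<noteq> 0 \<longrightarrow> v \<bullet> H v < 0)"

definition morse :: "(real^'d::finite \<Rightarrow> real) \<Rightarrow> bool" where
  "morse E \<longleftrightarrow> (\<forall>k\<in>crit E. E differentiable (at k) \<and> gradient E differentiable (at k)
                      \<and> inj (hessian E k))"

definition divergence :: "(real^'d::finite \<Rightarrow> real^'d) \<Rightarrow> real^'d \<Rightarrow> real" where
  "divergence X k = (\<Sum>i\<in>UNIV. frechet_derivative X (at k) (axis i 1) $ i)"

definition Xfield :: "(real^'d::finite \<Rightarrow> real) \<Rightarrow> (real \<Rightarrow> real) \<Rightarrow> real^'d \<Rightarrow> real^'d" where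
  "Xfield E F k = (F (E k) / (norm (gradient E k))\<^sup>2) *\<^sub>R gradient E k"

definition is_orbit :: "(real^'d::finite \<Rightarrow> real) \<Rightarrow> (real \<Rightarrow> real) \<Rightarrow> real^'d \<Rightarrow> (real \<Rightarrow> real^'d) \<Rightarrow> bool" where
  "is_orbit E F k \<gamma> \<longleftrightarrow> \<gamma> 0 = k \<and> (\<forall>t. \<gamma> t \<notin> crit E) \<and>
      (\<forall>t. (\<gamma> has_vector_derivative Xfield E F (\<gamma> t)) (at t))"

definition CM :: "(real^'d::finite \<Rightarrow> real) \<Rightarrow> (real \<Rightarrow> real) \<Rightarrow> (real^'d) set" where
  "CM E F = {k. \<not> (\<exists>\<gamma>. is_orbit E F k \<gamma>)}"

definition flow :: "(real^'d::finite \<Rightarrow> real) \<Rightarrow> (real \<Rightarrow> real) \<Rightarrow> real \<Rightarrow> real^'d \<Rightarrow> real^'d" where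
  "flow E F b k = (SOME \<gamma>. is_orbit E F k \<gamma>) b"

definition Wop :: "(real^'d::finite \<Rightarrow> real) \<Rightarrow> (real \<Rightarrow> real) \<Rightarrow> real
                    \<Rightarrow> (real^'d \<Rightarrow> complex) \<Rightarrow> real^'d \<Rightarrow> complex" where
  "Wop E F b \<phi> k = (if k \<in> CM E F then 0 else
     complex_of_real (exp (1/2 * (LBINT u=0..b. divergence (Xfield E F) (flow E F u k))))
       * \<phi> (flow E F b k))"

definition Dset :: "(real^'d::finite \<Rightarrow> real) \<Rightarrow> (real \<Rightarrow> real) \<Rightarrow> (real^'d \<Rightarrow> complex) set" where
  "Dset E F = {\<phi>. smooth_fun \<phi> \<and> periodic_T \<phi> \<and>
      (\<exists>U. open U \<and> CM E F \<subseteq> U \<and> (\<forall>k\<in>U. \<phi> k = 0))}"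

definition Aexpr :: "(real^'d::finite \<Rightarrow> real) \<Rightarrow> (real \<Rightarrow> real) \<Rightarrow> (real^'d \<Rightarrow> complex) \<Rightarrow> real^'d \<Rightarrow> complex" where
  "Aexpr E F \<phi> k = - \<i> * (frechet_derivative \<phi> (at k) (Xfield E F k)
       + complex_of_real (divergence (Xfield E F) k / 2) * \<phi> k)"

definition L2T :: "(real^'d::finite \<Rightarrow> complex) set" where
  "L2T = {g. periodic_T g \<and> g \<in> borel_measurable lborel \<and>
             set_integrable lborel torus_box (\<lambda>k. (cmod (g k))\<^sup>2)}"

definition l2inner :: "(real^'d::finite \<Rightarrow> complex) \<Rightarrow> (real^'d \<Rightarrow> complex) \<Rightarrow> complex" where
  "l2inner g h = (LINT k:torus_box|lborel. cnj (g k) * h k)"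

definition l2norm :: "(real^'d::finite \<Rightarrow> complex) \<Rightarrow> real" where
  "l2norm g = sqrt (LINT k:torus_box|lborel. (cmod (g k))\<^sup>2)"

definition aeq :: "(real^'d::finite \<Rightarrow> complex) \<Rightarrow> (real^'d \<Rightarrow> complex) \<Rightarrow> bool" where
  "aeq g h \<longleftrightarrow> (AE k in lborel. k \<in> torus_box \<longrightarrow> g k = h k)"

text \<open>U is a unitary operator on L^2 (acting on representatives, well defined up to a.e. equality).\<close>
definition unitary_L2 :: "((real^'d::finite \<Rightarrow> complex) \<Rightarrow> (real^'d \<Rightarrow> complex)) \<Rightarrow> bool" where
  "unitary_L2 U \<longleftrightarrow>
     (\<forall>g\<in>L2T. U g \<in> L2T) \<and>
     (\<forall>g\<in>L2T. \<forall>h\<in>L2T. aeq g h \<longrightarrow> aeq (U g) (U h)) \<and>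
     (\<forall>g\<in>L2T. \<forall>h\<in>L2T. \<forall>c. aeq (U (\<lambda>k. c * g k + h k)) (\<lambda>k. c * U g k + U h k)) \<and>
     (\<forall>g\<in>L2T. \<forall>h\<in>L2T. l2inner (U g) (U h) = l2inner g h) \<and>
     (\<forall>h\<in>L2T. \<exists>g\<in>L2T. aeq (U g) h)"

definition strongly_continuous_unitary_group ::
  "(real \<Rightarrow> (real^'d::finite \<Rightarrow> complex) \<Rightarrow> (real^'d \<Rightarrow> complex)) \<Rightarrow> bool" where
  "strongly_continuous_unitary_group U \<longleftrightarrow>
     (\<forall>b. unitary_L2 (U b)) \<and>
     (\<forall>g\<in>L2T. aeq (U 0 g) g) \<and>
     (\<forall>g\<in>L2T. \<forall>a b. aeq (U (a + b) g) (U a (U b g))) \<and>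
     (\<forall>g\<in>L2T. \<forall>b0. ((\<lambda>b. l2norm (\<lambda>k. U b g k - U b0 g k)) \<longlongrightarrow> 0) (at b0))"

text \<open>Graph of the generator A = (1/i) d/db U_b at b = 0 (strong derivative in L^2).\<close>
definition generator ::
  "(real \<Rightarrow> (real^'d::finite \<Rightarrow> complex) \<Rightarrow> (real^'d \<Rightarrow> complex))
     \<Rightarrow> (real^'d \<Rightarrow> complex) \<Rightarrow> (real^'d \<Rightarrow> complex) \<Rightarrow> bool" where
  "generator U g h \<longleftrightarrow> g \<in> L2T \<and> h \<in> L2T \<and>
     ((\<lambda>b. l2norm (\<lambda>k. (U b g k - g k) / (\<i> * complex_of_real b) - h k)) \<longlongrightarrow> 0) (at 0)"

definition self_adjoint_L2 ::
  "((real^'d::finite \<Rightarrow> complex) \<Rightarrow> (real^'d \<Rightarrow> complex) \<Rightarrow> bool) \<Rightarrow> bool" where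
  "self_adjoint_L2 G \<longleftrightarrow>
     (\<forall>g h. G g h \<longrightarrow> g \<in> L2T \<and> h \<in> L2T) \<and>
     (\<forall>\<psi>\<in>L2T. \<forall>\<epsilon>>0. \<exists>g h. G g h \<and> l2norm (\<lambda>k. g k - \<psi> k) < \<epsilon>) \<and>
     (\<forall>\<psi>\<in>L2T. \<forall>\<eta>\<in>L2T. G \<psi> \<eta> \<longleftrightarrow> (\<forall>g h. G g h \<longrightarrow> l2inner h \<psi> = l2inner g \<eta>))"

definition is_core ::
  "((real^'d::finite \<Rightarrow> complex) \<Rightarrow> (real^'d \<Rightarrow> complex) \<Rightarrow> bool) \<Rightarrow> (real^'d \<Rightarrow> complex) set \<Rightarrow> bool" where
  "is_core G D \<longleftrightarrow> (\<forall>\<phi>\<in>D. \<exists>h. G \<phi> h) \<and>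
     (\<forall>g h. G g h \<longrightarrow> (\<exists>\<phi>s hs. (\<forall>n. \<phi>s n \<in> D \<and> G (\<phi>s n) (hs n)) \<and>
        (\<lambda>n. l2norm (\<lambda>k. \<phi>s n k - g k)) \<longlonglongrightarrow> 0 \<and>
        (\<lambda>n. l2norm (\<lambda>k. hs n k - h k)) \<longlonglongrightarrow> 0))"

end

theory Submission
  imports Defs "HOL-Computational_Algebra.Polynomial"
begin

text \<open>
  The field \<open>X\<close> is the gradient field of \<open>E\<close> with its speed adjusted so that \<open>E\<close> evolves by
  \<open>dE/db = F(E)\<close>, i.e. \<open>f(E)\<close> grows linearly. Hence its orbits are reparametrised gradient orbits, and they
  are complete exactly on the open set of points whose gradient orbit runs from the minimum to the
  maximum: the two extreme values are not reached in finite time because \<open>F\<close> vanishes linearly there,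
  while saddles are. The complement is a countable union of stable and unstable sets of saddles. Such a
  set is null: the quadratic form of the Hessian expands differences of nearby gradient orbits in the directions
  where it is positive, so translates of the local stable set in such a direction are disjoint.

  On \<open>C\<^sup>1\<close> functions vanishing near the bad set, \<open>W\<^sub>b\<close> is a group that preserves the \<open>L\<^sup>2\<close> norm, since
  the derivative of the squared norm is the integral of a divergence. Such functions are dense, so \<open>W\<^sub>b\<close> acts
  isometrically on all of \<open>L\<^sup>2\<close> (pointwise a.e., by Fatou's lemma along a subsequence). Self-adjointness
  of the generator is obtained by duality; for the core property, Riemann sums of
  \<open>\<tau>\<^sup>-\<^sup>1 \<integral>\<^sub>0\<^sup>\<tau> W\<^sub>s \<phi> ds\<close> stay in the \<open>C\<^sup>1\<close> class and are then mollified into \<open>\<D>\<close>. Both commutation relations are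
  the product rule together with \<open>\<langle>X, \<nabla>E\<rangle> = F(E)\<close>.
\<close>

section \<open>Flows of vector fields with Lipschitz derivative\<close>

text \<open>The field X = F(E) grad E / |grad E|^2 blows up at the saddles, so it is never
  integrated directly. The gradient field is periodic and analytic; its flow \<open>phi\<close> is
  global and C^1, and an orbit of X arises from it through a change of time \<open>sg\<close>,
  defined by the scalar equation that f(E) has grown by b. Regularity of the flow of X thus reduces
  to regularity of \<open>phi\<close> and to the inverse function theorem for one scalar unknown.
  The weight of W_b is a second obstacle: its spatial derivative would be that of an integral of div
  X along moving orbits. Writing X = gg * grad E gives this integral a closed form, in which the
  only accumulated quantity is the Laplacian of E along the gradient orbit. Hence the Laplacian is
  carried along as an extra component of the gradient flow. The flow is controlled to first order
  only, so the class shown to be invariant under W_b is \<open>K1\<close> and not the smooth class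
  of the statement. This is why the core property ends with a mollification, which must also control
  the singular coefficients of the generator.\<close>

lemma has_vector_derivative_imp_continuous_on:
  "(\<And>t. (u has_vector_derivative u' t) (at t)) \<Longrightarrow> continuous_on A u"
  by (intro continuous_at_imp_continuous_on ballI has_vector_derivative_continuous)

lemma has_vector_derivative_reflect:
  assumes "(u has_vector_derivative d) (at (- s))"
  shows "((\<lambda>t. u (- t)) has_vector_derivative - d) (at s)"
proof -
  have "(u \<circ> uminus has_vector_derivative - 1 *\<^sub>R d) (at s)"
    by (rule vector_diff_chain_at) (auto intro!: derivative_eq_intros assms)
  then show ?thesis by (simp add: o_def)
qed

lemma has_vector_derivative_shift_time:
  assumes "(u has_vector_derivative d) (at (s + t))"
  shows "((\<lambda>s. u (s + t)) has_vector_derivative d) (at s)"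
proof -
  have "(u \<circ> (\<lambda>s. s + t) has_vector_derivative 1 *\<^sub>R d) (at s)"
    by (rule vector_diff_chain_at) (auto intro!: derivative_eq_intros assms)
  then show ?thesis by (simp add: o_def)
qed

section \<open>Antiderivatives and global existence of solutions\<close>

lemma continuous_has_antiderivative:
  fixes h :: "real \<Rightarrow> 'a::euclidean_space"
  assumes "continuous_on UNIV h"
  obtains H where "H 0 = 0" "\<And>t. (H has_vector_derivative h t) (at t)"
proof -
  have "isCont h t" for t
    using assms by (simp add: continuous_on_eq_continuous_at)
  then obtain H where H: "\<And>t. (H has_vector_derivative h t) (at t)"
    using einterval_antiderivative[of "-\<infinity>" "\<infinity>" h] by auto
  show thesis
    by (rule that[of "\<lambda>t. H t - H 0"]) (auto intro!: derivative_eq_intros H)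
qed

text \<open>Integration reproduces the bound M exp(c|t|) with M / c in place of M. A large c
  therefore gains a small factor for all times at once, which is what makes the Picard operator
  contract on the whole line.\<close>

lemma exp_weighted_antiderivative_bound:
  fixes H :: "real \<Rightarrow> 'a::real_normed_vector"
  assumes H: "\<And>t. (H has_vector_derivative h t) (at t)" and H0: "H 0 = 0"
    and le: "\<And>t. norm (h t) \<le> M * exp (c * \<bar>t\<bar>)" and c: "c > 0"
  shows "norm (H t) \<le> (M / c) * exp (c * \<bar>t\<bar>)"
proof -
  have M: "M \<ge> 0" using order_trans[OF norm_ge_zero le[of 0]] by simp
  have fwd: "norm (H' t) \<le> (M / c) * exp (c * t)"
    if H': "\<And>t. (H' has_vector_derivative h' t) (at t)" "H' 0 = 0"
      and le': "\<And>t. norm (h' t) \<le> M * exp (c * \<bar>t\<bar>)" and t: "t \<ge> 0" for H' h' :: "real \<Rightarrow> 'a" and t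
  proof (cases "t = 0")
    case True then show ?thesis using that M c by simp
  next
    case False
    have "norm (H' t - H' 0) \<le> (M / c) * exp (c * t) - (M / c) * exp (c * 0)"
    proof (rule differentiable_bound_general[where f' = h' and \<phi>' = "\<lambda>t. M * exp (c * t)"])
      show "0 < t" using False t by simp
      show "continuous_on {0..t} H'"
        by (rule has_vector_derivative_imp_continuous_on) (rule H'(1))
      show "((\<lambda>t. M / c * exp (c * t)) has_vector_derivative M * exp (c * x)) (at x)" for x
        using c unfolding has_real_derivative_iff_has_vector_derivative[symmetric]
        by (auto intro!: derivative_eq_intros)
      show "norm (h' x) \<le> M * exp (c * x)" if "0 < x" for x using le'[of x] that by simp
    qed (use c in \<open>auto intro!: continuous_intros H'(1)\<close>)
    moreover have "0 \<le> M / c" using M c by simp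
    ultimately show ?thesis using H'(2) by simp
  qed
  show ?thesis
  proof (cases "t \<ge> 0")
    case True then show ?thesis using fwd[OF H H0 le] by simp
  next
    case False
    have "((\<lambda>t. H (- t)) has_vector_derivative - h (- t)) (at t)" for t
      by (rule has_vector_derivative_reflect[OF H])
    from fwd[OF this, of "- t"] H0 le[of "- _"] False show ?thesis by simp
  qed
qed

text \<open>Solutions are sought in the form w(t) v(t) with v bounded and w an exponential weight
  (Bielecki's norm). In this norm the Picard operator contracts on the whole time line, so one
  application of Banach's fixed point theorem gives a global solution without continuation of local
  ones.\<close>

lemma picard_lindeloef_global:
  fixes f :: "real \<Rightarrow> 'a::euclidean_space \<Rightarrow> 'a"
  assumes cont: "continuous_on UNIV (\<lambda>(t, x). f t x)"
    and lip: "\<And>t x y. norm (f t x - f t y) \<le> L * norm (x - y)"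
    and bd: "\<And>t. norm (f t 0) \<le> B" and L: "L > 0"
  shows "\<exists>u. u 0 = x0 \<and> (\<forall>t. (u has_vector_derivative f t (u t)) (at t))"
proof -
  \<comment> \<open>The contraction factor will be L / c, here 1/2.\<close>
  define c where "c = 2 * L"
  have c: "c > 0" using L by (simp add: c_def)
  define w where "w t = exp (c * \<bar>t\<bar>)" for t :: real
  have w1: "w t \<ge> 1" for t using c by (simp add: w_def)
  have wc: "continuous_on UNIV w" unfolding w_def by (intro continuous_intros)
  have fc: "continuous_on UNIV (\<lambda>t. f t (w t *\<^sub>R apply_bcontfun v t))" for v :: "real \<Rightarrow>\<^sub>C 'a"
  proof -
    have "continuous_on UNIV (\<lambda>t. (t, w t *\<^sub>R apply_bcontfun v t))" by (intro continuous_intros wc) auto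
    from continuous_on_compose2[OF cont this] show ?thesis by simp
  qed
  have "\<exists>H. H 0 = 0 \<and> (\<forall>t. (H has_vector_derivative f t (w t *\<^sub>R apply_bcontfun v t)) (at t))" for v :: "real \<Rightarrow>\<^sub>C 'a"
    using continuous_has_antiderivative[OF fc[of v]] by metis
  then obtain H where H0: "\<And>v. H v 0 = 0"
    and H: "\<And>v t. (H v has_vector_derivative f t (w t *\<^sub>R apply_bcontfun v t)) (at t)" by metis
  \<comment> \<open>The Picard operator, conjugated by the weight so that it acts on bounded
    continuous functions.\<close>
  define T where "T v t = (1 / w t) *\<^sub>R (x0 + H v t)" for v t
  have Hcont: "continuous_on UNIV (H v)" for v
    by (rule has_vector_derivative_imp_continuous_on) (rule H)
  have "T v \<in> bcontfun" for v
  proof (rule bcontfun_normI)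
    show "continuous_on UNIV (T v)" unfolding T_def
      using w1 by (intro continuous_intros wc Hcont) (metis not_one_le_zero)
    fix t
    have "norm (f t (w t *\<^sub>R apply_bcontfun v t)) \<le> (B + L * norm v) * exp (c * \<bar>t\<bar>)" for t
    proof -
      have "norm (f t (w t *\<^sub>R apply_bcontfun v t)) \<le> norm (f t 0) + norm (f t (w t *\<^sub>R apply_bcontfun v t) - f t 0)"
        by (simp add: norm_triangle_sub)
      also have "\<dots> \<le> B + L * (w t * norm (apply_bcontfun v t))"
        using bd[of t] lip[of t "w t *\<^sub>R apply_bcontfun v t" 0] w1[of t] by simp
      also have "\<dots> \<le> B * w t + L * (w t * norm v)"
      proof (intro add_mono mult_left_mono)
        have "B \<ge> 0" using bd[of 0] norm_ge_zero[of "f 0 0"] by linarith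
        then show "B \<le> B * w t" using w1[of t] by (simp add: mult_le_cancel_left1)
        show "norm (apply_bcontfun v t) \<le> norm v" by (rule norm_bounded)
      qed (use L w1[of t] in auto)
      finally show ?thesis by (simp add: w_def algebra_simps)
    qed
    from exp_weighted_antiderivative_bound[OF H H0 this c]
    have "norm (H v t) \<le> (B + L * norm v) / c * w t" by (simp add: w_def)
    then have "norm (T v t) \<le> (norm x0 + (B + L * norm v) / c * w t) / w t"
      using w1[of t] norm_triangle_ineq[of x0 "H v t"] by (simp add: T_def divide_right_mono)
    also have "\<dots> \<le> norm x0 + (B + L * norm v) / c"
      using w1[of t] by (simp add: add_divide_distrib divide_le_eq mult_le_cancel_left1)
    finally show "norm (T v t) \<le> norm x0 + (B + L * norm v) / c" .
  qed
  then have ap: "apply_bcontfun (Bcontfun (T v)) = T v" for v by (simp add: Bcontfun_inverse)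
  have "dist (Bcontfun (T v)) (Bcontfun (T v')) \<le> 1/2 * dist v v'" for v v'
  proof (rule dist_bound)
    fix t
    have "((\<lambda>t. H v t - H v' t) has_vector_derivative
        f t (w t *\<^sub>R apply_bcontfun v t) - f t (w t *\<^sub>R apply_bcontfun v' t)) (at t)" for t
      by (intro derivative_intros H)
    moreover have "norm (f t (w t *\<^sub>R apply_bcontfun v t) - f t (w t *\<^sub>R apply_bcontfun v' t))
        \<le> (L * dist v v') * exp (c * \<bar>t\<bar>)" for t
    proof -
      have "norm (f t (w t *\<^sub>R apply_bcontfun v t) - f t (w t *\<^sub>R apply_bcontfun v' t))
         \<le> L * norm (w t *\<^sub>R apply_bcontfun v t - w t *\<^sub>R apply_bcontfun v' t)" by (rule lip)
      also have "\<dots> = L * (w t * dist (apply_bcontfun v t) (apply_bcontfun v' t))"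
        using w1[of t] by (simp add: dist_norm flip: scaleR_diff_right)
      also have "\<dots> \<le> L * (w t * dist v v')"
        using L w1[of t] by (intro mult_left_mono dist_bounded) auto
      finally show ?thesis by (simp add: w_def algebra_simps)
    qed
    ultimately have "norm (H v t - H v' t) \<le> (L * dist v v') / c * exp (c * \<bar>t\<bar>)"
      by (intro exp_weighted_antiderivative_bound[OF _ _ _ c]) (auto simp: H0)
    then have "norm (H v t - H v' t) \<le> (dist v v' / 2) * w t" using L by (simp add: c_def w_def)
    moreover have "dist (T v t) (T v' t) = norm (H v t - H v' t) / w t"
      using w1[of t] by (simp add: T_def dist_norm flip: scaleR_diff_right)
    ultimately show "dist (apply_bcontfun (Bcontfun (T v)) t) (apply_bcontfun (Bcontfun (T v')) t) \<le> 1/2 * dist v v'"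
      using w1[of t] by (simp add: ap divide_le_eq)
  qed
  then obtain v where v: "Bcontfun (T v) = v"
    using banach_fix_type[of "1/2" "\<lambda>v. Bcontfun (T v)"] by auto
  then have "apply_bcontfun v t = T v t" for t by (metis ap)
  then have e: "w t *\<^sub>R apply_bcontfun v t = x0 + H v t" for t
    using w1[of t] by (simp add: T_def)
  have "((\<lambda>t. x0 + H v t) has_vector_derivative f t (x0 + H v t)) (at t)" for t
    using H[of v t] by (auto simp: e intro!: derivative_eq_intros)
  then show ?thesis by (intro exI[of _ "\<lambda>t. x0 + H v t"]) (simp add: H0)
qed

text \<open>The estimate is made for |u|^2 + K^2, which stays differentiable where u vanishes. The
  inequality 2 K |u| <= |u|^2 + K^2 absorbs the inhomogeneity and explains the exponent 2 L +
  1.\<close>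

lemma gronwall_forward:
  fixes u :: "real \<Rightarrow> 'a::real_inner"
  assumes u: "\<And>t. 0 \<le> t \<Longrightarrow> t \<le> T \<Longrightarrow> (u has_vector_derivative h t) (at t)"
    and le: "\<And>t. 0 \<le> t \<Longrightarrow> t \<le> T \<Longrightarrow> norm (h t) \<le> L * norm (u t) + K"
    and K: "K \<ge> 0" and L: "L \<ge> 0" and T: "T \<ge> 0"
  shows "(norm (u T))\<^sup>2 + K\<^sup>2 \<le> exp ((2 * L + 1) * T) * ((norm (u 0))\<^sup>2 + K\<^sup>2)"
proof -
  define c where "c = 2 * L + 1"
  define n where "n t = exp (- c * t) * (u t \<bullet> u t + K\<^sup>2)" for t
  have dn: "(n has_real_derivative exp (- c * t) * (2 * (u t \<bullet> h t) - c * (u t \<bullet> u t + K\<^sup>2))) (at t)"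
    if "0 \<le> t" "t \<le> T" for t
  proof -
    have "((\<lambda>t. u t \<bullet> u t) has_real_derivative 2 * (u t \<bullet> h t)) (at t)"
      using has_derivative_inner[OF u[OF that, unfolded has_vector_derivative_def] u[OF that, unfolded has_vector_derivative_def]]
      unfolding has_field_derivative_def
      by (rule has_derivative_eq_rhs) (auto simp: algebra_simps inner_commute)
    then show ?thesis unfolding n_def
      by (auto intro!: derivative_eq_intros simp: algebra_simps)
  qed
  have "n T \<le> n 0"
  proof (rule DERIV_nonpos_imp_nonincreasing[OF T])
    fix t assume t: "0 \<le> t" "t \<le> T"
    have "u t \<bullet> h t \<le> norm (u t) * norm (h t)" by (rule norm_cauchy_schwarz)
    also have "\<dots> \<le> norm (u t) * (L * norm (u t) + K)"
      using le[OF t] by (intro mult_left_mono) auto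
    finally have "2 * (u t \<bullet> h t) \<le> 2 * (norm (u t) * (L * norm (u t) + K))" by simp
    also have "\<dots> \<le> 2 * L * (norm (u t))\<^sup>2 + (norm (u t))\<^sup>2 + K\<^sup>2"
      using zero_le_power2[of "norm (u t) - K"] by (simp add: power2_eq_square algebra_simps)
    also have "\<dots> \<le> c * (u t \<bullet> u t + K\<^sup>2)"
      using L by (simp add: c_def dot_square_norm algebra_simps)
    finally have "2 * (u t \<bullet> h t) - c * (u t \<bullet> u t + K\<^sup>2) \<le> 0" by simp
    then show "\<exists>y. (n has_real_derivative y) (at t) \<and> y \<le> 0"
      using dn[OF t] by (intro exI conjI) (auto simp: mult_nonneg_nonpos)
  qed
  then have "exp (c * T) * n T \<le> exp (c * T) * n 0" by simp
  then show ?thesis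
    by (simp add: n_def dot_square_norm mult_exp_exp flip: mult.assoc) (simp add: c_def)
qed

lemma gronwall:
  fixes u :: "real \<Rightarrow> 'a::real_inner"
  assumes u: "\<And>t. \<bar>t\<bar> \<le> T \<Longrightarrow> (u has_vector_derivative h t) (at t)"
    and le: "\<And>t. \<bar>t\<bar> \<le> T \<Longrightarrow> norm (h t) \<le> L * norm (u t) + K"
    and K: "K \<ge> 0" and L: "L \<ge> 0" and t: "\<bar>t\<bar> \<le> T"
  shows "(norm (u t))\<^sup>2 + K\<^sup>2 \<le> exp ((2 * L + 1) * T) * ((norm (u 0))\<^sup>2 + K\<^sup>2)"
proof -
  have "(norm (u t))\<^sup>2 + K\<^sup>2 \<le> exp ((2 * L + 1) * \<bar>t\<bar>) * ((norm (u 0))\<^sup>2 + K\<^sup>2)"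
  proof (cases "t \<ge> 0")
    case True
    then show ?thesis using gronwall_forward[of t u h L K] assms by auto
  next
    case False
    have "((\<lambda>t. u (- t)) has_vector_derivative - h (- s)) (at s)" if "\<bar>s\<bar> \<le> T" for s
      using that by (intro has_vector_derivative_reflect u) simp
    then show ?thesis
      using gronwall_forward[of "- t" "\<lambda>t. u (- t)" "\<lambda>t. - h (- t)" L K] False assms by auto
  qed
  also have "\<dots> \<le> exp ((2 * L + 1) * T) * ((norm (u 0))\<^sup>2 + K\<^sup>2)"
    using t L by (intro mult_right_mono) (auto intro!: mult_left_mono)
  finally show ?thesis .
qed

lemma gronwall_homogeneous:
  fixes u :: "real \<Rightarrow> 'a::real_inner"
  assumes "\<And>t. \<bar>t\<bar> \<le> T \<Longrightarrow> (u has_vector_derivative h t) (at t)"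
    and "\<And>t. \<bar>t\<bar> \<le> T \<Longrightarrow> norm (h t) \<le> L * norm (u t)" and "L \<ge> 0" and t: "\<bar>t\<bar> \<le> T"
  shows "norm (u t) \<le> exp ((L + 1/2) * T) * norm (u 0)"
proof -
  have "(norm (u t))\<^sup>2 \<le> exp ((2 * L + 1) * T) * (norm (u 0))\<^sup>2"
    using gronwall[of T u h L 0 t] assms by simp
  also have "\<dots> = (exp ((L + 1/2) * T) * norm (u 0))\<^sup>2"
    by (simp add: power_mult_distrib algebra_simps exp_double[symmetric])
  finally show ?thesis by (rule power2_le_imp_le) simp
qed

lemma gronwall_zero_start:
  fixes u :: "real \<Rightarrow> 'a::real_inner"
  assumes "\<And>t. \<bar>t\<bar> \<le> T \<Longrightarrow> (u has_vector_derivative h t) (at t)"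
    and "\<And>t. \<bar>t\<bar> \<le> T \<Longrightarrow> norm (h t) \<le> L * norm (u t) + K" and "L \<ge> 0" "K \<ge> 0"
    and t: "\<bar>t\<bar> \<le> T" and "u 0 = 0"
  shows "norm (u t) \<le> exp ((L + 1/2) * T) * K"
proof -
  have "(norm (u t))\<^sup>2 \<le> exp ((2 * L + 1) * T) * K\<^sup>2"
  proof -
    have "(norm (u t))\<^sup>2 + K\<^sup>2 \<le> exp ((2 * L + 1) * T) * ((norm (u 0))\<^sup>2 + K\<^sup>2)"
      by (rule gronwall) (use assms in auto)
    then show ?thesis using \<open>u 0 = 0\<close> order_trans[of "(norm (u t))\<^sup>2" "(norm (u t))\<^sup>2 + K\<^sup>2"] by simp
  qed
  also have "\<dots> = (exp ((L + 1/2) * T) * K)\<^sup>2"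
    by (simp add: power_mult_distrib algebra_simps exp_double[symmetric])
  finally show ?thesis by (rule power2_le_imp_le) (use assms in simp)
qed

text \<open>The Lipschitz condition on the derivative makes the Taylor remainder of \<open>Y\<close>
  quadratic, so differentiability of the flow in space and continuity of that derivative both come
  from Gronwall estimates.\<close>

locale C1_field =
  fixes Y :: "'a::euclidean_space \<Rightarrow> 'a" and DY :: "'a \<Rightarrow> 'a \<Rightarrow> 'a" and L L' :: real
  assumes deriv: "\<And>x. (Y has_derivative DY x) (at x)"
    and DY_bound: "\<And>x h. norm (DY x h) \<le> L * norm h"
    and DY_lipschitz: "\<And>x y h. norm (DY x h - DY y h) \<le> L' * norm (x - y) * norm h"
    and L_pos: "L > 0" and L'_nonneg: "L' \<ge> 0"
begin

lemma Y_lipschitz: "norm (Y x - Y y) \<le> L * norm (x - y)"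
  by (rule differentiable_bound[of UNIV Y DY]) (auto intro!: onorm_le DY_bound deriv)

lemma Y_linear_remainder: "norm (Y y - Y x - DY x (y - x)) \<le> L' * (norm (y - x))\<^sup>2"
proof -
  interpret D: bounded_linear "DY x" by (rule has_derivative_bounded_linear[OF deriv])
  have "norm ((Y y - DY x y) - (Y x - DY x x)) \<le> L' * norm (y - x) * norm (y - x)"
  proof (rule differentiable_bound[of "cball x (norm (y - x))" "\<lambda>z. Y z - DY x z" "\<lambda>z h. DY z h - DY x h"])
    fix z assume z: "z \<in> cball x (norm (y - x))"
    show "((\<lambda>z. Y z - DY x z) has_derivative (\<lambda>h. DY z h - DY x h)) (at z within cball x (norm (y - x)))"
      by (intro derivative_intros has_derivative_at_withinI[OF deriv] D.has_derivative has_derivative_ident)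
    show "onorm (\<lambda>h. DY z h - DY x h) \<le> L' * norm (y - x)"
    proof (rule onorm_le)
      fix h
      have "norm (DY z h - DY x h) \<le> L' * norm (z - x) * norm h" by (rule DY_lipschitz)
      also have "\<dots> \<le> L' * norm (y - x) * norm h"
        using z L'_nonneg by (intro mult_right_mono mult_left_mono) (auto simp: dist_norm norm_minus_commute)
      finally show "norm (DY z h - DY x h) \<le> L' * norm (y - x) * norm h" .
    qed
  qed (auto simp: dist_norm norm_minus_commute)
  then show ?thesis by (simp add: D.diff power2_eq_square algebra_simps)
qed

lemma Y_continuous: "continuous_on A Y"
  by (intro continuous_at_imp_continuous_on ballI has_derivative_continuous[OF deriv])

section \<open>The flow: uniqueness, group law, joint continuity\<close>

definition fl :: "real \<Rightarrow> 'a \<Rightarrow> 'a" where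
  "fl t x = (SOME u. u 0 = x \<and> (\<forall>t. (u has_vector_derivative Y (u t)) (at t))) t"

lemma fl_solution: "fl 0 x = x" "((\<lambda>t. fl t x) has_vector_derivative Y (fl t x)) (at t)"
proof -
  have "\<exists>u. u 0 = x \<and> (\<forall>t. (u has_vector_derivative Y (u t)) (at t))"
    by (rule picard_lindeloef_global[of "\<lambda>_. Y" L "norm (Y 0)"])
       (auto intro!: Y_lipschitz L_pos continuous_on_compose2[OF Y_continuous[of UNIV]] continuous_intros simp: case_prod_beta)
  from someI_ex[OF this] show "fl 0 x = x" "((\<lambda>t. fl t x) has_vector_derivative Y (fl t x)) (at t)"
    unfolding fl_def by auto
qed

text \<open>Uniqueness is stated for time-rescaled solutions, so that it also identifies
  orbits of fields proportional to \<^term>\<open>Y\<close>.\<close>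

lemma rescaled_solution_unique:
  assumes a: "continuous_on UNIV (a :: real \<Rightarrow> real)"
    and u: "\<And>t. (u has_vector_derivative a t *\<^sub>R Y (u t)) (at t)"
    and v: "\<And>t. (v has_vector_derivative a t *\<^sub>R Y (v t)) (at t)" and "u 0 = v 0"
  shows "u t = v t"
proof -
  have "compact (a ` {-\<bar>t\<bar>..\<bar>t\<bar>})" by (intro compact_continuous_image continuous_on_subset[OF a]) auto
  then obtain M where M: "\<And>s. s \<in> {-\<bar>t\<bar>..\<bar>t\<bar>} \<Longrightarrow> \<bar>a s\<bar> \<le> M" "M > 0"
    using bounded_pos[of "a ` {-\<bar>t\<bar>..\<bar>t\<bar>}"] compact_imp_bounded by (metis imageI real_norm_def)
  have "norm (u t - v t) \<le> exp ((M * L + 1/2) * \<bar>t\<bar>) * norm (u 0 - v 0)"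
  proof (rule gronwall_homogeneous[of "\<bar>t\<bar>" "\<lambda>t. u t - v t" "\<lambda>t. a t *\<^sub>R Y (u t) - a t *\<^sub>R Y (v t)" "M * L" t])
    fix s assume s: "\<bar>s\<bar> \<le> \<bar>t\<bar>"
    have "norm (a s *\<^sub>R Y (u s) - a s *\<^sub>R Y (v s)) = \<bar>a s\<bar> * norm (Y (u s) - Y (v s))"
      by (simp flip: scaleR_diff_right)
    also have "\<dots> \<le> M * (L * norm (u s - v s))"
      using M(2) s by (intro mult_mono Y_lipschitz M(1)) (auto simp: abs_le_iff)
    finally show "norm (a s *\<^sub>R Y (u s) - a s *\<^sub>R Y (v s)) \<le> M * L * norm (u s - v s)" by (simp add: mult.assoc)
  qed (use M L_pos in \<open>auto intro!: derivative_intros u v\<close>)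
  then show ?thesis using assms by simp
qed

lemma fl_unique:
  assumes "u 0 = x" "\<And>t. (u has_vector_derivative Y (u t)) (at t)"
  shows "u t = fl t x"
  by (rule rescaled_solution_unique[of "\<lambda>_. 1"]) (use assms fl_solution in auto)

lemma fl_rescaled_unique:
  assumes a: "continuous_on UNIV (a :: real \<Rightarrow> real)"
    and u: "\<And>t. (u has_vector_derivative a t *\<^sub>R Y (u t)) (at t)"
    and S: "\<And>t. (S has_real_derivative a t) (at t)" and "S 0 = 0"
  shows "u t = fl (S t) (u 0)"
proof (rule rescaled_solution_unique[OF a u])
  show "((\<lambda>t. fl (S t) (u 0)) has_vector_derivative a t *\<^sub>R Y (fl (S t) (u 0))) (at t)" for t
    using vector_diff_chain_at[of S "a t" t "\<lambda>s. fl s (u 0)" "Y (fl (S t) (u 0))"] S[of t] fl_solution(2)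
    by (auto simp: o_def has_real_derivative_iff_has_vector_derivative)
qed (use assms fl_solution in auto)

lemma fl_add: "fl (s + t) x = fl s (fl t x)"
proof (rule fl_unique[of "\<lambda>s. fl (s + t) x"])
  show "((\<lambda>s. fl (s + t) x) has_vector_derivative Y (fl (s + t) x)) (at s)" for s
    by (rule has_vector_derivative_shift_time[OF fl_solution(2)])
qed simp

lemma fl_lipschitz:
  assumes "\<bar>t\<bar> \<le> T"
  shows "norm (fl t x - fl t y) \<le> exp ((L + 1/2) * T) * norm (x - y)"
proof -
  have "norm (fl t x - fl t y) \<le> exp ((L + 1/2) * T) * norm (fl 0 x - fl 0 y)"
    by (rule gronwall_homogeneous[of T _ "\<lambda>t. Y (fl t x) - Y (fl t y)"])
       (use assms L_pos Y_lipschitz in \<open>auto intro!: has_vector_derivative_diff fl_solution\<close>)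
  then show ?thesis by (simp add: fl_solution)
qed

lemma fl_continuous_time: "continuous_on A (\<lambda>t. fl t x)"
  by (rule has_vector_derivative_imp_continuous_on) (rule fl_solution)

lemma locally_lipschitz_continuous_prod:
  fixes w :: "real \<Rightarrow> 'a \<Rightarrow> 'a"
  assumes lip: "\<And>T. \<exists>C. \<forall>t x y. \<bar>t\<bar> \<le> T \<longrightarrow> norm (w t x - w t y) \<le> C * norm (x - y)"
    and ct: "\<And>x. continuous_on UNIV (\<lambda>t. w t x)"
  shows "continuous_on UNIV (\<lambda>(t, x). w t x)"
  unfolding continuous_on_def
proof safe
  fix t x
  obtain C where C: "\<And>s y. \<bar>s\<bar> \<le> \<bar>t\<bar> + 1 \<Longrightarrow> norm (w s y - w s x) \<le> C * norm (y - x)"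
    using lip[of "\<bar>t\<bar> + 1"] by auto
  have "((\<lambda>p. w (fst p) x) \<longlongrightarrow> w t x) (at (t, x))"
    using ct[of x] by (intro isCont_tendsto_compose[of t "\<lambda>t. w t x"] tendsto_eq_intros)
      (auto simp: continuous_on_eq_continuous_at)
  moreover have "((\<lambda>p. w (fst p) (snd p) - w (fst p) x) \<longlongrightarrow> 0) (at (t, x))"
  proof (rule Lim_null_comparison)
    have "((\<lambda>p. fst p) \<longlongrightarrow> t) (at (t, x))" by (auto intro!: tendsto_eq_intros)
    then have "eventually (\<lambda>p. dist (fst p) t < 1) (at (t, x))" by (rule tendstoD) simp
    then show "eventually (\<lambda>p. norm (w (fst p) (snd p) - w (fst p) x) \<le> C * norm (snd p - x)) (at (t, x))"
      by eventually_elim (rule C, auto simp: dist_real_def)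
    show "((\<lambda>p. C * norm (snd p - x)) \<longlongrightarrow> 0) (at (t, x))" by (auto intro!: tendsto_eq_intros)
  qed
  ultimately have "((\<lambda>p. w (fst p) (snd p) - w (fst p) x + w (fst p) x) \<longlongrightarrow> 0 + w t x) (at (t, x))"
    by (intro tendsto_add)
  then show "((\<lambda>(t, x). w t x) \<longlongrightarrow> w t x) (at (t, x))" by (simp add: case_prod_unfold)
qed

lemma fl_continuous: "continuous_on UNIV (\<lambda>(t, x). fl t x)"
proof (rule locally_lipschitz_continuous_prod)
  show "\<exists>C. \<forall>t x y. \<bar>t\<bar> \<le> T \<longrightarrow> norm (fl t x - fl t y) \<le> C * norm (x - y)" for T
    using fl_lipschitz[of _ T] by (intro exI allI impI)
qed (rule fl_continuous_time)

lemma continuous_on_fl [continuous_intros]: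
  "continuous_on A s \<Longrightarrow> continuous_on A g \<Longrightarrow> continuous_on A (\<lambda>p. fl (s p) (g p))"
  using continuous_on_compose2[OF fl_continuous, of A "\<lambda>p. (s p, g p)"] by (auto intro!: continuous_intros)

lemma DY_continuous: "continuous_on UNIV (\<lambda>(x, h). DY x h)"
proof -
  have "((\<lambda>(x, h). DY x h) \<longlongrightarrow> DY x h) (at (x, h))" for x h
  proof -
    interpret D: bounded_linear "DY x" by (rule has_derivative_bounded_linear[OF deriv])
    have "((\<lambda>p. DY (fst p) (snd p) - DY x (snd p)) \<longlongrightarrow> 0) (at (x, h))"
    proof (rule Lim_null_comparison)
      show "eventually (\<lambda>p. norm (DY (fst p) (snd p) - DY x (snd p)) \<le> L' * norm (fst p - x) * norm (snd p)) (at (x, h))"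
        by (simp add: DY_lipschitz)
      show "((\<lambda>p. L' * norm (fst p - x) * norm (snd p)) \<longlongrightarrow> 0) (at (x, h))" by (auto intro!: tendsto_eq_intros)
    qed
    moreover have "((\<lambda>p. DY x (snd p)) \<longlongrightarrow> DY x h) (at (x, h))"
      by (intro D.tendsto tendsto_eq_intros) auto
    ultimately have "((\<lambda>p. DY (fst p) (snd p) - DY x (snd p) + DY x (snd p)) \<longlongrightarrow> 0 + DY x h) (at (x, h))"
      by (intro tendsto_add)
    then show ?thesis by (simp add: case_prod_unfold)
  qed
  then show ?thesis by (auto simp: continuous_on_def)
qed

lemma continuous_on_DY [continuous_intros]:
  "continuous_on A s \<Longrightarrow> continuous_on A g \<Longrightarrow> continuous_on A (\<lambda>p. DY (s p) (g p))"
  using continuous_on_compose2[OF DY_continuous, of A "\<lambda>p. (s p, g p)"] by (auto intro!: continuous_intros)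

text \<open>Solution of the first variation equation along the orbit of x with initial vector h. It
  turns out to be the spatial derivative of the flow in direction h.\<close>

definition vfl :: "real \<Rightarrow> 'a \<Rightarrow> 'a \<Rightarrow> 'a" where
  "vfl t x h = (SOME u. u 0 = h \<and> (\<forall>t. (u has_vector_derivative DY (fl t x) (u t)) (at t))) t"

lemma DY_linear: "bounded_linear (DY x)"
  by (rule has_derivative_bounded_linear[OF deriv])

lemma vfl_solution: "vfl 0 x h = h" "((\<lambda>t. vfl t x h) has_vector_derivative DY (fl t x) (vfl t x h)) (at t)"
proof -
  have "\<exists>u. u 0 = h \<and> (\<forall>t. (u has_vector_derivative DY (fl t x) (u t)) (at t))"
  proof (rule picard_lindeloef_global[of "\<lambda>t. DY (fl t x)" L 0])
    show "continuous_on UNIV (\<lambda>(t, y). DY (fl t x) y)"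
      unfolding case_prod_beta by (intro continuous_intros)
    show "norm (DY (fl t x) y - DY (fl t x) z) \<le> L * norm (y - z)" for t y z
      by (simp add: DY_bound flip: linear_diff[OF bounded_linear.linear[OF DY_linear]])
    show "norm (DY (fl t x) 0) \<le> 0" for t using DY_bound[of "fl t x" 0] by simp
  qed (rule L_pos)
  from someI_ex[OF this] show "vfl 0 x h = h" "((\<lambda>t. vfl t x h) has_vector_derivative DY (fl t x) (vfl t x h)) (at t)"
    unfolding vfl_def by auto
qed

lemma vfl_unique:
  assumes "u 0 = h" "\<And>t. (u has_vector_derivative DY (fl t x) (u t)) (at t)"
  shows "u t = vfl t x h"
proof -
  have "norm (u t - vfl t x h) \<le> exp ((L + 1/2) * \<bar>t\<bar>) * norm (u 0 - vfl 0 x h)"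
  proof (rule gronwall_homogeneous)
    fix s
    show "((\<lambda>t. u t - vfl t x h) has_vector_derivative DY (fl s x) (u s) - DY (fl s x) (vfl s x h)) (at s)"
      by (intro derivative_intros assms vfl_solution)
    show "norm (DY (fl s x) (u s) - DY (fl s x) (vfl s x h)) \<le> L * norm (u s - vfl s x h)"
      by (simp add: DY_bound flip: linear_diff[OF bounded_linear.linear[OF DY_linear]])
  qed (use L_pos in auto)
  then show ?thesis using assms vfl_solution by simp
qed

lemma vfl_linear: "linear (vfl t x)"
proof (rule linearI)
  note lin = bounded_linear.linear[OF DY_linear]
  show "vfl t x (a + b) = vfl t x a + vfl t x b" for a b
    by (rule sym, rule vfl_unique) (auto simp: vfl_solution linear_add[OF lin] intro!: derivative_intros vfl_solution)
  show "vfl t x (r *\<^sub>R b) = r *\<^sub>R vfl t x b" for r b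
    by (rule sym, rule vfl_unique[of "\<lambda>t. r *\<^sub>R vfl t x b"])
       (auto simp: vfl_solution linear_scale[OF lin] intro!: derivative_eq_intros vfl_solution)
qed

lemma vfl_bound: "\<bar>t\<bar> \<le> T \<Longrightarrow> norm (vfl t x h) \<le> exp ((L + 1/2) * T) * norm h"
  using gronwall_homogeneous[OF vfl_solution(2) DY_bound, of t T x h] L_pos
  by (simp add: vfl_solution)

text \<open>The difference of the variations at x and at y starts at 0 and solves a linear equation
  whose source is at most L' times the distance of the two orbits times the variation at y, hence at
  most a multiple of |x - y|.\<close>

lemma vfl_continuous: "continuous_on UNIV (\<lambda>(t, x). vfl t x h)"
proof (rule locally_lipschitz_continuous_prod)
  show "continuous_on UNIV (\<lambda>t. vfl t x h)" for x
    by (rule has_vector_derivative_imp_continuous_on) (rule vfl_solution)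
  fix T :: real
  define c where "c = exp ((L + 1/2) * T)"
  have c0: "0 \<le> c" by (simp add: c_def)
  have "norm (vfl t x h - vfl t y h) \<le> (c * (L' * c * (c * norm h))) * norm (x - y)" if t: "\<bar>t\<bar> \<le> T" for t x y
  proof -
    have "norm (vfl t x h - vfl t y h) \<le> exp ((L + 1/2) * T) * (L' * (c * norm (x - y)) * (c * norm h))"
    proof (rule gronwall_zero_start[where h = "\<lambda>t. DY (fl t x) (vfl t x h) - DY (fl t y) (vfl t y h)", OF _ _ _ _ t])
      fix s assume s: "\<bar>s\<bar> \<le> T"
      show "((\<lambda>t. vfl t x h - vfl t y h) has_vector_derivative DY (fl s x) (vfl s x h) - DY (fl s y) (vfl s y h)) (at s)"
        by (intro derivative_intros vfl_solution)
      have eq: "DY (fl s x) (vfl s x h) - DY (fl s y) (vfl s y h)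
        = DY (fl s x) (vfl s x h - vfl s y h) + (DY (fl s x) (vfl s y h) - DY (fl s y) (vfl s y h))"
        by (simp add: linear_diff[OF bounded_linear.linear[OF DY_linear]])
      have "norm (DY (fl s x) (vfl s x h) - DY (fl s y) (vfl s y h))
        \<le> L * norm (vfl s x h - vfl s y h) + L' * norm (fl s x - fl s y) * norm (vfl s y h)"
        unfolding eq by (rule norm_triangle_le) (rule add_mono[OF DY_bound DY_lipschitz])
      also have "\<dots> \<le> L * norm (vfl s x h - vfl s y h) + L' * (c * norm (x - y)) * (c * norm h)"
      proof -
        have a: "norm (fl s x - fl s y) \<le> c * norm (x - y)" unfolding c_def by (rule fl_lipschitz[OF s])
        have b: "norm (vfl s y h) \<le> c * norm h" unfolding c_def by (rule vfl_bound[OF s])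
        show ?thesis
          by (rule add_left_mono[OF mult_mono[OF mult_left_mono[OF a L'_nonneg] b]]) (simp_all add: c0 L'_nonneg)
      qed
      finally show "norm (DY (fl s x) (vfl s x h) - DY (fl s y) (vfl s y h))
         \<le> L * norm (vfl s x h - vfl s y h) + L' * (c * norm (x - y)) * (c * norm h)" .
    qed (use L_pos L'_nonneg vfl_solution c0 in auto)
    then show ?thesis unfolding c_def[symmetric] by (simp add: ac_simps)
  qed
  then show "\<exists>C. \<forall>t x y. \<bar>t\<bar> \<le> T \<longrightarrow> norm (vfl t x h - vfl t y h) \<le> C * norm (x - y)" by blast
qed

text \<open>The remainder of the linear approximation starts at 0 and solves the linearised equation
  up to the Taylor remainder of \<open>Y\<close>, which is quadratic in the distance of the two
  orbits. Gronwall keeps it quadratic in |y - x|.\<close>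

lemma fl_has_derivative_space: "(fl t has_derivative vfl t x) (at x)"
proof -
  define T where "T = \<bar>t\<bar>"
  define c where "c = exp ((L + 1/2) * T)"
  have c0: "0 \<le> c" by (simp add: c_def)
  have le: "norm (fl t y - fl t x - vfl t x (y - x)) \<le> (c * (L' * c\<^sup>2)) * (norm (y - x))\<^sup>2" for y
  proof -
    have "norm (fl t y - fl t x - vfl t x (y - x)) \<le> exp ((L + 1/2) * T) * (L' * (c * norm (y - x))\<^sup>2)"
    proof (rule gronwall_zero_start[where h = "\<lambda>t. Y (fl t y) - Y (fl t x) - DY (fl t x) (vfl t x (y - x))"])
      fix s assume s: "\<bar>s\<bar> \<le> T"
      show "((\<lambda>t. fl t y - fl t x - vfl t x (y - x)) has_vector_derivative
          Y (fl s y) - Y (fl s x) - DY (fl s x) (vfl s x (y - x))) (at s)"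
        by (intro derivative_intros vfl_solution fl_solution)
      have eq: "Y (fl s y) - Y (fl s x) - DY (fl s x) (vfl s x (y - x))
        = DY (fl s x) (fl s y - fl s x - vfl s x (y - x)) + (Y (fl s y) - Y (fl s x) - DY (fl s x) (fl s y - fl s x))"
        by (simp add: linear_diff[OF bounded_linear.linear[OF DY_linear]])
      have "norm (Y (fl s y) - Y (fl s x) - DY (fl s x) (vfl s x (y - x)))
        \<le> L * norm (fl s y - fl s x - vfl s x (y - x)) + L' * (norm (fl s y - fl s x))\<^sup>2"
        unfolding eq by (rule norm_triangle_le) (rule add_mono[OF DY_bound Y_linear_remainder])
      also have "\<dots> \<le> L * norm (fl s y - fl s x - vfl s x (y - x)) + L' * (c * norm (y - x))\<^sup>2"
      proof -
        have a: "norm (fl s y - fl s x) \<le> c * norm (y - x)" unfolding c_def by (rule fl_lipschitz[OF s])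
        show ?thesis
          by (rule add_left_mono[OF mult_left_mono[OF power_mono[OF a norm_ge_zero] L'_nonneg]])
      qed
      finally show "norm (Y (fl s y) - Y (fl s x) - DY (fl s x) (vfl s x (y - x)))
         \<le> L * norm (fl s y - fl s x - vfl s x (y - x)) + L' * (c * norm (y - x))\<^sup>2" .
    qed (use L_pos L'_nonneg vfl_solution fl_solution in \<open>auto simp: T_def\<close>)
    then show ?thesis unfolding c_def[symmetric] by (simp add: power_mult_distrib ac_simps)
  qed
  define C where "C = c * (L' * c\<^sup>2)"
  show ?thesis
  proof (rule has_derivativeI)
    show "bounded_linear (vfl t x)" using vfl_linear by (simp add: linear_conv_bounded_linear)
    show "((\<lambda>y. ((fl t y - fl t x) - vfl t x (y - x)) /\<^sub>R norm (y - x)) \<longlongrightarrow> 0) (at x)"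
    proof (rule Lim_null_comparison)
      show "eventually (\<lambda>y. norm (((fl t y - fl t x) - vfl t x (y - x)) /\<^sub>R norm (y - x)) \<le> C * norm (y - x)) (at x)"
        using le by (intro always_eventually allI)
          (simp add: C_def power2_eq_square divide_simps flip: divide_inverse_commute mult.assoc)
      show "((\<lambda>y. C * norm (y - x)) \<longlongrightarrow> 0) (at x)" by (auto intro!: tendsto_eq_intros)
    qed
  qed
qed

lemma fl_has_derivative:
  "((\<lambda>(t, x). fl t x) has_derivative (\<lambda>(\<tau>, h). \<tau> *\<^sub>R Y (fl t x) + vfl t x h)) (at (t, x))"
proof -
  \<comment> \<open>The criterion for partial derivatives asks for joint continuity of the partial
    derivative in the second slot. Time is put there, since its partial derivative is
    \<open>Y\<close> composed with the jointly continuous flow.\<close>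
  have "((\<lambda>(x, t). fl t x) has_derivative (\<lambda>(h, \<tau>). vfl t x h + blinfun_apply (blinfun_scaleR_left (Y (fl t x))) \<tau>))
      (at (x, t) within UNIV \<times> UNIV)"
  proof (rule has_derivative_partialsI)
    show "(fl t has_derivative vfl t x) (at x)" by (rule fl_has_derivative_space)
    show "((\<lambda>t. fl t x) has_derivative blinfun_apply (blinfun_scaleR_left (Y (fl t x)))) (at t)" for t x
      using fl_solution(2)[of x t] by (simp add: has_vector_derivative_def blinfun_scaleR_left.rep_eq)
    have "continuous_on UNIV (\<lambda>(x, t). blinfun_scaleR_left (Y (fl t x)))"
      unfolding case_prod_beta
      by (intro bounded_linear.continuous_on[OF bounded_linear_blinfun_scaleR_left]
          continuous_on_compose2[OF Y_continuous[of UNIV]] continuous_intros) auto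
    then show "continuous (at (x, t) within UNIV \<times> UNIV) (\<lambda>(x, t). blinfun_scaleR_left (Y (fl t x)))"
      by (simp add: continuous_on_eq_continuous_at)
  qed auto
  then have d: "((\<lambda>(x, t). fl t x) has_derivative (\<lambda>(h, \<tau>). vfl t x h + \<tau> *\<^sub>R Y (fl t x))) (at (x, t))"
    by (simp add: blinfun_scaleR_left.rep_eq)
  have "((\<lambda>p. (snd p, fst p)) has_derivative (\<lambda>p. (snd p, fst p))) (at (t, x))" by (auto intro!: derivative_eq_intros)
  then have "((\<lambda>p. (\<lambda>(x, t). fl t x) (snd p, fst p)) has_derivative
      (\<lambda>p. (\<lambda>(h, \<tau>). vfl t x h + \<tau> *\<^sub>R Y (fl t x)) (snd p, fst p))) (at (t, x))"
    by (rule has_derivative_compose) (simp add: d)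
  then show ?thesis by (simp add: case_prod_unfold add.commute)
qed

end

section \<open>Derivatives of analytic functions\<close>

abbreviation pderiv_at :: "'d::finite \<Rightarrow> (real^'d \<Rightarrow> real) \<Rightarrow> real^'d \<Rightarrow> real" where
  "pderiv_at i E \<equiv> (\<lambda>y. frechet_derivative E (at y) (axis i 1))"

text \<open>Convergence at the point x + (\<rho>0, ..., \<rho>0) is absolute and bounds the
  coefficients through the summable family \<open>M\<close>. At half that distance the exponents
  produced by differentiation are absorbed by powers of 2. The multi-indices are then enumerated, so
  that termwise differentiation of an ordinary series of functions applies.\<close>

lemma multi_power_series_has_derivative:
  fixes E :: "real^'d::finite \<Rightarrow> real"
  assumes S: "\<And>y. y \<in> ball x r \<Longrightarrow> ((\<lambda>\<alpha>. c \<alpha> * (\<Prod>i\<in>UNIV. (y$i - x$i) ^ \<alpha> i)) has_sum E y) UNIV"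
    and r: "r > 0"
  shows "\<exists>\<rho>>0. \<exists>D. \<forall>y\<in>ball x \<rho>. (E has_derivative (\<lambda>h. \<Sum>i\<in>UNIV. D i y * h$i)) (at y) \<and>
    (\<forall>i. ((\<lambda>\<alpha>. (real (\<alpha> i) + 1) * c (\<alpha>(i := Suc (\<alpha> i))) * (\<Prod>j\<in>UNIV. (y$j - x$j) ^ \<alpha> j)) has_sum D i y) UNIV)"
proof -
  \<comment> \<open>The vector with all entries \<rho>0 has l1 norm \<open>CARD('d)\<close> times
    \<rho>0, which is less than r, so it stays in the ball of convergence.\<close>
  define \<rho>0 where "\<rho>0 = r / (real CARD('d) + 1)"
  have r0: "\<rho>0 > 0" using r by (simp add: \<rho>0_def)
  define \<rho> where "\<rho> = min (\<rho>0 / 2) r"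
  have \<rho>: "\<rho> > 0" "\<rho> \<le> \<rho>0 / 2" "\<rho> \<le> r" using r r0 by (auto simp: \<rho>_def)
  define M where "M \<alpha> = \<bar>c \<alpha>\<bar> * \<rho>0 ^ (\<Sum>i\<in>UNIV. \<alpha> i)" for \<alpha> :: "'d \<Rightarrow> nat"
  have M0: "M \<alpha> \<ge> 0" for \<alpha> using r0 by (simp add: M_def)
  have Msum: "M summable_on UNIV"
  proof -
    define z :: "real^'d" where "z = (\<chi> i. \<rho>0)"
    have "norm z \<le> (\<Sum>i\<in>UNIV. \<bar>z$i\<bar>)" by (rule norm_le_l1_cart)
    also have "\<dots> < r" using r r0 by (simp add: z_def \<rho>0_def divide_simps)
    finally have "x + z \<in> ball x r" by (simp add: dist_norm)
    from has_sum_imp_summable[OF S[OF this]]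
    have "(\<lambda>\<alpha>. c \<alpha> * (\<Prod>i\<in>UNIV. \<rho>0 ^ \<alpha> i)) summable_on UNIV" by (simp add: z_def)
    then have "(\<lambda>\<alpha>. norm (c \<alpha> * (\<Prod>i\<in>UNIV. \<rho>0 ^ \<alpha> i))) summable_on UNIV"
      by (rule summable_on_iff_abs_summable_on_real[THEN iffD1])
    moreover have "norm (c \<alpha> * (\<Prod>i\<in>UNIV. \<rho>0 ^ \<alpha> i)) = M \<alpha>" for \<alpha>
      using r0 by (simp add: M_def abs_mult abs_prod power_sum)
    ultimately show ?thesis by simp
  qed
  define P where "P i \<alpha> y = c \<alpha> * (real (\<alpha> i) * (y$i - x$i) ^ (\<alpha> i - 1) * (\<Prod>j\<in>UNIV - {i}. (y$j - x$j) ^ \<alpha> j))"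
    for i \<alpha> and y :: "real^'d"
  \<comment> \<open>With n the total degree, 2^n (\<rho>0/2)^(n-1) = (2/\<rho>0) \<rho>0^n, where
    2^n bounds the exponent that differentiation brings down.\<close>
  define K where "K = 2 / \<rho>0"
  have K0: "K > 0" using r0 by (simp add: K_def)
  have Pb: "norm (P i \<alpha> y) \<le> K * M \<alpha>" if y: "y \<in> ball x \<rho>" for i \<alpha> y
  proof (cases "\<alpha> i = 0")
    case True then show ?thesis using K0 M0 by (simp add: P_def)
  next
    case False
    have yi: "\<bar>y$j - x$j\<bar> \<le> \<rho>" for j
      using y component_le_norm_cart[of "y - x" j] by (simp add: dist_norm norm_minus_commute)
    define n where "n = (\<Sum>j\<in>UNIV. \<alpha> j)"
    have ns: "n = \<alpha> i + (\<Sum>j\<in>UNIV - {i}. \<alpha> j)" unfolding n_def by (simp add: sum.remove[of _ i])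
    have "\<bar>(y$i - x$i) ^ (\<alpha> i - 1) * (\<Prod>j\<in>UNIV - {i}. (y$j - x$j) ^ \<alpha> j)\<bar>
       \<le> \<rho> ^ (\<alpha> i - 1) * (\<Prod>j\<in>UNIV - {i}. \<rho> ^ \<alpha> j)"
      unfolding abs_mult abs_prod power_abs using \<rho> yi
      by (intro mult_mono power_mono prod_mono) (auto intro!: power_mono prod_nonneg)
    also have "\<dots> = \<rho> ^ (n - 1)"
      using False ns by (simp flip: power_add power_sum)
    also have "\<dots> \<le> (\<rho>0 / 2) ^ (n - 1)" using \<rho> by (intro power_mono) auto
    finally have *: "\<bar>(y$i - x$i) ^ (\<alpha> i - 1) * (\<Prod>j\<in>UNIV - {i}. (y$j - x$j) ^ \<alpha> j)\<bar> \<le> (\<rho>0 / 2) ^ (n - 1)" .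
    have "\<bar>P i \<alpha> y\<bar> = \<bar>c \<alpha>\<bar> * (real (\<alpha> i) * \<bar>(y$i - x$i) ^ (\<alpha> i - 1) * (\<Prod>j\<in>UNIV - {i}. (y$j - x$j) ^ \<alpha> j)\<bar>)"
      by (simp add: P_def abs_mult)
    also have "\<dots> \<le> \<bar>c \<alpha>\<bar> * (2 ^ n * (\<rho>0 / 2) ^ (n - 1))"
    proof (intro mult_left_mono mult_mono *)
      have "\<alpha> i \<le> n" using ns by simp
      also have "n < 2 ^ n" by (rule less_exp)
      finally show "real (\<alpha> i) \<le> 2 ^ n" by (metis less_imp_le of_nat_less_numeral_power_cancel_iff)
    qed auto
    also have "\<dots> = K * M \<alpha>"
    proof -
      obtain m where "n = Suc m" using False ns not0_implies_Suc[of n] by auto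
      then show ?thesis using r0 by (simp add: K_def M_def n_def[symmetric] power_divide)
    qed
    finally show ?thesis by simp
  qed
  have Pabs: "(\<lambda>\<alpha>. P i \<alpha> y) summable_on UNIV" if "y \<in> ball x \<rho>" for i y
  proof -
    have "(\<lambda>\<alpha>. K * M \<alpha>) summable_on UNIV" using Msum by (rule summable_on_cmult_right)
    then have "(\<lambda>\<alpha>. norm (P i \<alpha> y)) summable_on UNIV"
      by (rule summable_on_comparison_test) (use Pb[OF that] in auto)
    then show ?thesis by (rule abs_summable_summable)
  qed
  define D where "D i y = infsum (\<lambda>\<alpha>. P i \<alpha> y) UNIV" for i y
  have inf: "infinite (UNIV :: ('d \<Rightarrow> nat) set)"
  proof
    assume "finite (UNIV :: ('d \<Rightarrow> nat) set)"
    then have "finite (range (\<lambda>n::nat. (\<lambda>_::'d. n)))" by (rule rev_finite_subset) simp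
    then show False by (auto dest!: finite_imageD simp: inj_on_def fun_eq_iff)
  qed
  define e where "e = from_nat_into (UNIV :: ('d \<Rightarrow> nat) set)"
  have e: "bij_betw e UNIV UNIV" unfolding e_def by (rule bij_betw_from_nat_into) (use inf in auto)
  have via_e: "(\<lambda>n. q (e n)) sums s" if "(q has_sum s) UNIV" for q :: "('d \<Rightarrow> nat) \<Rightarrow> real" and s
    using that has_sum_reindex_bij_betw[OF e, of q s] has_sum_imp_sums by blast
  have Me: "summable (\<lambda>n. K * M (e n))"
    using via_e[OF has_sum_infsum[OF Msum]] by (intro summable_mult) (rule sums_summable)
  define f where "f n y = c (e n) * (\<Prod>i\<in>UNIV. (y$i - x$i) ^ e n i)" for n y
  have fd: "(f n has_derivative (\<lambda>h. \<Sum>i\<in>UNIV. P i (e n) y * h$i)) (at y within A)" for n y A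
  proof -
    have lin: "((\<lambda>y. y$i - x$i) has_derivative (\<lambda>h. h$i)) (at y within A)" for i
      using has_derivative_diff[OF bounded_linear_imp_has_derivative[OF bounded_linear_vec_nth[of i], of "at y within A"] has_derivative_const[of "x$i"]]
      by simp
    have "((\<lambda>y. (y$i - x$i) ^ m) has_derivative (\<lambda>h. real m * (h$i * (y$i - x$i) ^ (m - 1)))) (at y within A)" for i m
      using has_derivative_power[OF lin[of i], of m] by (simp add: mult.assoc)
    then have "((\<lambda>y. \<Prod>i\<in>UNIV. (y$i - x$i) ^ e n i) has_derivative (\<lambda>h. \<Sum>i\<in>UNIV.
        (real (e n i) * (h$i * (y$i - x$i) ^ (e n i - 1))) * (\<Prod>j\<in>UNIV - {i}. (y$j - x$j) ^ e n j))) (at y within A)"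
      by (intro has_derivative_prod)
    from has_derivative_mult_right[OF this, of "c (e n)"]
    show ?thesis unfolding f_def
      by (rule has_derivative_eq_rhs) (simp add: P_def fun_eq_iff sum_distrib_left ac_simps)
  qed
  have "\<exists>g. \<forall>y\<in>ball x \<rho>. (\<lambda>n. f n y) sums (g y) \<and> (g has_derivative (\<lambda>h. \<Sum>i\<in>UNIV. D i y * h$i)) (at y within ball x \<rho>)"
  proof (rule has_derivative_series[where x = x and l = "E x"])
    show "(\<lambda>n. f n x) sums E x" unfolding f_def using S[of x] r by (intro via_e) auto
    fix \<epsilon> :: real assume "\<epsilon> > 0"
    then obtain N where N: "\<And>n. n \<ge> N \<Longrightarrow> norm (\<Sum>k. K * M (e (k + n))) < \<epsilon> / CARD('d)"
      using suminf_exist_split[OF _ Me, of "\<epsilon> / CARD('d)"] by (auto simp: field_simps)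
    have "norm ((\<Sum>k<n. \<Sum>i\<in>UNIV. P i (e k) y * h$i) - (\<Sum>i\<in>UNIV. D i y * h$i)) \<le> \<epsilon> * norm h"
      if n: "n \<ge> N" and y: "y \<in> ball x \<rho>" for n y h
    proof -
      have tail: "\<bar>(\<Sum>k<n. P i (e k) y) - D i y\<bar> \<le> \<epsilon> / CARD('d)" for i
      proof -
        have s: "(\<lambda>k. P i (e k) y) sums D i y"
          unfolding D_def by (rule via_e[OF has_sum_infsum[OF Pabs[OF y]]])
        then have "D i y = (\<Sum>k. P i (e (k + n)) y) + (\<Sum>k<n. P i (e k) y)"
          using suminf_split_initial_segment[OF sums_summable[OF s], of n] sums_unique[OF s] by simp
        then have "\<bar>(\<Sum>k<n. P i (e k) y) - D i y\<bar> = norm (\<Sum>k. P i (e (k + n)) y)" by simp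
        also have "\<dots> \<le> (\<Sum>k. K * M (e (k + n)))"
          by (rule norm_suminf_le) (use Pb[OF y] Me summable_ignore_initial_segment[OF Me] in auto)
        also have "\<dots> \<le> \<epsilon> / CARD('d)" using N[OF n] by simp
        finally show ?thesis .
      qed
      have "(\<Sum>k<n. \<Sum>i\<in>UNIV. P i (e k) y * h$i) - (\<Sum>i\<in>UNIV. D i y * h$i)
         = (\<Sum>i\<in>UNIV. ((\<Sum>k<n. P i (e k) y) - D i y) * h$i)"
        by (subst sum.swap) (simp add: sum_subtractf sum_distrib_right left_diff_distrib)
      then have "norm ((\<Sum>k<n. \<Sum>i\<in>UNIV. P i (e k) y * h$i) - (\<Sum>i\<in>UNIV. D i y * h$i))
         \<le> (\<Sum>i\<in>UNIV. \<bar>(\<Sum>k<n. P i (e k) y) - D i y\<bar> * \<bar>h$i\<bar>)"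
        by (simp add: sum_abs flip: abs_mult)
      also have "\<dots> \<le> (\<Sum>i\<in>(UNIV::'d set). \<epsilon> / CARD('d) * norm h)"
        using \<open>\<epsilon> > 0\<close> by (intro sum_mono mult_mono tail component_le_norm_cart) auto
      finally show ?thesis by simp
    qed
    then show "\<forall>\<^sub>F n in sequentially. \<forall>y\<in>ball x \<rho>. \<forall>h. norm ((\<Sum>k<n. \<Sum>i\<in>UNIV. P i (e k) y * h$i) - (\<Sum>i\<in>UNIV. D i y * h$i)) \<le> \<epsilon> * norm h"
      unfolding eventually_sequentially by blast
  qed (use \<rho> fd in auto)
  then obtain g where g: "\<And>y. y \<in> ball x \<rho> \<Longrightarrow> (\<lambda>n. f n y) sums (g y)"
    "\<And>y. y \<in> ball x \<rho> \<Longrightarrow> (g has_derivative (\<lambda>h. \<Sum>i\<in>UNIV. D i y * h$i)) (at y within ball x \<rho>)" by blast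
  have gE: "g y = E y" if "y \<in> ball x \<rho>" for y
  proof -
    have "(\<lambda>n. f n y) sums E y" unfolding f_def using S[of y] that \<rho> by (intro via_e) auto
    then show ?thesis using g(1)[OF that] sums_unique2 by blast
  qed
  have "(E has_derivative (\<lambda>h. \<Sum>i\<in>UNIV. D i y * h$i)) (at y)" if y: "y \<in> ball x \<rho>" for y
    using has_derivative_transform[OF y gE[symmetric] g(2)[OF y]] at_within_open[OF y open_ball] by simp
  moreover have "((\<lambda>\<alpha>. (real (\<alpha> i) + 1) * c (\<alpha>(i := Suc (\<alpha> i))) * (\<Prod>j\<in>UNIV. (y$j - x$j) ^ \<alpha> j)) has_sum D i y) UNIV"
    if y: "y \<in> ball x \<rho>" for i y
  proof -
    \<comment> \<open>Raising the i-th exponent by one reindexes the differentiated series. The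
      multi-indices outside the range of \<open>Q\<close> have i-th exponent 0, and their
      differentiated terms vanish.\<close>
    define Q where "Q \<alpha> = \<alpha>(i := Suc (\<alpha> i))" for \<alpha> :: "'d \<Rightarrow> nat"
    have inj: "inj Q"
    proof (rule injI)
      fix a b assume "Q a = Q b"
      then have "a j = b j" for j by (metis Q_def fun_upd_same fun_upd_other nat.inject)
      then show "a = b" by auto
    qed
    have "((\<lambda>\<alpha>. P i \<alpha> y) has_sum D i y) UNIV" unfolding D_def by (rule has_sum_infsum[OF Pabs[OF y]])
    then have "((\<lambda>\<alpha>. P i \<alpha> y) has_sum D i y) (range Q)"
    proof (rule has_sum_cong_neutral[THEN iffD1, rotated -1])
      fix \<alpha> assume "\<alpha> \<in> UNIV - range Q"
      then have "\<alpha> i = 0"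
        by (metis DiffD2 Q_def fun_upd_triv fun_upd_upd fun_upd_same not0_implies_Suc rangeI)
      then show "P i \<alpha> y = 0" by (simp add: P_def)
    qed auto
    then have "((\<lambda>\<alpha>. P i (Q \<alpha>) y) has_sum D i y) UNIV"
      by (simp add: has_sum_reindex[OF inj] o_def)
    moreover have "P i (Q \<alpha>) y = (real (\<alpha> i) + 1) * c (\<alpha>(i := Suc (\<alpha> i))) * (\<Prod>j\<in>UNIV. (y$j - x$j) ^ \<alpha> j)" for \<alpha>
    proof -
      have "(\<Prod>j\<in>UNIV. (y$j - x$j) ^ \<alpha> j) = (y$i - x$i) ^ \<alpha> i * (\<Prod>j\<in>UNIV - {i}. (y$j - x$j) ^ \<alpha> j)"
        by (rule prod.remove) auto
      moreover have "(\<Prod>j\<in>UNIV - {i}. (y$j - x$j) ^ Q \<alpha> j) = (\<Prod>j\<in>UNIV - {i}. (y$j - x$j) ^ \<alpha> j)"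
        by (rule prod.cong) (auto simp: Q_def)
      ultimately show ?thesis by (simp add: P_def Q_def algebra_simps)
    qed
    ultimately show ?thesis by simp
  qed
  ultimately show ?thesis using \<rho>(1) by (intro exI[of _ \<rho>] conjI exI[of _ D]) auto
qed

lemma has_derivative_pderiv_at:
  assumes "(E has_derivative (\<lambda>h. \<Sum>i\<in>UNIV. d i * h$i)) (at y)"
  shows "pderiv_at i E y = d i"
proof -
  have "frechet_derivative E (at y) = (\<lambda>h. \<Sum>i\<in>UNIV. d i * h$i)"
    using frechet_derivative_at[OF assms] by simp
  then show ?thesis by (simp add: axis_def if_distrib cong: if_cong)
qed

lemma multi_power_series_pderiv_at:
  fixes E :: "real^'d::finite \<Rightarrow> real"
  assumes S: "\<And>y. y \<in> ball x r \<Longrightarrow> ((\<lambda>\<alpha>. c \<alpha> * (\<Prod>i\<in>UNIV. (y$i - x$i) ^ \<alpha> i)) has_sum E y) UNIV"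
    and r: "r > 0"
  obtains \<rho> where "\<rho> > 0" "\<And>y i. y \<in> ball x \<rho> \<Longrightarrow>
    ((\<lambda>\<alpha>. (real (\<alpha> i) + 1) * c (\<alpha>(i := Suc (\<alpha> i))) * (\<Prod>j\<in>UNIV. (y$j - x$j) ^ \<alpha> j)) has_sum pderiv_at i E y) UNIV"
proof -
  obtain \<rho> D where \<rho>: "\<rho> > 0" and D: "\<And>y. y \<in> ball x \<rho> \<Longrightarrow> (E has_derivative (\<lambda>h. \<Sum>i\<in>UNIV. D i y * h$i)) (at y)"
    "\<And>y i. y \<in> ball x \<rho> \<Longrightarrow> ((\<lambda>\<alpha>. (real (\<alpha> i) + 1) * c (\<alpha>(i := Suc (\<alpha> i))) * (\<Prod>j\<in>UNIV. (y$j - x$j) ^ \<alpha> j)) has_sum D i y) UNIV"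
    using multi_power_series_has_derivative[OF S r] by blast
  show thesis
    by (rule that[OF \<rho>]) (use D(2) has_derivative_pderiv_at[OF D(1)] in simp)
qed

lemma real_analytic_has_derivative:
  assumes "real_analytic_Rd E"
  shows "(E has_derivative (\<lambda>h. \<Sum>i\<in>UNIV. pderiv_at i E y * h$i)) (at y)"
proof -
  obtain r c where r: "r > 0" "\<And>z. z \<in> ball y r \<Longrightarrow> ((\<lambda>\<alpha>. c \<alpha> * (\<Prod>i\<in>UNIV. (z$i - y$i) ^ \<alpha> i)) has_sum E z) UNIV"
    using assms unfolding real_analytic_Rd_def by metis
  obtain \<rho> D where "\<rho> > 0" "\<forall>z\<in>ball y \<rho>. (E has_derivative (\<lambda>h. \<Sum>i\<in>UNIV. D i z * h$i)) (at z)"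
    using multi_power_series_has_derivative[OF r(2,1)] by blast
  then have "(E has_derivative (\<lambda>h. \<Sum>i\<in>UNIV. D i y * h$i)) (at y)" by simp
  with has_derivative_pderiv_at[OF this] show ?thesis by simp
qed

lemma real_analytic_pderiv_at:
  assumes "real_analytic_Rd E"
  shows "real_analytic_Rd (pderiv_at i E)"
  unfolding real_analytic_Rd_def
proof
  fix y
  obtain r c where r: "r > 0" "\<And>z. z \<in> ball y r \<Longrightarrow> ((\<lambda>\<alpha>. c \<alpha> * (\<Prod>i\<in>UNIV. (z$i - y$i) ^ \<alpha> i)) has_sum E z) UNIV"
    using assms unfolding real_analytic_Rd_def by metis
  obtain \<rho> where "\<rho> > 0" "\<And>z i. z \<in> ball y \<rho> \<Longrightarrow>
    ((\<lambda>\<alpha>. (real (\<alpha> i) + 1) * c (\<alpha>(i := Suc (\<alpha> i))) * (\<Prod>j\<in>UNIV. (z$j - y$j) ^ \<alpha> j)) has_sum pderiv_at i E z) UNIV"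
    using multi_power_series_pderiv_at[OF r(2,1)] by blast
  then show "\<exists>r>0. \<exists>c. \<forall>z\<in>ball y r. ((\<lambda>\<alpha>. c \<alpha> * (\<Prod>i\<in>UNIV. (z$i - y$i) ^ \<alpha> i)) has_sum pderiv_at i E z) UNIV"
    by (intro exI[of _ \<rho>] conjI exI[of _ "\<lambda>\<alpha>. (real (\<alpha> i) + 1) * c (\<alpha>(i := Suc (\<alpha> i)))"]) auto
qed

text \<open>Since 0^0 = 1, exactly the zero multi-index survives at the centre.\<close>

lemma multi_power_series_at_centre:
  fixes c :: "('d::finite \<Rightarrow> nat) \<Rightarrow> real" and x :: "real^'d"
  assumes "((\<lambda>\<alpha>. c \<alpha> * (\<Prod>i\<in>UNIV. (x$i - x$i) ^ \<alpha> i)) has_sum s) UNIV"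
  shows "s = c (\<lambda>_. 0)"
proof -
  have "((\<lambda>\<alpha>. c \<alpha> * (\<Prod>i\<in>UNIV. (x$i - x$i) ^ \<alpha> i)) has_sum s) {\<lambda>_. 0}"
  proof (rule has_sum_cong_neutral[THEN iffD1, rotated -1, OF assms])
    fix \<alpha> :: "'d \<Rightarrow> nat" assume "\<alpha> \<in> UNIV - {\<lambda>_. 0}"
    then obtain i where "\<alpha> i \<noteq> 0" by auto
    then show "c \<alpha> * (\<Prod>i\<in>UNIV. (x$i - x$i) ^ \<alpha> i) = 0" by (auto simp: prod_zero_iff)
  qed auto
  then show ?thesis by (simp add: has_sum_finite_iff)
qed

text \<open>Two termwise differentiations express the mixed derivative at the centre of expansion by
  the coefficient of the multi-index in which i and j are both raised once, with a factor symmetric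
  in i and j.\<close>

lemma pderiv_at_commute:
  fixes E :: "real^'d::finite \<Rightarrow> real"
  assumes "real_analytic_Rd E"
  shows "pderiv_at i (pderiv_at j E) x = pderiv_at j (pderiv_at i E) x"
proof -
  obtain r c where r: "r > 0" "\<And>z. z \<in> ball x r \<Longrightarrow> ((\<lambda>\<alpha>. c \<alpha> * (\<Prod>i\<in>UNIV. (z$i - x$i) ^ \<alpha> i)) has_sum E z) UNIV"
    using assms unfolding real_analytic_Rd_def by metis
  define c1 where "c1 j \<alpha> = (real (\<alpha> j) + 1) * c (\<alpha>(j := Suc (\<alpha> j)))" for j \<alpha>
  obtain \<rho> where \<rho>: "\<rho> > 0" "\<And>z i. z \<in> ball x \<rho> \<Longrightarrow>
    ((\<lambda>\<alpha>. c1 i \<alpha> * (\<Prod>j\<in>UNIV. (z$j - x$j) ^ \<alpha> j)) has_sum pderiv_at i E z) UNIV"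
    using multi_power_series_pderiv_at[OF r(2,1)] unfolding c1_def by blast
  have "pderiv_at i (pderiv_at j E) x = (real 0 + 1) * c1 j ((\<lambda>_. 0)(i := Suc 0))" for i j
  proof -
    obtain \<rho>' where \<rho>': "\<rho>' > 0" "\<And>z i. z \<in> ball x \<rho>' \<Longrightarrow>
      ((\<lambda>\<alpha>. (real (\<alpha> i) + 1) * c1 j (\<alpha>(i := Suc (\<alpha> i))) * (\<Prod>j\<in>UNIV. (z$j - x$j) ^ \<alpha> j)) has_sum pderiv_at i (pderiv_at j E) z) UNIV"
      using multi_power_series_pderiv_at[OF \<rho>(2) \<rho>(1), of j] by blast
    from multi_power_series_at_centre[OF \<rho>'(2)[of x i]] \<rho>'(1) show ?thesis by simp
  qed
  then show ?thesis by (simp add: c1_def) (auto simp: fun_upd_twist)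
qed

text \<open>The power series represents \<open>F\<close> on a full ball around x, also outside S.
  The derivative is therefore two-sided even at the end points of an interval, which is how it is
  used at the extremal energies.\<close>

lemma real_analytic_R_derivative:
  assumes "real_analytic_R F S" "x \<in> S"
  shows "(F has_real_derivative deriv F x) (at x)" "isCont (deriv F) x"
proof -
  obtain r c where r: "r > 0" "\<And>y. y \<in> ball x r \<Longrightarrow> (\<lambda>n. c n * (y - x) ^ n) sums F y"
    using assms unfolding real_analytic_R_def by metis
  have sm: "summable (\<lambda>n. c n * z ^ n)" if "norm z < r" for z
    using r(2)[of "x + z"] that by (auto simp: dist_norm sums_iff)
  define G where "G z = (\<Sum>n. diffs c n * z ^ n)" for z
  have d: "((\<lambda>z. \<Sum>n. c n * z ^ n) has_real_derivative G z) (at z)" if "norm z < r" for z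
    unfolding G_def using termdiffs_strong'[OF sm that] by simp
  have dF: "(F has_real_derivative G (y - x)) (at y)" if y: "y \<in> ball x r" for y
  proof -
    have "((\<lambda>y. \<Sum>n. c n * (y - x) ^ n) has_real_derivative G (y - x) * 1) (at y)"
      using y by (intro DERIV_chain2[OF d] derivative_eq_intros) (auto simp: dist_norm norm_minus_commute)
    moreover have "(\<Sum>n. c n * (z - x) ^ n) = F z" if "z \<in> ball x r" for z
      using r(2)[OF that] by (simp add: sums_iff)
    ultimately show ?thesis
      using has_field_derivative_transform_within_open[OF _ open_ball y, of "\<lambda>y. \<Sum>n. c n * (y - x) ^ n" "G (y - x)" F]
      by simp
  qed
  have sd: "summable (\<lambda>n. diffs c n * z ^ n)" if "norm z < r" for z
    by (rule termdiff_converges[OF that sm])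
  have "isCont G 0" unfolding G_def
    using isCont_powser'[of 0 "\<lambda>z. z" "diffs c" "r/2"] sd[of "r/2"] r(1) by simp
  then have G: "isCont (\<lambda>y. G (y - x)) x" using isCont_o2[where f = "\<lambda>y. y - x" and g = G and a = x] by simp
  have eq: "deriv F y = G (y - x)" if "y \<in> ball x r" for y by (rule DERIV_imp_deriv[OF dF[OF that]])
  show "(F has_real_derivative deriv F x) (at x)" using dF[of x] eq[of x] r(1) by simp
  have "\<forall>\<^sub>F y in nhds x. deriv F y = G (y - x)"
    using eventually_nhds_in_open[OF open_ball, of x x r] r(1) by (auto elim!: eventually_mono simp: eq)
  then show "isCont (deriv F) x" using G isCont_cong[of "deriv F" "\<lambda>y. G (y - x)" x] by simp
qed

section \<open>Integration over the torus\<close>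

lemma lattice_vec_nth [simp]: "lattice_vec n $ i = 2 * pi * of_int (n i)"
  by (simp add: lattice_vec_def)

lemma lattice_vec_uminus: "lattice_vec (\<lambda>i. - n i) = - lattice_vec n"
  by (simp_all add: vec_eq_iff)

lemma periodic_T_diff:
  assumes "periodic_T g" shows "g (k - lattice_vec n) = g k"
  using assms unfolding periodic_T_def by (metis diff_add_cancel)

lemma torus_box_cbox: "torus_box = cbox 0 (\<chi> i. 2 * pi)"
  by (auto simp: torus_box_def mem_box_cart)

lemma compact_torus_box: "compact torus_box" and torus_box_sets [measurable]: "torus_box \<in> sets borel"
  by (auto simp: torus_box_cbox)

text \<open>\<open>torus_box\<close> contains both of two identified faces. The half-open box meets
  each lattice orbit in exactly one point, so its translates tile the space and can be summed to
  1.\<close>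

definition half_box :: "(real^'d::finite) set" where
  "half_box = {k. \<forall>i. 0 \<le> k$i \<and> k$i < 2 * pi}"

lemma half_box_sets [measurable]: "half_box \<in> sets borel"
proof -
  have "half_box = {k::real^'a. (\<forall>i. 0 \<le> k$i)} \<inter> {k. \<forall>i. k$i < 2 * pi}" by (auto simp: half_box_def)
  moreover have "closed {k::real^'a. (\<forall>i. 0 \<le> k$i)}"
    by (intro closed_Collect_all closed_Collect_le continuous_intros)
  moreover have "{k::real^'a. \<forall>i. k$i < 2 * pi} = (\<Inter>i. {k. k$i < 2 * pi})" by auto
  moreover have "open (\<Inter>i. {k::real^'a. k$i < 2 * pi})"
    by (intro open_INT ballI open_Collect_less continuous_intros) auto
  ultimately show ?thesis by (metis borel_closed borel_open sets.Int)
qed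

lemma half_box_subset: "half_box \<subseteq> torus_box"
  by (auto simp: half_box_def torus_box_def less_imp_le)

lemma lattice_translate_in_half_box_iff:
  "k + lattice_vec n \<in> half_box \<longleftrightarrow> n = (\<lambda>i. - \<lfloor>k$i / (2 * pi)\<rfloor>)"
proof -
  have "(0 \<le> k$i + 2 * pi * of_int (n i) \<and> k$i + 2 * pi * of_int (n i) < 2 * pi) \<longleftrightarrow> n i = - \<lfloor>k$i / (2 * pi)\<rfloor>" for i
  proof -
    define q where "q = k$i / (2 * pi)"
    have k: "k$i = 2 * pi * q" by (simp add: q_def)
    have "0 \<le> k$i + 2 * pi * of_int (n i) \<longleftrightarrow> 0 \<le> 2 * pi * (q + of_int (n i))" by (simp add: k algebra_simps)
    also have "\<dots> \<longleftrightarrow> 0 \<le> q + of_int (n i)"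
      using pi_gt_zero by (subst zero_le_mult_iff) (auto simp del: pi_gt_zero)
    finally have a: "0 \<le> k$i + 2 * pi * of_int (n i) \<longleftrightarrow> 0 \<le> q + of_int (n i)" .
    have "k$i + 2 * pi * of_int (n i) < 2 * pi \<longleftrightarrow> 2 * pi * (q + of_int (n i)) < 2 * pi * 1" by (simp add: k algebra_simps)
    also have "\<dots> \<longleftrightarrow> q + of_int (n i) < 1" by (subst mult_less_cancel_left_pos) auto
    finally have b: "k$i + 2 * pi * of_int (n i) < 2 * pi \<longleftrightarrow> q + of_int (n i) < 1" .
    have "0 \<le> q + of_int (n i) \<and> q + of_int (n i) < 1 \<longleftrightarrow> \<lfloor>q\<rfloor> = - n i"
      by (auto simp: floor_eq_iff)
    with a b show ?thesis by (auto simp: q_def)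
  qed
  then show ?thesis by (auto simp: half_box_def fun_eq_iff)
qed

lemma lattice_reduce: obtains n where "k + lattice_vec n \<in> torus_box"
  using lattice_translate_in_half_box_iff half_box_subset by blast

lemma periodic_bounded_by_box:
  assumes "periodic_T g" "\<And>k. k \<in> torus_box \<Longrightarrow> P (g k)"
  shows "P (g k)"
proof -
  obtain n where "k + lattice_vec n \<in> torus_box" by (rule lattice_reduce)
  with assms(2) have "P (g (k + lattice_vec n))" by blast
  then show ?thesis using assms(1) by (simp add: periodic_T_def)
qed

lemma periodic_continuous_bounded:
  fixes g :: "real^'d::finite \<Rightarrow> 'b::real_normed_vector"
  assumes "periodic_T g" "continuous_on UNIV g"
  obtains B where "B > 0" "\<And>k. norm (g k) \<le> B"
proof -
  have "compact (g ` torus_box)"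
    by (intro compact_continuous_image compact_torus_box continuous_on_subset[OF assms(2)]) auto
  then obtain B where "B > 0" "\<And>k. k \<in> torus_box \<Longrightarrow> norm (g k) \<le> B"
    using bounded_pos compact_imp_bounded by (metis imageI)
  then show thesis
    using that periodic_bounded_by_box[OF assms(1), of "\<lambda>x. norm x \<le> B"] by blast
qed

lemma negligible_box_diff: "negligible (torus_box - half_box :: (real^'d::finite) set)"
proof (rule negligible_subset)
  show "negligible (\<Union>i\<in>UNIV. {k::real^'d. k$i = 2 * pi})"
  proof (intro negligible_Union; clarsimp)
    fix i :: 'd
    have "negligible {k::real^'d. axis i 1 \<bullet> k = 2 * pi}"
      by (rule negligible_hyperplane) (simp add: axis_eq_0_iff)
    then show "negligible {k::real^'d. k$i = 2 * pi}" by (simp add: cart_eq_inner_axis inner_commute)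
  qed
  show "torus_box - half_box \<subseteq> (\<Union>i\<in>UNIV. {k::real^'d. k$i = 2 * pi})"
    by (auto simp: torus_box_def half_box_def) (metis less_le)
qed

lemma AE_box_iff_half_box: "AE k in lborel. indicator torus_box (k::real^'d::finite) = (indicator half_box k :: 'b::zero_neq_one)"
proof -
  have "AE k in lebesgue. k \<notin> (torus_box - half_box :: (real^'d) set)"
    using negligible_box_diff unfolding negligible_iff_null_sets by (rule AE_not_in)
  then have "AE k in lborel. k \<notin> (torus_box - half_box :: (real^'d) set)"
    by (simp add: AE_completion_iff)
  then show ?thesis by eventually_elim (use half_box_subset in \<open>auto simp: indicator_def\<close>)
qed

lemma nn_integral_lborel_translate:
  fixes f :: "'a::euclidean_space \<Rightarrow> ennreal"
  assumes [measurable]: "f \<in> borel_measurable borel"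
  shows "(\<integral>\<^sup>+k. f (k + a) \<partial>lborel) = (\<integral>\<^sup>+k. f k \<partial>lborel)"
proof -
  have "(\<integral>\<^sup>+k. f k \<partial>lborel) = (\<integral>\<^sup>+k. f k \<partial>distr lborel borel ((+) a))" by (simp add: lborel_distr_plus)
  also have "\<dots> = (\<integral>\<^sup>+k. f (a + k) \<partial>lborel)" by (subst nn_integral_distr) auto
  finally show ?thesis by (simp add: add.commute)
qed

lemma nn_integral_lborel_reflect:
  fixes f :: "'a::euclidean_space \<Rightarrow> ennreal"
  assumes [measurable]: "f \<in> borel_measurable borel"
  shows "(\<integral>\<^sup>+k. f (a - k) \<partial>lborel) = (\<integral>\<^sup>+k. f k \<partial>lborel)"
proof -
  have "lborel = density (distr lborel borel (\<lambda>x. a + (-1) *\<^sub>R x)) (\<lambda>_. \<bar>-1::real\<bar> ^ DIM('a))"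
    by (rule lborel_affine) simp
  then have "(lborel :: 'a measure) = distr lborel borel (\<lambda>x. a - x)" by (simp add: density_1)
  then have "(\<integral>\<^sup>+k. f k \<partial>lborel) = (\<integral>\<^sup>+k. f k \<partial>distr lborel borel (\<lambda>x. a - x))" by simp
  also have "\<dots> = (\<integral>\<^sup>+k. f (a - k) \<partial>lborel)" by (subst nn_integral_distr) auto
  finally show ?thesis by simp
qed

lemma lattice_countable: "countable (UNIV :: ('d::finite \<Rightarrow> int) set)"
  by simp

text \<open>Insert the sum of the indicators of all translates of \<open>half_box\<close>, which is
  1; exchange sum and integral, translate each term back into the box, and add up w. Every weight
  whose lattice translates sum to 1 thus computes the torus integral, in particular the indicator of
  a shifted or reflected box.\<close>

lemma nn_integral_torus_unfold:
  fixes w g :: "real^'d::finite \<Rightarrow> ennreal"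
  assumes [measurable]: "w \<in> borel_measurable borel" "g \<in> borel_measurable borel"
    and g: "periodic_T g" and w: "\<And>k. (\<integral>\<^sup>+n. w (k + lattice_vec n) \<partial>count_space UNIV) = 1"
  shows "(\<integral>\<^sup>+k. w k * g k \<partial>lborel) = (\<integral>\<^sup>+k. indicator half_box k * g k \<partial>lborel)"
proof -
  have one: "(\<integral>\<^sup>+n. indicator half_box (k + lattice_vec n) \<partial>count_space UNIV) = (1::ennreal)" for k :: "real^'d"
  proof -
    have "indicator half_box (k + lattice_vec n) = (indicator {\<lambda>i. - \<lfloor>k$i / (2 * pi)\<rfloor>} n :: ennreal)" for n
      by (simp add: indicator_def lattice_translate_in_half_box_iff)
    then show ?thesis by (simp add: nn_integral_indicator)
  qed
  have "(\<integral>\<^sup>+k. w k * g k \<partial>lborel) = (\<integral>\<^sup>+k. (\<integral>\<^sup>+n. w k * g k * indicator half_box (k + lattice_vec n) \<partial>count_space UNIV) \<partial>lborel)"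
    by (intro nn_integral_cong) (simp add: nn_integral_cmult one)
  also have "\<dots> = (\<integral>\<^sup>+n. (\<integral>\<^sup>+k. w k * g k * indicator half_box (k + lattice_vec n) \<partial>lborel) \<partial>count_space UNIV)"
    by (rule nn_integral_count_space_nn_integral[OF lattice_countable]) measurable
  also have "\<dots> = (\<integral>\<^sup>+n. (\<integral>\<^sup>+k. w (k + lattice_vec (\<lambda>i. - n i)) * g k * indicator half_box k \<partial>lborel) \<partial>count_space UNIV)"
  proof (rule nn_integral_cong)
    fix n :: "'d \<Rightarrow> int"
    have "(\<integral>\<^sup>+k. w k * g k * indicator half_box (k + lattice_vec n) \<partial>lborel)
      = (\<integral>\<^sup>+k. w (k - lattice_vec n) * g (k - lattice_vec n) * indicator half_box k \<partial>lborel)"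
      using nn_integral_lborel_translate[of "\<lambda>k. w (k - lattice_vec n) * g (k - lattice_vec n) * indicator half_box k" "lattice_vec n"]
      by simp
    then show "(\<integral>\<^sup>+k. w k * g k * indicator half_box (k + lattice_vec n) \<partial>lborel)
      = (\<integral>\<^sup>+k. w (k + lattice_vec (\<lambda>i. - n i)) * g k * indicator half_box k \<partial>lborel)"
      by (simp add: periodic_T_diff[OF g] lattice_vec_uminus)
  qed
  \<comment> \<open>Reindexing the lattice by n -> -n.\<close>
  also have "\<dots> = (\<integral>\<^sup>+n. (\<integral>\<^sup>+k. w (k + lattice_vec n) * g k * indicator half_box k \<partial>lborel) \<partial>count_space UNIV)"
    by (rule nn_integral_bij_count_space[where g = "\<lambda>n i. - n i"])
       (rule bij_betw_byWitness[where f' = "\<lambda>n i. - n i"], auto)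
  also have "\<dots> = (\<integral>\<^sup>+k. (\<integral>\<^sup>+n. w (k + lattice_vec n) * g k * indicator half_box k \<partial>count_space UNIV) \<partial>lborel)"
    by (rule nn_integral_count_space_nn_integral[OF lattice_countable, symmetric]) measurable
  also have "\<dots> = (\<integral>\<^sup>+k. indicator half_box k * g k \<partial>lborel)"
  proof (rule nn_integral_cong)
    fix k
    have "(\<integral>\<^sup>+n. w (k + lattice_vec n) * g k * indicator half_box k \<partial>count_space UNIV)
      = (\<integral>\<^sup>+n. (g k * indicator half_box k) * w (k + lattice_vec n) \<partial>count_space UNIV)" by (simp add: ac_simps)
    also have "\<dots> = (g k * indicator half_box k) * 1" by (subst nn_integral_cmult) (auto simp: w)
    finally show "(\<integral>\<^sup>+n. w (k + lattice_vec n) * g k * indicator half_box k \<partial>count_space UNIV) = indicator half_box k * g k"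
      by (simp add: ac_simps)
  qed
  finally show ?thesis .
qed

lemma nn_integral_torus_affine:
  fixes g :: "real^'d::finite \<Rightarrow> ennreal"
  assumes [measurable]: "g \<in> borel_measurable borel" and g: "periodic_T g"
  shows nn_integral_torus_reflect:
      "(\<integral>\<^sup>+y. indicator torus_box y * g (x - y) \<partial>lborel) = (\<integral>\<^sup>+y. indicator torus_box y * g y \<partial>lborel)"
    and nn_integral_torus_translate:
      "(\<integral>\<^sup>+y. indicator torus_box y * g (y + x) \<partial>lborel) = (\<integral>\<^sup>+y. indicator torus_box y * g y \<partial>lborel)"
proof -
  have box: "(\<integral>\<^sup>+y. indicator torus_box y * h y \<partial>lborel) = (\<integral>\<^sup>+y. indicator half_box y * h y \<partial>lborel)" for h :: "real^'d \<Rightarrow> ennreal"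
  proof (rule nn_integral_cong_AE)
    show "AE y in lborel. indicator torus_box y * h y = indicator half_box y * h y"
      using AE_box_iff_half_box[where 'd = 'd and 'b = ennreal] by eventually_elim simp
  qed
  have one: "(\<integral>\<^sup>+n. indicator half_box (k + lattice_vec n) \<partial>count_space UNIV) = (1::ennreal)" for k :: "real^'d"
  proof -
    have "indicator half_box (k + lattice_vec n) = (indicator {\<lambda>i. - \<lfloor>k$i / (2 * pi)\<rfloor>} n :: ennreal)" for n
      by (simp add: indicator_def lattice_translate_in_half_box_iff)
    then show ?thesis by (simp add: nn_integral_indicator)
  qed
  have one': "(\<integral>\<^sup>+n. indicator half_box (x - (k + lattice_vec n)) \<partial>count_space UNIV) = (1::ennreal)" for k :: "real^'d"
  proof -
    have "(\<integral>\<^sup>+n. indicator half_box ((x - k) + lattice_vec (\<lambda>i. - n i)) \<partial>count_space UNIV)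
       = (\<integral>\<^sup>+n. indicator half_box ((x - k) + lattice_vec n) \<partial>count_space (UNIV :: ('d \<Rightarrow> int) set))"
      by (rule nn_integral_bij_count_space[where g = "\<lambda>n i. - n i" and f = "\<lambda>n. indicator half_box ((x - k) + lattice_vec n)"])
         (rule bij_betw_byWitness[where f' = "\<lambda>n i. - n i"], auto)
    moreover have "x - (k + lattice_vec n) = (x - k) + lattice_vec (\<lambda>i. - n i)" for n
      by (simp add: lattice_vec_uminus)
    ultimately show ?thesis by (simp only: one)
  qed
  have "(\<integral>\<^sup>+y. indicator half_box y * g (x - y) \<partial>lborel) = (\<integral>\<^sup>+y. indicator half_box (x - y) * g y \<partial>lborel)"
    using nn_integral_lborel_reflect[of "\<lambda>y. indicator half_box (x - y) * g y" x] by simp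
  also have "\<dots> = (\<integral>\<^sup>+y. indicator half_box y * g y \<partial>lborel)"
    by (rule nn_integral_torus_unfold[OF _ _ g one']) measurable
  finally show "(\<integral>\<^sup>+y. indicator torus_box y * g (x - y) \<partial>lborel) = (\<integral>\<^sup>+y. indicator torus_box y * g y \<partial>lborel)"
    by (simp add: box)
  have "(\<integral>\<^sup>+y. indicator half_box y * g (y + x) \<partial>lborel) = (\<integral>\<^sup>+y. indicator half_box (y - x) * g y \<partial>lborel)"
    using nn_integral_lborel_translate[of "\<lambda>y. indicator half_box (y - x) * g y" x] by simp
  also have "\<dots> = (\<integral>\<^sup>+y. indicator half_box y * g y \<partial>lborel)"
  proof (rule nn_integral_torus_unfold[OF _ _ g])
    show "(\<integral>\<^sup>+n. indicator half_box (k + lattice_vec n - x) \<partial>count_space UNIV) = (1::ennreal)" for k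
      using one[of "k - x"] by (simp add: algebra_simps)
  qed measurable
  finally show "(\<integral>\<^sup>+y. indicator torus_box y * g (y + x) \<partial>lborel) = (\<integral>\<^sup>+y. indicator torus_box y * g y \<partial>lborel)"
    by (simp add: box)
qed

section \<open>Integration against the measure of the torus\<close>

abbreviation TM :: "(real^'d::finite) measure" where
  "TM \<equiv> restrict_space lborel torus_box"

lemma torus_box_emeasure: "emeasure lborel (torus_box :: (real^'d::finite) set) < \<infinity>"
  unfolding torus_box_cbox by (rule emeasure_lborel_cbox_finite)

lemma TM_integral: "(LINT k:torus_box|lborel. f k) = (\<integral>k. f k \<partial>TM)"
  for f :: "real^'d::finite \<Rightarrow> 'b::{banach, second_countable_topology}"
  by (simp add: integral_restrict_space set_lebesgue_integral_def)

lemma TM_integrable: "set_integrable lborel torus_box f \<longleftrightarrow> integrable TM f"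
  for f :: "real^'d::finite \<Rightarrow> 'b::{banach, second_countable_topology}"
  by (simp add: integrable_restrict_space set_integrable_def)

lemma TM_finite: "finite_measure (TM :: (real^'d::finite) measure)"
  by (rule finite_measureI) (use torus_box_emeasure[where 'd = 'd] in \<open>auto simp: emeasure_restrict_space space_restrict_space\<close>)

lemma TM_measurable: "f \<in> borel_measurable borel \<Longrightarrow> f \<in> borel_measurable TM"
  by (simp add: measurable_restrict_space1)

lemma TM_integrable_bounded:
  fixes f :: "real^'d::finite \<Rightarrow> 'b::{banach, second_countable_topology}"
  assumes "f \<in> borel_measurable borel" "\<And>k. norm (f k) \<le> B"
  shows "integrable TM f"
proof -
  interpret finite_measure "TM :: (real^'d) measure" by (rule TM_finite)
  show ?thesis by (rule integrable_const_bound[of _ B]) (use assms TM_measurable in auto)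
qed

lemma TM_nn_integral: "(\<integral>\<^sup>+k. f k \<partial>TM) = (\<integral>\<^sup>+k. indicator torus_box k * f k \<partial>lborel)"
  by (subst nn_integral_restrict_space) (auto simp: ac_simps)

lemma integral_torus_affine_real:
  fixes g :: "real^'d::finite \<Rightarrow> real"
  assumes c: "continuous_on UNIV g" and g: "periodic_T g"
  shows "(\<integral>y. g (x - y) \<partial>TM) = (\<integral>y. g y \<partial>TM)" "(\<integral>y. g (y + x) \<partial>TM) = (\<integral>y. g y \<partial>TM)"
proof -
  obtain B where B: "B > 0" "\<And>k. norm (g k) \<le> B" using periodic_continuous_bounded[OF g c] by blast
  have [measurable]: "g \<in> borel_measurable borel" by (rule borel_measurable_continuous_onI[OF c])
  interpret finite_measure "TM :: (real^'d) measure" by (rule TM_finite)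
  \<comment> \<open>Adding the bound B makes the function nonnegative, so the invariance of the
    nonnegative integral applies. The integral of B is subtracted again afterwards.\<close>
  define e where "e k = ennreal (g k + B)" for k
  have e: "periodic_T e" "e \<in> borel_measurable borel" using g unfolding e_def[abs_def] periodic_T_def by auto
  have nn: "0 \<le> g k + B" for k using B(2)[of k] by (auto simp: abs_le_iff)
  have shift: "(\<integral>y. g (t y) \<partial>TM) = (\<integral>y. g y \<partial>TM)"
    if t[measurable]: "t \<in> borel_measurable borel" and "(\<integral>\<^sup>+y. indicator torus_box y * e (t y) \<partial>lborel) = (\<integral>\<^sup>+y. indicator torus_box y * e y \<partial>lborel)" for t :: "real^'d \<Rightarrow> real^'d"
  proof -
    have i: "integrable TM (\<lambda>y. g (t y))" if "t \<in> borel_measurable borel" for t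
      by (rule TM_integrable_bounded[where B = B]) (use that B in measurable)
    have "(\<integral>y. g (t y) + B \<partial>TM) = enn2real (\<integral>\<^sup>+y. e (t y) \<partial>TM)" if [measurable]: "t \<in> borel_measurable borel" for t
      unfolding e_def using nn by (intro integral_eq_nn_integral TM_measurable) auto
    from this[OF t] this[of "\<lambda>x. x"] that(2) have "(\<integral>y. g (t y) + B \<partial>TM) = (\<integral>y. g y + B \<partial>TM)"
      by (simp add: TM_nn_integral)
    moreover have "(\<integral>y. g (t y) + B \<partial>TM) = (\<integral>y. g (t y) \<partial>TM) + (\<integral>y. B \<partial>(TM :: (real^'d) measure))"
      by (rule Bochner_Integration.integral_add[OF i[OF t]]) simp
    moreover have "(\<integral>y. g y + B \<partial>TM) = (\<integral>y. g y \<partial>TM) + (\<integral>y. B \<partial>(TM :: (real^'d) measure))"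
      by (rule Bochner_Integration.integral_add[OF i[of "\<lambda>x. x"]]) auto
    ultimately show ?thesis by linarith
  qed
  show "(\<integral>y. g (x - y) \<partial>TM) = (\<integral>y. g y \<partial>TM)"
    by (rule shift) (use nn_integral_torus_reflect[OF e(2,1)] in auto)
  show "(\<integral>y. g (y + x) \<partial>TM) = (\<integral>y. g y \<partial>TM)"
    by (rule shift) (use nn_integral_torus_translate[OF e(2,1)] in auto)
qed

lemma integral_torus_reflect_complex:
  fixes g :: "real^'d::finite \<Rightarrow> complex"
  assumes c: "continuous_on UNIV g" and g: "periodic_T g"
  shows "(\<integral>y. g (x - y) \<partial>TM) = (\<integral>y. g y \<partial>TM)"
proof -
  obtain B where B: "B > 0" "\<And>k. norm (g k) \<le> B" using periodic_continuous_bounded[OF g c] by blast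
  have [measurable]: "g \<in> borel_measurable borel" by (rule borel_measurable_continuous_onI[OF c])
  have i: "integrable TM (\<lambda>y. g (t y))" if "t \<in> borel_measurable borel" for t
    by (rule TM_integrable_bounded[where B = B]) (use that B in measurable)
  have "Re (\<integral>y. g (x - y) \<partial>TM) = Re (\<integral>y. g y \<partial>TM)"
    using integral_torus_affine_real(1)[of "\<lambda>y. Re (g y)" x] c g i[of "\<lambda>y. x - y"] i[of "\<lambda>y. y"]
    by (simp add: continuous_on_Re periodic_T_def)
  moreover have "Im (\<integral>y. g (x - y) \<partial>TM) = Im (\<integral>y. g y \<partial>TM)"
    using integral_torus_affine_real(1)[of "\<lambda>y. Im (g y)" x] c g i[of "\<lambda>y. x - y"] i[of "\<lambda>y. y"]
    by (simp add: continuous_on_Im periodic_T_def)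
  ultimately show ?thesis by (rule complex_eqI)
qed

lemma has_derivative_translate:
  assumes "(V has_derivative D) (at (k + a))"
  shows "((\<lambda>x. V (x + a)) has_derivative D) (at k)"
proof -
  have "((\<lambda>x. x + a) has_derivative (\<lambda>h. h)) (at k)" by (auto intro!: derivative_eq_intros)
  from has_derivative_compose[OF this, of V D] assms show ?thesis by simp
qed

lemma periodic_frechet_derivative:
  assumes "periodic_T V"
  shows "frechet_derivative V (at (k + lattice_vec n)) = frechet_derivative V (at k)"
proof -
  have V: "(\<lambda>x. V (x + lattice_vec n)) = V" "(\<lambda>x. V (x + - lattice_vec n)) = V"
    using assms periodic_T_diff[OF assms] by (auto simp: periodic_T_def)
  have "(V has_derivative D) (at (k + lattice_vec n)) \<longleftrightarrow> (V has_derivative D) (at k)" for D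
  proof
    assume D: "(V has_derivative D) (at (k + lattice_vec n))"
    from has_derivative_translate[OF this] show "(V has_derivative D) (at k)" by (simp add: V)
  next
    assume D: "(V has_derivative D) (at k)"
    then have "(V has_derivative D) (at ((k + lattice_vec n) + - lattice_vec n))" by simp
    from has_derivative_translate[OF this] show "(V has_derivative D) (at (k + lattice_vec n))" by (simp only: V)
  qed
  then show ?thesis by (simp add: frechet_derivative_def)
qed

text \<open>The difference quotients have integral 0 by translation invariance. The mean value
  theorem bounds them by the supremum of the derivative, and dominated convergence passes to the
  limit. Applied to the components of a field this is the divergence theorem on the torus.\<close>

lemma integral_torus_directional_derivative:
  fixes V :: "real^'d::finite \<Rightarrow> real"
  assumes V: "periodic_T V" and d: "\<And>k. V differentiable (at k)"
    and c: "continuous_on UNIV (\<lambda>k. frechet_derivative V (at k) v)"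
  shows "(\<integral>k. frechet_derivative V (at k) v \<partial>TM) = 0"
proof -
  define D where "D k = frechet_derivative V (at k) v" for k
  have Dp: "periodic_T D" unfolding periodic_T_def D_def by (simp add: periodic_frechet_derivative[OF V])
  obtain B where B: "B > 0" "\<And>k. norm (D k) \<le> B" using periodic_continuous_bounded[OF Dp] c unfolding D_def by blast
  have Vc: "continuous_on UNIV V" using d by (meson continuous_at_imp_continuous_on differentiable_imp_continuous_within)
  have [measurable]: "V \<in> borel_measurable borel" by (rule borel_measurable_continuous_onI[OF Vc])
  have dV: "((\<lambda>t. V (k + t *\<^sub>R v)) has_real_derivative D (k + t *\<^sub>R v)) (at t)" for k t
  proof -
    have lin: "linear (frechet_derivative V (at (k + t *\<^sub>R v)))" by (rule linear_frechet_derivative[OF d])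
    have "((\<lambda>t. V (k + t *\<^sub>R v)) has_derivative (\<lambda>s. frechet_derivative V (at (k + t *\<^sub>R v)) (s *\<^sub>R v))) (at t)"
      by (rule has_derivative_compose[where g = V]) (auto intro!: derivative_eq_intros frechet_derivative_works[THEN iffD1] d)
    then show ?thesis
      unfolding has_field_derivative_def D_def
      by (rule has_derivative_eq_rhs) (simp add: fun_eq_iff linear_scale[OF lin] mult.commute)
  qed
  define q where "q n k = (V (k + (1 / Suc n) *\<^sub>R v) - V k) / (1 / Suc n)" for n k
  obtain C where C: "C > 0" "\<And>k. norm (V k) \<le> C" using periodic_continuous_bounded[OF V Vc] by blast
  have iV: "integrable TM (\<lambda>k. V (k + a))" for a
    by (rule TM_integrable_bounded[where B = C]) (use C in measurable)
  have q0: "(\<integral>k. q n k \<partial>TM) = 0" for n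
    unfolding q_def using integral_torus_affine_real(2)[OF Vc V] iV[of "(1 / Suc n) *\<^sub>R v"] iV[of 0]
    by (simp add: Bochner_Integration.integral_diff)
  have "(\<lambda>n. \<integral>k. q n k \<partial>TM) \<longlonglongrightarrow> (\<integral>k. D k \<partial>TM)"
  proof (rule integral_dominated_convergence[where w = "\<lambda>_. B"])
    show "D \<in> borel_measurable TM" "\<And>n. q n \<in> borel_measurable TM"
      unfolding q_def D_def using borel_measurable_continuous_onI[OF c] by (auto intro!: TM_measurable)
    show "integrable TM (\<lambda>_. B)" by (rule TM_integrable_bounded[where B = B]) (use B in auto)
    show "AE k in TM. (\<lambda>n. q n k) \<longlonglongrightarrow> D k"
    proof (rule AE_I2)
      fix k
      have "((\<lambda>h. (V (k + (0 + h) *\<^sub>R v) - V (k + 0 *\<^sub>R v)) / h) \<longlongrightarrow> D (k + 0 *\<^sub>R v)) (at 0)"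
        using dV[of k 0] unfolding DERIV_def by simp
      then have "((\<lambda>h. (V (k + h *\<^sub>R v) - V k) / h) \<longlongrightarrow> D k) (at 0)" by simp
      moreover have "filterlim (\<lambda>n. 1 / real (Suc n)) (at 0) sequentially"
        using LIMSEQ_Suc[OF lim_1_over_n] by (simp add: filterlim_at)
      ultimately show "(\<lambda>n. q n k) \<longlonglongrightarrow> D k" unfolding q_def by (rule filterlim_compose)
    qed
    show "AE k in TM. norm (q n k) \<le> B" for n
    proof (rule AE_I2)
      fix k
      obtain z where "V (k + (1 / Suc n) *\<^sub>R v) - V (k + 0 *\<^sub>R v) = (1 / Suc n - 0) * D (k + z *\<^sub>R v)"
        using MVT2[of 0 "1 / Suc n" "\<lambda>t. V (k + t *\<^sub>R v)" "\<lambda>t. D (k + t *\<^sub>R v)"] dV by auto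
      then have "q n k = D (k + z *\<^sub>R v)" by (simp add: q_def)
      then show "norm (q n k) \<le> B" using B(2) by simp
    qed
  qed
  then show ?thesis using q0 LIMSEQ_unique[OF tendsto_const] unfolding D_def by fastforce
qed

section \<open>The space of square-integrable functions on the torus\<close>

lemma L2T_iff: "g \<in> L2T \<longleftrightarrow> periodic_T g \<and> g \<in> borel_measurable borel \<and> integrable TM (\<lambda>k. (cmod (g k))\<^sup>2)"
  by (simp add: L2T_def TM_integrable)

lemma l2inner_TM: "l2inner g h = (\<integral>k. cnj (g k) * h k \<partial>TM)"
  by (simp add: l2inner_def TM_integral)

lemma l2norm_TM: "l2norm g = sqrt (\<integral>k. (cmod (g k))\<^sup>2 \<partial>TM)"
  by (simp add: l2norm_def TM_integral)

lemma aeq_TM: "aeq g h \<longleftrightarrow> (AE k in TM. g k = h k)"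
  by (simp add: aeq_def AE_restrict_space_iff)

lemma aeq_sym: "aeq g h \<Longrightarrow> aeq h g"
  unfolding aeq_TM by (auto elim: eventually_mono)

lemma aeq_refl: "(\<And>k. g k = h k) \<Longrightarrow> aeq g h"
  unfolding aeq_TM by simp

lemma L2T_measurable: "g \<in> L2T \<Longrightarrow> g \<in> borel_measurable TM"
  by (simp add: L2T_iff TM_measurable)

lemma borel_measurable_cnj [measurable (raw)]:
  "f \<in> borel_measurable M \<Longrightarrow> (\<lambda>x. cnj (f x)) \<in> borel_measurable M"
  by (rule borel_measurable_continuous_on) (auto intro!: continuous_intros)

lemma L2T_bounded:
  assumes "periodic_T g" "g \<in> borel_measurable borel" "\<And>k. cmod (g k) \<le> B"
  shows "g \<in> L2T"
proof -
  have "norm ((cmod (g k))\<^sup>2) \<le> B\<^sup>2" for k using assms(3)[of k] by (simp add: power_mono)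
  then have "integrable TM (\<lambda>k. (cmod (g k))\<^sup>2)"
    using assms(2) by (intro TM_integrable_bounded[where B = "B\<^sup>2"]) auto
  then show ?thesis using assms by (simp add: L2T_iff)
qed

lemma L2T_lin:
  assumes "f \<in> L2T" "g \<in> L2T"
  shows "(\<lambda>k. c * f k + g k) \<in> L2T"
proof -
  have [measurable]: "f \<in> borel_measurable borel" "g \<in> borel_measurable borel" using assms by (auto simp: L2T_iff)
  have "integrable TM (\<lambda>k. (cmod (c * f k + g k))\<^sup>2)"
  proof (rule Bochner_Integration.integrable_bound)
    show "integrable TM (\<lambda>k. 2 * (cmod c)\<^sup>2 * (cmod (f k))\<^sup>2 + 2 * (cmod (g k))\<^sup>2)"
      using assms by (auto simp: L2T_iff)
    show "AE k in TM. norm ((cmod (c * f k + g k))\<^sup>2) \<le> norm (2 * (cmod c)\<^sup>2 * (cmod (f k))\<^sup>2 + 2 * (cmod (g k))\<^sup>2)"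
    proof (rule AE_I2)
      fix k
      have "(cmod (c * f k + g k))\<^sup>2 \<le> (cmod (c * f k) + cmod (g k))\<^sup>2" by (simp add: norm_triangle_ineq power_mono)
      also have "\<dots> \<le> 2 * (cmod (c * f k))\<^sup>2 + 2 * (cmod (g k))\<^sup>2"
        using zero_le_power2[of "cmod (c * f k) - cmod (g k)"] by (simp add: power2_eq_square algebra_simps)
      finally show "norm ((cmod (c * f k + g k))\<^sup>2) \<le> norm (2 * (cmod c)\<^sup>2 * (cmod (f k))\<^sup>2 + 2 * (cmod (g k))\<^sup>2)"
        by (simp add: norm_mult power_mult_distrib)
    qed
  qed (auto intro!: TM_measurable)
  then show ?thesis using assms by (auto simp: L2T_iff periodic_T_def)
qed

lemma L2T_zero: "(\<lambda>_. 0) \<in> L2T"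
  by (rule L2T_bounded[of _ 0]) (auto simp: periodic_T_def)

lemma L2T_scale: "f \<in> L2T \<Longrightarrow> (\<lambda>k. c * f k) \<in> L2T"
  using L2T_lin[OF _ L2T_zero, of f c] by simp

lemma L2T_add: "f \<in> L2T \<Longrightarrow> g \<in> L2T \<Longrightarrow> (\<lambda>k. f k + g k) \<in> L2T"
  using L2T_lin[of f g 1] by simp

lemma L2T_diff: "f \<in> L2T \<Longrightarrow> g \<in> L2T \<Longrightarrow> (\<lambda>k. f k - g k) \<in> L2T"
  using L2T_lin[of g f "-1"] by simp

lemma L2T_divide: "f \<in> L2T \<Longrightarrow> (\<lambda>k. f k / c) \<in> L2T"
  using L2T_scale[of f "1 / c"] by simp

lemma L2T_product_integrable:
  assumes "f \<in> L2T" "g \<in> L2T"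
  shows "integrable TM (\<lambda>k. cnj (f k) * g k)"
proof (rule Bochner_Integration.integrable_bound)
  have [measurable]: "f \<in> borel_measurable borel" "g \<in> borel_measurable borel" using assms by (auto simp: L2T_iff)
  show "integrable TM (\<lambda>k. (cmod (f k))\<^sup>2 + (cmod (g k))\<^sup>2)" using assms by (auto simp: L2T_iff)
  show "(\<lambda>k. cnj (f k) * g k) \<in> borel_measurable TM" by (intro TM_measurable) measurable
  show "AE k in TM. norm (cnj (f k) * g k) \<le> norm ((cmod (f k))\<^sup>2 + (cmod (g k))\<^sup>2)"
  proof (rule AE_I2)
    fix k
    have "2 * (cmod (f k) * cmod (g k)) \<le> (cmod (f k))\<^sup>2 + (cmod (g k))\<^sup>2"
      using sum_squares_bound[of "cmod (f k)" "cmod (g k)"] by simp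
    moreover have "0 \<le> cmod (f k) * cmod (g k)" by simp
    ultimately have "cmod (f k) * cmod (g k) \<le> (cmod (f k))\<^sup>2 + (cmod (g k))\<^sup>2" by linarith
    then show "norm (cnj (f k) * g k) \<le> norm ((cmod (f k))\<^sup>2 + (cmod (g k))\<^sup>2)" by (simp add: norm_mult)
  qed
qed

lemma l2inner_lin_right:
  assumes "h \<in> L2T" "f \<in> L2T" "g \<in> L2T"
  shows "l2inner h (\<lambda>k. c * f k + g k) = c * l2inner h f + l2inner h g"
proof -
  have "l2inner h (\<lambda>k. c * f k + g k) = (\<integral>k. c * (cnj (h k) * f k) + cnj (h k) * g k \<partial>TM)"
    by (simp add: l2inner_TM algebra_simps)
  also have "\<dots> = (\<integral>k. c * (cnj (h k) * f k) \<partial>TM) + l2inner h g"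
    unfolding l2inner_TM using L2T_product_integrable assms
    by (intro Bochner_Integration.integral_add integrable_mult_right) auto
  finally show ?thesis by (simp add: l2inner_TM)
qed

lemma l2inner_diff_right:
  "h \<in> L2T \<Longrightarrow> f \<in> L2T \<Longrightarrow> g \<in> L2T \<Longrightarrow> l2inner h (\<lambda>k. f k - g k) = l2inner h f - l2inner h g"
  using l2inner_lin_right[of h g f "-1"] by simp

lemma l2inner_scale_right: "h \<in> L2T \<Longrightarrow> f \<in> L2T \<Longrightarrow> l2inner h (\<lambda>k. c * f k) = c * l2inner h f"
  using l2inner_lin_right[of h f "\<lambda>_. 0" c] L2T_zero by (simp add: l2inner_TM)

lemma l2inner_cnj: "l2inner g f = cnj (l2inner f g)"
  unfolding l2inner_TM using Bochner_Integration.integral_cnj[of TM "\<lambda>k. cnj (f k) * g k"] by (simp add: mult.commute)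

lemma l2inner_diff_left:
  "h \<in> L2T \<Longrightarrow> f \<in> L2T \<Longrightarrow> g \<in> L2T \<Longrightarrow> l2inner (\<lambda>k. f k - g k) h = l2inner f h - l2inner g h"
  using l2inner_diff_right[of h f g] by (metis complex_cnj_diff l2inner_cnj)

lemma l2inner_scale_left: "h \<in> L2T \<Longrightarrow> f \<in> L2T \<Longrightarrow> l2inner (\<lambda>k. c * f k) h = cnj c * l2inner f h"
  using l2inner_scale_right[of h f c] by (metis complex_cnj_mult l2inner_cnj)

lemma l2norm_nonneg: "0 \<le> l2norm f"
  by (simp add: l2norm_TM)

lemma l2norm_power2: "(l2norm f)\<^sup>2 = (\<integral>k. (cmod (f k))\<^sup>2 \<partial>TM)"
  by (simp add: l2norm_TM)

lemma l2inner_self: "l2inner f f = complex_of_real ((l2norm f)\<^sup>2)"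
  unfolding l2norm_power2 l2inner_TM
  by (subst integral_complex_of_real[symmetric]) (simp add: complex_norm_square mult.commute del: of_real_power)

lemma l2_cauchy_schwarz:
  assumes "f \<in> L2T" "g \<in> L2T"
  shows "cmod (l2inner f g) \<le> l2norm f * l2norm g"
proof -
  have [measurable]: "f \<in> borel_measurable TM" "g \<in> borel_measurable TM" using assms by (auto simp: L2T_measurable)
  define a where "a = (\<integral>k. cmod (f k) * cmod (g k) \<partial>TM)"
  have i: "integrable TM (\<lambda>k. cmod (f k) * cmod (g k))"
    using integrable_norm[OF L2T_product_integrable[OF assms]] by (simp add: norm_mult)
  have le: "cmod (l2inner f g) \<le> a"
    unfolding l2inner_TM a_def by (rule order_trans[OF integral_norm_bound]) (simp add: norm_mult)
  have a0: "a \<ge> 0" unfolding a_def by simp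
  have "(\<integral>\<^sup>+k. ennreal (cmod (f k)) * ennreal (cmod (g k)) \<partial>TM)\<^sup>2 \<le>
      (\<integral>\<^sup>+k. (ennreal (cmod (f k)))\<^sup>2 \<partial>TM) * (\<integral>\<^sup>+k. (ennreal (cmod (g k)))\<^sup>2 \<partial>TM)"
    by (rule Cauchy_Schwarz_nn_integral) measurable
  also have "(\<integral>\<^sup>+k. (ennreal (cmod (f k)))\<^sup>2 \<partial>TM) = ennreal ((l2norm f)\<^sup>2)"
    unfolding l2norm_power2 using assms(1) by (subst nn_integral_eq_integral[symmetric]) (auto simp: L2T_iff ennreal_power)
  also have "(\<integral>\<^sup>+k. (ennreal (cmod (g k)))\<^sup>2 \<partial>TM) = ennreal ((l2norm g)\<^sup>2)"
    unfolding l2norm_power2 using assms(2) by (subst nn_integral_eq_integral[symmetric]) (auto simp: L2T_iff ennreal_power)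
  also have "(\<integral>\<^sup>+k. ennreal (cmod (f k)) * ennreal (cmod (g k)) \<partial>TM) = ennreal a"
    unfolding a_def using i by (subst nn_integral_eq_integral[symmetric]) (auto simp: ennreal_mult)
  finally have "a\<^sup>2 \<le> (l2norm f * l2norm g)\<^sup>2"
    using a0 by (simp add: ennreal_power power_mult_distrib flip: ennreal_mult)
  then have "a \<le> l2norm f * l2norm g"
    by (rule power2_le_imp_le) (simp add: l2norm_nonneg)
  with le show ?thesis by simp
qed

lemma l2norm_power2_add:
  assumes "f \<in> L2T" "g \<in> L2T"
  shows "(l2norm (\<lambda>k. f k + g k))\<^sup>2 = (l2norm f)\<^sup>2 + 2 * Re (l2inner f g) + (l2norm g)\<^sup>2"
proof -
  have p: "(cmod (f k + g k))\<^sup>2 = (cmod (f k))\<^sup>2 + 2 * Re (cnj (f k) * g k) + (cmod (g k))\<^sup>2" for k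
    unfolding cmod_power2 by (simp add: power2_eq_square algebra_simps)
  have i: "integrable TM (\<lambda>k. (cmod (f k))\<^sup>2)" "integrable TM (\<lambda>k. (cmod (g k))\<^sup>2)"
    "integrable TM (\<lambda>k. 2 * Re (cnj (f k) * g k))"
    using assms L2T_product_integrable[OF assms] integrable_Re by (auto simp: L2T_iff simp del: times_complex.sel)
  have "(\<integral>k. (cmod (f k + g k))\<^sup>2 \<partial>TM) = (\<integral>k. (cmod (f k))\<^sup>2 + 2 * Re (cnj (f k) * g k) \<partial>TM) + (\<integral>k. (cmod (g k))\<^sup>2 \<partial>TM)"
    unfolding p by (intro Bochner_Integration.integral_add Bochner_Integration.integrable_add i)
  also have "(\<integral>k. (cmod (f k))\<^sup>2 + 2 * Re (cnj (f k) * g k) \<partial>TM) = (\<integral>k. (cmod (f k))\<^sup>2 \<partial>TM) + (\<integral>k. 2 * Re (cnj (f k) * g k) \<partial>TM)"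
    by (intro Bochner_Integration.integral_add i)
  also have "(\<integral>k. 2 * Re (cnj (f k) * g k) \<partial>TM) = 2 * (\<integral>k. Re (cnj (f k) * g k) \<partial>TM)"
    by (rule integral_mult_right_zero)
  also have "(\<integral>k. Re (cnj (f k) * g k) \<partial>TM) = Re (l2inner f g)"
    unfolding l2inner_TM by (rule integral_Re[OF L2T_product_integrable[OF assms]])
  finally show ?thesis by (simp add: l2norm_power2)
qed

lemma l2norm_triangle:
  assumes "f \<in> L2T" "g \<in> L2T"
  shows "l2norm (\<lambda>k. f k + g k) \<le> l2norm f + l2norm g"
proof (rule power2_le_imp_le)
  have "Re (l2inner f g) \<le> l2norm f * l2norm g"
    using l2_cauchy_schwarz[OF assms] complex_Re_le_cmod[of "l2inner f g"] by linarith
  then show "(l2norm (\<lambda>k. f k + g k))\<^sup>2 \<le> (l2norm f + l2norm g)\<^sup>2"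
    unfolding l2norm_power2_add[OF assms] by (simp add: power2_sum)
qed (simp add: l2norm_nonneg)

lemma l2norm_scale: "l2norm (\<lambda>k. c * f k) = cmod c * l2norm f"
  by (simp add: l2norm_TM norm_mult power_mult_distrib real_sqrt_mult)

lemma l2norm_divide: "l2norm (\<lambda>k. f k / c) = l2norm f / cmod c"
  using l2norm_scale[of "1 / c" f] by (simp add: norm_divide)

lemma l2norm_diff_commute: "l2norm (\<lambda>k. f k - g k) = l2norm (\<lambda>k. g k - f k)"
  by (simp add: l2norm_TM norm_minus_commute)

lemma l2norm_diff_triangle:
  assumes "f \<in> L2T" "g \<in> L2T" "h \<in> L2T"
  shows "l2norm (\<lambda>k. f k - h k) \<le> l2norm (\<lambda>k. f k - g k) + l2norm (\<lambda>k. g k - h k)"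
  using l2norm_triangle[OF L2T_diff[OF assms(1,2)] L2T_diff[OF assms(2,3)]] by simp

lemma l2norm_diff_le:
  assumes "f \<in> L2T" "g \<in> L2T"
  shows "l2norm (\<lambda>k. f k - g k) \<le> l2norm f + l2norm g"
  using l2norm_diff_triangle[OF assms(1) L2T_zero assms(2)] l2norm_diff_commute[of "\<lambda>_. 0" g] by simp

lemma l2norm_cong: "g \<in> L2T \<Longrightarrow> h \<in> L2T \<Longrightarrow> aeq g h \<Longrightarrow> l2norm g = l2norm h"
  unfolding l2norm_TM aeq_TM
  by (intro arg_cong[where f = sqrt] integral_cong_AE) (auto dest!: L2T_measurable)

lemma l2inner_cong: "g \<in> L2T \<Longrightarrow> g' \<in> L2T \<Longrightarrow> h \<in> L2T \<Longrightarrow> h' \<in> L2T \<Longrightarrow> aeq g g' \<Longrightarrow> aeq h h' \<Longrightarrow> l2inner g h = l2inner g' h'"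
  unfolding l2inner_TM aeq_TM
  by (intro integral_cong_AE) (auto dest!: L2T_measurable)

lemma l2norm_bounded:
  fixes g :: "real^'d::finite \<Rightarrow> complex"
  assumes "g \<in> L2T" "\<And>k. k \<in> torus_box \<Longrightarrow> cmod (g k) \<le> B"
  shows "l2norm g \<le> B * sqrt (measure TM (torus_box :: (real^'d) set))"
    (is "_ \<le> B * sqrt ?m")
proof -
  interpret finite_measure "TM :: (real^'d) measure" by (rule TM_finite)
  have ne: "(0::real^'d) \<in> torus_box" by (simp add: torus_box_def)
  have B: "B \<ge> 0" using order_trans[OF norm_ge_zero assms(2)[OF ne]] .
  have "(\<integral>k. (cmod (g k))\<^sup>2 \<partial>TM) \<le> (\<integral>k. B\<^sup>2 \<partial>(TM :: (real^'d) measure))"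
    using assms by (intro integral_mono) (auto simp: L2T_iff space_restrict_space intro!: power_mono)
  also have "\<dots> = B\<^sup>2 * ?m" by (simp add: space_restrict_space)
  finally have "l2norm g \<le> sqrt (B\<^sup>2 * ?m)" unfolding l2norm_TM by simp
  also have "\<dots> = B * sqrt ?m" using B by (simp add: real_sqrt_mult)
  finally show ?thesis .
qed

lemma l2norm_dominated_tendsto_0:
  fixes q :: "nat \<Rightarrow> real^'d::finite \<Rightarrow> complex"
  assumes "\<And>n. q n \<in> borel_measurable borel" "AE k in TM. (\<lambda>n. q n k) \<longlonglongrightarrow> 0"
    and le: "\<And>n k. cmod (q n k) \<le> w k" and w: "w \<in> borel_measurable borel" "integrable TM (\<lambda>k. (w k)\<^sup>2)"
  shows "(\<lambda>n. l2norm (q n)) \<longlonglongrightarrow> 0"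
proof -
  have "(\<lambda>n. \<integral>k. (cmod (q n k))\<^sup>2 \<partial>TM) \<longlonglongrightarrow> (\<integral>k. 0 \<partial>(TM :: (real^'d) measure))"
  proof (rule integral_dominated_convergence[where w = "\<lambda>k. (w k)\<^sup>2"])
    show "(\<lambda>k. (cmod (q n k))\<^sup>2) \<in> borel_measurable TM" for n
      using assms(1) by (intro TM_measurable) measurable
    show "AE k in TM. (\<lambda>n. (cmod (q n k))\<^sup>2) \<longlonglongrightarrow> 0"
      using assms(2) by eventually_elim (metis norm_zero tendsto_norm tendsto_power power_zero_numeral)
    show "AE k in TM. norm ((cmod (q n k))\<^sup>2) \<le> (w k)\<^sup>2" for n using le by (auto intro!: power_mono)
  qed (use w in auto)
  then show ?thesis unfolding l2norm_TM using tendsto_real_sqrt by fastforce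
qed

lemma l2norm_bounded_tendsto_0_at:
  fixes q :: "real \<Rightarrow> real^'d::finite \<Rightarrow> complex"
  assumes m: "\<And>b. q b \<in> borel_measurable borel" and l: "\<And>k. ((\<lambda>b. q b k) \<longlongrightarrow> 0) (at b0)"
    and le: "\<And>b k. \<bar>b - b0\<bar> \<le> 1 \<Longrightarrow> b \<noteq> b0 \<Longrightarrow> cmod (q b k) \<le> B"
  shows "((\<lambda>b. l2norm (q b)) \<longlongrightarrow> 0) (at b0)"
  unfolding tendsto_at_iff_sequentially
proof (intro allI impI)
  fix X assume X: "\<forall>i. X i \<in> UNIV - {b0}" "X \<longlonglongrightarrow> b0"
  then obtain N where N: "\<And>n. n \<ge> N \<Longrightarrow> dist (X n) b0 < 1"
    using metric_LIMSEQ_D[of X b0 1] by auto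
  \<comment> \<open>The shift by N places all terms within distance 1 of b0, where the uniform bound
    is available.\<close>
  have "(\<lambda>n. l2norm (q (X (n + N)))) \<longlonglongrightarrow> 0"
  proof (rule l2norm_dominated_tendsto_0[where w = "\<lambda>_. B"])
    have "(\<lambda>n. q (X n) k) \<longlonglongrightarrow> 0" for k
      using l[of k] X unfolding tendsto_at_iff_sequentially o_def by blast
    then show "AE k in TM. (\<lambda>n. q (X (n + N)) k) \<longlonglongrightarrow> 0" by (intro AE_I2) (rule LIMSEQ_ignore_initial_segment)
    show "cmod (q (X (n + N)) k) \<le> B" for n k
      using N[of "n + N"] X(1) by (intro le) (auto simp: dist_real_def less_imp_le)
    show "integrable TM (\<lambda>k. B\<^sup>2)" by (rule TM_integrable_bounded[where B = "B\<^sup>2"]) auto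
  qed (use m in auto)
  then show "((\<lambda>b. l2norm (q b)) \<circ> X) \<longlonglongrightarrow> 0"
    using LIMSEQ_offset[of "\<lambda>n. l2norm (q (X n))" N 0] by (simp add: o_def)
qed

section \<open>Periodic mollifiers\<close>

text \<open>The polynomial parameter closes the family under differentiation: with s = 1 / t one has
  d/dt = - s^2 d/ds, which sends p(s) exp(-s) to s^2 (p - p')(s) exp(-s).\<close>

definition bump :: "real poly \<Rightarrow> real \<Rightarrow> real" where
  "bump p t = (if t > 0 then poly p (1 / t) * exp (- (1 / t)) else 0)"

lemma poly_times_exp_tendsto_0: "((\<lambda>s. poly p s * exp (- s)) \<longlongrightarrow> (0::real)) at_top"
proof -
  have "((\<lambda>s. \<Sum>i\<le>degree p. coeff p i * (s ^ i / exp s)) \<longlongrightarrow> (\<Sum>i\<le>degree p. coeff p i * 0)) at_top"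
    by (intro tendsto_intros tendsto_power_div_exp_0)
  then show ?thesis
    by (simp add: poly_altdef sum_distrib_right exp_minus divide_inverse mult.assoc)
qed

lemma bump_has_derivative:
  "(bump p has_real_derivative bump ([:0, 0, 1:] * (p - pderiv p)) t) (at t)"
proof -
  consider "t > 0" | "t < 0" | "t = 0" by linarith
  then show ?thesis
  proof cases
    case 1
    have "((\<lambda>t. poly p (1 / t) * exp (- (1 / t))) has_real_derivative
        bump ([:0, 0, 1:] * (p - pderiv p)) t) (at t)"
      using 1 by (auto simp: bump_def field_simps power2_eq_square intro!: derivative_eq_intros DERIV_chain2[of "poly p"] poly_DERIV)
    then show ?thesis
      by (rule has_field_derivative_transform_within_open[of _ _ _ "{0<..}"]) (use 1 in \<open>auto simp: bump_def\<close>)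
  next
    case 2
    have "((\<lambda>t. 0) has_real_derivative bump ([:0, 0, 1:] * (p - pderiv p)) t) (at t)"
      using 2 by (auto simp: bump_def)
    then show ?thesis
      by (rule has_field_derivative_transform_within_open[of _ _ _ "{..<0}"]) (use 2 in \<open>auto simp: bump_def\<close>)
  next
    case 3
    have "((\<lambda>h. bump p h / h) \<longlongrightarrow> 0) (at_right 0)"
    proof -
      have "((\<lambda>h. poly ([:0, 1:] * p) (inverse h) * exp (- inverse h)) \<longlongrightarrow> 0) (at_right (0::real))"
        by (rule filterlim_compose[OF poly_times_exp_tendsto_0 filterlim_inverse_at_top_right])
      moreover have "\<forall>\<^sub>F h in at_right (0::real). poly ([:0, 1:] * p) (inverse h) * exp (- inverse h) = bump p h / h"
        using eventually_at_right_less[of "0::real"] by eventually_elim (simp add: bump_def field_simps)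
      ultimately show ?thesis by (rule Lim_transform_eventually)
    qed
    moreover have "((\<lambda>h. bump p h / h) \<longlongrightarrow> 0) (at_left 0)"
    proof (rule Lim_transform_eventually[OF tendsto_const])
      show "\<forall>\<^sub>F h in at_left (0::real). 0 = bump p h / h"
        using eventually_at_left_real[of "-1" "0::real"] by (auto elim!: eventually_mono simp: bump_def)
    qed
    ultimately have "((\<lambda>h. bump p h / h) \<longlongrightarrow> 0) (at 0)" by (simp add: filterlim_split_at)
    then show ?thesis unfolding 3 DERIV_def by (simp add: bump_def)
  qed
qed

text \<open>A smooth periodic stand-in for half the squared distance to the lattice: nonnegative,
  and zero exactly at the lattice points.\<close>

abbreviation cosdist :: "real^'d::finite \<Rightarrow> real" where
  "cosdist x \<equiv> \<Sum>i\<in>UNIV. 1 - cos (x$i)"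

text \<open>A class that contains the mollifier, consists of periodic functions and is closed under
  directional derivatives. Smoothness in the sense of \<open>smooth_fun\<close>, which speaks of all
  iterated derivatives, then becomes an induction on the list of directions.\<close>

inductive_set trigbump :: "real \<Rightarrow> (real^'d::finite \<Rightarrow> real) set" for e where
  const: "(\<lambda>x. c) \<in> trigbump e"
| sin: "(\<lambda>x. sin (x$i)) \<in> trigbump e"
| cos: "(\<lambda>x. cos (x$i)) \<in> trigbump e"
| bump: "(\<lambda>x. bump p (e - cosdist x)) \<in> trigbump e"
| add: "f \<in> trigbump e \<Longrightarrow> g \<in> trigbump e \<Longrightarrow> (\<lambda>x. f x + g x) \<in> trigbump e"
| mult: "f \<in> trigbump e \<Longrightarrow> g \<in> trigbump e \<Longrightarrow> (\<lambda>x. f x * g x) \<in> trigbump e"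

lemma trigbump_sum:
  assumes "finite A" "\<And>i. i \<in> A \<Longrightarrow> f i \<in> trigbump e"
  shows "(\<lambda>x. \<Sum>i\<in>A. f i x) \<in> trigbump e"
  using assms by (induction A) (auto intro: trigbump.intros)

lemma has_derivative_vec_nth: "((\<lambda>x. x$i) has_derivative (\<lambda>h. h$i)) (at (x::real^'d::finite))"
  by (rule bounded_linear_imp_has_derivative) (rule bounded_linear_vec_nth)

lemma trigbump_has_derivative:
  assumes "f \<in> trigbump e"
  shows "\<exists>f'. (\<forall>v. f' v \<in> trigbump e) \<and> (\<forall>x. (f has_derivative (\<lambda>v. f' v x)) (at x))"
  using assms
proof induction
  case (const c)
  show ?case by (rule exI[of _ "\<lambda>v x. 0"]) (auto intro: trigbump.intros)
next
  case (sin i)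
  show ?case
  proof (intro exI[of _ "\<lambda>v x. v$i * cos (x$i)"] conjI allI)
    show "((\<lambda>x. sin (x$i)) has_derivative (\<lambda>v. v$i * cos (x$i))) (at x)" for x :: "real^'a"
      by (auto intro!: derivative_eq_intros has_derivative_vec_nth)
  qed (intro trigbump.intros)
next
  case (cos i)
  show ?case
  proof (intro exI[of _ "\<lambda>v x. (- v$i) * sin (x$i)"] conjI allI)
    show "((\<lambda>x. cos (x$i)) has_derivative (\<lambda>v. (- v$i) * sin (x$i))) (at x)" for x :: "real^'a"
      by (auto intro!: derivative_eq_intros has_derivative_vec_nth)
  qed (intro trigbump.intros)
next
  case (bump p)
  define q where "q = [:0, 0, 1:] * (p - pderiv p)"
  show ?case
  proof (intro exI[of _ "\<lambda>v x. bump q (e - cosdist x) * (\<Sum>i\<in>UNIV. (- v$i) * sin (x$i))"] conjI allI)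
    fix x :: "real^'a"
    have "((\<lambda>x. e - cosdist x) has_derivative (\<lambda>v. \<Sum>i\<in>UNIV. (- v$i) * sin (x$i))) (at x)"
      by (auto intro!: derivative_eq_intros has_derivative_vec_nth simp: sum_negf)
    from has_derivative_compose[OF this bump_has_derivative[of p, unfolded has_field_derivative_def]]
    show "((\<lambda>x. bump p (e - cosdist x)) has_derivative (\<lambda>v. bump q (e - cosdist x) * (\<Sum>i\<in>UNIV. (- v$i) * sin (x$i)))) (at x)"
      by (simp add: q_def)
  qed (intro trigbump.intros trigbump_sum; simp)
next
  case (add f g)
  then obtain f' g' where "\<And>v. f' v \<in> trigbump e" "\<And>x. (f has_derivative (\<lambda>v. f' v x)) (at x)"
    "\<And>v. g' v \<in> trigbump e" "\<And>x. (g has_derivative (\<lambda>v. g' v x)) (at x)" by metis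
  then show ?case
    by (intro exI[of _ "\<lambda>v x. f' v x + g' v x"] conjI allI trigbump.add has_derivative_add)
next
  case (mult f g)
  then obtain f' g' where *: "\<And>v. f' v \<in> trigbump e" "\<And>x. (f has_derivative (\<lambda>v. f' v x)) (at x)"
    "\<And>v. g' v \<in> trigbump e" "\<And>x. (g has_derivative (\<lambda>v. g' v x)) (at x)" by metis
  show ?case
    by (intro exI[of _ "\<lambda>v x. f x * g' v x + f' v x * g x"] conjI allI trigbump.add trigbump.mult has_derivative_mult * mult)
qed

lemma trigbump_continuous: "f \<in> trigbump e \<Longrightarrow> continuous_on A f"
  by (metis continuous_at_imp_continuous_on has_derivative_continuous trigbump_has_derivative)

lemma cosdist_periodic: "cosdist (x + lattice_vec n) = cosdist x"
proof -
  have "cos (x$i + 2 * pi * of_int (n i)) = cos (x$i)" for i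
    by (simp add: cos_add cos_int_2pin sin_int_2pin)
  then show ?thesis by simp
qed

lemma trigbump_periodic: "f \<in> trigbump e \<Longrightarrow> periodic_T f"
proof (induction rule: trigbump.induct)
  case (bump p)
  show ?case unfolding periodic_T_def by (simp only: cosdist_periodic) simp
qed (auto simp: periodic_T_def sin_add cos_add cos_int_2pin sin_int_2pin)

lemma leibniz_rule_torus:
  fixes q :: "real^'d::finite \<Rightarrow> real^'d \<Rightarrow> complex"
  assumes d: "\<And>x y. y \<in> torus_box \<Longrightarrow> ((\<lambda>x. q x y) has_derivative q' x y) (at x)"
    and c: "\<And>x. continuous_on torus_box (q x)"
    and c': "\<And>v. continuous_on (UNIV \<times> torus_box) (\<lambda>p. q' (fst p) (snd p) v)"
  shows "((\<lambda>x. integral torus_box (q x)) has_derivative (\<lambda>v. integral torus_box (\<lambda>y. q' x y v))) (at x)"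
proof -
  \<comment> \<open>The Leibniz rule wants the derivative as a bounded linear function. Off the box
    the derivative is not assumed, and 0 is a placeholder.\<close>
  define B where "B x y = (if y \<in> torus_box then Blinfun (q' x y) else 0)" for x y
  have B: "blinfun_apply (B x y) = q' x y" if "y \<in> torus_box" for x y
    using that has_derivative_bounded_linear[OF d[OF that]] by (simp add: B_def bounded_linear_Blinfun_apply)
  have Bc: "continuous_on (UNIV \<times> torus_box) (\<lambda>(x, y). B x y)"
  proof (rule continuous_on_blinfun_componentwise)
    fix v :: "real^'d"
    have "continuous_on (UNIV \<times> torus_box) (\<lambda>p. blinfun_apply (case p of (x, y) \<Rightarrow> B x y) v) \<longleftrightarrow>
      continuous_on (UNIV \<times> torus_box) (\<lambda>p. q' (fst p) (snd p) v)"
      by (rule continuous_on_cong) (auto simp: B)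
    then show "continuous_on (UNIV \<times> torus_box) (\<lambda>p. blinfun_apply (case p of (x, y) \<Rightarrow> B x y) v)" using c' by simp
  qed
  have "((\<lambda>x. integral torus_box (q x)) has_derivative blinfun_apply (integral torus_box (B x))) (at x)"
    unfolding torus_box_cbox
  proof (rule leibniz_rule[where U = UNIV])
    show "((\<lambda>x. q x t) has_derivative blinfun_apply (B x t)) (at x)" if "t \<in> cbox 0 (\<chi> i. 2 * pi)" for x t
      using that d B by (simp add: torus_box_cbox)
    show "q x integrable_on cbox 0 (\<chi> i. 2 * pi)" for x
      using c by (intro integrable_continuous) (simp add: torus_box_cbox)
  qed (use Bc in \<open>auto simp: torus_box_cbox\<close>)
  moreover have "blinfun_apply (integral torus_box (B x)) v = integral torus_box (\<lambda>y. q' x y v)" for v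
  proof -
    have "continuous_on torus_box (\<lambda>y. (x, y))" by (intro continuous_intros)
    from continuous_on_compose2[OF Bc this] have "continuous_on torus_box (B x)" by auto
    then have "B x integrable_on torus_box" unfolding torus_box_cbox by (rule integrable_continuous)
    from blinfun_apply_integral[OF this, of v]
    have "blinfun_apply (integral torus_box (B x)) v = integral torus_box (\<lambda>y. blinfun_apply (B x y) v)" .
    also have "\<dots> = integral torus_box (\<lambda>y. q' x y v)" by (rule integral_cong) (simp add: B)
    finally show ?thesis .
  qed
  ultimately show ?thesis by (simp add: fun_eq_iff has_derivative_eq_rhs)
qed

text \<open>The variable x occurs in the kernel alone, so the result inherits smoothness and
  periodicity from the kernel. This lets it act on functions on the box that do not continue
  periodically.\<close>

definition tconv :: "(real^'d::finite \<Rightarrow> real) \<Rightarrow> (real^'d \<Rightarrow> complex) \<Rightarrow> real^'d \<Rightarrow> complex" where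
  "tconv f h x = integral torus_box (\<lambda>y. of_real (f (x - y)) * h y)"

text \<open>Derivatives fall on the kernel: every iterated derivative of the convolution is again a
  convolution of h, with another kernel from \<open>trigbump\<close>.\<close>

lemma tconv_smooth:
  assumes h: "continuous_on torus_box h" and f: "f \<in> trigbump e"
  shows "smooth_fun (tconv f h)"
proof -
  have step: "\<exists>f'. (\<forall>v. f' v \<in> trigbump e) \<and> (\<forall>x. (tconv f h has_derivative (\<lambda>v. tconv (f' v) h x)) (at x))"
    if tf: "f \<in> trigbump e" for f
  proof -
    obtain f' where f': "\<And>v. f' v \<in> trigbump e" "\<And>x. (f has_derivative (\<lambda>v. f' v x)) (at x)"
      using trigbump_has_derivative[OF tf] by metis
    have "((\<lambda>x. integral torus_box (\<lambda>y. of_real (f (x - y)) * h y)) has_derivative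
       (\<lambda>v. integral torus_box (\<lambda>y. of_real (f' v (x - y)) * h y))) (at x)" for x
    proof (rule leibniz_rule_torus)
      show "((\<lambda>x. of_real (f (x - y)) * h y) has_derivative (\<lambda>v. of_real (f' v (x - y)) * h y)) (at x)" for x y
      proof -
        have "((\<lambda>x. f (x + - y)) has_derivative (\<lambda>v. f' v (x + - y))) (at x)"
          by (rule has_derivative_translate) (rule f')
        then show ?thesis by (auto intro!: derivative_eq_intros)
      qed
      show "continuous_on torus_box (\<lambda>y. of_real (f (x - y)) * h y)" for x
        by (intro continuous_intros h continuous_on_compose2[OF trigbump_continuous[OF tf, of UNIV]]) auto
      show "continuous_on (UNIV \<times> torus_box) (\<lambda>p. of_real (f' v (fst p - snd p)) * h (snd p))" for v
        by (intro continuous_intros continuous_on_compose2[OF h] continuous_on_compose2[OF trigbump_continuous[OF f'(1), of UNIV]]) auto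
    qed
    then show ?thesis unfolding tconv_def[abs_def] using f'(1) by blast
  qed
  have "\<exists>g\<in>trigbump e. iter_dd vs (tconv f h) = tconv g h" for vs
  proof (induction vs)
    case Nil then show ?case using f by auto
  next
    case (Cons v vs)
    then obtain g where g: "g \<in> trigbump e" "iter_dd vs (tconv f h) = tconv g h" by auto
    obtain g' where g': "\<And>v. g' v \<in> trigbump e" "\<And>x. (tconv g h has_derivative (\<lambda>v. tconv (g' v) h x)) (at x)"
      using step[OF g(1)] by metis
    have "iter_dd (v # vs) (tconv f h) = tconv (g' v) h"
      using frechet_derivative_at[OF g'(2), symmetric] by (simp add: g fun_eq_iff)
    then show ?case using g'(1) by blast
  qed
  then show ?thesis unfolding smooth_fun_def using step by (metis differentiable_def)
qed

text \<open>The mollifier: a bump in e - \<open>cosdist\<close>, hence supported near the lattice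
  for small e, divided by its integral over the box. In \<open>bump 1\<close> the 1 is the constant
  polynomial.\<close>

definition mker :: "real \<Rightarrow> real^'d::finite \<Rightarrow> real" where
  "mker e x = inverse (integral torus_box (\<lambda>y::real^'d. bump 1 (e - cosdist y))) * bump 1 (e - cosdist x)"

lemma mker_trigbump: "mker e \<in> trigbump e"
  unfolding mker_def[abs_def] by (intro trigbump.intros)

lemma mker_continuous: "continuous_on A (mker e)"
  by (rule trigbump_continuous[OF mker_trigbump])

lemma mker_periodic: "periodic_T (mker e)"
  by (rule trigbump_periodic[OF mker_trigbump])

lemma continuous_torus_integral:
  fixes g :: "real^'d::finite \<Rightarrow> 'b::euclidean_space"
  assumes "continuous_on torus_box g"
  shows "integral torus_box g = (\<integral>y. g y \<partial>TM)" "integrable TM g"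
proof -
  have "set_integrable lborel torus_box g"
    unfolding set_integrable_def by (rule borel_integrable_compact[OF compact_torus_box assms])
  then show "integral torus_box g = (\<integral>y. g y \<partial>TM)" "integrable TM g"
    using set_borel_integral_eq_integral(2)[of torus_box g] by (auto simp: TM_integral TM_integrable)
qed

lemma mker_nonneg: "mker e x \<ge> 0"
proof -
  have b: "0 \<le> bump 1 t" for t by (simp add: bump_def)
  show ?thesis unfolding mker_def
    by (intro mult_nonneg_nonneg inverse_nonnegative_iff_nonnegative[THEN iffD2] b)
       (cases "(\<lambda>y::real^'a. bump 1 (e - cosdist y)) integrable_on torus_box",
        auto intro!: integral_nonneg b simp: not_integrable_integral)
qed

lemma mker_support: "mker e x \<noteq> 0 \<Longrightarrow> cosdist x < e"
  by (auto simp: mker_def bump_def split: if_splits)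

text \<open>The normalising integral is not 0, because the unnormalised bump is continuous,
  nonnegative and positive at the origin.\<close>

lemma mker_integral:
  assumes "e > 0"
  shows "integral torus_box (mker e :: real^'d::finite \<Rightarrow> real) = 1"
proof -
  define b where "b x = bump 1 (e - cosdist x)" for x :: "real^'d"
  have b: "b \<in> trigbump e" unfolding b_def[abs_def] by (intro trigbump.intros)
  have "integral torus_box b \<noteq> 0"
  proof
    assume "integral torus_box b = 0"
    moreover have "box (0::real^'d) (\<chi> i. 2 * pi) \<noteq> {}"
      by (simp add: interval_ne_empty_cart)
    moreover have "b x \<ge> 0" for x by (simp add: b_def bump_def)
    moreover have "(0::real^'d) \<in> cbox 0 (\<chi> i. 2 * pi)" by (auto simp: mem_box_cart)
    ultimately have "b 0 = 0"
      unfolding torus_box_cbox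
      using integral_cbox_eq_0_iff[OF trigbump_continuous[OF b], of 0 "\<chi> i. 2 * pi"] by blast
    then show False using assms by (simp add: b_def bump_def)
  qed
  then show ?thesis unfolding mker_def b_def[symmetric] by simp
qed

lemma mker_reflect_integral:
  assumes "e > 0"
  shows "integral torus_box (\<lambda>y. mker e (x - y)) = 1"
proof -
  have "continuous_on torus_box (\<lambda>y. mker e (x - y))"
    by (rule continuous_on_compose2[OF mker_continuous[of UNIV]]) (auto intro!: continuous_intros)
  then show ?thesis
    using integral_torus_affine_real(1)[OF mker_continuous mker_periodic, of e x] mker_integral[OF assms]
    by (simp add: continuous_torus_integral mker_continuous)
qed

lemma tconv_periodic: "periodic_T f \<Longrightarrow> periodic_T (tconv f h)"
proof -
  assume f: "periodic_T f"
  have "f (k + lattice_vec n - y) = f (k - y)" for k n y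
    using f unfolding periodic_T_def by (metis add_diff_eq add.commute add_diff_cancel_left' diff_add_eq)
  then show ?thesis by (simp add: periodic_T_def tconv_def)
qed

text \<open>The reflected kernel is nonnegative with mass 1, so the difference is a weighted average
  of h - a over the points y with cosdist (x - y) < e. With a = 0 and tolerance 0 the same estimate
  later gives vanishing of the convolution.\<close>

lemma tconv_mker_close:
  fixes h :: "real^'d::finite \<Rightarrow> complex"
  assumes e: "e > 0" and h: "continuous_on torus_box h"
    and le: "\<And>y. y \<in> torus_box \<Longrightarrow> cosdist (x - y) < e \<Longrightarrow> cmod (h y - a) \<le> \<eta>"
  shows "cmod (tconv (mker e) h x - a) \<le> \<eta>"
proof -
  have mc: "continuous_on torus_box (\<lambda>y. mker e (x - y))"
    by (rule continuous_on_compose2[OF mker_continuous[of UNIV]]) (auto intro!: continuous_intros)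
  have i: "(\<lambda>y. of_real (mker e (x - y)) * h y) integrable_on torus_box" "(\<lambda>y. of_real (mker e (x - y)) * a) integrable_on torus_box"
     "(\<lambda>y. of_real (mker e (x - y)) * (h y - a)) integrable_on torus_box" "(\<lambda>y. mker e (x - y) * \<eta>) integrable_on torus_box"
    unfolding torus_box_cbox
    by (intro integrable_continuous continuous_intros h[unfolded torus_box_cbox] mc[unfolded torus_box_cbox])+
  have mi: "(\<lambda>y. mker e (x - y)) integrable_on torus_box"
    unfolding torus_box_cbox by (intro integrable_continuous mc[unfolded torus_box_cbox])
  have "integral torus_box (\<lambda>y. of_real (mker e (x - y)) * a) = of_real (integral torus_box (\<lambda>y. mker e (x - y))) * a"
  proof -
    have "((\<lambda>y. complex_of_real (mker e (x - y)) * a) has_integral of_real (integral torus_box (\<lambda>y. mker e (x - y))) * a) torus_box"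
      using has_integral_mult_left[OF has_integral_of_real[OF integrable_integral[OF mi]]] by blast
    then show ?thesis by (rule integral_unique)
  qed
  also have "\<dots> = a" by (simp add: mker_reflect_integral[OF e])
  finally have "tconv (mker e) h x - a = integral torus_box (\<lambda>y. of_real (mker e (x - y)) * h y) - integral torus_box (\<lambda>y. of_real (mker e (x - y)) * a)"
    by (simp add: tconv_def)
  also have "\<dots> = integral torus_box (\<lambda>y. of_real (mker e (x - y)) * (h y - a))"
    unfolding integral_diff[OF i(1,2), symmetric] by (simp add: right_diff_distrib)
  finally have "cmod (tconv (mker e) h x - a) \<le> integral torus_box (\<lambda>y. mker e (x - y) * \<eta>)"
  proof (simp only:, intro integral_norm_bound_integral i)
    fix y :: "real^'d" assume y: "y \<in> torus_box"
    show "cmod (of_real (mker e (x - y)) * (h y - a)) \<le> mker e (x - y) * \<eta>"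
    proof (cases "mker e (x - y) = 0")
      case False
      from le[OF y mker_support[OF False]] show ?thesis
        using mker_nonneg[of e "x - y"] by (simp add: norm_mult mult_left_mono)
    qed simp
  qed
  also have "\<dots> = \<eta>" by (simp add: integral_mult_left mker_reflect_integral[OF e])
  finally show ?thesis .
qed

text \<open>For periodic h the substitution y -> x - y moves the dependence on x from the kernel to
  h, so the derivative can fall on h. Mollification thus commutes with differentiation and
  approximates the first derivatives as well.\<close>

lemma tconv_mker_has_derivative:
  fixes h :: "real^'d::finite \<Rightarrow> complex"
  assumes h: "periodic_T h" and d: "\<And>x. h differentiable (at x)"
    and c: "\<And>v. continuous_on UNIV (\<lambda>x. frechet_derivative h (at x) v)"
  shows "(tconv (mker e) h has_derivative (\<lambda>v. tconv (mker e) (\<lambda>y. frechet_derivative h (at y) v) x)) (at x)"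
proof -
  have hc: "continuous_on UNIV h" using d by (meson continuous_at_imp_continuous_on differentiable_imp_continuous_within)
  have flip: "tconv (mker e) g x = integral torus_box (\<lambda>y. of_real (mker e y) * g (x - y))"
    if g: "periodic_T g" "continuous_on UNIV g" for g :: "real^'d \<Rightarrow> complex" and x
  proof -
    define G where "G y = of_real (mker e y) * g (x - y)" for y
    have Gp: "periodic_T G"
      using g(1) mker_periodic[of e] periodic_T_diff[OF g(1)] unfolding periodic_T_def G_def
      by (metis diff_diff_eq)
    have Gc: "continuous_on A G" for A unfolding G_def
      by (intro continuous_intros mker_continuous continuous_on_compose2[OF g(2)]) auto
    have "continuous_on torus_box (\<lambda>y. G (x - y))"
      by (rule continuous_on_compose2[OF Gc[of UNIV]]) (auto intro!: continuous_intros)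
    then have "integral torus_box (\<lambda>y. G (x - y)) = integral torus_box G"
      using integral_torus_reflect_complex[OF Gc Gp, of x] by (simp add: continuous_torus_integral Gc)
    then show ?thesis by (simp add: tconv_def G_def[abs_def])
  qed
  have dp: "periodic_T (\<lambda>y. frechet_derivative h (at y) v)" for v
    unfolding periodic_T_def by (simp add: periodic_frechet_derivative[OF h])
  have "((\<lambda>x. integral torus_box (\<lambda>y. of_real (mker e y) * h (x - y))) has_derivative
    (\<lambda>v. integral torus_box (\<lambda>y. of_real (mker e y) * frechet_derivative h (at (x - y)) v))) (at x)"
  proof (rule leibniz_rule_torus)
    show "((\<lambda>x. of_real (mker e y) * h (x - y)) has_derivative (\<lambda>v. of_real (mker e y) * frechet_derivative h (at (x - y)) v)) (at x)" for x y
    proof -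
      have "((\<lambda>x. h (x + - y)) has_derivative frechet_derivative h (at (x + - y))) (at x)"
        by (rule has_derivative_translate) (rule frechet_derivative_works[THEN iffD1, OF d])
      then show ?thesis by (auto intro!: derivative_eq_intros)
    qed
    show "continuous_on torus_box (\<lambda>y. of_real (mker e y) * h (x - y))" for x
      by (intro continuous_intros mker_continuous continuous_on_compose2[OF hc]) auto
    show "continuous_on (UNIV \<times> torus_box) (\<lambda>p. of_real (mker e (snd p)) * frechet_derivative h (at (fst p - snd p)) v)" for v
      by (intro continuous_intros continuous_on_compose2[OF mker_continuous[of UNIV]] continuous_on_compose2[OF c]) auto
  qed
  moreover have "(\<lambda>x. integral torus_box (\<lambda>y. of_real (mker e y) * h (x - y))) = tconv (mker e) h"
    by (simp add: fun_eq_iff flip[OF h hc])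
  moreover have "(\<lambda>v. integral torus_box (\<lambda>y. of_real (mker e y) * frechet_derivative h (at (x - y)) v))
     = (\<lambda>v. tconv (mker e) (\<lambda>y. frechet_derivative h (at y) v) x)"
    by (simp add: fun_eq_iff flip[OF dp c])
  ultimately show ?thesis by simp
qed

text \<open>On the box without the \<delta>-balls about lattice points, a compact set,
  \<open>cosdist\<close> is positive and attains its minimum.\<close>

lemma cosdist_small_near_lattice:
  assumes "\<delta> > 0"
  obtains e where "e > 0" "\<And>z::real^'d::finite. cosdist z < e \<Longrightarrow> \<exists>n. norm (z - lattice_vec n) < \<delta>"
proof -
  define K where "K = (torus_box :: (real^'d) set) - (\<Union>n. ball (lattice_vec n) \<delta>)"
  have K: "compact K" unfolding K_def
    by (intro compact_diff compact_torus_box open_UN) auto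
  have pos: "cosdist z > 0" if z: "z \<in> K" for z
  proof (rule ccontr)
    assume "\<not> cosdist z > 0"
    moreover have "cosdist z \<ge> 0" by (intro sum_nonneg) auto
    ultimately have "cosdist z = 0" by simp
    then have "cos (z$i) = 1" for i by (subst (asm) sum_nonneg_eq_0_iff) auto
    then have "\<exists>n::int. z$i = of_int n * 2 * pi" for i by (simp add: cos_one_2pi_int)
    then obtain n :: "'d \<Rightarrow> int" where "\<And>i. z$i = of_int (n i) * 2 * pi" by metis
    then have "z = lattice_vec n" by (simp add: vec_eq_iff)
    moreover have "lattice_vec n \<in> ball (lattice_vec n) \<delta>" using assms by simp
    ultimately show False using z by (auto simp only: K_def)
  qed
  obtain e where e: "e > 0" "\<And>z. z \<in> K \<Longrightarrow> e \<le> cosdist z"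
  proof (cases "K = {}")
    case True then show ?thesis using that[of 1] by auto
  next
    case False
    have "continuous_on K (cosdist :: real^'d \<Rightarrow> real)" by (intro continuous_intros)
    from continuous_attains_inf[OF K False this] pos show ?thesis using that by (metis)
  qed
  show thesis
  proof (rule that[OF e(1)])
    fix z :: "real^'d" assume z: "cosdist z < e"
    obtain m where m: "z + lattice_vec m \<in> torus_box" by (rule lattice_reduce)
    have "z + lattice_vec m \<notin> K" using e(2)[of "z + lattice_vec m"] z unfolding cosdist_periodic by auto
    then obtain n where "norm (lattice_vec n - (z + lattice_vec m)) < \<delta>" using m by (auto simp: K_def dist_norm)
    moreover have "lattice_vec n - (z + lattice_vec m) = - (z - lattice_vec (\<lambda>i. n i - m i))"
      by (simp add: vec_eq_iff algebra_simps)
    ultimately show "\<exists>n. norm (z - lattice_vec n) < \<delta>" by (metis norm_minus_cancel)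
  qed
qed

section \<open>The gradient flow\<close>

locale analytic_torus =
  fixes E :: "real^'d::finite \<Rightarrow> real"
  assumes E_periodic: "periodic_T E" and E_analytic: "real_analytic_Rd E"
begin

section \<open>Gradient, Hessian and Laplacian as fields with Lipschitz derivatives\<close>

abbreviation G :: "real^'d \<Rightarrow> real^'d" where "G \<equiv> gradient E"

abbreviation E2 :: "'d \<Rightarrow> 'd \<Rightarrow> real^'d \<Rightarrow> real" where
  "E2 i j \<equiv> pderiv_at i (pderiv_at j E)"

abbreviation E3 :: "'d \<Rightarrow> 'd \<Rightarrow> 'd \<Rightarrow> real^'d \<Rightarrow> real" where
  "E3 l i j \<equiv> pderiv_at l (pderiv_at i (pderiv_at j E))"

definition DG :: "real^'d \<Rightarrow> real^'d \<Rightarrow> real^'d" where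
  "DG k h = (\<chi> i. \<Sum>j\<in>UNIV. E2 j i k * h$j)"

definition Lap :: "real^'d \<Rightarrow> real" where
  "Lap k = (\<Sum>i\<in>UNIV. E2 i i k)"

definition DLap :: "real^'d \<Rightarrow> real^'d \<Rightarrow> real" where
  "DLap k h = (\<Sum>i\<in>UNIV. \<Sum>j\<in>UNIV. E3 j i i k * h$j)"

lemma pderiv_at_periodic: "periodic_T f \<Longrightarrow> periodic_T (pderiv_at i f)"
  by (simp add: periodic_T_def[of "pderiv_at i f"] periodic_frechet_derivative)

lemma analytic_continuous: "real_analytic_Rd f \<Longrightarrow> continuous_on A f"
  by (intro continuous_at_imp_continuous_on ballI has_derivative_continuous[OF real_analytic_has_derivative])

lemma analytic_periodic_bound:
  fixes f :: "real^'d \<Rightarrow> real"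
  assumes "real_analytic_Rd f" "periodic_T f"
  shows "\<exists>B\<ge>0. (\<forall>k. \<bar>f k\<bar> \<le> B) \<and> (\<forall>k k'. \<bar>f k - f k'\<bar> \<le> B * norm (k - k'))"
proof -
  have "\<exists>B>0. \<forall>k. \<bar>g k\<bar> \<le> B" if "real_analytic_Rd g" "periodic_T g" for g :: "real^'d \<Rightarrow> real"
    using periodic_continuous_bounded[OF that(2) analytic_continuous[OF that(1)]] by (metis real_norm_def)
  note b = this
  obtain B0 where B0: "B0 > 0" "\<And>k. \<bar>f k\<bar> \<le> B0" using b[OF assms] by auto
  have "\<forall>i. \<exists>B>0. \<forall>k. \<bar>pderiv_at i f k\<bar> \<le> B"
    by (intro allI b real_analytic_pderiv_at pderiv_at_periodic assms)
  then obtain B where B: "\<And>i. B i > 0" "\<And>i k. \<bar>pderiv_at i f k\<bar> \<le> B i" by metis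
  define C where "C = (\<Sum>i\<in>UNIV. B i)"
  have C0: "C \<ge> 0" unfolding C_def by (intro sum_nonneg) (auto intro: less_imp_le B)
  have "norm (f k - f k') \<le> C * norm (k - k')" for k k'
  proof (rule differentiable_bound[of UNIV f "\<lambda>k h. \<Sum>i\<in>UNIV. pderiv_at i f k * h$i"])
    show "onorm (\<lambda>h. \<Sum>i\<in>UNIV. pderiv_at i f k * h$i) \<le> C" for k
    proof (rule onorm_le)
      fix h :: "real^'d"
      have "norm (\<Sum>i\<in>UNIV. pderiv_at i f k * h$i) \<le> (\<Sum>i\<in>UNIV. B i * norm h)"
        by (rule sum_norm_le) (simp add: abs_mult mult_mono B component_le_norm_cart less_imp_le)
      then show "norm (\<Sum>i\<in>UNIV. pderiv_at i f k * h$i) \<le> C * norm h" by (simp add: C_def sum_distrib_right)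
    qed
  qed (auto intro!: real_analytic_has_derivative assms)
  then have "\<bar>f k - f k'\<bar> \<le> (B0 + C) * norm (k - k')" for k k'
    using order_trans[of "\<bar>f k - f k'\<bar>" "C * norm (k - k')" "(B0 + C) * norm (k - k')"] B0(1)
    by (simp add: mult_right_mono)
  moreover have "\<bar>f k\<bar> \<le> B0 + C" for k using B0(2)[of k] C0 by linarith
  ultimately show ?thesis using C0 B0(1) by (intro exI[of _ "B0 + C"]) auto
qed

lemma E_has_derivative: "(E has_derivative (\<lambda>h. G k \<bullet> h)) (at k)"
  using real_analytic_has_derivative[OF E_analytic, of k]
  by (simp add: inner_vec_def gradient_def)

lemma E_continuous: "continuous_on A E"
  by (rule analytic_continuous[OF E_analytic])

lemma E2_analytic: "real_analytic_Rd (E2 i j)" "periodic_T (E2 i j)"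
  by (intro real_analytic_pderiv_at pderiv_at_periodic E_analytic E_periodic)+

lemma E3_analytic: "real_analytic_Rd (E3 l i j)" "periodic_T (E3 l i j)"
  by (intro real_analytic_pderiv_at pderiv_at_periodic E_analytic E_periodic)+

lemma G_periodic: "G (k + lattice_vec n) = G k"
  by (simp add: gradient_def periodic_frechet_derivative[OF E_periodic])

lemma Lap_periodic: "Lap (k + lattice_vec n) = Lap k"
  using E2_analytic(2) unfolding periodic_T_def by (simp add: Lap_def)

lemma G_has_derivative: "(G has_derivative DG k) (at k)"
proof -
  have "((\<lambda>x. G x \<bullet> b) has_derivative (\<lambda>h. DG k h \<bullet> b)) (at k)" if "b \<in> Basis" for b :: "real^'d"
  proof -
    from that have "\<exists>i. b = axis i 1" by (auto simp: Basis_vec_def)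
    then obtain i where b: "b = axis i 1" ..
    have "(pderiv_at i E has_derivative (\<lambda>h. \<Sum>j\<in>UNIV. E2 j i k * h$j)) (at k)"
      by (intro real_analytic_has_derivative real_analytic_pderiv_at E_analytic)
    then show ?thesis by (simp add: b inner_axis gradient_def DG_def)
  qed
  then show ?thesis by (simp add: has_derivative_componentwise_within[of G])
qed

lemma G_continuous: "continuous_on A G"
  by (intro continuous_at_imp_continuous_on ballI has_derivative_continuous[OF G_has_derivative])

lemma hessian_eq: "hessian E k = DG k"
  unfolding hessian_def by (rule frechet_derivative_at[OF G_has_derivative, symmetric])

lemma DG_linear: "linear (DG k)"
  using G_has_derivative has_derivative_bounded_linear bounded_linear.linear by blast

lemma DG_symmetric: "v \<bullet> DG k w = DG k v \<bullet> w"
proof -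
  have "v \<bullet> DG k w = (\<Sum>i\<in>UNIV. \<Sum>j\<in>UNIV. v$i * E2 j i k * w$j)"
    by (simp add: inner_vec_def DG_def sum_distrib_left mult.assoc)
  also have "\<dots> = (\<Sum>j\<in>UNIV. \<Sum>i\<in>UNIV. v$i * E2 j i k * w$j)" by (rule sum.swap)
  also have "\<dots> = (\<Sum>j\<in>UNIV. \<Sum>i\<in>UNIV. E2 i j k * v$i * w$j)"
  proof (intro sum.cong refl)
    show "v$i * E2 j i k * w$j = E2 i j k * v$i * w$j" for i j
      using pderiv_at_commute[OF E_analytic, where i = j and j = i and x = k] by simp
  qed
  also have "\<dots> = DG k v \<bullet> w"
    by (simp add: inner_vec_def DG_def sum_distrib_right)
  finally show ?thesis .
qed

lemma Lap_has_derivative: "(Lap has_derivative DLap k) (at k)"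
  unfolding Lap_def[abs_def] DLap_def[abs_def]
  by (intro has_derivative_sum real_analytic_has_derivative E2_analytic)

lemma Lap_continuous: "continuous_on A Lap"
  by (intro continuous_at_imp_continuous_on ballI has_derivative_continuous[OF Lap_has_derivative])

lemma Lap_eq_trace: "Lap k = (\<Sum>i\<in>UNIV. DG k (axis i 1) $ i)"
  by (simp add: Lap_def DG_def axis_def if_distrib cong: if_cong)

lemma derivative_constants:
  obtains B where "B > 0" "\<And>k h. norm (DG k h) \<le> B * norm h" "\<And>k k' h. norm (DG k h - DG k' h) \<le> B * norm (k - k') * norm h"
    "\<And>k h. \<bar>DLap k h\<bar> \<le> B * norm h" "\<And>k k' h. \<bar>DLap k h - DLap k' h\<bar> \<le> B * norm (k - k') * norm h"
proof -
  define Q where "Q f B \<longleftrightarrow> 0 \<le> B \<and> (\<forall>k. \<bar>f k\<bar> \<le> B) \<and> (\<forall>k k'. \<bar>f k - f k'\<bar> \<le> B * norm (k - k'))" for f :: "real^'d \<Rightarrow> real" and B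
  have Q: "Q f (SOME B. Q f B)" if "real_analytic_Rd f" "periodic_T f" for f
    using analytic_periodic_bound[OF that] by (intro someI_ex[of "Q f"]) (simp add: Q_def)
  \<comment> \<open>The constants are selected as functions of the indices so that they can be added
    up to a single one.\<close>
  define C where "C i j = (SOME B. Q (E2 i j) B)" for i j
  define D where "D l i j = (SOME B. Q (E3 l i j) B)" for l i j
  have "Q (E2 i j) (C i j)" "Q (E3 l i j) (D l i j)" for l i j
    unfolding C_def D_def by (intro Q E2_analytic E3_analytic)+
  then have C: "\<And>i j. C i j \<ge> 0" "\<And>i j k. \<bar>E2 i j k\<bar> \<le> C i j" "\<And>i j k k'. \<bar>E2 i j k - E2 i j k'\<bar> \<le> C i j * norm (k - k')"
    and D: "\<And>l i j. D l i j \<ge> 0" "\<And>l i j k. \<bar>E3 l i j k\<bar> \<le> D l i j" "\<And>l i j k k'. \<bar>E3 l i j k - E3 l i j k'\<bar> \<le> D l i j * norm (k - k')"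
    unfolding Q_def by simp_all
  define B where "B = 1 + (\<Sum>i\<in>UNIV. \<Sum>j\<in>UNIV. C j i) + (\<Sum>i\<in>UNIV. \<Sum>j\<in>UNIV. D j i i)"
  have C0: "(\<Sum>i\<in>UNIV. \<Sum>j\<in>UNIV. C j i) \<ge> 0" and D0: "(\<Sum>i\<in>UNIV. \<Sum>j\<in>UNIV. D j i i) \<ge> 0"
    by (intro sum_nonneg C D)+
  have sumG: "norm (\<chi> i. \<Sum>j\<in>UNIV. a j i * h$j) \<le> B * r * norm h"
    if "\<And>i j. \<bar>a j i\<bar> \<le> C j i * r" "r \<ge> 0" for a :: "'d \<Rightarrow> 'd \<Rightarrow> real" and h :: "real^'d" and r
  proof -
    have "norm (\<chi> i. \<Sum>j\<in>UNIV. a j i * h$j) \<le> (\<Sum>i\<in>UNIV. \<bar>\<Sum>j\<in>UNIV. a j i * h$j\<bar>)"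
      using norm_le_l1_cart[of "\<chi> i. \<Sum>j\<in>UNIV. a j i * h$j"] by simp
    also have "\<dots> \<le> (\<Sum>i\<in>UNIV. \<Sum>j\<in>UNIV. (C j i * r) * norm h)"
    proof (rule sum_mono)
      fix i
      have "\<bar>\<Sum>j\<in>UNIV. a j i * h$j\<bar> \<le> (\<Sum>j\<in>UNIV. \<bar>a j i * h$j\<bar>)" by (rule sum_abs)
      also have "\<dots> \<le> (\<Sum>j\<in>UNIV. (C j i * r) * norm h)"
        unfolding abs_mult using C(1) that(2) by (intro sum_mono mult_mono that(1) component_le_norm_cart) auto
      finally show "\<bar>\<Sum>j\<in>UNIV. a j i * h$j\<bar> \<le> (\<Sum>j\<in>UNIV. (C j i * r) * norm h)" .
    qed
    also have "\<dots> = (\<Sum>i\<in>UNIV. \<Sum>j\<in>UNIV. C j i) * (r * norm h)" by (simp add: sum_distrib_right mult.assoc)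
    also have "\<dots> \<le> B * (r * norm h)" using that(2) C0 D0 by (intro mult_right_mono) (auto simp: B_def)
    finally show ?thesis by (simp add: mult.assoc)
  qed
  have sumL: "\<bar>\<Sum>i\<in>UNIV. \<Sum>j\<in>UNIV. a j i * h$j\<bar> \<le> B * r * norm h"
    if "\<And>i j. \<bar>a j i\<bar> \<le> D j i i * r" "r \<ge> 0" for a :: "'d \<Rightarrow> 'd \<Rightarrow> real" and h :: "real^'d" and r
  proof -
    have "\<bar>\<Sum>i\<in>UNIV. \<Sum>j\<in>UNIV. a j i * h$j\<bar> \<le> (\<Sum>i\<in>UNIV. \<bar>\<Sum>j\<in>UNIV. a j i * h$j\<bar>)" by (rule sum_abs)
    also have "\<dots> \<le> (\<Sum>i\<in>UNIV. \<Sum>j\<in>UNIV. (D j i i * r) * norm h)"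
    proof (rule sum_mono)
      fix i
      have "\<bar>\<Sum>j\<in>UNIV. a j i * h$j\<bar> \<le> (\<Sum>j\<in>UNIV. \<bar>a j i * h$j\<bar>)" by (rule sum_abs)
      also have "\<dots> \<le> (\<Sum>j\<in>UNIV. (D j i i * r) * norm h)"
        unfolding abs_mult using D(1) that(2) by (intro sum_mono mult_mono that(1) component_le_norm_cart) auto
      finally show "\<bar>\<Sum>j\<in>UNIV. a j i * h$j\<bar> \<le> (\<Sum>j\<in>UNIV. (D j i i * r) * norm h)" .
    qed
    also have "\<dots> = (\<Sum>i\<in>UNIV. \<Sum>j\<in>UNIV. D j i i) * (r * norm h)" by (simp add: sum_distrib_right mult.assoc)
    also have "\<dots> \<le> B * (r * norm h)" using that(2) C0 D0 by (intro mult_right_mono) (auto simp: B_def)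
    finally show ?thesis by (simp add: mult.assoc)
  qed
  show thesis
  proof (rule that[of B])
    show "B > 0" using C0 D0 by (simp add: B_def)
    show "norm (DG k h) \<le> B * norm h" for k h using sumG[of "\<lambda>j i. E2 j i k" 1 h] C by (simp add: DG_def)
    show "\<bar>DLap k h\<bar> \<le> B * norm h" for k h using sumL[of "\<lambda>j i. E3 j i i k" 1 h] D by (simp add: DLap_def)
    show "norm (DG k h - DG k' h) \<le> B * norm (k - k') * norm h" for k k' h
    proof -
      have "DG k h - DG k' h = (\<chi> i. \<Sum>j\<in>UNIV. (E2 j i k - E2 j i k') * h$j)"
        by (simp add: DG_def vec_eq_iff sum_subtractf left_diff_distrib)
      then show ?thesis using sumG[of "\<lambda>j i. E2 j i k - E2 j i k'" "norm (k - k')" h] C by simp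
    qed
    show "\<bar>DLap k h - DLap k' h\<bar> \<le> B * norm (k - k') * norm h" for k k' h
    proof -
      have "DLap k h - DLap k' h = (\<Sum>i\<in>UNIV. \<Sum>j\<in>UNIV. (E3 j i i k - E3 j i i k') * h$j)"
        by (simp add: DLap_def sum_subtractf left_diff_distrib)
      then show ?thesis using sumL[of "\<lambda>j i. E3 j i i k - E3 j i i k'" "norm (k - k')" h] D by simp
    qed
  qed
qed

text \<open>The gradient flow is augmented by a scalar component that accumulates the Laplacian along
  orbits; this is the logarithm of the Jacobian determinant of the gradient flow.\<close>

definition Z :: "(real^'d) \<times> real \<Rightarrow> (real^'d) \<times> real" where
  "Z p = (G (fst p), Lap (fst p))"

definition DZ :: "(real^'d) \<times> real \<Rightarrow> (real^'d) \<times> real \<Rightarrow> (real^'d) \<times> real" where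
  "DZ p h = (DG (fst p) (fst h), DLap (fst p) (fst h))"

text \<open>The sublocale needs a term for the Lipschitz constant, while existence of a suitable
  constant is all that is proved; hence the choice operator.\<close>

definition LZ :: real where "LZ = (SOME B. C1_field Z DZ B B)"

lemma Z_C1_field: "C1_field Z DZ LZ LZ"
proof -
  obtain B where B: "B > 0" "\<And>k h. norm (DG k h) \<le> B * norm h" "\<And>k k' h. norm (DG k h - DG k' h) \<le> B * norm (k - k') * norm h"
    "\<And>k h. \<bar>DLap k h\<bar> \<le> B * norm h" "\<And>k k' h. \<bar>DLap k h - DLap k' h\<bar> \<le> B * norm (k - k') * norm h"
    using derivative_constants by metis
  have "C1_field Z DZ (2 * B) (2 * B)"
  proof
    have fst': "norm (fst h) \<le> norm h" for h :: "(real^'d) \<times> real"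
      using norm_fst_le[of "fst h" "snd h"] by simp
    show "(Z has_derivative DZ x) (at x)" for x
      unfolding Z_def[abs_def] DZ_def[abs_def]
      by (intro has_derivative_Pair has_derivative_compose[OF has_derivative_fst[OF has_derivative_ident] G_has_derivative]
          has_derivative_compose[OF has_derivative_fst[OF has_derivative_ident] Lap_has_derivative])
    show "norm (DZ x h) \<le> 2 * B * norm h" for x h
    proof -
      have "norm (DZ x h) \<le> norm (DG (fst x) (fst h)) + norm (DLap (fst x) (fst h))"
        unfolding DZ_def by (rule norm_Pair_le)
      also have "\<dots> \<le> B * norm (fst h) + B * norm (fst h)" using B by (intro add_mono) auto
      also have "\<dots> \<le> B * norm h + B * norm h" using B(1) fst' by (intro add_mono mult_left_mono) auto
      finally show ?thesis by simp
    qed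
    show "norm (DZ x h - DZ y h) \<le> 2 * B * norm (x - y) * norm h" for x y h
    proof -
      have "norm (DZ x h - DZ y h) \<le> norm (DG (fst x) (fst h) - DG (fst y) (fst h)) + norm (DLap (fst x) (fst h) - DLap (fst y) (fst h))"
        unfolding DZ_def diff_Pair by (rule norm_Pair_le)
      also have "\<dots> \<le> B * norm (fst (x - y)) * norm (fst h) + B * norm (fst (x - y)) * norm (fst h)" using B by (intro add_mono) auto
      also have "\<dots> \<le> B * norm (x - y) * norm h + B * norm (x - y) * norm h"
        using B(1) by (intro add_mono mult_mono mult_left_mono fst') auto
      finally show ?thesis by (simp add: ac_simps)
    qed
  qed (use B in auto)
  then show ?thesis unfolding LZ_def by (rule someI)
qed

sublocale Zf: C1_field Z DZ LZ LZ
  by (rule Z_C1_field)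


section \<open>The gradient flow and the accumulated Laplacian\<close>

definition phi :: "real \<Rightarrow> real^'d \<Rightarrow> real^'d" where
  "phi t k = fst (Zf.fl t (k, 0))"

definition Ip :: "real \<Rightarrow> real^'d \<Rightarrow> real" where
  "Ip t k = snd (Zf.fl t (k, 0))"

lemma phi_0 [simp]: "phi 0 k = k" and Ip_0 [simp]: "Ip 0 k = 0"
  by (simp_all add: phi_def Ip_def Zf.fl_solution)

lemma phi_deriv: "((\<lambda>t. phi t k) has_vector_derivative G (phi t k)) (at t)"
  using bounded_linear.has_vector_derivative[OF bounded_linear_fst Zf.fl_solution(2), of "(k, 0)" t]
  by (simp add: phi_def Z_def)

lemma Ip_deriv: "((\<lambda>t. Ip t k) has_real_derivative Lap (phi t k)) (at t)"
  using bounded_linear.has_vector_derivative[OF bounded_linear_snd Zf.fl_solution(2), of "(k, 0)" t]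
  by (simp add: phi_def Ip_def Z_def has_real_derivative_iff_has_vector_derivative)

lemma Ip_vector_deriv: "((\<lambda>t. Ip t k) has_vector_derivative Lap (phi t k)) (at t)"
  using Ip_deriv by (simp add: has_real_derivative_iff_has_vector_derivative)

text \<open>\<open>Z\<close> does not depend on the scalar component, so shifting its initial value
  shifts the whole orbit. This makes \<open>Ip\<close> an additive cocycle over the gradient
  flow.\<close>

lemma fl_shift: "Zf.fl t (k, z) = (phi t k, z + Ip t k)"
proof (rule Zf.fl_unique[symmetric])
  show "((\<lambda>t. (phi t k, z + Ip t k)) has_vector_derivative Z (phi t k, z + Ip t k)) (at t)" for t
  proof -
    have "((\<lambda>t. z + Ip t k) has_vector_derivative Lap (phi t k)) (at t)"
      using has_vector_derivative_add[OF has_vector_derivative_const[of z] Ip_vector_deriv[of k t]] by simp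
    from has_vector_derivative_Pair[OF phi_deriv[of k t] this] show ?thesis by (simp add: Z_def)
  qed
qed simp

lemma phi_add: "phi (s + t) k = phi s (phi t k)" and Ip_add: "Ip (s + t) k = Ip t k + Ip s (phi t k)"
  using Zf.fl_add[of s t "(k, 0)"] unfolding fl_shift by auto

lemma phi_inverse: "phi (- t) (phi t k) = k" "phi t (phi (- t) k) = k"
  using phi_add[of "- t" t k] phi_add[of t "- t" k] by simp_all

lemma fl_lattice: "Zf.fl t (k + lattice_vec n, 0) = (phi t k + lattice_vec n, Ip t k)"
proof (rule Zf.fl_unique[symmetric])
  show "((\<lambda>t. (phi t k + lattice_vec n, Ip t k)) has_vector_derivative Z (phi t k + lattice_vec n, Ip t k)) (at t)" for t
  proof -
    have "((\<lambda>t. phi t k + lattice_vec n) has_vector_derivative G (phi t k)) (at t)"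
      using has_vector_derivative_add[OF phi_deriv[of k t] has_vector_derivative_const[of "lattice_vec n"]] by simp
    from has_vector_derivative_Pair[OF this Ip_vector_deriv[of k t]] show ?thesis
      by (simp add: Z_def G_periodic Lap_periodic)
  qed
qed simp

lemma phi_lattice: "phi t (k + lattice_vec n) = phi t k + lattice_vec n"
  and Ip_lattice: "Ip t (k + lattice_vec n) = Ip t k"
  using fl_lattice[of t k n] by (auto simp: phi_def Ip_def)

lemma continuous_on_phi [continuous_intros]:
  "continuous_on A s \<Longrightarrow> continuous_on A g \<Longrightarrow> continuous_on A (\<lambda>p. phi (s p) (g p))"
  unfolding phi_def by (intro continuous_intros)

definition vphi :: "real \<Rightarrow> real^'d \<Rightarrow> real^'d \<Rightarrow> real^'d" where
  "vphi t k h = fst (Zf.vfl t (k, 0) (h, 0))"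

definition vIp :: "real \<Rightarrow> real^'d \<Rightarrow> real^'d \<Rightarrow> real" where
  "vIp t k h = snd (Zf.vfl t (k, 0) (h, 0))"

lemma fl_has_derivative_pair:
  "((\<lambda>p. Zf.fl (fst p) (snd p, 0)) has_derivative (\<lambda>q. fst q *\<^sub>R Z (Zf.fl t (k, 0)) + Zf.vfl t (k, 0) (snd q, 0))) (at (t, k))"
proof -
  have d: "((\<lambda>p. (fst p, snd p, 0::real)) has_derivative (\<lambda>p. (fst p, snd p, 0))) (at (t, k))"
    by (intro has_derivative_Pair has_derivative_fst has_derivative_snd has_derivative_ident has_derivative_const)
  have "((\<lambda>p. (\<lambda>(t, x). Zf.fl t x) (fst p, snd p, 0)) has_derivative
    (\<lambda>p. (\<lambda>(\<tau>, h). \<tau> *\<^sub>R Z (Zf.fl t (k, 0)) + Zf.vfl t (k, 0) h) (fst p, snd p, 0))) (at (t, k))"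
    by (rule has_derivative_compose[OF d]) (simp add: Zf.fl_has_derivative)
  then show ?thesis by simp
qed

lemma phi_has_derivative:
  "((\<lambda>p. phi (fst p) (snd p)) has_derivative (\<lambda>q. fst q *\<^sub>R G (phi t k) + vphi t k (snd q))) (at (t, k))"
  using has_derivative_fst[OF fl_has_derivative_pair[of t k]]
  by (simp add: phi_def vphi_def Z_def)

lemma Ip_has_derivative:
  "((\<lambda>p. Ip (fst p) (snd p)) has_derivative (\<lambda>q. fst q * Lap (phi t k) + vIp t k (snd q))) (at (t, k))"
  using has_derivative_snd[OF fl_has_derivative_pair[of t k]]
  by (simp add: Ip_def vIp_def Z_def phi_def)

lemma continuous_on_vphi [continuous_intros]:
  assumes "continuous_on A s" "continuous_on A g"
  shows "continuous_on A (\<lambda>p. vphi (s p) (g p) h)"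
proof -
  have "continuous_on A (\<lambda>p. (s p, g p, 0::real))" by (intro continuous_intros assms)
  from continuous_on_compose2[OF Zf.vfl_continuous[of "(h, 0)"] this]
  have "continuous_on A (\<lambda>p. Zf.vfl (s p) (g p, 0) (h, 0))" by simp
  then show ?thesis unfolding vphi_def by (rule continuous_on_fst)
qed

lemma continuous_on_vIp [continuous_intros]:
  assumes "continuous_on A s" "continuous_on A g"
  shows "continuous_on A (\<lambda>p. vIp (s p) (g p) h)"
proof -
  have "continuous_on A (\<lambda>p. (s p, g p, 0::real))" by (intro continuous_intros assms)
  from continuous_on_compose2[OF Zf.vfl_continuous[of "(h, 0)"] this]
  have "continuous_on A (\<lambda>p. Zf.vfl (s p) (g p, 0) (h, 0))" by simp
  then show ?thesis unfolding vIp_def by (rule continuous_on_snd)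
qed

lemma phi_differentiable: "phi t differentiable (at k)"
proof -
  have "((\<lambda>k. (t, k)) has_derivative (\<lambda>h. (0, h))) (at k)"
    by (intro has_derivative_Pair has_derivative_const has_derivative_ident)
  from has_derivative_compose[OF this phi_has_derivative] show ?thesis
    unfolding differentiable_def by auto
qed

lemma phi_rescaled_unique:
  assumes a: "continuous_on UNIV (a :: real \<Rightarrow> real)"
    and u: "\<And>t. (u has_vector_derivative a t *\<^sub>R G (u t)) (at t)"
    and S: "\<And>t. (S has_real_derivative a t) (at t)" "S 0 = 0"
  shows "u t = phi (S t) (u 0)"
proof -
  have "continuous_on UNIV u" by (rule has_vector_derivative_imp_continuous_on[OF u])
  \<comment> \<open>Uniqueness is known for the augmented field, so u is completed by a scalar z
    that integrates the rescaled Laplacian along it.\<close>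
  then have "continuous_on UNIV (\<lambda>t. a t * Lap (u t))"
    by (intro continuous_intros a continuous_on_compose2[OF Lap_continuous[of UNIV]]) auto
  then obtain z where z: "z 0 = 0" "\<And>t. (z has_vector_derivative a t * Lap (u t)) (at t)"
    by (rule continuous_has_antiderivative) blast
  have "(u t, z t) = Zf.fl (S t) (u 0, z 0)"
    by (rule Zf.fl_rescaled_unique[OF a _ S])
       (use z u in \<open>auto simp: Z_def intro!: has_vector_derivative_Pair\<close>)
  then show ?thesis by (simp add: phi_def z(1)) (metis fst_conv)
qed

section \<open>Energy along gradient orbits\<close>

lemma E_phi_deriv: "((\<lambda>t. E (phi t k)) has_real_derivative (norm (G (phi t k)))\<^sup>2) (at t)"
proof -
  have "((\<lambda>t. E (phi t k)) has_derivative (\<lambda>s. G (phi t k) \<bullet> (s *\<^sub>R G (phi t k)))) (at t)"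
    by (rule has_derivative_compose[OF phi_deriv[unfolded has_vector_derivative_def] E_has_derivative])
  then show ?thesis unfolding has_field_derivative_def
    by (rule has_derivative_eq_rhs) (simp add: fun_eq_iff dot_square_norm)
qed

lemma E_phi_mono: "s \<le> t \<Longrightarrow> E (phi s k) \<le> E (phi t k)"
  by (rule DERIV_nonneg_imp_nondecreasing[of s t "\<lambda>t. E (phi t k)"]) (auto intro!: E_phi_deriv exI)

lemma crit_fixed: assumes "k \<in> crit E" shows "phi t k = k"
proof -
  have "k = phi t k"
    using phi_rescaled_unique[of "\<lambda>_. 1" "\<lambda>_. k" "\<lambda>t. t" t] assms by (simp add: crit_def)
  then show ?thesis by simp
qed

lemma phi_not_crit: assumes "k \<notin> crit E" shows "phi t k \<notin> crit E"
proof
  assume "phi t k \<in> crit E"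
  then have "phi (- t) (phi t k) = phi t k" by (rule crit_fixed)
  then show False using assms phi_inverse(1)[of t k] \<open>phi t k \<in> crit E\<close> by simp
qed

lemma E_phi_strict_mono:
  assumes "k \<notin> crit E" "s < t"
  shows "E (phi s k) < E (phi t k)"
proof (rule DERIV_pos_imp_increasing[OF assms(2)])
  fix x
  have "G (phi x k) \<noteq> 0" using phi_not_crit[OF assms(1), of x] by (simp add: crit_def)
  then show "\<exists>y. ((\<lambda>t. E (phi t k)) has_real_derivative y) (at x) \<and> 0 < y"
    using E_phi_deriv[of k x] by (intro exI conjI) auto
qed

end

section \<open>Orbits reaching saddle points form a closed null set\<close>

locale morse_band = analytic_torus E for E :: "real^'d::finite \<Rightarrow> real" +
  fixes F :: "real \<Rightarrow> real" and kmin kmax :: "real^'d" and Emin Emax Er :: real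
  assumes E_morse: "morse E"
    and Emin_def: "E kmin = Emin" and Emax_def: "E kmax = Emax"
    and E_range: "\<And>k. Emin \<le> E k \<and> E k \<le> Emax"
    and Emin_lt: "Emin < Emax"
    and crit_definite: "\<And>k. k \<in> crit E \<Longrightarrow>
        (definite (hessian E k) \<longrightarrow> lat_eq kmin k \<or> lat_eq kmax k)"
    and crit_indefinite: "\<And>k. k \<in> crit E \<Longrightarrow> \<not> definite (hessian E k) \<Longrightarrow> Emin < E k \<and> E k < Emax"
    and F_analytic: "real_analytic_R F {Emin..Emax}"
    and F_nonneg: "\<And>e. e \<in> {Emin..Emax} \<Longrightarrow> F e \<ge> 0"
    and F_zero: "\<And>e. e \<in> {Emin..Emax} \<Longrightarrow> F e = 0 \<longleftrightarrow> e = Emin \<or> e = Emax"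
    and F_linear: "\<exists>C. \<forall>e\<in>{Emin..Emax}. F e \<le> C * \<bar>e - Emin\<bar> \<and> F e \<le> C * \<bar>Emax - e\<bar>"
    and Er_in: "Emin < Er" "Er < Emax"
begin

section \<open>Critical points are isolated and finite in number modulo the lattice\<close>

lemma crit_closed: "closed (crit E)"
proof -
  have "crit E = G -` {0}" by (auto simp: crit_def)
  then show ?thesis using continuous_closed_vimage[of "{0}" G] G_continuous[of UNIV]
    by (simp add: continuous_on_eq_continuous_at)
qed

lemma crit_lattice: "k + lattice_vec n \<in> crit E \<longleftrightarrow> k \<in> crit E"
  by (simp add: crit_def G_periodic)

lemma hessian_lower_bound:
  assumes "q \<in> crit E"
  obtains m where "m > 0" "\<And>w. m * norm w \<le> norm (DG q w)"
proof -
  have "inj (DG q)" using E_morse assms by (auto simp: morse_def hessian_eq)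
  from linear_inj_bounded_below_pos[OF DG_linear this] show thesis using that by blast
qed

text \<open>On the ball of radius r about q the derivative of \<open>G - DG q\<close> has norm at
  most B r, so this difference is Lipschitz with that constant. It is stated for two points because
  the stable set argument compares two orbits.\<close>

lemma G_linearization:
  assumes B: "\<And>k k' h. norm (DG k h - DG k' h) \<le> B * norm (k - k') * norm h" "B > 0"
    and y: "norm (y1 - q) \<le> r" "norm (y2 - q) \<le> r"
  shows "norm (G y1 - G y2 - DG q (y1 - y2)) \<le> B * r * norm (y1 - y2)"
proof -
  have "norm ((G y1 - DG q y1) - (G y2 - DG q y2)) \<le> B * r * norm (y1 - y2)"
  proof (rule differentiable_bound[of "cball q r" "\<lambda>z. G z - DG q z" "\<lambda>z h. DG z h - DG q h"])
    fix z assume z: "z \<in> cball q r"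
    show "((\<lambda>z. G z - DG q z) has_derivative (\<lambda>h. DG z h - DG q h)) (at z within cball q r)"
      by (intro has_derivative_diff has_derivative_at_withinI[OF G_has_derivative] linear_imp_has_derivative DG_linear)
    show "onorm (\<lambda>h. DG z h - DG q h) \<le> B * r"
    proof (rule onorm_le)
      fix h
      have "norm (DG z h - DG q h) \<le> B * norm (z - q) * norm h" by (rule B)
      also have "\<dots> \<le> B * r * norm h"
        using z B(2) by (intro mult_right_mono mult_left_mono) (auto simp: dist_norm norm_minus_commute)
      finally show "norm (DG z h - DG q h) \<le> B * r * norm h" .
    qed
  qed (use y in \<open>auto simp: dist_norm norm_minus_commute\<close>)
  then show ?thesis by (simp add: linear_diff[OF DG_linear] algebra_simps)
qed

lemma crit_isolated:
  assumes "q \<in> crit E"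
  obtains r where "r > 0" "\<And>y. y \<in> crit E \<Longrightarrow> norm (y - q) < r \<Longrightarrow> y = q"
proof -
  obtain m where m: "m > 0" "\<And>w. m * norm w \<le> norm (DG q w)" using hessian_lower_bound[OF assms] by blast
  obtain B where B: "B > 0" "\<And>k k' h. norm (DG k h - DG k' h) \<le> B * norm (k - k') * norm h"
    by (rule derivative_constants) blast
  \<comment> \<open>With this radius the linearisation error is at most half of the lower bound m |y
    - q| for the linear part.\<close>
  define r where "r = m / (2 * B)"
  have r: "r > 0" using m B by (simp add: r_def)
  have "y = q" if y: "y \<in> crit E" "norm (y - q) < r" for y
  proof (rule ccontr)
    assume "y \<noteq> q"
    have "norm (G y - G q - DG q (y - q)) \<le> B * r * norm (y - q)"
      using y r by (intro G_linearization B) auto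
    moreover have "G y = 0" "G q = 0" using y assms by (auto simp: crit_def)
    ultimately have "m * norm (y - q) \<le> B * r * norm (y - q)" using m(2)[of "y - q"] by simp
    then have "m \<le> B * r" using \<open>y \<noteq> q\<close> by simp
    also have "B * r = m / 2" using B(1) by (simp add: r_def)
    finally show False using m(1) by simp
  qed
  with r show thesis using that by blast
qed

lemma crit_box_finite: "finite (crit E \<inter> torus_box)"
proof -
  have "\<not> z islimpt crit E" if z: "z \<in> torus_box" for z
  proof
    assume l: "z islimpt crit E"
    then have "z \<in> crit E" using crit_closed closed_limpt by blast
    then obtain r where r: "r > 0" "\<And>y. y \<in> crit E \<Longrightarrow> norm (y - z) < r \<Longrightarrow> y = z" using crit_isolated by blast
    then show False using l unfolding islimpt_approachable dist_norm by blast
  qed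
  from finite_not_islimpt_in_compact[OF compact_torus_box this] show ?thesis by (simp add: Int_commute)
qed

lemma crit_reduce:
  assumes "q \<in> crit E" obtains n where "q + lattice_vec n \<in> crit E \<inter> torus_box"
proof -
  obtain n where "q + lattice_vec n \<in> torus_box" by (rule lattice_reduce)
  then show thesis using that assms by (simp add: crit_lattice)
qed

lemma crit_countable: "countable (crit E)"
proof -
  have "crit E \<subseteq> (\<Union>n. (\<lambda>x. x - lattice_vec n) ` (crit E \<inter> torus_box))"
  proof
    fix q assume "q \<in> crit E"
    then obtain n where "q + lattice_vec n \<in> crit E \<inter> torus_box" by (rule crit_reduce)
    then have "q \<in> (\<lambda>x. x - lattice_vec n) ` (crit E \<inter> torus_box)" by (intro image_eqI[of _ _ "q + lattice_vec n"]) auto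
    then show "q \<in> (\<Union>n. (\<lambda>x. x - lattice_vec n) ` (crit E \<inter> torus_box))" by blast
  qed
  moreover have "countable (\<Union>n. (\<lambda>x. x - lattice_vec n) ` (crit E \<inter> torus_box))"
    using crit_box_finite by (intro countable_UN lattice_countable countable_image countable_finite)
  ultimately show ?thesis by (rule countable_subset)
qed

text \<open>An isolation radius at a representative in the box serves for all its lattice
  translates, so the minimum over finitely many representatives is uniform.\<close>

lemma crit_separated:
  obtains \<rho> where "\<rho> > 0" "\<And>q q'. q \<in> crit E \<Longrightarrow> q' \<in> crit E \<Longrightarrow> norm (q - q') < \<rho> \<Longrightarrow> q = q'"
proof -
  have "\<forall>q\<in>crit E. \<exists>r>0. \<forall>y\<in>crit E. norm (y - q) < r \<longrightarrow> y = q"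
    using crit_isolated by metis
  then obtain r where r: "\<And>q. q \<in> crit E \<Longrightarrow> r q > 0" "\<And>q y. q \<in> crit E \<Longrightarrow> y \<in> crit E \<Longrightarrow> norm (y - q) < r q \<Longrightarrow> y = q"
    by metis
  define \<rho> where "\<rho> = Min (insert 1 (r ` (crit E \<inter> torus_box)))"
  have fin: "finite (insert 1 (r ` (crit E \<inter> torus_box)))" using crit_box_finite by simp
  have "\<rho> > 0" unfolding \<rho>_def using fin r(1) by (subst Min_gr_iff) auto
  moreover have "q = q'" if q: "q \<in> crit E" "q' \<in> crit E" "norm (q - q') < \<rho>" for q q'
  proof -
    obtain n where n: "q' + lattice_vec n \<in> crit E \<inter> torus_box" using crit_reduce[OF q(2)] by blast
    have "\<rho> \<le> r (q' + lattice_vec n)" unfolding \<rho>_def using fin n by (intro Min_le) auto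
    then have "q + lattice_vec n = q' + lattice_vec n"
      using n q crit_lattice by (intro r(2)) auto
    then show ?thesis by simp
  qed
  ultimately show thesis using that by blast
qed

text \<open>Outside the balls about critical points the gradient has a positive minimum on the
  compact box; periodicity carries this bound to the whole space.\<close>

lemma small_gradient_near_crit:
  assumes "r > 0"
  obtains \<eta> where "\<eta> > 0" "\<And>y. norm (G y) < \<eta> \<Longrightarrow> \<exists>q\<in>crit E. norm (y - q) < r"
proof -
  define K where "K = torus_box - (\<Union>q\<in>crit E. ball q r)"
  have K: "compact K" unfolding K_def by (intro compact_diff compact_torus_box open_UN) auto
  have pos: "norm (G z) > 0" if "z \<in> K" for z
    using that assms by (force simp: K_def crit_def)
  obtain \<eta> where \<eta>: "\<eta> > 0" "\<And>z. z \<in> K \<Longrightarrow> \<eta> \<le> norm (G z)"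
  proof (cases "K = {}")
    case True then show ?thesis using that[of 1] by auto
  next
    case False
    have "continuous_on K (\<lambda>z. norm (G z))" by (intro continuous_intros G_continuous)
    from continuous_attains_inf[OF K False this] pos show ?thesis using that by metis
  qed
  show thesis
  proof (rule that[OF \<eta>(1)])
    fix y assume y: "norm (G y) < \<eta>"
    obtain n where n: "y + lattice_vec n \<in> torus_box" by (rule lattice_reduce)
    have "y + lattice_vec n \<notin> K" using \<eta>(2)[of "y + lattice_vec n"] y by (auto simp: G_periodic)
    then obtain q where q: "q \<in> crit E" "norm (y + lattice_vec n - q) < r"
      using n by (auto simp: K_def dist_norm norm_minus_commute)
    have "q - lattice_vec n \<in> crit E" using crit_lattice[of "q - lattice_vec n" n] q by simp
    moreover have "norm (y - (q - lattice_vec n)) < r" using q by (simp add: algebra_simps)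
    ultimately show "\<exists>q\<in>crit E. norm (y - q) < r" by blast
  qed
qed

section \<open>Every gradient orbit converges in both time directions\<close>

lemma phi_signed_deriv:
  "((\<lambda>\<tau>. phi (\<sigma> * \<tau>) k) has_vector_derivative \<sigma> *\<^sub>R G (phi (\<sigma> * \<tau>) k)) (at \<tau>)"
proof -
  have "((\<lambda>t. phi t k) \<circ> (\<lambda>\<tau>. \<sigma> * \<tau>) has_vector_derivative \<sigma> *\<^sub>R G (phi (\<sigma> * \<tau>) k)) (at \<tau>)"
    by (rule vector_diff_chain_at) (auto intro!: phi_deriv derivative_eq_intros)
  then show ?thesis by (simp add: o_def)
qed

text \<open>The sign \<sigma> treats forward and backward orbits together: \<sigma> E increases
  along \<tau> -> phi (\<sigma> \<tau>) in both cases, at the rate |G|^2.\<close>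

lemma E_phi_signed_deriv:
  assumes "\<sigma> = 1 \<or> \<sigma> = -1"
  shows "((\<lambda>\<tau>. \<sigma> * E (phi (\<sigma> * \<tau>) k)) has_real_derivative (norm (G (phi (\<sigma> * \<tau>) k)))\<^sup>2) (at \<tau>)"
proof -
  have "((\<lambda>\<tau>. E (phi (\<sigma> * \<tau>) k)) has_real_derivative (norm (G (phi (\<sigma> * \<tau>) k)))\<^sup>2 * \<sigma>) (at \<tau>)"
    by (rule DERIV_chain2[OF E_phi_deriv]) (auto intro!: derivative_eq_intros)
  from DERIV_cmult[OF this, of \<sigma>] show ?thesis using assms by auto
qed

text \<open>An argument of Barbalat type. The energy is bounded and increases at the rate p = |G|^2,
  and p falls with slope at most C. If p were at least \<epsilon> at a late time, it would stay
  above \<epsilon>/2 for a fixed duration, and the energy would rise above its supremum.\<close>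

lemma gradient_tendsto_0:
  assumes \<sigma>: "\<sigma> = 1 \<or> \<sigma> = -1"
  shows "((\<lambda>\<tau>. norm (G (phi (\<sigma> * \<tau>) k))) \<longlongrightarrow> 0) at_top"
proof -
  define p where "p \<tau> = (norm (G (phi (\<sigma> * \<tau>) k)))\<^sup>2" for \<tau>
  define e where "e \<tau> = \<sigma> * E (phi (\<sigma> * \<tau>) k)" for \<tau>
  have de: "(e has_real_derivative p \<tau>) (at \<tau>)" for \<tau>
    unfolding e_def[abs_def] p_def by (rule E_phi_signed_deriv[OF \<sigma>])
  have mono: "e s \<le> e t" if "s \<le> t" for s t
    by (rule DERIV_nonneg_imp_nondecreasing[OF that]) (auto intro!: exI de simp: p_def)
  have "e \<tau> \<le> \<bar>Emin\<bar> + \<bar>Emax\<bar>" for \<tau>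
    using \<sigma> E_range[of "phi (\<sigma> * \<tau>) k"] unfolding e_def by auto
  then have bdd: "bdd_above (range e)" by (rule bdd_aboveI2)
  obtain B where B: "B > 0" "\<And>k h. norm (DG k h) \<le> B * norm h" by (rule derivative_constants) blast
  have "periodic_T G" by (simp add: periodic_T_def G_periodic)
  then obtain M where M: "M > 0" "\<And>k. norm (G k) \<le> M"
    using periodic_continuous_bounded[of G] G_continuous by blast
  define C where "C = 2 * (M * (B * M))"
  have C: "C > 0" using M B by (simp add: C_def)
  have dp: "(p has_real_derivative 2 * (G (phi (\<sigma> * \<tau>) k) \<bullet> DG (phi (\<sigma> * \<tau>) k) (\<sigma> *\<^sub>R G (phi (\<sigma> * \<tau>) k)))) (at \<tau>)" for \<tau>
  proof -
    have g: "((\<lambda>\<tau>. G (phi (\<sigma> * \<tau>) k)) has_derivative (\<lambda>s. DG (phi (\<sigma> * \<tau>) k) (s *\<^sub>R (\<sigma> *\<^sub>R G (phi (\<sigma> * \<tau>) k))))) (at \<tau>)"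
      by (rule has_derivative_compose[OF phi_signed_deriv[unfolded has_vector_derivative_def] G_has_derivative])
    have p: "p = (\<lambda>\<tau>. G (phi (\<sigma> * \<tau>) k) \<bullet> G (phi (\<sigma> * \<tau>) k))" by (simp add: p_def fun_eq_iff dot_square_norm)
    show ?thesis unfolding has_field_derivative_def p
      by (rule has_derivative_eq_rhs[OF has_derivative_inner[OF g g]])
         (simp add: fun_eq_iff inner_commute linear_scale[OF DG_linear])
  qed
  have plip: "p s \<ge> p \<tau> - C * (s - \<tau>)" if "\<tau> \<le> s" for s \<tau>
  proof -
    have ab: "\<bar>2 * (G (phi (\<sigma> * t) k) \<bullet> DG (phi (\<sigma> * t) k) (\<sigma> *\<^sub>R G (phi (\<sigma> * t) k)))\<bar> \<le> C" for t
    proof -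
      have "\<bar>G (phi (\<sigma> * t) k) \<bullet> DG (phi (\<sigma> * t) k) (\<sigma> *\<^sub>R G (phi (\<sigma> * t) k))\<bar>
        \<le> norm (G (phi (\<sigma> * t) k)) * norm (DG (phi (\<sigma> * t) k) (\<sigma> *\<^sub>R G (phi (\<sigma> * t) k)))"
        by (rule Cauchy_Schwarz_ineq2)
      also have "\<dots> \<le> M * (B * norm (\<sigma> *\<^sub>R G (phi (\<sigma> * t) k)))" using M(1) by (intro mult_mono M B) auto
      also have "\<dots> \<le> M * (B * M)" using \<sigma> M B(1) by (intro mult_left_mono) auto
      finally show ?thesis by (simp add: C_def)
    qed
    have d: "0 \<le> 2 * (G (phi (\<sigma> * t) k) \<bullet> DG (phi (\<sigma> * t) k) (\<sigma> *\<^sub>R G (phi (\<sigma> * t) k))) + C" for t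
      using abs_le_D2[OF ab[of t]] by linarith
    have "p \<tau> + C * \<tau> \<le> p s + C * s"
    proof (rule DERIV_nonneg_imp_nondecreasing[OF that])
      fix t
      have "((\<lambda>t. p t + C * t) has_real_derivative 2 * (G (phi (\<sigma> * t) k) \<bullet> DG (phi (\<sigma> * t) k) (\<sigma> *\<^sub>R G (phi (\<sigma> * t) k))) + C) (at t)"
        by (auto intro!: derivative_eq_intros dp)
      then show "\<exists>y. ((\<lambda>t. p t + C * t) has_real_derivative y) (at t) \<and> 0 \<le> y" using d by blast
    qed
    then show ?thesis by (simp add: algebra_simps)
  qed
  have "(p \<longlongrightarrow> 0) at_top"
  proof (rule tendstoI)
    fix \<epsilon> :: real assume \<epsilon>: "\<epsilon> > 0"
    \<comment> \<open>Over this duration p loses at most C \<delta> = \<epsilon>/2.\<close>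
    define \<delta> where "\<delta> = \<epsilon> / (2 * C)"
    have \<delta>: "\<delta> > 0" "C * \<delta> = \<epsilon> / 2" using \<epsilon> C by (auto simp: \<delta>_def)
    have "(SUP \<tau>. e \<tau>) - \<epsilon> * \<delta> / 2 < (SUP \<tau>. e \<tau>)" using \<epsilon> \<delta> by simp
    then obtain T where T: "(SUP \<tau>. e \<tau>) - \<epsilon> * \<delta> / 2 < e T"
      using less_cSUP_iff[OF _ bdd] by auto
    have "p \<tau> < \<epsilon>" if \<tau>: "\<tau> \<ge> T" for \<tau>
    proof (rule ccontr)
      assume "\<not> p \<tau> < \<epsilon>"
      obtain z where z: "\<tau> < z" "z < \<tau> + \<delta>" "e (\<tau> + \<delta>) - e \<tau> = (\<tau> + \<delta> - \<tau>) * p z"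
        using MVT2[of \<tau> "\<tau> + \<delta>" e p] \<delta>(1) de by auto
      have "C * (z - \<tau>) \<le> C * \<delta>" using z C by (intro mult_left_mono) auto
      then have "p z \<ge> \<epsilon> / 2" using plip[of \<tau> z] z \<open>\<not> p \<tau> < \<epsilon>\<close> \<delta>(2) by linarith
      then have "\<delta> * (\<epsilon> / 2) \<le> \<delta> * p z" using \<delta>(1) by (intro mult_left_mono) auto
      then have "e (\<tau> + \<delta>) - e \<tau> \<ge> \<epsilon> * \<delta> / 2" using z(3) by (simp add: mult.commute)
      moreover have "e (\<tau> + \<delta>) \<le> (SUP \<tau>. e \<tau>)" using bdd by (intro cSUP_upper) auto
      ultimately show False using T mono[OF \<tau>] by linarith
    qed
    then show "\<forall>\<^sub>F \<tau> in at_top. dist (p \<tau>) 0 < \<epsilon>"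
      unfolding eventually_at_top_linorder by (intro exI[of _ T]) (auto simp: p_def)
  qed
  then have "((\<lambda>\<tau>. sqrt (p \<tau>)) \<longlongrightarrow> sqrt 0) at_top" by (rule tendsto_real_sqrt)
  then show ?thesis by (simp add: p_def)
qed

text \<open>Late in time the gradient is small, so the orbit lies in the union of small balls about
  critical points. These are disjoint for radius \<open>\<rho> / 3\<close>, and a connected orbit
  tail stays in one of them; repeating the argument with smaller radii gives convergence to its
  centre.\<close>

lemma orbit_converges:
  assumes \<sigma>: "\<sigma> = 1 \<or> \<sigma> = -1"
  obtains q where "q \<in> crit E" "((\<lambda>\<tau>. phi (\<sigma> * \<tau>) k) \<longlongrightarrow> q) at_top"
proof -
  obtain \<rho> where \<rho>: "\<rho> > 0" "\<And>q q'. q \<in> crit E \<Longrightarrow> q' \<in> crit E \<Longrightarrow> norm (q - q') < \<rho> \<Longrightarrow> q = q'"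
    using crit_separated by blast
  have near: "\<exists>T. \<forall>\<tau>\<ge>T. \<exists>q\<in>crit E. norm (phi (\<sigma> * \<tau>) k - q) < r" if r: "r > 0" for r
  proof -
    obtain \<eta> where \<eta>: "\<eta> > 0" "\<And>y. norm (G y) < \<eta> \<Longrightarrow> \<exists>q\<in>crit E. norm (y - q) < r"
      using small_gradient_near_crit[OF r] by blast
    from tendstoD[OF gradient_tendsto_0[OF \<sigma>, of k] \<eta>(1)]
    obtain N where "\<And>n. n \<ge> N \<Longrightarrow> norm (G (phi (\<sigma> * n) k)) < \<eta>" unfolding eventually_at_top_linorder by auto
    then show ?thesis using \<eta>(2) by blast
  qed
  define r0 where "r0 = \<rho> / 3"
  have r0: "r0 > 0" using \<rho> by (simp add: r0_def)
  obtain T where T: "\<And>\<tau>. \<tau> \<ge> T \<Longrightarrow> \<exists>q\<in>crit E. norm (phi (\<sigma> * \<tau>) k - q) < r0" using near[OF r0] by blast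
  obtain q where q: "q \<in> crit E" "norm (phi (\<sigma> * T) k - q) < r0" using T[of T] by auto
  define S where "S = (\<lambda>\<tau>. phi (\<sigma> * \<tau>) k) ` {T..}"
  have "connected S" unfolding S_def
    by (intro connected_continuous_image continuous_intros) (auto simp: connected_iff_interval)
  moreover have "open (ball q r0)" "open (\<Union>q'\<in>crit E - {q}. ball q' r0)" by auto
  moreover have "ball q r0 \<inter> (\<Union>q'\<in>crit E - {q}. ball q' r0) \<inter> S = {}"
  proof -
    have False if "y \<in> ball q r0" "q' \<in> crit E" "q' \<noteq> q" "y \<in> ball q' r0" for y q'
    proof -
      have "norm (q - q') \<le> dist q y + dist q' y" using dist_triangle2[of q q' y] by (simp add: dist_norm)
      also have "\<dots> < \<rho>" using that \<rho>(1) by (simp add: r0_def)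
      finally show False using \<rho>(2)[OF q(1) that(2)] that(3) by blast
    qed
    then show ?thesis by blast
  qed
  moreover have "S \<subseteq> ball q r0 \<union> (\<Union>q'\<in>crit E - {q}. ball q' r0)"
    unfolding S_def using T by (force simp: dist_norm norm_minus_commute)
  moreover have "phi (\<sigma> * T) k \<in> ball q r0 \<inter> S" using q by (auto simp: S_def dist_norm norm_minus_commute)
  ultimately have "(\<Union>q'\<in>crit E - {q}. ball q' r0) \<inter> S = {}"
    using connectedD[of S "ball q r0" "\<Union>q'\<in>crit E - {q}. ball q' r0"] by blast
  with \<open>S \<subseteq> ball q r0 \<union> _\<close> have S: "S \<subseteq> ball q r0" by blast
  have "((\<lambda>\<tau>. phi (\<sigma> * \<tau>) k) \<longlongrightarrow> q) at_top"
  proof (rule tendstoI)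
    fix \<epsilon> :: real assume "\<epsilon> > 0"
    then have "min \<epsilon> r0 > 0" using r0 by simp
    from near[OF this] obtain T' where T': "\<And>\<tau>. \<tau> \<ge> T' \<Longrightarrow> \<exists>q\<in>crit E. norm (phi (\<sigma> * \<tau>) k - q) < min \<epsilon> r0" by blast
    have "dist (phi (\<sigma> * \<tau>) k) q < \<epsilon>" if tt: "\<tau> \<ge> max T T'" for \<tau>
    proof -
      obtain q' where q': "q' \<in> crit E" "norm (phi (\<sigma> * \<tau>) k - q') < min \<epsilon> r0" using T'[of \<tau>] tt by auto
      have "phi (\<sigma> * \<tau>) k \<in> ball q r0" using S tt by (auto simp: S_def)
      then have "norm (q - q') < \<rho>"
        using dist_triangle2[of q q' "phi (\<sigma> * \<tau>) k"] q' \<rho>(1) by (simp add: dist_norm norm_minus_commute r0_def)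
      then have "q = q'" using \<rho>(2)[OF q(1) q'(1)] by blast
      then show ?thesis using q' by (simp add: dist_norm)
    qed
    then show "\<forall>\<^sub>F \<tau> in at_top. dist (phi (\<sigma> * \<tau>) k) q < \<epsilon>"
      unfolding eventually_at_top_linorder by blast
  qed
  with q(1) show thesis using that by blast
qed


text \<open>Indefiniteness gives a nonzero v with \<sigma> v . H v >= 0. If this value is 0, then H
  v is still nonzero by nondegeneracy, and moving v in the direction \<sigma> H v increases the form
  to first order.\<close>

lemma indefinite_direction:
  assumes q: "q \<in> crit E" and nd: "\<not> definite (hessian E q)" and \<sigma>: "\<sigma> = 1 \<or> \<sigma> = -1"
  obtains v where "\<sigma> * (v \<bullet> DG q v) > 0"
proof -
  define H where "H = DG q"
  have lin: "linear H" and sym: "\<And>v w. v \<bullet> H w = H v \<bullet> w" unfolding H_def by (rule DG_linear, rule DG_symmetric)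
  have inj: "inj H" using E_morse q by (auto simp: morse_def hessian_eq H_def)
  obtain v where v: "v \<noteq> 0" "\<sigma> * (v \<bullet> H v) \<ge> 0"
    using nd \<sigma> unfolding definite_def hessian_eq H_def[symmetric] by (auto simp: not_less)
  show thesis
  proof (cases "\<sigma> * (v \<bullet> H v) > 0")
    case True then show ?thesis using that unfolding H_def by blast
  next
    case False
    then have z: "v \<bullet> H v = 0" using v \<sigma> by auto
    define u where "u = \<sigma> *\<^sub>R H v"
    have "H v \<noteq> 0" using inj v(1) linear_0[OF lin] by (metis injD)
    then have u: "u \<bullet> u > 0" "\<sigma> * (H v \<bullet> u) = u \<bullet> u" using \<sigma> by (auto simp: u_def)
    define c where "c = \<sigma> * (u \<bullet> H u)"
    \<comment> \<open>Small enough for the first-order gain 2 s |u|^2 to dominate the correction s^2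
      c.\<close>
    define s where "s = (u \<bullet> u) / (\<bar>c\<bar> + 1)"
    have s: "s > 0" unfolding s_def using u(1) by (intro divide_pos_pos) auto
    have "s * \<bar>c\<bar> \<le> s * (\<bar>c\<bar> + 1)" using s by (intro mult_left_mono) auto
    also have "\<dots> = u \<bullet> u" by (simp add: s_def)
    finally have sc: "s * \<bar>c\<bar> \<le> u \<bullet> u" .
    have "(v + s *\<^sub>R u) \<bullet> H (v + s *\<^sub>R u) = 2 * s * (H v \<bullet> u) + s * s * (u \<bullet> H u)"
      using z sym[of v u] by (simp add: linear_add[OF lin] linear_scale[OF lin] inner_add_left inner_add_right inner_commute algebra_simps)
    then have "\<sigma> * ((v + s *\<^sub>R u) \<bullet> H (v + s *\<^sub>R u)) = 2 * s * (\<sigma> * (H v \<bullet> u)) + s * s * c"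
      by (simp add: c_def algebra_simps)
    also have "\<dots> = s * (2 * (u \<bullet> u) + s * c)" unfolding u(2) by (simp add: algebra_simps)
    also have "\<dots> > 0"
    proof (rule mult_pos_pos[OF s])
      have "- (s * \<bar>c\<bar>) \<le> s * c" using s by (simp add: abs_if mult_nonneg_nonneg)
      then show "0 < 2 * (u \<bullet> u) + s * c" using sc u(1) by linarith
    qed
    finally show ?thesis using that unfolding H_def by blast
  qed
qed

text \<open>The quadratic form \<open>w \<bullet> H w\<close> of the difference of two gradient orbits near a saddle grows
  exponentially once it is positive, so the local stable set meets every line in a direction of
  positive curvature at most once. Its translates along that direction are therefore disjoint.\<close>

lemma local_stable_set_line:
  assumes q: "q \<in> crit E" and \<sigma>: "\<sigma> = 1 \<or> \<sigma> = -1" and v: "\<sigma> * (v \<bullet> DG q v) > 0"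
  obtains r where "r > 0" "\<And>x c. (\<And>\<tau>. \<tau> \<ge> 0 \<Longrightarrow> norm (phi (\<sigma> * \<tau>) x - q) \<le> r) \<Longrightarrow>
     (\<And>\<tau>. \<tau> \<ge> 0 \<Longrightarrow> norm (phi (\<sigma> * \<tau>) (x + c *\<^sub>R v) - q) \<le> r) \<Longrightarrow> c = 0"
proof -
  obtain m where m: "m > 0" "\<And>w. m * norm w \<le> norm (DG q w)" using hessian_lower_bound[OF q] by blast
  obtain B where B: "B > 0" "\<And>k h. norm (DG k h) \<le> B * norm h" "\<And>k k' h. norm (DG k h - DG k' h) \<le> B * norm (k - k') * norm h"
    by (rule derivative_constants) blast
  \<comment> \<open>In this ball the difference w of two orbits satisfies |w' - \<sigma> H w| <= |H
    w| / 2, where H is the Hessian at q.\<close>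
  define r where "r = m / (2 * B)"
  have r: "r > 0" and Br: "B * r = m / 2" using m B by (auto simp: r_def)
  have "c = 0" if x: "\<And>\<tau>. \<tau> \<ge> 0 \<Longrightarrow> norm (phi (\<sigma> * \<tau>) x - q) \<le> r"
    and x': "\<And>\<tau>. \<tau> \<ge> 0 \<Longrightarrow> norm (phi (\<sigma> * \<tau>) (x + c *\<^sub>R v) - q) \<le> r" for x c
  proof (rule ccontr)
    assume c: "c \<noteq> 0"
    define w where "w \<tau> = phi (\<sigma> * \<tau>) (x + c *\<^sub>R v) - phi (\<sigma> * \<tau>) x" for \<tau>
    define dw where "dw \<tau> = G (phi (\<sigma> * \<tau>) (x + c *\<^sub>R v)) - G (phi (\<sigma> * \<tau>) x)" for \<tau>
    have w: "(w has_vector_derivative \<sigma> *\<^sub>R dw \<tau>) (at \<tau>)" for \<tau>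
      unfolding w_def[abs_def] dw_def scaleR_diff_right by (intro has_vector_derivative_diff phi_signed_deriv)
    define Q where "Q \<tau> = \<sigma> * (w \<tau> \<bullet> DG q (w \<tau>))" for \<tau>
    have dQ: "(Q has_real_derivative 2 * (DG q (w \<tau>) \<bullet> dw \<tau>)) (at \<tau>)" for \<tau>
    proof -
      have w': "(w has_derivative (\<lambda>s. s *\<^sub>R (\<sigma> *\<^sub>R dw \<tau>))) (at \<tau>)" using w by (simp add: has_vector_derivative_def)
      have "((\<lambda>\<tau>. DG q (w \<tau>)) has_derivative (\<lambda>s. DG q (s *\<^sub>R (\<sigma> *\<^sub>R dw \<tau>)))) (at \<tau>)"
        by (rule has_derivative_compose[OF w' linear_imp_has_derivative[OF DG_linear]])
      from has_derivative_mult_right[OF has_derivative_inner[OF w' this], of \<sigma>]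
      have "(Q has_derivative (\<lambda>s. \<sigma> * (w \<tau> \<bullet> DG q (s *\<^sub>R (\<sigma> *\<^sub>R dw \<tau>)) + (s *\<^sub>R (\<sigma> *\<^sub>R dw \<tau>)) \<bullet> DG q (w \<tau>)))) (at \<tau>)"
        unfolding Q_def .
      moreover have "\<sigma> * (w \<tau> \<bullet> DG q (s *\<^sub>R (\<sigma> *\<^sub>R dw \<tau>)) + (s *\<^sub>R (\<sigma> *\<^sub>R dw \<tau>)) \<bullet> DG q (w \<tau>))
         = 2 * (DG q (w \<tau>) \<bullet> dw \<tau>) * s" for s
      proof -
        have "w \<tau> \<bullet> DG q (dw \<tau>) = DG q (w \<tau>) \<bullet> dw \<tau>" by (rule DG_symmetric)
        then have "\<sigma> * (w \<tau> \<bullet> DG q (s *\<^sub>R (\<sigma> *\<^sub>R dw \<tau>)) + (s *\<^sub>R (\<sigma> *\<^sub>R dw \<tau>)) \<bullet> DG q (w \<tau>))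
          = (\<sigma> * \<sigma>) * (2 * (DG q (w \<tau>) \<bullet> dw \<tau>) * s)"
          by (simp add: linear_scale[OF DG_linear] inner_commute[of "dw \<tau>"])
        moreover have "\<sigma> * \<sigma> = 1" using \<sigma> by auto
        ultimately show ?thesis by simp
      qed
      ultimately show ?thesis unfolding has_field_derivative_def by simp
    qed
    \<comment> \<open>The growth rate of Q: its derivative is at least |H w|^2 >= m^2 |w|^2 = C B
      |w|^2, and B |w|^2 bounds Q.\<close>
    define C where "C = m * m / B"
    have C: "C > 0" using m B by (simp add: C_def)
    have Qle: "Q \<tau> \<le> B * (norm (w \<tau>))\<^sup>2" for \<tau>
    proof -
      have "\<bar>w \<tau> \<bullet> DG q (w \<tau>)\<bar> \<le> norm (w \<tau>) * norm (DG q (w \<tau>))" by (rule Cauchy_Schwarz_ineq2)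
      also have "\<dots> \<le> norm (w \<tau>) * (B * norm (w \<tau>))" by (intro mult_left_mono B) auto
      finally show ?thesis using \<sigma> unfolding Q_def by (auto simp: power2_eq_square algebra_simps abs_le_iff)
    qed
    have grow: "2 * (DG q (w \<tau>) \<bullet> dw \<tau>) \<ge> C * Q \<tau>" if \<tau>: "\<tau> \<ge> 0" for \<tau>
    proof -
      define h where "h = DG q (w \<tau>)"
      have "norm (dw \<tau> - h) \<le> B * r * norm (w \<tau>)"
        unfolding dw_def h_def w_def by (rule G_linearization[OF B(3,1) x'[OF \<tau>] x[OF \<tau>]])
      then have "norm (dw \<tau> - h) \<le> norm h / 2"
        using m(2)[of "w \<tau>"] by (simp add: Br h_def)
      then have "norm h * norm (dw \<tau> - h) \<le> norm h * (norm h / 2)" by (intro mult_left_mono) auto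
      moreover have "\<bar>h \<bullet> (dw \<tau> - h)\<bar> \<le> norm h * norm (dw \<tau> - h)" by (rule Cauchy_Schwarz_ineq2)
      moreover have "h \<bullet> dw \<tau> = (norm h)\<^sup>2 + h \<bullet> (dw \<tau> - h)" by (simp add: inner_diff_right dot_square_norm)
      ultimately have "2 * (h \<bullet> dw \<tau>) \<ge> (norm h)\<^sup>2" by (simp add: power2_eq_square abs_le_iff)
      moreover have "(norm h)\<^sup>2 \<ge> (m * norm (w \<tau>))\<^sup>2" unfolding h_def using m by (intro power_mono) auto
      moreover have "(m * norm (w \<tau>))\<^sup>2 = C * (B * (norm (w \<tau>))\<^sup>2)" using B(1) by (simp add: C_def power2_eq_square)
      moreover have "C * (B * (norm (w \<tau>))\<^sup>2) \<ge> C * Q \<tau>" using C Qle by (intro mult_left_mono) auto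
      ultimately show ?thesis unfolding h_def by linarith
    qed
    have "w 0 = c *\<^sub>R v" by (simp add: w_def)
    then have "Q 0 = (c * c) * (\<sigma> * (v \<bullet> DG q v))" by (simp add: Q_def linear_scale[OF DG_linear])
    moreover have "c * c > 0" using c not_real_square_gt_zero by blast
    ultimately have Q0: "Q 0 > 0" using v by (simp add: mult_pos_pos)
    have ge: "Q \<tau> \<ge> exp (C * \<tau>) * Q 0" if "\<tau> \<ge> 0" for \<tau>
    proof -
      have "exp (- C * 0) * Q 0 \<le> exp (- C * \<tau>) * Q \<tau>"
      proof (rule DERIV_nonneg_imp_nondecreasing[OF that])
        fix t assume t: "0 \<le> t" "t \<le> \<tau>"
        have "((\<lambda>t. exp (- C * t) * Q t) has_real_derivative exp (- C * t) * (2 * (DG q (w t) \<bullet> dw t) - C * Q t)) (at t)"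
          by (auto intro!: derivative_eq_intros dQ simp: algebra_simps)
        then show "\<exists>y. ((\<lambda>t. exp (- C * t) * Q t) has_real_derivative y) (at t) \<and> 0 \<le> y"
          using grow[OF t(1)] by (intro exI conjI) auto
      qed
      then have "exp (C * \<tau>) * Q 0 \<le> exp (C * \<tau>) * (exp (- C * \<tau>) * Q \<tau>)" by simp
      then show ?thesis by (simp add: mult_exp_exp flip: mult.assoc)
    qed
    have up: "Q \<tau> \<le> B * (2 * r)\<^sup>2" if "\<tau> \<ge> 0" for \<tau>
    proof -
      have "norm (w \<tau>) \<le> 2 * r"
        using norm_triangle_ineq4[of "phi (\<sigma> * \<tau>) (x + c *\<^sub>R v) - q" "phi (\<sigma> * \<tau>) x - q"] x[OF that] x'[OF that]
        by (simp add: w_def)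
      then have "B * (norm (w \<tau>))\<^sup>2 \<le> B * (2 * r)\<^sup>2" using B(1) by (intro mult_left_mono power_mono) auto
      then show ?thesis using Qle[of \<tau>] by linarith
    qed
    \<comment> \<open>The time at which C \<tau> Q(0) equals the upper bound of Q; as exp (C \<tau>)
      >= 1 + C \<tau>, exponential growth has passed the bound by then.\<close>
    define \<tau> where "\<tau> = B * (2 * r)\<^sup>2 / (C * Q 0)"
    have \<tau>: "\<tau> \<ge> 0" using B(1) C Q0 by (simp add: \<tau>_def)
    have "(1 + C * \<tau>) * Q 0 \<le> exp (C * \<tau>) * Q 0" using Q0 by (intro mult_right_mono exp_ge_add_one_self) auto
    also have "\<dots> \<le> B * (2 * r)\<^sup>2" using ge[OF \<tau>] up[OF \<tau>] by linarith
    also have "\<dots> = C * \<tau> * Q 0" using C Q0 by (simp add: \<tau>_def)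
    finally show False using Q0 by (simp add: algebra_simps)
  qed
  with r show thesis using that by blast
qed

text \<open>The translates by v / (n + 1) are pairwise disjoint, have the same measure and lie in
  one ball. Infinitely many of them fit only if this measure is 0.\<close>

lemma disjoint_translates_negligible:
  fixes W :: "'a::euclidean_space set"
  assumes W: "compact W" and inj: "\<And>x c. x \<in> W \<Longrightarrow> x + c *\<^sub>R v \<in> W \<Longrightarrow> c = 0"
  shows "negligible W"
proof -
  define A where "A n = (\<lambda>x. (1 / real (Suc n)) *\<^sub>R v + x) ` W" for n
  have disj: "disjoint_family_on A UNIV"
    unfolding disjoint_family_on_def
  proof (intro ballI impI)
    fix i j :: nat assume ij: "i \<noteq> j"
    have False if "y \<in> A i" "y \<in> A j" for y
    proof -
      obtain x x' where x: "x \<in> W" "x' \<in> W" "y = (1 / real (Suc i)) *\<^sub>R v + x" "y = (1 / real (Suc j)) *\<^sub>R v + x'"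
        using \<open>y \<in> A i\<close> \<open>y \<in> A j\<close> by (auto simp: A_def)
      then have "x' = x + (1 / real (Suc i) - 1 / real (Suc j)) *\<^sub>R v" by (simp add: algebra_simps)
      then have "1 / real (Suc i) - 1 / real (Suc j) = 0" using inj x by metis
      then have "inverse (real (Suc i)) = inverse (real (Suc j))" by (simp add: inverse_eq_divide)
      then show False using ij by (simp only: inverse_eq_iff_eq of_nat_eq_iff nat.inject)
    qed
    then show "A i \<inter> A j = {}" by blast
  qed
  have Am: "A n \<in> lmeasurable" "measure lebesgue (A n) = measure lebesgue W" for n
    unfolding A_def using lmeasurable_compact[OF W] by (auto simp: measurable_translation measure_translation)
  obtain b where b: "\<And>x. x \<in> W \<Longrightarrow> norm x \<le> b" using compact_imp_bounded[OF W] by (auto simp: bounded_iff)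
  define S where "S = (cball 0 (norm v + b) :: 'a set)"
  have sub: "A n \<subseteq> S" for n
  proof
    fix y assume "y \<in> A n"
    then obtain x where x: "x \<in> W" "y = (1 / real (Suc n)) *\<^sub>R v + x" by (auto simp: A_def)
    have "norm y \<le> norm ((1 / real (Suc n)) *\<^sub>R v) + norm x" unfolding x(2) by (rule norm_triangle_ineq)
    also have "\<dots> \<le> norm v + b" using b[OF x(1)] by (intro add_mono) (auto simp: divide_le_eq mult_le_cancel_left1)
    finally show "y \<in> S" by (simp add: S_def)
  qed
  have le: "real N * measure lebesgue W \<le> measure lebesgue S" for N
  proof -
    have "measure lebesgue (\<Union>n\<in>{..<N}. A n) = (\<Sum>n<N. measure lebesgue (A n))"
    proof (rule measure_finite_Union)
      show "disjoint_family_on A {..<N}" using disj by (auto simp: disjoint_family_on_def)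
      show "emeasure lebesgue (A n) \<noteq> \<infinity>" for n
        unfolding infinity_ennreal_def by (rule fmeasurableD2[OF Am(1)])
    qed (use fmeasurableD[OF Am(1)] in auto)
    also have "\<dots> = real N * measure lebesgue W" by (simp add: Am)
    finally have "real N * measure lebesgue W = measure lebesgue (\<Union>n\<in>{..<N}. A n)" by simp
    also have "\<dots> \<le> measure lebesgue S"
      using Am sub by (intro measure_mono_fmeasurable) (auto simp: S_def fmeasurableD intro!: sets.finite_UN)
    finally show ?thesis .
  qed
  have "measure lebesgue W = 0"
  proof (rule ccontr)
    assume "measure lebesgue W \<noteq> 0"
    then have pos: "measure lebesgue W > 0" by (simp add: zero_less_measure_iff)
    obtain N where "measure lebesgue S < real N * measure lebesgue W"
      using reals_Archimedean3[OF pos] by blast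
    then show False using le[of N] by simp
  qed
  then show ?thesis using lmeasurable_compact[OF W] by (simp add: negligible_iff_measure)
qed

text \<open>A point whose orbit tends to q has entered the local stable set for good at some integer
  time. The stable set is therefore covered by countably many images of a null compact set under the
  differentiable inverse time maps.\<close>

lemma stable_set_negligible:
  assumes q: "q \<in> crit E" and nd: "\<not> definite (hessian E q)" and \<sigma>: "\<sigma> = 1 \<or> \<sigma> = -1"
  shows "negligible {k. ((\<lambda>\<tau>. phi (\<sigma> * \<tau>) k) \<longlongrightarrow> q) at_top}"
proof -
  obtain v where v: "\<sigma> * (v \<bullet> DG q v) > 0" using indefinite_direction[OF assms] by blast
  obtain r where r: "r > 0" "\<And>x c. (\<And>\<tau>. \<tau> \<ge> 0 \<Longrightarrow> norm (phi (\<sigma> * \<tau>) x - q) \<le> r) \<Longrightarrow>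
     (\<And>\<tau>. \<tau> \<ge> 0 \<Longrightarrow> norm (phi (\<sigma> * \<tau>) (x + c *\<^sub>R v) - q) \<le> r) \<Longrightarrow> c = 0"
    by (rule local_stable_set_line[OF q \<sigma> v]) blast
  define W where "W = {x. \<forall>\<tau>\<ge>0. norm (phi (\<sigma> * \<tau>) x - q) \<le> r}"
  have "W = (\<Inter>\<tau>\<in>{0..}. {x. norm (phi (\<sigma> * \<tau>) x - q) \<le> r})" by (auto simp: W_def)
  moreover have "closed {x. norm (phi (\<sigma> * \<tau>) x - q) \<le> r}" for \<tau>
    by (intro closed_Collect_le continuous_intros)
  ultimately have "closed W" by auto
  moreover have "W \<subseteq> cball q r" by (auto simp: W_def dist_norm norm_minus_commute dest!: spec[of _ 0])
  ultimately have "compact W" using compact_eq_bounded_closed bounded_subset bounded_cball by blast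
  then have "negligible W"
    by (rule disjoint_translates_negligible[of W v]) (rule r(2), auto simp: W_def)
  then have neg: "negligible (phi (- (\<sigma> * real n)) ` W)" for n
    by (intro negligible_differentiable_image_negligible) (auto intro!: differentiable_at_imp_differentiable_on phi_differentiable)
  have "{k. ((\<lambda>\<tau>. phi (\<sigma> * \<tau>) k) \<longlongrightarrow> q) at_top} \<subseteq> (\<Union>n. phi (- (\<sigma> * real n)) ` W)"
  proof
    fix k assume "k \<in> {k. ((\<lambda>\<tau>. phi (\<sigma> * \<tau>) k) \<longlongrightarrow> q) at_top}"
    then have "\<forall>\<^sub>F \<tau> in at_top. dist (phi (\<sigma> * \<tau>) k) q < r" using r(1) by (auto dest: tendstoD)
    then obtain T where T: "\<And>\<tau>. \<tau> \<ge> T \<Longrightarrow> dist (phi (\<sigma> * \<tau>) k) q < r" by (auto simp: eventually_at_top_linorder)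
    obtain n :: nat where n: "real n \<ge> T" using real_arch_simple by blast
    have "phi (\<sigma> * real n) k \<in> W"
      unfolding W_def
    proof safe
      fix \<tau> :: real assume "\<tau> \<ge> 0"
      then have "dist (phi (\<sigma> * (\<tau> + real n)) k) q < r" using n by (intro T) auto
      then show "norm (phi (\<sigma> * \<tau>) (phi (\<sigma> * real n) k) - q) \<le> r"
        by (simp add: dist_norm distrib_left phi_add)
    qed
    then have "phi (- (\<sigma> * real n)) (phi (\<sigma> * real n) k) \<in> phi (- (\<sigma> * real n)) ` W" by blast
    then show "k \<in> (\<Union>n. phi (- (\<sigma> * real n)) ` W)" by (auto simp: phi_inverse)
  qed
  then show ?thesis
    using negligible_Union_nat[of "\<lambda>n. phi (- (\<sigma> * real n)) ` W"] neg negligible_subset by blast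
qed

section \<open>The good set: orbits from the minimum to the maximum\<close>

lemma extreme_value_crit: "E k = Emin \<Longrightarrow> k \<in> crit E" "E k = Emax \<Longrightarrow> k \<in> crit E"
  using E_phi_strict_mono[of k "-1" 0] E_range[of "phi (-1) k"] E_phi_strict_mono[of k 0 1] E_range[of "phi 1 k"] by force+

lemma E_noncrit: "k \<notin> crit E \<Longrightarrow> Emin < E k \<and> E k < Emax"
  using extreme_value_crit E_range[of k] by (metis less_le)

lemma crit_interior_not_definite:
  assumes "q \<in> crit E" "E q \<noteq> Emin" "E q \<noteq> Emax"
  shows "\<not> definite (hessian E q)"
proof
  assume "definite (hessian E q)"
  then have "lat_eq kmin q \<or> lat_eq kmax q" using crit_definite assms(1) by blast
  then show False using assms E_periodic Emin_def Emax_def by (auto simp: lat_eq_def periodic_T_def)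
qed

text \<open>The complement of \<open>CM\<close>, as \<open>CM_eq\<close> will show. It is phrased by
  limits of the energy, which do not distinguish between lattice translates of the limit
  point.\<close>

definition Ogood :: "(real^'d) set" where
  "Ogood = {k. k \<notin> crit E \<and> ((\<lambda>\<tau>. E (phi \<tau> k)) \<longlongrightarrow> Emax) at_top \<and> ((\<lambda>\<tau>. E (phi (- \<tau>) k)) \<longlongrightarrow> Emin) at_top}"

lemma energy_limits:
  obtains q q' where "q \<in> crit E" "((\<lambda>\<tau>. phi \<tau> k) \<longlongrightarrow> q) at_top" "((\<lambda>\<tau>. E (phi \<tau> k)) \<longlongrightarrow> E q) at_top"
    "q' \<in> crit E" "((\<lambda>\<tau>. phi (- \<tau>) k) \<longlongrightarrow> q') at_top" "((\<lambda>\<tau>. E (phi (- \<tau>) k)) \<longlongrightarrow> E q') at_top"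
    "\<And>s. E (phi s k) \<le> E q" "\<And>s. E q' \<le> E (phi s k)"
proof -
  have cE: "isCont E x" for x using E_continuous[of UNIV] by (simp add: continuous_on_eq_continuous_at)
  obtain q where q: "q \<in> crit E" "((\<lambda>\<tau>. phi \<tau> k) \<longlongrightarrow> q) at_top" using orbit_converges[of 1 k] by auto
  obtain q' where q': "q' \<in> crit E" "((\<lambda>\<tau>. phi (- \<tau>) k) \<longlongrightarrow> q') at_top" using orbit_converges[of "-1" k] by auto
  have l: "((\<lambda>\<tau>. E (phi \<tau> k)) \<longlongrightarrow> E q) at_top" "((\<lambda>\<tau>. E (phi (- \<tau>) k)) \<longlongrightarrow> E q') at_top"
    using isCont_tendsto_compose[OF cE q(2)] isCont_tendsto_compose[OF cE q'(2)] by auto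
  have "E (phi s k) \<le> E q" for s
    by (rule tendsto_lowerbound[OF l(1)]) (auto intro!: eventually_at_top_linorderI[of s] E_phi_mono)
  moreover have "E q' \<le> E (phi s k)" for s
    by (rule tendsto_upperbound[OF l(2)]) (auto intro!: eventually_at_top_linorderI[of "- s"] E_phi_mono)
  ultimately show thesis using that q q' l by blast
qed

lemma saddle_levels:
  obtains c1 c2 where "Emin < c1" "c1 < Emax" "Emin < c2" "c2 < Emax"
    "\<And>q. q \<in> crit E \<Longrightarrow> E q > c1 \<Longrightarrow> E q = Emax" "\<And>q. q \<in> crit E \<Longrightarrow> E q < c2 \<Longrightarrow> E q = Emin"
proof -
  define V where "V = E ` (crit E \<inter> torus_box)"
  have V: "finite V" unfolding V_def using crit_box_finite by simp
  have EV: "E q \<in> V" if cq: "q \<in> crit E" for q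
  proof -
    obtain n where n: "q + lattice_vec n \<in> crit E \<inter> torus_box" using crit_reduce[OF cq] by blast
    moreover have "E (q + lattice_vec n) = E q" using E_periodic by (simp add: periodic_T_def)
    ultimately show ?thesis unfolding V_def by (metis imageI)
  qed
  \<comment> \<open>Inserting Er keeps both sets nonempty and places the two levels strictly between
    the extremal energies.\<close>
  define c1 where "c1 = Max (insert Er {e \<in> V. e < Emax})"
  define c2 where "c2 = Min (insert Er {e \<in> V. e > Emin})"
  have f: "finite (insert Er {e \<in> V. e < Emax})" "finite (insert Er {e \<in> V. e > Emin})" using V by auto
  have c1: "c1 < Emax" "c1 \<ge> Er" unfolding c1_def using f Er_in by (auto simp: Max_less_iff intro!: Max_ge)
  have c2: "c2 > Emin" "c2 \<le> Er" unfolding c2_def using f Er_in by (auto simp: Min_gr_iff intro!: Min_le)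
  have m1: "E q = Emax" if "q \<in> crit E" "E q > c1" for q
  proof (rule ccontr)
    assume "E q \<noteq> Emax"
    then have "E q \<in> insert Er {e \<in> V. e < Emax}" using EV[OF that(1)] E_range[of q] by auto
    then have "E q \<le> c1" unfolding c1_def using f by (intro Max_ge) auto
    then show False using that by simp
  qed
  have m2: "E q = Emin" if "q \<in> crit E" "E q < c2" for q
  proof (rule ccontr)
    assume "E q \<noteq> Emin"
    then have "E q \<in> insert Er {e \<in> V. e > Emin}" using EV[OF that(1)] E_range[of q] by auto
    then have "E q \<ge> c2" unfolding c2_def using f by (intro Min_le) auto
    then show False using that by simp
  qed
  have "Emin < c1" "c2 < Emax" using c1 c2 Er_in by linarith+
  then show thesis using that[of c1 c2] c1(1) c2(1) m1 m2 by blast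
qed

text \<open>Once an orbit has passed the level c1, its limit is a critical point above c1 and hence
  has energy Emax; likewise below c2. The asymptotic condition is thereby tested at finite times,
  from which openness follows.\<close>

lemma Ogood_iff:
  assumes c: "c1 < Emax" "Emin < c2"
    "\<And>q. q \<in> crit E \<Longrightarrow> E q > c1 \<Longrightarrow> E q = Emax" "\<And>q. q \<in> crit E \<Longrightarrow> E q < c2 \<Longrightarrow> E q = Emin"
  shows "k \<in> Ogood \<longleftrightarrow> k \<notin> crit E \<and> (\<exists>s. E (phi s k) > c1) \<and> (\<exists>s. E (phi s k) < c2)"
proof -
  obtain q q' where q: "q \<in> crit E" "((\<lambda>\<tau>. E (phi \<tau> k)) \<longlongrightarrow> E q) at_top"
    "q' \<in> crit E" "((\<lambda>\<tau>. E (phi (- \<tau>) k)) \<longlongrightarrow> E q') at_top"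
    "\<And>s. E (phi s k) \<le> E q" "\<And>s. E q' \<le> E (phi s k)"
    by (rule energy_limits[of k]) blast
  show ?thesis
  proof
    assume k: "k \<in> Ogood"
    then have "((\<lambda>\<tau>. E (phi \<tau> k)) \<longlongrightarrow> Emax) at_top" "((\<lambda>\<tau>. E (phi (- \<tau>) k)) \<longlongrightarrow> Emin) at_top" by (auto simp: Ogood_def)
    then have ev: "\<forall>\<^sub>F \<tau> in at_top. E (phi \<tau> k) > c1" "\<forall>\<^sub>F \<tau> in at_top. E (phi (- \<tau>) k) < c2"
      using c(1,2) by (auto dest: order_tendstoD)
    have "\<exists>s. E (phi s k) > c1" "\<exists>s. E (phi s k) < c2"
      using eventually_happens'[OF trivial_limit_at_top_linorder ev(1)]
        eventually_happens'[OF trivial_limit_at_top_linorder ev(2)] by auto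
    then show "k \<notin> crit E \<and> (\<exists>s. E (phi s k) > c1) \<and> (\<exists>s. E (phi s k) < c2)" using k by (auto simp: Ogood_def)
  next
    assume "k \<notin> crit E \<and> (\<exists>s. E (phi s k) > c1) \<and> (\<exists>s. E (phi s k) < c2)"
    then obtain s s' where "k \<notin> crit E" "E (phi s k) > c1" "E (phi s' k) < c2" by blast
    then have "E q = Emax" "E q' = Emin" using c(3)[OF q(1)] c(4)[OF q(3)] q(5)[of s] q(6)[of s'] by auto
    then show "k \<in> Ogood" using q \<open>k \<notin> crit E\<close> by (simp add: Ogood_def)
  qed
qed

lemma Ogood_open: "open Ogood"
proof -
  obtain c1 c2 where c: "c1 < Emax" "Emin < c2"
    "\<And>q. q \<in> crit E \<Longrightarrow> E q > c1 \<Longrightarrow> E q = Emax" "\<And>q. q \<in> crit E \<Longrightarrow> E q < c2 \<Longrightarrow> E q = Emin"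
    by (rule saddle_levels) blast
  have "Ogood = (- crit E) \<inter> (\<Union>s. {k. E (phi s k) > c1}) \<inter> (\<Union>s. {k. E (phi s k) < c2})"
    using Ogood_iff[OF c] by auto
  moreover have "open {k. E (phi s k) > c1}" "open {k. E (phi s k) < c2}" for s
    by (intro open_Collect_less continuous_intros continuous_on_compose2[OF E_continuous[of UNIV]]; auto)+
  moreover have "open (- crit E)" using crit_closed by auto
  ultimately show ?thesis by (simp add: open_Int open_UN)
qed

lemma Ogood_complement_negligible: "negligible (- Ogood)"
proof -
  define S where "S = {q \<in> crit E. \<not> definite (hessian E q)}"
  have cS: "countable S" unfolding S_def using crit_countable by (rule countable_subset[rotated]) auto
  define N where "N \<sigma> = (\<Union>q\<in>S. {k. ((\<lambda>\<tau>. phi (\<sigma> * \<tau>) k) \<longlongrightarrow> q) at_top})" for \<sigma>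
  have N: "negligible (N \<sigma>)" if "\<sigma> = 1 \<or> \<sigma> = -1" for \<sigma>
    unfolding N_def using cS that by (intro negligible_countable_Union countable_image) (auto simp: S_def intro!: stable_set_negligible)
  have "- Ogood \<subseteq> crit E \<union> N 1 \<union> N (-1)"
  proof
    fix k assume k: "k \<in> - Ogood"
    show "k \<in> crit E \<union> N 1 \<union> N (-1)"
    proof (cases "k \<in> crit E")
      case False
      obtain q q' where q: "q \<in> crit E" "((\<lambda>\<tau>. phi \<tau> k) \<longlongrightarrow> q) at_top" "((\<lambda>\<tau>. E (phi \<tau> k)) \<longlongrightarrow> E q) at_top"
        "q' \<in> crit E" "((\<lambda>\<tau>. phi (- \<tau>) k) \<longlongrightarrow> q') at_top" "((\<lambda>\<tau>. E (phi (- \<tau>) k)) \<longlongrightarrow> E q') at_top"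
        "\<And>s. E (phi s k) \<le> E q" "\<And>s. E q' \<le> E (phi s k)"
        by (rule energy_limits[of k]) blast
      have "E q \<noteq> Emax \<or> E q' \<noteq> Emin" using k False q by (auto simp: Ogood_def)
      \<comment> \<open>The forward limit has at least the energy of k and the backward limit at
        most, and k is not critical. So a failure of the good condition forces an interior critical
        value.\<close>
      moreover have "E q \<noteq> Emin" "E q' \<noteq> Emax"
        using q(7)[of 0] q(8)[of 0] E_noncrit[OF False] by auto
      ultimately have "q \<in> S \<or> q' \<in> S" unfolding S_def using crit_interior_not_definite q by blast
      then show ?thesis unfolding N_def using q by auto
    qed simp
  qed
  moreover have "negligible (crit E \<union> N 1 \<union> N (-1))"
    using N crit_countable by (intro negligible_Un)
      (auto simp: negligible_iff_null_sets intro!: null_sets_completionI countable_imp_null_set_lborel)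
  ultimately show ?thesis by (rule negligible_subset[rotated])
qed

lemma Ogood_phi:
  assumes "k \<in> Ogood" shows "phi s k \<in> Ogood"
proof -
  obtain c1 c2 where c: "c1 < Emax" "Emin < c2"
    "\<And>q. q \<in> crit E \<Longrightarrow> E q > c1 \<Longrightarrow> E q = Emax" "\<And>q. q \<in> crit E \<Longrightarrow> E q < c2 \<Longrightarrow> E q = Emin"
    by (rule saddle_levels) blast
  obtain t t' where t: "k \<notin> crit E" "E (phi t k) > c1" "E (phi t' k) < c2" using assms Ogood_iff[OF c, of k] by blast
  have "E (phi (t - s) (phi s k)) > c1" "E (phi (t' - s) (phi s k)) < c2" using t by (simp_all flip: phi_add)
  then show ?thesis using phi_not_crit[OF t(1)] Ogood_iff[OF c, of "phi s k"] by blast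
qed

lemma Ogood_lattice: "k + lattice_vec n \<in> Ogood \<longleftrightarrow> k \<in> Ogood"
  using E_periodic by (simp add: Ogood_def crit_lattice phi_lattice periodic_T_def)

lemma Ogood_noncrit: "k \<in> Ogood \<Longrightarrow> k \<notin> crit E"
  by (simp add: Ogood_def)

end

section \<open>Reparametrisation by energy\<close>

context morse_band
begin

lemma F_pos: "Emin < e \<Longrightarrow> e < Emax \<Longrightarrow> F e > 0"
  using F_nonneg[of e] F_zero[of e] by (simp add: less_le)

lemma F_deriv:
  assumes "e \<in> {Emin..Emax}"
  shows "(F has_real_derivative deriv F e) (at e)" "isCont (deriv F) e" "isCont F e"
  using real_analytic_R_derivative[OF F_analytic assms] DERIV_isCont by auto

text \<open>The function f of the statement, given for every argument by its integral formula. Along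
  orbits of X the quantity fF (E) is a clock: it runs with unit speed.\<close>

definition fF :: "real \<Rightarrow> real" where
  "fF e = (LBINT x=Er..e. 1 / F x)"

lemma fF_deriv:
  assumes e: "Emin < e" "e < Emax"
  shows "(fF has_real_derivative 1 / F e) (at e)"
proof -
  define a where "a = (Emin + min Er e) / 2"
  define b where "b = (Emax + max Er e) / 2"
  have ab: "Emin < a" "a < Er" "a < e" "Er < b" "e < b" "b < Emax"
    using e Er_in by (auto simp: a_def b_def min_def max_def)
  have "continuous_on {a..b} (\<lambda>x. 1 / F x)"
  proof (intro continuous_on_divide continuous_on_const continuous_at_imp_continuous_on ballI)
    fix x assume "x \<in> {a..b}"
    then have x: "Emin < x" "x < Emax" using ab by auto
    then show "isCont F x" "F x \<noteq> 0" using F_deriv(3)[of x] F_pos[OF x] by auto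
  qed
  from interval_integral_FTC2[OF _ _ this, of Er e] ab
  have "(fF has_vector_derivative 1 / F e) (at e within {a..b})" unfolding fF_def[abs_def] by simp
  moreover have "at e within {a..b} = at e" using ab by (intro at_within_interior) auto
  ultimately show ?thesis by (simp add: has_real_derivative_iff_has_vector_derivative)
qed

lemma fF_strict_mono:
  assumes *: "Emin < a" "a < b" "b < Emax"
  shows "fF a < fF b"
proof (rule DERIV_pos_imp_increasing[OF *(2)])
  show "\<exists>y. (fF has_real_derivative y) (at x) \<and> 0 < y" if "a \<le> x" "x \<le> b" for x
    using fF_deriv[of x] F_pos[of x] * that by (intro exI[of _ "1 / F x"]) auto
qed

text \<open>Linear vanishing of \<open>F\<close> gives f' = 1/F >= 1 / (C (Emax - e)), so f + ln
  (Emax - e) / C is nondecreasing and f grows at least like a logarithm towards the maximum. The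
  same holds with opposite sign at the minimum. This is why the extremal energies take infinite
  time.\<close>

lemma fF_unbounded:
  obtains e0 e1 where "Emin < e0" "e0 < Emax" "\<And>e. e0 < e \<Longrightarrow> e < Emax \<Longrightarrow> M < fF e"
    "Emin < e1" "e1 < Emax" "\<And>e. Emin < e \<Longrightarrow> e < e1 \<Longrightarrow> fF e < M"
proof -
  obtain C0 where C0: "\<And>e. e \<in> {Emin..Emax} \<Longrightarrow> F e \<le> C0 * \<bar>e - Emin\<bar> \<and> F e \<le> C0 * \<bar>Emax - e\<bar>"
    using F_linear by blast
  define C where "C = max C0 1"
  have C: "C > 0" by (simp add: C_def)
  have C': "F e \<le> C * (e - Emin)" "F e \<le> C * (Emax - e)" if "Emin < e" "e < Emax" for e
  proof -
    have le: "C0 * (e - Emin) \<le> C * (e - Emin)" "C0 * (Emax - e) \<le> C * (Emax - e)"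
      using that by (auto simp: C_def intro!: mult_right_mono)
    have f: "F e \<le> C0 * (e - Emin)" "F e \<le> C0 * (Emax - e)" using C0[of e] that by auto
    show "F e \<le> C * (e - Emin)" "F e \<le> C * (Emax - e)"
      by (rule order_trans[OF f(1) le(1)], rule order_trans[OF f(2) le(2)])
  qed
  have up: "fF Er + ln (Emax - Er) / C \<le> fF e + ln (Emax - e) / C" if e: "Er \<le> e" "e < Emax" for e
  proof (rule DERIV_nonneg_imp_nondecreasing[OF e(1)])
    fix x assume x: "Er \<le> x" "x \<le> e"
    then have xr: "Emin < x" "x < Emax" using e Er_in by auto
    have "((\<lambda>e. ln (Emax - e)) has_real_derivative - 1 / (Emax - x)) (at x)"
      using xr by (auto intro!: derivative_eq_intros)
    from DERIV_add[OF fF_deriv[OF xr] DERIV_cdivide[OF this, of C]]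
    have "((\<lambda>e. fF e + ln (Emax - e) / C) has_real_derivative 1 / F x - 1 / (C * (Emax - x))) (at x)"
      by (simp add: mult.commute)
    moreover have "1 / (C * (Emax - x)) \<le> 1 / F x"
      using C'(2)[OF xr] F_pos[OF xr] by (intro divide_left_mono) (auto intro!: mult_pos_pos C simp: xr)
    ultimately show "\<exists>y. ((\<lambda>e. fF e + ln (Emax - e) / C) has_real_derivative y) (at x) \<and> 0 \<le> y" by force
  qed
  have dn: "fF e - ln (e - Emin) / C \<le> fF Er - ln (Er - Emin) / C" if e: "Emin < e" "e \<le> Er" for e
  proof (rule DERIV_nonneg_imp_nondecreasing[OF e(2)])
    fix x assume x: "e \<le> x" "x \<le> Er"
    then have xr: "Emin < x" "x < Emax" using e Er_in by auto
    have "((\<lambda>e. ln (e - Emin)) has_real_derivative 1 / (x - Emin)) (at x)"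
      using xr by (auto intro!: derivative_eq_intros)
    from DERIV_diff[OF fF_deriv[OF xr] DERIV_cdivide[OF this, of C]]
    have "((\<lambda>e. fF e - ln (e - Emin) / C) has_real_derivative 1 / F x - 1 / (C * (x - Emin))) (at x)"
      by (simp add: mult.commute)
    moreover have "1 / (C * (x - Emin)) \<le> 1 / F x"
      using C'(1)[OF xr] F_pos[OF xr] by (intro divide_left_mono) (auto intro!: mult_pos_pos C simp: xr)
    ultimately show "\<exists>y. ((\<lambda>e. fF e - ln (e - Emin) / C) has_real_derivative y) (at x) \<and> 0 \<le> y" by force
  qed
  define K where "K = fF Er + ln (Emax - Er) / C"
  define K' where "K' = fF Er - ln (Er - Emin) / C"
  \<comment> \<open>Solved from the requirement that K - ln (Emax - e) / C exceed M;
    \<open>e1\<close> comes from the mirrored inequality.\<close>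
  define e0 where "e0 = max Er (Emax - exp (C * (K - M)))"
  define e1 where "e1 = min Er (Emin + exp (C * (M - K')))"
  have "M < fF e" if e: "e0 < e" "e < Emax" for e
  proof -
    have "Emax - e < exp (C * (K - M))" using e by (simp add: e0_def)
    then have "ln (Emax - e) < C * (K - M)" using e by (metis diff_gt_0_iff_gt exp_gt_zero ln_exp ln_less_cancel_iff)
    then have "ln (Emax - e) / C < K - M" using C by (simp add: divide_less_eq mult.commute)
    moreover have "K \<le> fF e + ln (Emax - e) / C" unfolding K_def using e by (intro up) (auto simp: e0_def)
    ultimately show ?thesis by linarith
  qed
  moreover have "fF e < M" if e: "Emin < e" "e < e1" for e
  proof -
    have "e - Emin < exp (C * (M - K'))" using e by (simp add: e1_def)
    then have "ln (e - Emin) < C * (M - K')" using e by (metis diff_gt_0_iff_gt exp_gt_zero ln_exp ln_less_cancel_iff)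
    then have "ln (e - Emin) / C < M - K'" using C by (simp add: divide_less_eq mult.commute)
    moreover have "fF e - ln (e - Emin) / C \<le> K'" unfolding K'_def using e by (intro dn) (auto simp: e1_def)
    ultimately show ?thesis by linarith
  qed
  moreover have "Emin < e0" "e0 < Emax" "Emin < e1" "e1 < Emax" using Er_in by (auto simp: e0_def e1_def)
  ultimately show thesis using that by blast
qed

text \<open>The factor between X and the gradient field, hence the local rate of the time change
  between their flows.\<close>

definition gg :: "real^'d \<Rightarrow> real" where
  "gg k = F (E k) / (norm (G k))\<^sup>2"

lemma G_nonzero: "k \<notin> crit E \<Longrightarrow> G k \<noteq> 0"
  by (simp add: crit_def)

lemma F_E_pos: "k \<notin> crit E \<Longrightarrow> F (E k) > 0"
  using E_noncrit F_pos by blast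

lemma gg_pos: "k \<notin> crit E \<Longrightarrow> gg k > 0"
  unfolding gg_def using F_E_pos[of k] G_nonzero[of k] by (intro divide_pos_pos) auto

lemma Xfield_eq: "Xfield E F k = gg k *\<^sub>R G k"
  by (simp add: Xfield_def gg_def)

text \<open>The clock reading along a gradient orbit, as a function of gradient time s. Inverting it
  in s gives the time change.\<close>

definition hh :: "real \<Rightarrow> real^'d \<Rightarrow> real" where
  "hh s k = fF (E (phi s k))"

lemma fF_E_has_derivative:
  assumes "k \<notin> crit E"
  shows "((\<lambda>k. fF (E k)) has_derivative (\<lambda>h. (G k \<bullet> h) / F (E k))) (at k)"
proof -
  have "((\<lambda>k. fF (E k)) has_derivative (\<lambda>h. 1 / F (E k) * (G k \<bullet> h))) (at k)"
    using E_noncrit[OF assms]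
    by (intro has_derivative_compose[OF E_has_derivative fF_deriv[unfolded has_field_derivative_def]]) auto
  then show ?thesis by simp
qed

lemma hh_deriv:
  assumes "k \<notin> crit E"
  shows "((\<lambda>s. hh s k) has_real_derivative 1 / gg (phi s k)) (at s)"
proof -
  have "((\<lambda>s. hh s k) has_real_derivative 1 / F (E (phi s k)) * (norm (G (phi s k)))\<^sup>2) (at s)"
    unfolding hh_def using E_noncrit[OF phi_not_crit[OF assms]]
    by (intro DERIV_chain2[OF fF_deriv E_phi_deriv]) auto
  then show ?thesis by (simp add: gg_def)
qed

lemma hh_strict_mono: "k \<notin> crit E \<Longrightarrow> s < t \<Longrightarrow> hh s k < hh t k"
  unfolding hh_def using E_noncrit phi_not_crit by (intro fF_strict_mono E_phi_strict_mono) auto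

text \<open>On a good orbit the energy tends to both extremes, where the clock is unbounded, so the
  intermediate value theorem yields every reading.\<close>

lemma hh_surj:
  assumes "k \<in> Ogood"
  obtains s where "hh s k = c"
proof -
  have nc: "k \<notin> crit E" using assms by (rule Ogood_noncrit)
  obtain e0 e1 where e: "e0 < Emax" "\<And>e. e0 < e \<Longrightarrow> e < Emax \<Longrightarrow> c < fF e"
    "Emin < e1" "\<And>e. Emin < e \<Longrightarrow> e < e1 \<Longrightarrow> fF e < c"
    by (rule fF_unbounded[of c]) blast
  have lim: "((\<lambda>\<tau>. E (phi \<tau> k)) \<longlongrightarrow> Emax) at_top" "((\<lambda>\<tau>. E (phi (- \<tau>) k)) \<longlongrightarrow> Emin) at_top"
    using assms by (auto simp: Ogood_def)
  have r: "Emin < E (phi s k)" "E (phi s k) < Emax" for s using E_noncrit[OF phi_not_crit[OF nc]] by auto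
  have "\<exists>t. c < hh t k"
    using eventually_happens'[OF trivial_limit_at_top_linorder order_tendstoD(1)[OF lim(1) e(1)]] e(2) r
    unfolding hh_def by blast
  then obtain t where t: "c < hh t k" ..
  have "\<exists>s. hh s k < c"
    using eventually_happens'[OF trivial_limit_at_top_linorder order_tendstoD(2)[OF lim(2) e(3)]] e(4) r
    unfolding hh_def by blast
  then obtain s where s: "hh s k < c" ..
  have "s \<le> t" using s t hh_strict_mono[OF nc, of t s] by (cases "s \<le> t") auto
  moreover have "continuous_on {s..t} (\<lambda>s. hh s k)"
    by (intro continuous_at_imp_continuous_on ballI DERIV_isCont[OF hh_deriv[OF nc]])
  ultimately obtain x where "hh x k = c" using IVT'[of "\<lambda>s. hh s k" s c t] s t by (auto simp: less_imp_le)
  then show thesis by (rule that)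
qed

text \<open>The gradient time after which the clock has advanced by b. On \<open>Ogood\<close> it
  exists by \<open>hh_surj\<close> and is unique by strict monotonicity; it is meaningful there
  only.\<close>

definition sg :: "real \<Rightarrow> real^'d \<Rightarrow> real" where
  "sg b k = (SOME s. hh s k = fF (E k) + b)"

definition theta :: "real \<Rightarrow> real^'d \<Rightarrow> real^'d" where
  "theta b k = phi (sg b k) k"

lemma sg_eq: assumes "k \<in> Ogood" shows "hh (sg b k) k = fF (E k) + b"
proof -
  have "\<exists>s. hh s k = fF (E k) + b" using hh_surj[OF assms, of "fF (E k) + b"] by blast
  then show ?thesis unfolding sg_def by (rule someI_ex)
qed

lemma sg_unique:
  assumes "k \<in> Ogood" "hh s k = fF (E k) + b"
  shows "sg b k = s"
  using sg_eq[OF assms(1), of b] assms(2) hh_strict_mono[OF Ogood_noncrit[OF assms(1)], of s "sg b k"]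
    hh_strict_mono[OF Ogood_noncrit[OF assms(1)], of "sg b k" s]
  by (cases s "sg b k" rule: linorder_cases) auto

lemma sg_0: "k \<in> Ogood \<Longrightarrow> sg 0 k = 0"
  by (rule sg_unique) (auto simp: hh_def)

lemma theta_0: "k \<in> Ogood \<Longrightarrow> theta 0 k = k"
  by (simp add: theta_def sg_0)

lemma theta_good: "k \<in> Ogood \<Longrightarrow> theta b k \<in> Ogood"
  by (simp add: theta_def Ogood_phi)

lemma theta_noncrit: "k \<in> Ogood \<Longrightarrow> theta b k \<notin> crit E"
  using theta_good Ogood_noncrit by blast

lemma energy_theta: "k \<in> Ogood \<Longrightarrow> fF (E (theta b k)) = fF (E k) + b"
  using sg_eq[of k b] by (simp add: theta_def hh_def)

lemma sg_add: assumes "k \<in> Ogood" shows "sg (a + b) k = sg a (theta b k) + sg b k"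
proof (rule sg_unique[OF assms])
  have "hh (sg a (theta b k) + sg b k) k = hh (sg a (theta b k)) (theta b k)"
    by (simp add: hh_def phi_add theta_def)
  also have "\<dots> = fF (E (theta b k)) + a" by (rule sg_eq[OF theta_good[OF assms]])
  finally show "hh (sg a (theta b k) + sg b k) k = fF (E k) + (a + b)" by (simp add: energy_theta[OF assms])
qed

lemma theta_add: "k \<in> Ogood \<Longrightarrow> theta (a + b) k = theta a (theta b k)"
  using sg_add[of k a b] by (simp add: theta_def phi_add)

lemma sg_lattice: "k \<in> Ogood \<Longrightarrow> sg b (k + lattice_vec n) = sg b k"
  using sg_eq[of k b] E_periodic
  by (intro sg_unique) (auto simp: Ogood_lattice hh_def phi_lattice periodic_T_def)

lemma theta_lattice: "k \<in> Ogood \<Longrightarrow> theta b (k + lattice_vec n) = theta b k + lattice_vec n"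
  by (simp add: theta_def sg_lattice phi_lattice)

text \<open>Obtained by implicit differentiation in k of hh (sg b k) k = fF (E k) + b, where 1 / gg
  at the end point is the derivative of \<open>hh\<close> in s.\<close>

definition dsg :: "real \<Rightarrow> real^'d \<Rightarrow> real^'d \<Rightarrow> real" where
  "dsg b k w = gg (theta b k) * ((G k \<bullet> w) / F (E k) - (G (theta b k) \<bullet> vphi (sg b k) k w) / F (E (theta b k)))"

lemma hh_has_derivative:
  assumes "k \<notin> crit E"
  shows "((\<lambda>p. hh (fst p) (snd p)) has_derivative
    (\<lambda>q. fst q / gg (phi s k) + (G (phi s k) \<bullet> vphi s k (snd q)) / F (E (phi s k)))) (at (s, k))"
proof -
  have "((\<lambda>p. fF (E (phi (fst p) (snd p)))) has_derivative
      (\<lambda>q. (G (phi s k) \<bullet> (fst q *\<^sub>R G (phi s k) + vphi s k (snd q))) / F (E (phi s k)))) (at (s, k))"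
    using has_derivative_compose[OF phi_has_derivative[of s k], of "\<lambda>k. fF (E k)"] fF_E_has_derivative[OF phi_not_crit[OF assms, of s]]
    by simp
  then show ?thesis unfolding hh_def
    by (rule has_derivative_eq_rhs)
       (simp add: fun_eq_iff inner_add_right dot_square_norm gg_def add_divide_distrib)
qed

text \<open>The time change is the first component of the inverse of
  \<open>(s, k) \<mapsto> (fF (E (phi s k)) - fF (E k), k)\<close>, hence differentiable by the inverse function theorem.\<close>

lemma sg_has_derivative:
  assumes k: "k \<in> Ogood"
  shows "((\<lambda>p. sg (fst p) (snd p)) has_derivative (\<lambda>q. fst q * gg (theta b k) + dsg b k (snd q))) (at (b, k))"
proof -
  define s where "s = sg b k"
  define Psi where "Psi p = (hh (fst p) (snd p) - fF (E (snd p)), snd p)" for p :: "real \<times> (real^'d)"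
  define Gam where "Gam q = (sg (fst q) (snd q), snd q)" for q :: "real \<times> (real^'d)"
  define D where "D q = (fst q / gg (phi s k) + (G (phi s k) \<bullet> vphi s k (snd q)) / F (E (phi s k)) - (G k \<bullet> snd q) / F (E k), snd q)"
    for q :: "real \<times> (real^'d)"
  define D' where "D' q = (fst q * gg (theta b k) + dsg b k (snd q), snd q)" for q :: "real \<times> (real^'d)"
  have nc: "k \<notin> crit E" using k by (rule Ogood_noncrit)
  have Psider: "(Psi has_derivative
      (\<lambda>q. (fst q / gg (phi t y) + (G (phi t y) \<bullet> vphi t y (snd q)) / F (E (phi t y)) - (G y \<bullet> snd q) / F (E y), snd q))) (at (t, y))"
    if "y \<in> Ogood" for t y
  proof -
    have ny: "y \<notin> crit E" using that by (rule Ogood_noncrit)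
    have "((\<lambda>p. fF (E (snd p))) has_derivative (\<lambda>q. (G y \<bullet> snd q) / F (E y))) (at (t, y))"
      using has_derivative_compose[OF has_derivative_snd[OF has_derivative_ident], of "\<lambda>k. fF (E k)" _ "(t, y)" UNIV] fF_E_has_derivative[OF ny]
      by simp
    then show ?thesis unfolding Psi_def[abs_def]
      by (intro has_derivative_Pair has_derivative_diff hh_has_derivative[OF ny] has_derivative_snd has_derivative_ident)
  qed
  have "(Gam has_derivative D') (at (Psi (s, k)))"
  proof (rule has_derivative_inverse_strong[of "UNIV \<times> Ogood" "(s, k)" Psi Gam D])
    show "open (UNIV \<times> Ogood :: (real \<times> (real^'d)) set)" by (intro open_Times Ogood_open) auto
    show "(s, k) \<in> UNIV \<times> Ogood" using k by simp
    show "continuous_on (UNIV \<times> Ogood) Psi"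
      by (rule continuous_at_imp_continuous_on) (auto intro: has_derivative_continuous[OF Psider])
    show "Gam (Psi p) = p" if "p \<in> UNIV \<times> Ogood" for p
      using that sg_unique[of "snd p" "fst p"] by (auto simp: Gam_def Psi_def)
    show "(Psi has_derivative D) (at (s, k))" unfolding D_def[abs_def] by (rule Psider[OF k])
    have "gg (theta b k) \<noteq> 0" using gg_pos[OF theta_noncrit[OF k, of b]] by simp
    then show "D \<circ> D' = id"
      by (simp add: D_def D'_def fun_eq_iff dsg_def s_def flip: theta_def) (simp add: field_simps)
  qed
  moreover have "Psi (s, k) = (b, k)" using sg_eq[OF k, of b] by (simp add: Psi_def s_def)
  ultimately have "(Gam has_derivative D') (at (b, k))" by simp
  from has_derivative_fst[OF this] show ?thesis by (simp add: Gam_def D'_def)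
qed

definition dth :: "real \<Rightarrow> real^'d \<Rightarrow> real^'d \<Rightarrow> real^'d" where
  "dth b k w = dsg b k w *\<^sub>R G (theta b k) + vphi (sg b k) k w"

lemma sg_pair_has_derivative:
  assumes k: "k \<in> Ogood"
  shows "((\<lambda>p. (sg (fst p) (snd p), snd p)) has_derivative (\<lambda>q. (fst q * gg (theta b k) + dsg b k (snd q), snd q))) (at (b, k))"
  by (intro has_derivative_Pair sg_has_derivative[OF k] has_derivative_snd has_derivative_ident)

lemma theta_has_derivative:
  assumes k: "k \<in> Ogood"
  shows "((\<lambda>p. theta (fst p) (snd p)) has_derivative (\<lambda>q. fst q *\<^sub>R Xfield E F (theta b k) + dth b k (snd q))) (at (b, k))"
proof -
  have "((\<lambda>p. (\<lambda>p. phi (fst p) (snd p)) (sg (fst p) (snd p), snd p)) has_derivative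
     (\<lambda>q. (\<lambda>q. fst q *\<^sub>R G (phi (sg b k) k) + vphi (sg b k) k (snd q)) (fst q * gg (theta b k) + dsg b k (snd q), snd q))) (at (b, k))"
    by (rule has_derivative_compose[OF sg_pair_has_derivative[OF k]]) (simp add: phi_has_derivative)
  then show ?thesis
    by (simp add: theta_def[symmetric] Xfield_eq dth_def scaleR_add_left add.assoc)
qed

lemma Ip_sg_has_derivative:
  assumes k: "k \<in> Ogood"
  shows "((\<lambda>p. Ip (sg (fst p) (snd p)) (snd p)) has_derivative
    (\<lambda>q. fst q * (gg (theta b k) * Lap (theta b k)) + (dsg b k (snd q) * Lap (theta b k) + vIp (sg b k) k (snd q)))) (at (b, k))"
proof -
  have "((\<lambda>p. (\<lambda>p. Ip (fst p) (snd p)) (sg (fst p) (snd p), snd p)) has_derivative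
     (\<lambda>q. (\<lambda>q. fst q * Lap (phi (sg b k) k) + vIp (sg b k) k (snd q)) (fst q * gg (theta b k) + dsg b k (snd q), snd q))) (at (b, k))"
    by (rule has_derivative_compose[OF sg_pair_has_derivative[OF k]]) (simp add: Ip_has_derivative)
  then show ?thesis
    by (simp add: theta_def[symmetric] distrib_right mult.assoc add.assoc)
qed

lemma sg_continuous: "continuous_on (UNIV \<times> Ogood) (\<lambda>p. sg (fst p) (snd p))"
  by (rule continuous_at_imp_continuous_on) (auto intro: has_derivative_continuous[OF sg_has_derivative])

lemma theta_continuous: "continuous_on (UNIV \<times> Ogood) (\<lambda>p. theta (fst p) (snd p))"
  by (rule continuous_at_imp_continuous_on) (auto intro: has_derivative_continuous[OF theta_has_derivative])

lemma theta_has_vector_derivative: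
  assumes k: "k \<in> Ogood"
  shows "((\<lambda>b. theta b k) has_vector_derivative Xfield E F (theta b k)) (at b)"
proof -
  have d: "((\<lambda>b. (b, k)) has_derivative (\<lambda>\<beta>. (\<beta>, 0))) (at b)"
    by (intro has_derivative_Pair has_derivative_const has_derivative_ident)
  \<comment> \<open>Linearity of the joint derivative at the zero vector, which leaves the time
    direction alone.\<close>
  have dth0: "dth b k 0 = 0"
    using linear_0[OF bounded_linear.linear[OF has_derivative_bounded_linear[OF theta_has_derivative[OF k, of b]]]] by (simp add: zero_prod_def)
  from has_derivative_compose[OF d theta_has_derivative[OF k]] show ?thesis
    by (simp add: has_vector_derivative_def dth0)
qed

lemma is_orbit_theta:
  assumes "k \<in> Ogood" shows "is_orbit E F k (\<lambda>b. theta b k)"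
  unfolding is_orbit_def using theta_0[OF assms] theta_noncrit[OF assms] theta_has_vector_derivative[OF assms] by blast

text \<open>An orbit of X that exists for all times is a rescaled gradient orbit by uniqueness.
  Along it the clock advances with unit speed over the whole real line, so the energy passes both
  levels of \<open>Ogood_iff\<close>. An orbit running into a saddle would keep the energy on one
  side of a level, which a complete orbit cannot do.\<close>

lemma orbit_unique:
  assumes \<gamma>: "is_orbit E F k \<gamma>"
  shows "k \<in> Ogood" "\<gamma> t = theta t k"
proof -
  have g0: "\<gamma> 0 = k" and nc: "\<And>t. \<gamma> t \<notin> crit E" and d: "\<And>t. (\<gamma> has_vector_derivative gg (\<gamma> t) *\<^sub>R G (\<gamma> t)) (at t)"
    using \<gamma> by (auto simp: is_orbit_def Xfield_eq)
  have gc: "continuous_on UNIV \<gamma>" by (rule has_vector_derivative_imp_continuous_on[OF d])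
  have "continuous_on UNIV (\<lambda>t. gg (\<gamma> t))"
    unfolding gg_def
  proof (intro continuous_intros)
    have Ec: "continuous_on UNIV (\<lambda>t. E (\<gamma> t))" by (rule continuous_on_compose2[OF E_continuous[of UNIV] gc]) auto
    have Fc: "continuous_on {Emin..Emax} F" using F_deriv(3) by (intro continuous_at_imp_continuous_on) auto
    show "continuous_on UNIV (\<lambda>t. F (E (\<gamma> t)))" by (rule continuous_on_compose2[OF Fc Ec]) (use E_range in auto)
    show "continuous_on UNIV (\<lambda>t. G (\<gamma> t))" by (rule continuous_on_compose2[OF G_continuous[of UNIV] gc]) auto
    show "\<forall>x\<in>UNIV. (norm (G (\<gamma> x)))\<^sup>2 \<noteq> 0" using nc G_nonzero by auto
  qed
  note ggc = this
  obtain S where S: "S 0 = 0" "\<And>t. (S has_vector_derivative gg (\<gamma> t)) (at t)"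
    using continuous_has_antiderivative[OF ggc] by blast
  have \<gamma>phi: "\<gamma> t = phi (S t) k" for t
    using phi_rescaled_unique[OF ggc d, of S t] S g0 by (simp add: has_real_derivative_iff_has_vector_derivative)
  have "((\<lambda>t. fF (E (\<gamma> t)) - t) has_real_derivative 0) (at t)" for t
  proof -
    have "((\<lambda>t. fF (E (\<gamma> t))) has_derivative (\<lambda>s. (G (\<gamma> t) \<bullet> (s *\<^sub>R (gg (\<gamma> t) *\<^sub>R G (\<gamma> t)))) / F (E (\<gamma> t)))) (at t)"
      by (rule has_derivative_compose[OF d[unfolded has_vector_derivative_def] fF_E_has_derivative[OF nc]])
    moreover have eq: "(G (\<gamma> t) \<bullet> (s *\<^sub>R (gg (\<gamma> t) *\<^sub>R G (\<gamma> t)))) / F (E (\<gamma> t)) = 1 * s" for s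
      using F_E_pos[OF nc[of t]] G_nonzero[OF nc[of t]] by (simp add: gg_def dot_square_norm)
    ultimately have "((\<lambda>t. fF (E (\<gamma> t))) has_real_derivative 1) (at t)"
      unfolding has_field_derivative_def by (simp only: eq)
    from DERIV_diff[OF this DERIV_ident] show ?thesis by simp
  qed
  then have "fF (E (\<gamma> t)) - t = fF (E (\<gamma> 0)) - 0" for t by (rule DERIV_isconst_all[rule_format])
  then have en: "fF (E (\<gamma> t)) = fF (E k) + t" for t using g0 by (simp add: algebra_simps)
  obtain c1 c2 where c: "Emin < c1" "c1 < Emax" "Emin < c2" "c2 < Emax"
    "\<And>q. q \<in> crit E \<Longrightarrow> E q > c1 \<Longrightarrow> E q = Emax" "\<And>q. q \<in> crit E \<Longrightarrow> E q < c2 \<Longrightarrow> E q = Emin"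
    by (rule saddle_levels) blast
  have r: "Emin < E (\<gamma> t)" "E (\<gamma> t) < Emax" for t using E_noncrit[OF nc] by auto
  \<comment> \<open>At this time the clock reads fF c1 + 1, one unit past the level; the time for c2
    is chosen one unit before its level.\<close>
  have "E (\<gamma> (fF c1 - fF (E k) + 1)) > c1"
  proof (rule ccontr)
    assume "\<not> ?thesis"
    then have "fF (E (\<gamma> (fF c1 - fF (E k) + 1))) \<le> fF c1"
      using fF_strict_mono[OF r(1) _ c(2)] by (cases "E (\<gamma> (fF c1 - fF (E k) + 1)) = c1") (auto simp: less_le)
    then show False by (simp add: en)
  qed
  moreover have "E (\<gamma> (fF c2 - fF (E k) - 1)) < c2"
  proof (rule ccontr)
    assume "\<not> ?thesis"
    then have "fF (E (\<gamma> (fF c2 - fF (E k) - 1))) \<ge> fF c2"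
      using fF_strict_mono[OF c(3) _ r(2)] by (cases "E (\<gamma> (fF c2 - fF (E k) - 1)) = c2") (auto simp: less_le)
    then show False by (simp add: en)
  qed
  moreover have "k \<notin> crit E" using nc[of 0] g0 by simp
  ultimately show k: "k \<in> Ogood" using Ogood_iff[OF c(2,3,5,6), of k] \<gamma>phi by metis
  have "sg t k = S t" by (rule sg_unique[OF k]) (simp add: hh_def flip: \<gamma>phi en)
  then show "\<gamma> t = theta t k" by (simp add: theta_def \<gamma>phi)
qed

lemma CM_eq: "CM E F = - Ogood"
  unfolding CM_def using is_orbit_theta orbit_unique(1) by blast

lemma flow_eq: "k \<in> Ogood \<Longrightarrow> flow E F b k = theta b k"
  unfolding flow_def using someI[of "is_orbit E F k", OF is_orbit_theta] orbit_unique(2) by metis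

end

section \<open>The transported functions\<close>

text \<open>Continuity of the derivative is recorded for each fixed direction. The expansion
  transfers it to directions that vary with the point, as the transported direction and X
  do.\<close>

lemma frechet_derivative_expand:
  fixes \<phi> :: "real^'d::finite \<Rightarrow> complex"
  assumes "\<phi> differentiable (at x)"
  shows "frechet_derivative \<phi> (at x) v = (\<Sum>i\<in>UNIV. of_real (v$i) * frechet_derivative \<phi> (at x) (axis i 1))"
proof -
  have lin: "linear (frechet_derivative \<phi> (at x))" by (rule linear_frechet_derivative[OF assms])
  have "frechet_derivative \<phi> (at x) v = frechet_derivative \<phi> (at x) (\<Sum>i\<in>UNIV. v$i *s axis i 1)"
    by (simp add: basis_expansion)
  also have "\<dots> = (\<Sum>i\<in>UNIV. frechet_derivative \<phi> (at x) (v$i *\<^sub>R axis i 1))"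
    by (simp add: linear_sum[OF lin] scalar_mult_eq_scaleR)
  also have "\<dots> = (\<Sum>i\<in>UNIV. of_real (v$i) * frechet_derivative \<phi> (at x) (axis i 1))"
    unfolding linear_scale[OF lin] by (simp add: scaleR_conv_of_real)
  finally show ?thesis .
qed

lemma frechet_derivative_zero_open:
  assumes "open U" "x \<in> U" "\<And>y. y \<in> U \<Longrightarrow> f y = 0"
  shows "(f has_derivative (\<lambda>_. 0)) (at x)" "frechet_derivative f (at x) = (\<lambda>_. 0)"
proof -
  show d: "(f has_derivative (\<lambda>_. 0)) (at x)"
    by (rule has_derivative_transform_within_open[OF has_derivative_const[of 0] assms(1,2)]) (use assms in auto)
  show "frechet_derivative f (at x) = (\<lambda>_. 0)" by (rule frechet_derivative_at[OF d, symmetric])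
qed

lemma continuous_on_two_open:
  assumes "open A" "continuous_on A f" "open B" "\<And>x. x \<in> B \<Longrightarrow> f x = 0" "A \<union> B = UNIV"
  shows "continuous_on UNIV f"
proof -
  have "continuous_on B f" using continuous_on_cong[of B B f "\<lambda>_. 0"] assms(4) by simp
  then show ?thesis using continuous_on_open_Un[OF assms(1,3,2)] assms(5) by simp
qed

text \<open>Lets the lattice translates of a compact set form a closed set.\<close>

lemma closed_lattice: "closed (range (lattice_vec :: ('d::finite \<Rightarrow> int) \<Rightarrow> real^'d))"
proof -
  have "range (lattice_vec :: ('d \<Rightarrow> int) \<Rightarrow> real^'d) = {x. \<forall>i. x$i / (2 * pi) \<in> \<int>}"
  proof safe
    fix x :: "real^'d" assume "\<forall>i. x$i / (2 * pi) \<in> \<int>"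
    then have "\<forall>i. \<exists>n. x$i / (2 * pi) = of_int n" by (auto elim: Ints_cases)
    then obtain n where "\<And>i. x$i / (2 * pi) = of_int (n i)" by metis
    then have "x = lattice_vec n" by (simp add: vec_eq_iff field_simps)
    then show "x \<in> range lattice_vec" by blast
  qed simp
  moreover have "closed {x::real^'d. x$i / (2 * pi) \<in> \<int>}" for i
    using continuous_closed_vimage[OF closed_Ints, of "\<lambda>x::real^'d. x$i / (2 * pi)"]
    by (auto simp: vimage_def intro!: continuous_intros)
  ultimately show ?thesis by (simp add: closed_Collect_all)
qed

context morse_band
begin

section \<open>Derivative and divergence of X away from critical points\<close>

lemma continuous_on_DG [continuous_intros]:
  assumes "continuous_on A s" "continuous_on A g"
  shows "continuous_on A (\<lambda>p. DG (s p) (g p))"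
proof -
  have "continuous_on A (\<lambda>p. DZ (s p, 0) (g p, 0))"
    by (intro Zf.continuous_on_DY continuous_intros assms)
  then have "continuous_on A (\<lambda>p. fst (DZ (s p, 0) (g p, 0)))" by (rule continuous_on_fst)
  then show ?thesis by (simp add: DZ_def)
qed

lemma continuous_on_G [continuous_intros]: "continuous_on A s \<Longrightarrow> continuous_on A (\<lambda>p. G (s p))"
  using continuous_on_compose2[OF G_continuous[of UNIV]] by auto

lemma continuous_on_E [continuous_intros]: "continuous_on A s \<Longrightarrow> continuous_on A (\<lambda>p. E (s p))"
  using continuous_on_compose2[OF E_continuous[of UNIV]] by auto

lemma continuous_on_Lap [continuous_intros]: "continuous_on A s \<Longrightarrow> continuous_on A (\<lambda>p. Lap (s p))"
  using continuous_on_compose2[OF Lap_continuous[of UNIV]] by auto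

lemma continuous_on_F_E [continuous_intros]:
  assumes "continuous_on A s" shows "continuous_on A (\<lambda>p. F (E (s p)))"
proof -
  have "continuous_on {Emin..Emax} F" using F_deriv(3) by (intro continuous_at_imp_continuous_on) auto
  then show ?thesis by (rule continuous_on_compose2[OF _ continuous_on_E[OF assms]]) (use E_range in auto)
qed

lemma continuous_on_dF_E [continuous_intros]:
  assumes "continuous_on A s" shows "continuous_on A (\<lambda>p. deriv F (E (s p)))"
proof -
  have "continuous_on {Emin..Emax} (deriv F)" using F_deriv(2) by (intro continuous_at_imp_continuous_on) auto
  then show ?thesis by (rule continuous_on_compose2[OF _ continuous_on_E[OF assms]]) (use E_range in auto)
qed

lemma continuous_on_gg:
  assumes "continuous_on A s" "\<And>p. p \<in> A \<Longrightarrow> s p \<notin> crit E"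
  shows "continuous_on A (\<lambda>p. gg (s p))"
  unfolding gg_def using assms(2) G_nonzero by (intro continuous_intros assms(1)) auto

definition dgg :: "real^'d \<Rightarrow> real^'d \<Rightarrow> real" where
  "dgg k h = deriv F (E k) * (G k \<bullet> h) / (norm (G k))\<^sup>2 - gg k * (2 * (G k \<bullet> DG k h)) / (norm (G k))\<^sup>2"

lemma gg_has_derivative:
  assumes "k \<notin> crit E"
  shows "(gg has_derivative dgg k) (at k)"
proof -
  have g0: "G k \<bullet> G k \<noteq> 0" using G_nonzero[OF assms] by simp
  have FE: "((\<lambda>k. F (E k)) has_derivative (\<lambda>h. deriv F (E k) * (G k \<bullet> h))) (at k)"
    using E_range[of k]
    by (intro has_derivative_compose[OF E_has_derivative F_deriv(1)[unfolded has_field_derivative_def]]) auto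
  have GG: "((\<lambda>k. G k \<bullet> G k) has_derivative (\<lambda>h. G k \<bullet> DG k h + DG k h \<bullet> G k)) (at k)"
    by (rule has_derivative_inner[OF G_has_derivative G_has_derivative])
  have eq: "- F (E k) * (inverse (G k \<bullet> G k) * (G k \<bullet> DG k h + DG k h \<bullet> G k) * inverse (G k \<bullet> G k)) + deriv F (E k) * (G k \<bullet> h) / (G k \<bullet> G k)
     = dgg k h" for h
    using g0 unfolding dgg_def gg_def power2_norm_eq_inner inner_commute[of "DG k h" "G k"]
    by (simp add: divide_inverse algebra_simps)
  have "((\<lambda>k. F (E k) / (G k \<bullet> G k)) has_derivative dgg k) (at k)"
    using has_derivative_divide[OF FE GG g0] by (simp only: eq)
  moreover have "gg = (\<lambda>k. F (E k) / (G k \<bullet> G k))" by (simp add: gg_def[abs_def] power2_norm_eq_inner)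
  ultimately show ?thesis by simp
qed

lemma dgg_linear: "k \<notin> crit E \<Longrightarrow> linear (dgg k)"
  using gg_has_derivative has_derivative_bounded_linear bounded_linear.linear by blast

lemma continuous_on_dgg:
  assumes "continuous_on A s" "\<And>p. p \<in> A \<Longrightarrow> s p \<notin> crit E" "continuous_on A h"
  shows "continuous_on A (\<lambda>p. dgg (s p) (h p))"
  unfolding dgg_def using assms(2) G_nonzero by (intro continuous_intros continuous_on_gg assms) auto

definition divX :: "real^'d \<Rightarrow> real" where
  "divX k = dgg k (G k) + gg k * Lap k"

lemma continuous_on_divX:
  assumes "continuous_on A s" "\<And>p. p \<in> A \<Longrightarrow> s p \<notin> crit E"
  shows "continuous_on A (\<lambda>p. divX (s p))"
  unfolding divX_def by (intro continuous_intros continuous_on_gg continuous_on_dgg assms)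

lemma Xfield_has_derivative:
  assumes "k \<notin> crit E"
  shows "(Xfield E F has_derivative (\<lambda>h. gg k *\<^sub>R DG k h + dgg k h *\<^sub>R G k)) (at k)"
  unfolding Xfield_eq[abs_def] by (intro has_derivative_scaleR gg_has_derivative G_has_derivative assms)

text \<open>Product rule for X = gg G: the part gg DG has trace gg times the Laplacian, and the
  rank-one part h -> dgg(h) G has trace dgg(G).\<close>

lemma divergence_Xfield:
  assumes "k \<notin> crit E"
  shows "divergence (Xfield E F) k = divX k"
proof -
  have "divergence (Xfield E F) k = (\<Sum>i\<in>UNIV. gg k * DG k (axis i 1) $ i + dgg k (axis i 1) * G k $ i)"
    unfolding divergence_def frechet_derivative_at[OF Xfield_has_derivative[OF assms], symmetric] by simp
  also have "\<dots> = gg k * Lap k + (\<Sum>i\<in>UNIV. dgg k (G k $ i *\<^sub>R axis i 1))"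
    by (simp add: sum.distrib Lap_eq_trace sum_distrib_left linear_scale[OF dgg_linear[OF assms]] mult.commute)
  also have "(\<Sum>i\<in>UNIV. dgg k (G k $ i *\<^sub>R axis i 1)) = dgg k (\<Sum>i\<in>UNIV. G k $ i *s axis i 1)"
    by (simp add: linear_sum[OF dgg_linear[OF assms]] scalar_mult_eq_scaleR)
  finally show ?thesis by (simp add: basis_expansion divX_def)
qed

text \<open>Half the integral of the divergence along the orbit, in closed form. Since theta moves
  with velocity gg G, the b-derivative of ln gg (theta) is dgg(G), and that of Ip (sg) is gg times
  the Laplacian; together they make up div X. All ingredients are differentiable in k, hence so is
  the weight.\<close>

definition PP :: "real \<Rightarrow> real^'d \<Rightarrow> real" where
  "PP b k = (ln (gg (theta b k)) - ln (gg k) + Ip (sg b k) k) / 2"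

definition dPP :: "real \<Rightarrow> real^'d \<Rightarrow> real^'d \<Rightarrow> real" where
  "dPP b k w = (dgg (theta b k) (dth b k w) / gg (theta b k) - dgg k w / gg k
     + (dsg b k w * Lap (theta b k) + vIp (sg b k) k w)) / 2"

lemma PP_has_derivative:
  assumes k: "k \<in> Ogood"
  shows "((\<lambda>p. PP (fst p) (snd p)) has_derivative (\<lambda>q. fst q * (divX (theta b k) / 2) + dPP b k (snd q))) (at (b, k))"
proof -
  have ln_gg: "((\<lambda>k. ln (gg k)) has_derivative (\<lambda>h. dgg y h / gg y)) (at y)" if "y \<notin> crit E" for y
    using has_derivative_compose[OF gg_has_derivative[OF that] DERIV_ln[OF gg_pos[OF that], unfolded has_field_derivative_def]]
    by (simp add: divide_inverse mult.commute)
  have nt: "theta b k \<notin> crit E" by (rule theta_noncrit[OF k])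
  have a: "((\<lambda>p. ln (gg (theta (fst p) (snd p)))) has_derivative
      (\<lambda>q. dgg (theta b k) (fst q *\<^sub>R Xfield E F (theta b k) + dth b k (snd q)) / gg (theta b k))) (at (b, k))"
    using has_derivative_compose[OF theta_has_derivative[OF k, of b], of "\<lambda>k. ln (gg k)"] ln_gg[OF nt] by simp
  have c: "((\<lambda>p. ln (gg (snd p))) has_derivative (\<lambda>q. dgg k (snd q) / gg k)) (at (b, k))"
    using has_derivative_compose[OF has_derivative_snd[OF has_derivative_ident], of "\<lambda>k. ln (gg k)" _ "(b, k)" UNIV] ln_gg[OF Ogood_noncrit[OF k]]
    by simp
  have "((\<lambda>p. (ln (gg (theta (fst p) (snd p))) - ln (gg (snd p)) + Ip (sg (fst p) (snd p)) (snd p)) / 2) has_derivative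
    (\<lambda>q. (dgg (theta b k) (fst q *\<^sub>R Xfield E F (theta b k) + dth b k (snd q)) / gg (theta b k) - dgg k (snd q) / gg k +
      (fst q * (gg (theta b k) * Lap (theta b k)) + (dsg b k (snd q) * Lap (theta b k) + vIp (sg b k) k (snd q)))) / 2)) (at (b, k))"
    by (rule bounded_linear.has_derivative[OF bounded_linear_divide has_derivative_add[OF has_derivative_diff[OF a c] Ip_sg_has_derivative[OF k]]])
  moreover have eq: "dgg (theta b k) (fst q *\<^sub>R Xfield E F (theta b k) + dth b k (snd q)) / gg (theta b k)
     = fst q * dgg (theta b k) (G (theta b k)) + dgg (theta b k) (dth b k (snd q)) / gg (theta b k)" for q
    using gg_pos[OF nt]
    by (simp add: Xfield_eq linear_add[OF dgg_linear[OF nt]] linear_scale[OF dgg_linear[OF nt]] add_divide_distrib)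
  moreover have "(x * a + d - e + (x * g + r)) / 2 = x * ((a + g) / 2) + (d - e + r) / 2" for x a d e g r :: real
    by (simp add: field_simps)
  ultimately show ?thesis
    unfolding PP_def dPP_def divX_def by (simp only: eq)
qed

lemma PP_time_derivative:
  assumes k: "k \<in> Ogood"
  shows "((\<lambda>b. PP b k) has_real_derivative divX (theta b k) / 2) (at b)"
proof -
  have d: "((\<lambda>b. (b, k)) has_derivative (\<lambda>\<beta>. (\<beta>, 0))) (at b)"
    by (intro has_derivative_Pair has_derivative_const has_derivative_ident)
  have z: "dPP b k 0 = 0"
    using linear_0[OF bounded_linear.linear[OF has_derivative_bounded_linear[OF PP_has_derivative[OF k, of b]]]] by (simp add: zero_prod_def)
  have "((\<lambda>b. PP b k) has_derivative (\<lambda>\<beta>. \<beta> * (divX (theta b k) / 2) + dPP b k 0)) (at b)"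
    using has_derivative_compose[OF d PP_has_derivative[OF k]] by simp
  then show ?thesis unfolding has_field_derivative_def
    by (rule has_derivative_eq_rhs) (simp add: z fun_eq_iff)
qed

lemma PP_0: "k \<in> Ogood \<Longrightarrow> PP 0 k = 0"
  by (simp add: PP_def theta_0 sg_0)

lemma PP_add: "k \<in> Ogood \<Longrightarrow> PP (a + b) k = PP a k + PP b (theta a k)"
  using theta_add[of k b a] sg_add[of k b a] Ip_add[of "sg b (theta a k)" "sg a k" k]
  by (simp add: PP_def add.commute[of a b] theta_def[symmetric] add_divide_distrib diff_divide_distrib)

lemma PP_lattice: "k \<in> Ogood \<Longrightarrow> PP b (k + lattice_vec n) = PP b k"
proof -
  have "gg (y + lattice_vec n) = gg y" for y using E_periodic by (simp add: gg_def G_periodic periodic_T_def)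
  then show "k \<in> Ogood \<Longrightarrow> PP b (k + lattice_vec n) = PP b k"
    by (simp add: PP_def theta_lattice sg_lattice Ip_lattice)
qed

text \<open>The fundamental theorem of calculus replaces the integral in the definition of the
  operator by the closed form \<open>PP\<close>.\<close>

lemma Wop_good:
  assumes k: "k \<in> Ogood"
  shows "Wop E F b \<phi> k = of_real (exp (PP b k)) * \<phi> (theta b k)"
proof -
  have "(LBINT u=0..b. divergence (Xfield E F) (flow E F u k)) = (LBINT u=0..b. divX (theta u k))"
    by (simp add: flow_eq[OF k] divergence_Xfield[OF theta_noncrit[OF k]])
  also have "\<dots> = (LBINT u=ereal 0..b. divX (theta u k))" by (simp add: zero_ereal_def)
  also have "\<dots> = 2 * PP b k - 2 * PP 0 k"
  proof (rule interval_integral_FTC_finite)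
    show "continuous_on {min 0 b..max 0 b} (\<lambda>u. divX (theta u k))"
      by (rule continuous_on_divX[OF has_vector_derivative_imp_continuous_on[OF theta_has_vector_derivative[OF k]] theta_noncrit[OF k]])
    show "((\<lambda>b. 2 * PP b k) has_vector_derivative divX (theta x k)) (at x within {min 0 b..max 0 b})" for x
      using DERIV_cmult[OF PP_time_derivative[OF k, of x], of 2]
      by (auto simp: has_real_derivative_iff_has_vector_derivative intro: has_vector_derivative_at_within)
  qed
  finally have "(LBINT u=0..b. divergence (Xfield E F) (flow E F u k)) = 2 * PP b k"
    by (simp add: PP_0[OF k])
  then show ?thesis using k by (simp add: Wop_def CM_eq flow_eq)
qed

lemma Wop_bad: "k \<notin> Ogood \<Longrightarrow> Wop E F b \<phi> k = 0"
  by (simp add: Wop_def CM_eq)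

lemma Wop_add: "Wop E F (a + b) \<phi> k = Wop E F a (Wop E F b \<phi>) k"
proof (cases "k \<in> Ogood")
  case True
  have "theta (a + b) k = theta b (theta a k)" using theta_add[OF True, of b a] by (simp add: add.commute)
  then show ?thesis using True by (simp add: Wop_good theta_good PP_add exp_add)
qed (simp add: Wop_bad)

lemma Wop_0: "k \<in> Ogood \<Longrightarrow> Wop E F 0 \<phi> k = \<phi> k"
  by (simp add: Wop_good PP_0 theta_0)

lemma Wop_lin: "Wop E F b (\<lambda>k. c * f k + g k) k = c * Wop E F b f k + Wop E F b g k"
  by (simp add: Wop_def algebra_simps)

lemma Wop_periodic: "periodic_T \<phi> \<Longrightarrow> periodic_T (Wop E F b \<phi>)"
  unfolding periodic_T_def
proof (intro allI)
  fix k n assume "\<forall>k n. \<phi> (k + lattice_vec n) = \<phi> k"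
  then show "Wop E F b \<phi> (k + lattice_vec n) = Wop E F b \<phi> k"
    by (cases "k \<in> Ogood") (auto simp: Wop_good Wop_bad Ogood_lattice theta_lattice PP_lattice)
qed

section \<open>Function classes invariant under the transport\<close>

definition vnear :: "(real^'d \<Rightarrow> complex) \<Rightarrow> bool" where
  "vnear \<phi> \<longleftrightarrow> (\<exists>U. open U \<and> - Ogood \<subseteq> U \<and> (\<forall>k\<in>U. \<phi> k = 0))"

definition K0 :: "(real^'d \<Rightarrow> complex) set" where
  "K0 = {\<phi>. periodic_T \<phi> \<and> vnear \<phi> \<and> continuous_on UNIV \<phi>}"

definition K1 :: "(real^'d \<Rightarrow> complex) set" where
  "K1 = {\<phi>. periodic_T \<phi> \<and> vnear \<phi> \<and> (\<forall>x. \<phi> differentiable (at x)) \<and>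
     (\<forall>v. continuous_on UNIV (\<lambda>x. frechet_derivative \<phi> (at x) v))}"

lemma K1_K0: "\<phi> \<in> K1 \<Longrightarrow> \<phi> \<in> K0"
  unfolding K0_def K1_def by (auto intro!: continuous_at_imp_continuous_on differentiable_imp_continuous_within)

text \<open>Modulo the lattice the support of \<phi> is a compact part of the good set. Flowing it
  for all times in [-\<tau>, \<tau>] sweeps a compact set, whose lattice translates form a closed
  set inside the good set. On the complement all W_b \<phi> with |b| <= \<tau> vanish, so one
  neighbourhood of the bad set serves a whole time interval.\<close>

lemma orbit_tube:
  assumes "periodic_T \<phi>" "vnear \<phi>"
  obtains V where "open V" "- Ogood \<subseteq> V" "\<And>b k. \<bar>b\<bar> \<le> \<tau> \<Longrightarrow> k \<in> V \<Longrightarrow> Wop E F b \<phi> k = 0"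
proof -
  obtain U where U: "open U" "- Ogood \<subseteq> U" "\<And>k. k \<in> U \<Longrightarrow> \<phi> k = 0" using assms(2) by (auto simp: vnear_def)
  define S where "S = (- U) \<inter> torus_box"
  have S: "compact S" "S \<subseteq> Ogood" unfolding S_def
    using U by (auto intro!: closed_Int_compact compact_torus_box)
  define Q where "Q = (\<lambda>p. theta (fst p) (snd p)) ` ({-\<tau>..\<tau>} \<times> S)"
  have Q: "compact Q" unfolding Q_def
    by (intro compact_continuous_image continuous_on_subset[OF theta_continuous] compact_Times S) (use S in auto)
  define C where "C = (\<Union>x\<in>Q. \<Union>y\<in>range lattice_vec. {x + y})"
  have C: "closed C" unfolding C_def by (rule compact_closed_sums[OF Q closed_lattice])
  have "C \<subseteq> Ogood" unfolding C_def Q_def using S by (auto simp: Ogood_lattice theta_good)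
  moreover have "Wop E F b \<phi> k = 0" if b: "\<bar>b\<bar> \<le> \<tau>" and k: "k \<in> - C" for b k
  proof (rule ccontr)
    assume nz: "Wop E F b \<phi> k \<noteq> 0"
    then have kO: "k \<in> Ogood" using Wop_bad by blast
    then have p: "\<phi> (theta b k) \<noteq> 0" using nz by (auto simp: Wop_good)
    obtain n where n: "theta b k + lattice_vec n \<in> torus_box" by (rule lattice_reduce)
    define y where "y = theta b (k + lattice_vec n)"
    have y: "y = theta b k + lattice_vec n" using theta_lattice[OF kO] by (simp add: y_def)
    have "\<phi> y \<noteq> 0" using p assms(1) by (simp add: y periodic_T_def)
    then have "y \<in> S" using n U(3) by (auto simp: S_def y)
    moreover have "k + lattice_vec n = theta (- b) y"
      unfolding y_def using theta_add[of "k + lattice_vec n" "- b" b] theta_0 kO by (simp add: Ogood_lattice)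
    ultimately have "k + lattice_vec n \<in> Q" using b by (auto simp: Q_def intro!: image_eqI[of _ _ "(- b, y)"])
    then have "k + lattice_vec n + lattice_vec (\<lambda>i. - n i) \<in> C" unfolding C_def by blast
    then show False using k by (simp add: lattice_vec_uminus)
  qed
  moreover have "open (- C)" using C by auto
  ultimately show thesis using that[of "- C"] by blast
qed

lemma continuous_on_PP: "continuous_on (UNIV \<times> Ogood) (\<lambda>p. PP (fst p) (snd p))"
  by (rule continuous_at_imp_continuous_on) (auto intro: has_derivative_continuous[OF PP_has_derivative])

text \<open>At good points the explicit formula is continuous. At bad points the function vanishes
  on a full neighbourhood in (b, k) by \<open>orbit_tube\<close>, although flow and weight have no
  meaning there.\<close>

lemma Wop_continuous:
  assumes "\<phi> \<in> K0"
  shows "continuous_on UNIV (\<lambda>p. Wop E F (fst p) \<phi> (snd p))"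
proof -
  have \<phi>: "periodic_T \<phi>" "vnear \<phi>" "continuous_on UNIV \<phi>" using assms by (auto simp: K0_def)
  have "continuous_on (UNIV \<times> Ogood) (\<lambda>p. of_real (exp (PP (fst p) (snd p))) * \<phi> (theta (fst p) (snd p)))"
    by (intro continuous_intros continuous_on_PP continuous_on_compose2[OF \<phi>(3) theta_continuous]) auto
  then have c1: "continuous_on (UNIV \<times> Ogood) (\<lambda>p. Wop E F (fst p) \<phi> (snd p))"
    by (rule continuous_on_eq) (auto simp: Wop_good)
  have "isCont (\<lambda>p. Wop E F (fst p) \<phi> (snd p)) (b, k)" for b k
  proof (cases "k \<in> Ogood")
    case True
    have "open (UNIV \<times> Ogood :: (real \<times> (real^'d)) set)" by (intro open_Times Ogood_open) auto
    then show ?thesis using c1 True by (auto simp: continuous_on_eq_continuous_at)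
  next
    case False
    obtain V where V: "open V" "- Ogood \<subseteq> V" "\<And>b' k. \<bar>b'\<bar> \<le> \<bar>b\<bar> + 1 \<Longrightarrow> k \<in> V \<Longrightarrow> Wop E F b' \<phi> k = 0"
      by (rule orbit_tube[OF \<phi>(1,2), of "\<bar>b\<bar> + 1"]) blast
    define N where "N = {- (\<bar>b\<bar> + 1)<..<\<bar>b\<bar> + 1} \<times> V"
    have "open N" "(b, k) \<in> N" unfolding N_def using V False by (auto intro!: open_Times simp: abs_if)
    moreover have "continuous_on N (\<lambda>p. Wop E F (fst p) \<phi> (snd p)) \<longleftrightarrow> continuous_on N (\<lambda>p. 0 :: complex)"
      by (rule continuous_on_cong) (auto simp: N_def intro!: V(3))
    ultimately show ?thesis by (auto simp: continuous_on_eq_continuous_at)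
  qed
  then show ?thesis by (auto intro!: continuous_at_imp_continuous_on)
qed

lemma Wop_bounded:
  assumes "\<phi> \<in> K0"
  obtains B where "B > 0" "\<And>b k. \<bar>b\<bar> \<le> \<tau> \<Longrightarrow> cmod (Wop E F b \<phi> k) \<le> B"
proof -
  have "compact ((\<lambda>p. Wop E F (fst p) \<phi> (snd p)) ` ({-\<tau>..\<tau>} \<times> torus_box))"
    by (intro compact_continuous_image continuous_on_subset[OF Wop_continuous[OF assms]] compact_Times compact_torus_box) auto
  from compact_imp_bounded[OF this] obtain B where B: "B > 0" "\<And>x. x \<in> (\<lambda>p. Wop E F (fst p) \<phi> (snd p)) ` ({-\<tau>..\<tau>} \<times> torus_box) \<Longrightarrow> norm x \<le> B"
    unfolding bounded_pos by blast
  have "cmod (Wop E F b \<phi> k) \<le> B" if b: "\<bar>b\<bar> \<le> \<tau>" for b k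
  proof (rule periodic_bounded_by_box[of "Wop E F b \<phi>" "\<lambda>z. cmod z \<le> B"])
    show "periodic_T (Wop E F b \<phi>)" using assms by (intro Wop_periodic) (simp add: K0_def)
    show "cmod (Wop E F b \<phi> k) \<le> B" if "k \<in> torus_box" for k
      using b that by (intro B(2) image_eqI[of _ _ "(b, k)"]) auto
  qed
  then show thesis using that B(1) by blast
qed

lemma Wop_vnear:
  assumes "periodic_T \<phi>" "vnear \<phi>" shows "vnear (Wop E F b \<phi>)"
  using orbit_tube[OF assms, of "\<bar>b\<bar>"] unfolding vnear_def by (metis order_refl)

lemma Wop_K0: assumes "\<phi> \<in> K0" shows "Wop E F b \<phi> \<in> K0"
proof -
  have "continuous_on UNIV (\<lambda>k. (b, k))" by (intro continuous_intros)
  from continuous_on_compose2[OF Wop_continuous[OF assms] this] have "continuous_on UNIV (Wop E F b \<phi>)" by simp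
  then show ?thesis using assms by (auto simp: K0_def Wop_periodic Wop_vnear)
qed

lemma slice_has_derivative:
  assumes "((\<lambda>p. f (fst p) (snd p)) has_derivative (\<lambda>q. fst q *\<^sub>R a + D (snd q))) (at (b, k))"
  shows "((\<lambda>k. f b k) has_derivative D) (at k)"
proof -
  have "((\<lambda>k. (b, k)) has_derivative (\<lambda>w. (0, w))) (at k)"
    by (intro has_derivative_Pair has_derivative_const has_derivative_ident)
  from has_derivative_compose[OF this assms] show ?thesis by simp
qed

lemma Wop_has_derivative_space:
  assumes \<phi>: "\<phi> \<in> K1" and k: "k \<in> Ogood"
  shows "(Wop E F b \<phi> has_derivative (\<lambda>w. of_real (exp (PP b k)) *
     (of_real (dPP b k w) * \<phi> (theta b k) + frechet_derivative \<phi> (at (theta b k)) (dth b k w)))) (at k)"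
proof -
  have d\<phi>: "(\<phi> has_derivative frechet_derivative \<phi> (at x)) (at x)" for x
    using \<phi> by (auto simp: K1_def frechet_derivative_works[symmetric])
  have p: "(PP b has_derivative dPP b k) (at k)"
    using slice_has_derivative[of PP "divX (theta b k) / 2" "dPP b k" b k] PP_has_derivative[OF k, of b] by simp
  have t: "(theta b has_derivative dth b k) (at k)"
    by (rule slice_has_derivative[OF theta_has_derivative[OF k]])
  have e: "((\<lambda>k. complex_of_real (exp (PP b k))) has_derivative (\<lambda>w. of_real (exp (PP b k) * dPP b k w))) (at k)"
    by (intro has_derivative_of_real has_derivative_compose[OF p DERIV_exp[unfolded has_field_derivative_def]])
  have "((\<lambda>k. of_real (exp (PP b k)) * \<phi> (theta b k)) has_derivative (\<lambda>w. of_real (exp (PP b k)) *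
     (of_real (dPP b k w) * \<phi> (theta b k) + frechet_derivative \<phi> (at (theta b k)) (dth b k w)))) (at k)"
    by (rule has_derivative_eq_rhs[OF has_derivative_mult[OF e has_derivative_compose[OF t d\<phi>]]])
       (simp add: fun_eq_iff algebra_simps)
  then show ?thesis
    by (rule has_derivative_transform_within_open[OF _ Ogood_open k]) (simp add: Wop_good)
qed

lemma sg_slice_continuous: "continuous_on Ogood (sg b)"
  and theta_slice_continuous: "continuous_on Ogood (theta b)"
  and PP_slice_continuous: "continuous_on Ogood (PP b)"
proof -
  have c: "continuous_on Ogood (\<lambda>k. (b, k))" by (intro continuous_intros)
  show "continuous_on Ogood (sg b)" "continuous_on Ogood (theta b)" "continuous_on Ogood (PP b)"
    using continuous_on_compose2[OF sg_continuous c] continuous_on_compose2[OF theta_continuous c] continuous_on_compose2[OF continuous_on_PP c]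
    by auto
qed

lemma dsg_continuous: "continuous_on Ogood (\<lambda>k. dsg b k w)"
  unfolding dsg_def
  by (intro continuous_intros continuous_on_gg sg_slice_continuous theta_slice_continuous continuous_on_id)
     (use F_E_pos theta_noncrit Ogood_noncrit in \<open>auto simp: less_imp_neq[symmetric] dest: F_E_pos\<close>)

lemma dth_continuous: "continuous_on Ogood (\<lambda>k. dth b k w)"
  unfolding dth_def
  by (intro continuous_intros dsg_continuous sg_slice_continuous theta_slice_continuous continuous_on_id)

lemma dPP_continuous: "continuous_on Ogood (\<lambda>k. dPP b k w)"
proof -
  have nz: "gg (theta b k) \<noteq> 0" "gg k \<noteq> 0" if "k \<in> Ogood" for k
    using gg_pos[OF theta_noncrit[OF that, of b]] gg_pos[OF Ogood_noncrit[OF that]] by auto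
  show ?thesis
    unfolding dPP_def
    by (intro continuous_intros continuous_on_gg continuous_on_dgg dsg_continuous dth_continuous
        sg_slice_continuous theta_slice_continuous continuous_on_id continuous_on_const)
       (use nz theta_noncrit Ogood_noncrit in auto)
qed

lemma Wop_K1: assumes \<phi>: "\<phi> \<in> K1" shows "Wop E F b \<phi> \<in> K1"
proof -
  have per: "periodic_T \<phi>" and vn: "vnear \<phi>" and dif: "\<And>x. \<phi> differentiable (at x)"
    and cd: "\<And>v. continuous_on UNIV (\<lambda>x. frechet_derivative \<phi> (at x) v)" using \<phi> by (auto simp: K1_def)
  obtain V where V: "open V" "- Ogood \<subseteq> V" "\<And>k. k \<in> V \<Longrightarrow> Wop E F b \<phi> k = 0"
    using Wop_vnear[OF per vn, of b] by (auto simp: vnear_def)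
  have \<phi>c: "continuous_on UNIV \<phi>" using K1_K0[OF \<phi>] by (simp add: K0_def)
  have zd: "(Wop E F b \<phi> has_derivative (\<lambda>_. 0)) (at x)" if "x \<in> V" for x
    by (rule frechet_derivative_zero_open(1)[OF V(1) that]) (rule V(3))
  have "Wop E F b \<phi> differentiable (at x)" for x
    using Wop_has_derivative_space[OF \<phi>, of x b] zd[of x] V(2)
    unfolding differentiable_def by (cases "x \<in> Ogood") auto
  moreover have "continuous_on UNIV (\<lambda>x. frechet_derivative (Wop E F b \<phi>) (at x) v)" for v
  proof (rule continuous_on_two_open[OF Ogood_open _ V(1)])
    have "continuous_on Ogood (\<lambda>k. of_real (exp (PP b k)) *
     (of_real (dPP b k v) * \<phi> (theta b k) + (\<Sum>i\<in>UNIV. of_real (dth b k v $ i) * frechet_derivative \<phi> (at (theta b k)) (axis i 1))))"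
      by (intro continuous_intros PP_slice_continuous dPP_continuous dth_continuous
          continuous_on_compose2[OF \<phi>c theta_slice_continuous] continuous_on_compose2[OF cd theta_slice_continuous]) auto
    then show "continuous_on Ogood (\<lambda>x. frechet_derivative (Wop E F b \<phi>) (at x) v)"
      by (rule continuous_on_eq)
         (simp add: frechet_derivative_at[OF Wop_has_derivative_space[OF \<phi>], symmetric] frechet_derivative_expand[OF dif, symmetric])
    show "frechet_derivative (Wop E F b \<phi>) (at x) v = 0" if "x \<in> V" for x
      using frechet_derivative_at[OF zd[OF that]] by metis
    show "Ogood \<union> V = UNIV" using V(2) by auto
  qed
  ultimately show ?thesis using per vn by (simp add: K1_def Wop_periodic Wop_vnear)
qed

text \<open>The generator without the factor 1 / i, that is, the derivative of W_b at b = 0 as a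
  real differential expression.\<close>

definition Bop :: "(real^'d \<Rightarrow> complex) \<Rightarrow> real^'d \<Rightarrow> complex" where
  "Bop \<phi> k = frechet_derivative \<phi> (at k) (Xfield E F k) + of_real (divergence (Xfield E F) k / 2) * \<phi> k"

lemma Aexpr_Bop: "Aexpr E F \<phi> k = - \<i> * Bop \<phi> k"
  by (simp add: Aexpr_def Bop_def)

lemma Xfield_lattice: "Xfield E F (k + lattice_vec n) = Xfield E F k"
  using E_periodic by (simp add: Xfield_def G_periodic periodic_T_def)

lemma divergence_lattice: "divergence (Xfield E F) (k + lattice_vec n) = divergence (Xfield E F) k"
  using periodic_frechet_derivative[of "Xfield E F" k n] Xfield_lattice by (simp add: divergence_def periodic_T_def)

lemma Bop_K0: assumes \<phi>: "\<phi> \<in> K1" shows "Bop \<phi> \<in> K0"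
proof -
  have per: "periodic_T \<phi>" and vn: "vnear \<phi>" and dif: "\<And>x. \<phi> differentiable (at x)"
    and cd: "\<And>v. continuous_on UNIV (\<lambda>x. frechet_derivative \<phi> (at x) v)" using \<phi> by (auto simp: K1_def)
  obtain V where V: "open V" "- Ogood \<subseteq> V" "\<And>k. k \<in> V \<Longrightarrow> \<phi> k = 0" using vn by (auto simp: vnear_def)
  have \<phi>c: "continuous_on A \<phi>" for A using K1_K0[OF \<phi>] continuous_on_subset by (fastforce simp: K0_def)
  have z: "Bop \<phi> x = 0" if "x \<in> V" for x
    using frechet_derivative_zero_open(2)[of V x \<phi>] V that by (simp add: Bop_def)
  have "continuous_on UNIV (Bop \<phi>)"
  proof (rule continuous_on_two_open[OF Ogood_open _ V(1)])
    have "continuous_on Ogood (\<lambda>k. (\<Sum>i\<in>UNIV. of_real ((gg k *\<^sub>R G k) $ i) * frechet_derivative \<phi> (at k) (axis i 1)) + of_real (divX k / 2) * \<phi> k)"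
      by (intro continuous_intros continuous_on_gg continuous_on_divX \<phi>c continuous_on_subset[OF cd] continuous_on_id)
         (use Ogood_noncrit in auto)
    then show "continuous_on Ogood (Bop \<phi>)"
    proof (rule continuous_on_eq)
      show "(\<Sum>i\<in>UNIV. of_real ((gg x *\<^sub>R G x) $ i) * frechet_derivative \<phi> (at x) (axis i 1)) + of_real (divX x / 2) * \<phi> x = Bop \<phi> x"
        if "x \<in> Ogood" for x
        unfolding Bop_def divergence_Xfield[OF Ogood_noncrit[OF that]] Xfield_eq
        using frechet_derivative_expand[OF dif, of x "gg x *\<^sub>R G x"] by simp
    qed
  qed (use z V in auto)
  moreover have "periodic_T (Bop \<phi>)"
    unfolding periodic_T_def using per by (simp add: Bop_def Xfield_lattice divergence_lattice periodic_frechet_derivative[OF per] periodic_T_def)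
  moreover have "vnear (Bop \<phi>)" using V z by (auto simp: vnear_def)
  ultimately show ?thesis by (simp add: K0_def)
qed

text \<open>Differentiating the weight produces div X / 2 and differentiating the argument produces
  the derivative along X, both at the transported point. The result is W_b applied to
  \<open>Bop \<phi>\<close>, for every b and not only at 0.\<close>

lemma Wop_time_derivative:
  assumes \<phi>: "\<phi> \<in> K1"
  shows "((\<lambda>b. Wop E F b \<phi> k) has_vector_derivative Wop E F b (Bop \<phi>) k) (at b)"
proof (cases "k \<in> Ogood")
  case False
  then show ?thesis by (simp add: Wop_bad)
next
  case True
  have d\<phi>: "(\<phi> has_derivative frechet_derivative \<phi> (at x)) (at x)" for x
    using \<phi> by (auto simp: K1_def frechet_derivative_works[symmetric])
  have lin: "linear (frechet_derivative \<phi> (at x))" for x using bounded_linear.linear[OF has_derivative_bounded_linear[OF d\<phi>]] .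
  have e: "((\<lambda>b. complex_of_real (exp (PP b k))) has_vector_derivative of_real (exp (PP b k) * (divX (theta b k) / 2))) (at b)"
    using DERIV_chain2[OF DERIV_exp PP_time_derivative[OF True, of b]]
    by (intro has_vector_derivative_of_real) (simp add: has_real_derivative_iff_has_vector_derivative)
  have t: "((\<lambda>b. \<phi> (theta b k)) has_vector_derivative frechet_derivative \<phi> (at (theta b k)) (Xfield E F (theta b k))) (at b)"
    using has_derivative_compose[OF theta_has_vector_derivative[OF True, unfolded has_vector_derivative_def] d\<phi>, of b]
    by (simp add: has_vector_derivative_def linear_scale[OF lin])
  have "((\<lambda>b. complex_of_real (exp (PP b k)) * \<phi> (theta b k)) has_vector_derivative Wop E F b (Bop \<phi>) k) (at b)"
    using has_vector_derivative_mult[OF e t]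
    by (simp add: Wop_good[OF True] Bop_def divergence_Xfield[OF theta_noncrit[OF True]] algebra_simps)
  then show ?thesis by (simp add: Wop_good[OF True])
qed

text \<open>Near the bad set the product vanishes with \<phi>, so u is differentiated on the good
  set. This admits u = f(E), whose derivative has F(E) in the denominator.\<close>

lemma K1_multiply:
  assumes \<phi>: "\<phi> \<in> K1" and u: "periodic_T u" and du: "\<And>k. k \<in> Ogood \<Longrightarrow> (u has_derivative du k) (at k)"
    and cdu: "\<And>v. continuous_on Ogood (\<lambda>k. du k v)"
  shows "(\<lambda>k. of_real (u k) * \<phi> k) \<in> K1"
    and "\<And>k. k \<in> Ogood \<Longrightarrow> Bop (\<lambda>k. of_real (u k) * \<phi> k) k = of_real (u k) * Bop \<phi> k + of_real (du k (Xfield E F k)) * \<phi> k"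
proof -
  have per: "periodic_T \<phi>" and vn: "vnear \<phi>" and dif: "\<And>x. \<phi> differentiable (at x)"
    and cd: "\<And>v. continuous_on UNIV (\<lambda>x. frechet_derivative \<phi> (at x) v)" using \<phi> by (auto simp: K1_def)
  have d\<phi>: "(\<phi> has_derivative frechet_derivative \<phi> (at x)) (at x)" for x using dif by (simp add: frechet_derivative_works[symmetric])
  obtain V where V: "open V" "- Ogood \<subseteq> V" "\<And>k. k \<in> V \<Longrightarrow> \<phi> k = 0" using vn by (auto simp: vnear_def)
  have \<phi>c: "continuous_on A \<phi>" for A using K1_K0[OF \<phi>] continuous_on_subset by (fastforce simp: K0_def)
  have uc: "continuous_on Ogood u"
    by (intro continuous_at_imp_continuous_on ballI has_derivative_continuous[OF du])
  define \<psi> where "\<psi> k = of_real (u k) * \<phi> k" for k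
  have V': "\<psi> k = 0" if "k \<in> V" for k using V(3)[OF that] by (simp add: \<psi>_def)
  have d: "(\<psi> has_derivative (\<lambda>v. of_real (u k) * frechet_derivative \<phi> (at k) v + of_real (du k v) * \<phi> k)) (at k)" if "k \<in> Ogood" for k
    unfolding \<psi>_def[abs_def] by (intro has_derivative_mult has_derivative_of_real du[OF that] d\<phi>)
  have fd: "frechet_derivative \<psi> (at k) v = of_real (u k) * frechet_derivative \<phi> (at k) v + of_real (du k v) * \<phi> k" if "k \<in> Ogood" for k v
    using frechet_derivative_at[OF d[OF that]] by metis
  have zd: "(\<psi> has_derivative (\<lambda>_. 0)) (at x)" if "x \<in> V" for x
    by (rule frechet_derivative_zero_open(1)[OF V(1) that]) (rule V')
  have "\<psi> differentiable (at x)" for x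
    using d[of x] zd[of x] V(2)
    unfolding differentiable_def by (cases "x \<in> Ogood") auto
  moreover have "continuous_on UNIV (\<lambda>x. frechet_derivative \<psi> (at x) v)" for v
  proof (rule continuous_on_two_open[OF Ogood_open _ V(1)])
    have "continuous_on Ogood (\<lambda>k. of_real (u k) * frechet_derivative \<phi> (at k) v + of_real (du k v) * \<phi> k)"
      by (intro continuous_intros uc cdu \<phi>c continuous_on_subset[OF cd]) auto
    then show "continuous_on Ogood (\<lambda>x. frechet_derivative \<psi> (at x) v)"
      by (rule continuous_on_eq) (simp add: fd)
    show "frechet_derivative \<psi> (at x) v = 0" if "x \<in> V" for x
      using frechet_derivative_at[OF zd[OF that]] by metis
  qed (use V in auto)
  moreover have "periodic_T \<psi>" using per u by (simp add: periodic_T_def \<psi>_def)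
  moreover have "vnear \<psi>" using V V' by (auto simp: vnear_def)
  ultimately have "\<psi> \<in> K1" by (simp add: K1_def)
  then show "(\<lambda>k. of_real (u k) * \<phi> k) \<in> K1" by (simp add: \<psi>_def[abs_def])
  show "Bop (\<lambda>k. of_real (u k) * \<phi> k) k = of_real (u k) * Bop \<phi> k + of_real (du k (Xfield E F k)) * \<phi> k" if "k \<in> Ogood" for k
    using fd[OF that, of "Xfield E F k"] unfolding \<psi>_def[abs_def] Bop_def by (simp add: algebra_simps)
qed

lemma K1_lin:
  assumes f: "f \<in> K1" and g: "g \<in> K1" shows "(\<lambda>k. c * f k + g k) \<in> K1" "Bop (\<lambda>k. c * f k + g k) k = c * Bop f k + Bop g k"
proof -
  have d: "((\<lambda>k. c * f k + g k) has_derivative (\<lambda>v. c * frechet_derivative f (at x) v + frechet_derivative g (at x) v)) (at x)" for x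
    using f g by (intro has_derivative_add has_derivative_mult_right) (auto simp: K1_def frechet_derivative_works[symmetric])
  have fd: "frechet_derivative (\<lambda>k. c * f k + g k) (at x) v = c * frechet_derivative f (at x) v + frechet_derivative g (at x) v" for x v
    using frechet_derivative_at[OF d] by metis
  obtain U V where "open U" "- Ogood \<subseteq> U" "\<And>k. k \<in> U \<Longrightarrow> f k = 0" "open V" "- Ogood \<subseteq> V" "\<And>k. k \<in> V \<Longrightarrow> g k = 0"
    using f g by (auto simp: K1_def vnear_def)
  then have "vnear (\<lambda>k. c * f k + g k)" unfolding vnear_def by (intro exI[of _ "U \<inter> V"]) auto
  moreover have "continuous_on UNIV (\<lambda>x. frechet_derivative (\<lambda>k. c * f k + g k) (at x) v)" for v
    unfolding fd using f g by (intro continuous_intros) (auto simp: K1_def)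
  moreover have "(\<lambda>k. c * f k + g k) differentiable (at x)" for x using d unfolding differentiable_def by blast
  ultimately show "(\<lambda>k. c * f k + g k) \<in> K1" using f g by (auto simp: K1_def periodic_T_def)
  show "Bop (\<lambda>k. c * f k + g k) k = c * Bop f k + Bop g k" unfolding Bop_def fd by (simp add: algebra_simps add_divide_distrib)
qed

end

section \<open>The generator on continuously differentiable functions\<close>

lemma has_vector_derivative_difference_quotient:
  assumes "(f has_vector_derivative w) (at 0)"
  shows "((\<lambda>b. (f b - f 0) /\<^sub>R b) \<longlongrightarrow> w) (at 0)"
proof -
  have "((\<lambda>h. norm (f (0 + h) - f 0 - h *\<^sub>R w) / norm h) \<longlongrightarrow> 0) (at 0)"
    using assms unfolding has_vector_derivative_def has_derivative_at by blast
  moreover have "\<forall>\<^sub>F h in at 0. norm (f (0 + h) - f 0 - h *\<^sub>R w) / norm h = norm ((f h - f 0) /\<^sub>R h - w)"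
  proof -
    have "norm (f (0 + h) - f 0 - h *\<^sub>R w) / norm h = norm ((f h - f 0) /\<^sub>R h - w)" if "h \<noteq> 0" for h
    proof -
      have "(f h - f 0) /\<^sub>R h - w = (f h - f 0 - h *\<^sub>R w) /\<^sub>R h" using that by (simp add: scaleR_diff_right)
      then show ?thesis by (simp add: divide_inverse mult.commute)
    qed
    then show ?thesis by (auto simp: eventually_at_filter)
  qed
  ultimately have "((\<lambda>h. norm ((f h - f 0) /\<^sub>R h - w)) \<longlongrightarrow> 0) (at 0)" by (rule Lim_transform_eventually)
  then show ?thesis by (rule LIM_zero_cancel[OF tendsto_norm_zero_cancel])
qed

context morse_band
begin

lemma K0_L2T: assumes "\<phi> \<in> K0" shows "\<phi> \<in> L2T"
proof -
  have \<phi>: "periodic_T \<phi>" "continuous_on UNIV \<phi>" using assms by (auto simp: K0_def)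
  obtain B where "\<And>k. norm (\<phi> k) \<le> B" using periodic_continuous_bounded[OF \<phi>] by blast
  then show ?thesis using \<phi> borel_measurable_continuous_onI[OF \<phi>(2)] by (intro L2T_bounded) auto
qed

lemma K1_L2T: "\<phi> \<in> K1 \<Longrightarrow> \<phi> \<in> L2T"
  by (intro K0_L2T K1_K0)

lemma Dset_K1: assumes "\<phi> \<in> Dset E F" shows "\<phi> \<in> K1"
proof -
  have s: "smooth_fun \<phi>" using assms by (simp add: Dset_def)
  have "\<phi> differentiable (at x)" for x using s[unfolded smooth_fun_def, rule_format, of "[]" x] by simp
  moreover have "(\<lambda>x. frechet_derivative \<phi> (at x) v) differentiable (at x)" for v x
    using s[unfolded smooth_fun_def, rule_format, of "[v]" x] by simp
  then have "continuous_on UNIV (\<lambda>x. frechet_derivative \<phi> (at x) v)" for v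
    by (intro continuous_at_imp_continuous_on ballI differentiable_imp_continuous_within)
  ultimately show ?thesis using assms by (auto simp: Dset_def K1_def vnear_def CM_eq)
qed

lemma vnear_zero: "vnear \<phi> \<Longrightarrow> k \<notin> Ogood \<Longrightarrow> \<phi> k = 0"
  by (auto simp: vnear_def)

lemma Aexpr_L2T: assumes "\<phi> \<in> K1" shows "Aexpr E F \<phi> \<in> L2T"
  unfolding Aexpr_Bop[abs_def] by (intro L2T_scale K0_L2T Bop_K0 assms)

lemma Wop_K0_strongly_continuous:
  assumes "\<phi> \<in> K0"
  shows "((\<lambda>b. l2norm (\<lambda>k. Wop E F b \<phi> k - Wop E F b0 \<phi> k)) \<longlongrightarrow> 0) (at b0)"
proof -
  obtain B where B: "\<And>b k. \<bar>b\<bar> \<le> \<bar>b0\<bar> + 1 \<Longrightarrow> cmod (Wop E F b \<phi> k) \<le> B" using Wop_bounded[OF assms] by blast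
  have m: "Wop E F b \<phi> \<in> borel_measurable borel" for b
    using Wop_K0[OF assms, of b] K0_L2T by (auto simp: L2T_iff)
  show ?thesis
  proof (rule l2norm_bounded_tendsto_0_at[where B = "B + B"])
    show "(\<lambda>k. Wop E F b \<phi> k - Wop E F b0 \<phi> k) \<in> borel_measurable borel" for b
      using m by (intro borel_measurable_diff) auto
    show "((\<lambda>b. Wop E F b \<phi> k - Wop E F b0 \<phi> k) \<longlongrightarrow> 0) (at b0)" for k
    proof -
      have "continuous_on UNIV (\<lambda>b. (b, k))" by (intro continuous_intros)
      from continuous_on_compose2[OF Wop_continuous[OF assms] this]
      have "isCont (\<lambda>b. Wop E F b \<phi> k) b0" by (simp add: continuous_on_eq_continuous_at)
      then show ?thesis unfolding isCont_def by (rule LIM_zero)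
    qed
    show "cmod (Wop E F b \<phi> k - Wop E F b0 \<phi> k) \<le> B + B" if "\<bar>b - b0\<bar> \<le> 1" for b k
      using that by (intro order_trans[OF norm_triangle_ineq4] add_mono B) auto
  qed
qed

text \<open>The difference quotient converges pointwise by \<open>Wop_time_derivative\<close>. The
  mean value inequality bounds it by the supremum of W_b (Bop \<phi>) over |b| <= 1, which is
  finite, so convergence holds in L^2 by domination.\<close>

lemma generator_on_K1:
  assumes \<phi>: "\<phi> \<in> K1"
  shows "generator (Wop E F) \<phi> (Aexpr E F \<phi>)"
proof -
  obtain B where B: "\<And>b k. \<bar>b\<bar> \<le> 1 \<Longrightarrow> cmod (Wop E F b (Bop \<phi>) k) \<le> B" using Wop_bounded[OF Bop_K0[OF \<phi>]] by blast
  have B0: "B \<ge> 0" using order_trans[OF norm_ge_zero B[of 0]] by simp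
  have m: "Wop E F b \<phi> \<in> borel_measurable borel" for b
    using Wop_K0[OF K1_K0[OF \<phi>], of b] K0_L2T by (auto simp: L2T_iff)
  have m': "\<phi> \<in> borel_measurable borel" "Aexpr E F \<phi> \<in> borel_measurable borel"
    using K1_L2T[OF \<phi>] Aexpr_L2T[OF \<phi>] by (auto simp: L2T_iff)
  have vn: "vnear \<phi>" "vnear (Bop \<phi>)" using \<phi> Bop_K0[OF \<phi>] by (auto simp: K1_def K0_def)
  have W0: "Wop E F 0 \<psi> k = \<psi> k" if "vnear \<psi>" for \<psi> k
    using Wop_0[of k \<psi>] Wop_bad[of k] vnear_zero[OF that, of k] by (cases "k \<in> Ogood") auto
  have lip: "cmod (Wop E F b \<phi> k - \<phi> k) \<le> B * \<bar>b\<bar>" if "\<bar>b\<bar> \<le> 1" for b k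
  proof -
    have "cmod (Wop E F b \<phi> k - Wop E F 0 \<phi> k) \<le> B * norm (b - 0)"
    proof (rule differentiable_bound[of "{-1..1}" "\<lambda>b. Wop E F b \<phi> k" "\<lambda>b s. s *\<^sub>R Wop E F b (Bop \<phi>) k"])
      fix x :: real assume x: "x \<in> {-1..1}"
      show "((\<lambda>b. Wop E F b \<phi> k) has_derivative (\<lambda>s. s *\<^sub>R Wop E F x (Bop \<phi>) k)) (at x within {-1..1})"
        using Wop_time_derivative[OF \<phi>, of k x] by (auto simp: has_vector_derivative_def intro: has_derivative_at_withinI)
      show "onorm (\<lambda>s. s *\<^sub>R Wop E F x (Bop \<phi>) k) \<le> B"
      proof (rule onorm_le)
        have "cmod (Wop E F x (Bop \<phi>) k) \<le> B" using x by (intro B) auto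
        then show "norm (s *\<^sub>R Wop E F x (Bop \<phi>) k) \<le> B * norm s" for s
          by (simp add: mult.commute[of B] mult_left_mono)
      qed
    qed (use that in \<open>auto simp: abs_le_iff\<close>)
    then show ?thesis by (simp add: W0[OF vn(1)])
  qed
  have AB: "cmod (Aexpr E F \<phi> k) \<le> B" for k
    using B[of 0 k] by (simp add: Aexpr_Bop W0[OF vn(2)] norm_mult)
  have "((\<lambda>b. l2norm (\<lambda>k. (Wop E F b \<phi> k - \<phi> k) / (\<i> * complex_of_real b) - Aexpr E F \<phi> k)) \<longlongrightarrow> 0) (at 0)"
  proof (rule l2norm_bounded_tendsto_0_at[where B = "B + B"])
    show "(\<lambda>k. (Wop E F b \<phi> k - \<phi> k) / (\<i> * complex_of_real b) - Aexpr E F \<phi> k) \<in> borel_measurable borel" for b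
      using m m' by (intro borel_measurable_diff borel_measurable_divide) auto
    show "cmod ((Wop E F b \<phi> k - \<phi> k) / (\<i> * complex_of_real b) - Aexpr E F \<phi> k) \<le> B + B" if "\<bar>b - 0\<bar> \<le> 1" "b \<noteq> 0" for b k
    proof (rule order_trans[OF norm_triangle_ineq4 add_mono[OF _ AB]])
      show "cmod ((Wop E F b \<phi> k - \<phi> k) / (\<i> * complex_of_real b)) \<le> B"
        using lip[of b k] that by (simp add: norm_divide norm_mult divide_le_eq)
    qed
    show "((\<lambda>b. (Wop E F b \<phi> k - \<phi> k) / (\<i> * complex_of_real b) - Aexpr E F \<phi> k) \<longlongrightarrow> 0) (at 0)" for k
    proof -
      have "((\<lambda>b. (Wop E F b \<phi> k - Wop E F 0 \<phi> k) /\<^sub>R (b - 0)) \<longlongrightarrow> Wop E F 0 (Bop \<phi>) k) (at 0)"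
        using has_vector_derivative_difference_quotient[OF Wop_time_derivative[OF \<phi>, of k 0]] by simp
      then have "((\<lambda>b. (Wop E F b \<phi> k - \<phi> k) /\<^sub>R b) \<longlongrightarrow> Bop \<phi> k) (at 0)" by (simp add: W0[OF vn(1)] W0[OF vn(2)])
      from LIM_zero[OF tendsto_mult[OF tendsto_const[of "- \<i>"] this]]
      show ?thesis
      proof (rule Lim_transform_eventually)
        show "\<forall>\<^sub>F b in at 0. - \<i> * ((Wop E F b \<phi> k - \<phi> k) /\<^sub>R b) - - \<i> * Bop \<phi> k = (Wop E F b \<phi> k - \<phi> k) / (\<i> * complex_of_real b) - Aexpr E F \<phi> k"
          by (intro always_eventually allI) (simp add: Aexpr_Bop scaleR_conv_of_real divide_inverse)
      qed
    qed
  qed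
  then show ?thesis unfolding generator_def using K1_L2T[OF \<phi>] Aexpr_L2T[OF \<phi>] by blast
qed

text \<open>Twice the real part of conj(\<psi>) Bop \<psi> is the divergence of |\<psi>|^2 X, whose
  torus integral is 0. Half the divergence in the generator is exactly the term that makes this
  identity hold.\<close>

lemma Bop_antisymmetric:
  assumes \<psi>: "\<psi> \<in> K1"
  shows "Re (l2inner \<psi> (Bop \<psi>)) = 0"
proof -
  have per: "periodic_T \<psi>" and vn: "vnear \<psi>" and dif: "\<And>x. \<psi> differentiable (at x)"
    and cd: "\<And>v. continuous_on UNIV (\<lambda>x. frechet_derivative \<psi> (at x) v)" using \<psi> by (auto simp: K1_def)
  have d\<psi>: "(\<psi> has_derivative frechet_derivative \<psi> (at x)) (at x)" for x using dif by (simp add: frechet_derivative_works[symmetric])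
  have lin: "linear (frechet_derivative \<psi> (at x))" for x by (rule linear_frechet_derivative[OF dif])
  obtain V where V: "open V" "- Ogood \<subseteq> V" "\<And>k. k \<in> V \<Longrightarrow> \<psi> k = 0" using vn by (auto simp: vnear_def)
  have \<psi>c: "continuous_on A \<psi>" for A using K1_K0[OF \<psi>] continuous_on_subset by (fastforce simp: K0_def)
  \<comment> \<open>The i-th component of |\<psi>|^2 X. It is C^1 on the whole torus because \<psi>
    vanishes near the singularities of X.\<close>
  define Y where "Y i k = (\<psi> k \<bullet> \<psi> k) * Xfield E F k $ i" for i k
  define D where "D i k v = (\<psi> k \<bullet> \<psi> k) * (gg k *\<^sub>R DG k v + dgg k v *\<^sub>R G k) $ i + (\<psi> k \<bullet> frechet_derivative \<psi> (at k) v + frechet_derivative \<psi> (at k) v \<bullet> \<psi> k) * Xfield E F k $ i" for i k v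
  have dY: "(Y i has_derivative D i k) (at k)" if "k \<in> Ogood" for i k
  proof -
    have "((\<lambda>k. Xfield E F k $ i) has_derivative (\<lambda>h. (gg k *\<^sub>R DG k h + dgg k h *\<^sub>R G k) $ i)) (at k)"
      by (rule bounded_linear.has_derivative[OF bounded_linear_vec_nth Xfield_has_derivative[OF Ogood_noncrit[OF that]]])
    from has_derivative_mult[OF has_derivative_inner[OF d\<psi>[of k] d\<psi>[of k]] this]
    show ?thesis unfolding Y_def[abs_def] D_def[abs_def] .
  qed
  have zY: "(Y i has_derivative (\<lambda>_. 0)) (at k)" if "k \<in> V" for i k
    by (rule frechet_derivative_zero_open(1)[OF V(1) that]) (simp add: Y_def V(3))
  have fY: "frechet_derivative (Y i) (at k) v = (if k \<in> V then 0 else D i k v)" for i k v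
    using frechet_derivative_at[OF zY[of k i]] frechet_derivative_at[OF dY[of k i]] V(2) by (metis (no_types, lifting) ComplI subsetD)
  have diffY: "Y i differentiable (at k)" for i k
    using zY[of k i] dY[of k i] V(2) unfolding differentiable_def by (cases "k \<in> Ogood") auto
  have cY: "continuous_on UNIV (\<lambda>k. frechet_derivative (Y i) (at k) v)" for i v
  proof (rule continuous_on_two_open[OF Ogood_open _ V(1)])
    have "continuous_on Ogood (\<lambda>k. D i k v)"
      unfolding D_def Xfield_eq using Ogood_noncrit
      by (intro continuous_intros continuous_on_gg continuous_on_dgg \<psi>c continuous_on_subset[OF cd] continuous_on_id continuous_on_const) auto
    then show "continuous_on Ogood (\<lambda>k. frechet_derivative (Y i) (at k) v)"
      by (rule continuous_on_eq) (metis dY frechet_derivative_at)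
  qed (use V fY in auto)
  have pY: "periodic_T (Y i)" for i using per by (simp add: periodic_T_def Y_def Xfield_lattice)
  have int: "integrable TM (\<lambda>k. frechet_derivative (Y i) (at k) v)" for i v
    by (rule continuous_torus_integral(2)) (rule continuous_on_subset[OF cY], simp)
  have sum: "(\<Sum>i\<in>UNIV. frechet_derivative (Y i) (at k) (axis i 1)) = 2 * Re (cnj (\<psi> k) * Bop \<psi> k)" for k
  proof (cases "k \<in> V")
    case True
    then show ?thesis by (simp add: fY V(3))
  next
    case False
    then have k: "k \<in> Ogood" using V(2) by auto
    have nc: "k \<notin> crit E" by (rule Ogood_noncrit[OF k])
    have dv: "divX k = (\<Sum>i\<in>UNIV. (gg k *\<^sub>R DG k (axis i 1) + dgg k (axis i 1) *\<^sub>R G k) $ i)"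
      unfolding divergence_Xfield[OF nc, symmetric] divergence_def frechet_derivative_at[OF Xfield_has_derivative[OF nc], symmetric] ..
    have ex: "\<psi> k \<bullet> frechet_derivative \<psi> (at k) (Xfield E F k) = (\<Sum>i\<in>UNIV. (\<psi> k \<bullet> frechet_derivative \<psi> (at k) (axis i 1)) * Xfield E F k $ i)"
      by (subst frechet_derivative_expand[OF dif])
         (simp add: inner_sum_right mult.commute flip: scaleR_conv_of_real)
    have "(\<Sum>i\<in>UNIV. frechet_derivative (Y i) (at k) (axis i 1)) = (\<psi> k \<bullet> \<psi> k) * divX k + 2 * (\<psi> k \<bullet> frechet_derivative \<psi> (at k) (Xfield E F k))"
    proof -
      have com: "frechet_derivative \<psi> (at k) v \<bullet> \<psi> k = \<psi> k \<bullet> frechet_derivative \<psi> (at k) v" for v by (rule inner_commute)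
      have "frechet_derivative (Y i) (at k) (axis i 1) = (\<psi> k \<bullet> \<psi> k) * (gg k *\<^sub>R DG k (axis i 1) + dgg k (axis i 1) *\<^sub>R G k) $ i
         + 2 * ((\<psi> k \<bullet> frechet_derivative \<psi> (at k) (axis i 1)) * Xfield E F k $ i)" for i
        using False by (simp add: fY D_def com)
      then show ?thesis unfolding dv ex by (simp only: sum.distrib sum_distrib_left)
    qed
    also have "\<dots> = 2 * (\<psi> k \<bullet> Bop \<psi> k)"
    proof -
      have "Bop \<psi> k = frechet_derivative \<psi> (at k) (Xfield E F k) + (divX k / 2) *\<^sub>R \<psi> k"
        by (simp add: Bop_def divergence_Xfield[OF nc] scaleR_conv_of_real)
      then show ?thesis by (simp add: inner_add_right)
    qed
    also have "\<psi> k \<bullet> Bop \<psi> k = Re (cnj (\<psi> k) * Bop \<psi> k)" by (simp add: inner_complex_def)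
    finally show ?thesis .
  qed
  have "2 * (\<integral>k. Re (cnj (\<psi> k) * Bop \<psi> k) \<partial>TM) = (\<integral>k. (\<Sum>i\<in>UNIV. frechet_derivative (Y i) (at k) (axis i 1)) \<partial>TM)"
    by (simp only: sum integral_mult_right_zero)
  also have "\<dots> = (\<Sum>i\<in>UNIV. (\<integral>k. frechet_derivative (Y i) (at k) (axis i 1) \<partial>TM))"
    by (rule Bochner_Integration.integral_sum) (rule int)
  also have "\<dots> = 0" by (simp add: integral_torus_directional_derivative[OF pY diffY cY])
  finally have "(\<integral>k. Re (cnj (\<psi> k) * Bop \<psi> k) \<partial>TM) = 0" by simp
  moreover have "(\<integral>k. Re (cnj (\<psi> k) * Bop \<psi> k) \<partial>TM) = Re (l2inner \<psi> (Bop \<psi>))"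
    unfolding l2inner_TM by (rule integral_Re[OF L2T_product_integrable[OF K1_L2T[OF \<psi>] K0_L2T[OF Bop_K0[OF \<psi>]]]])
  ultimately show ?thesis by simp
qed

text \<open>By the group law the derivative of the squared norm at any b is one at time 0 for the
  function \<psi> = W_b \<phi>, which is again in \<open>K1\<close>. It is computed from L^2
  difference quotients, so no differentiation under the integral is involved.\<close>

lemma Wop_isometry_K1:
  assumes \<phi>: "\<phi> \<in> K1"
  shows "l2norm (Wop E F b \<phi>) = l2norm \<phi>"
proof -
  define n where "n b = (l2norm (Wop E F b \<phi>))\<^sup>2" for b
  have "(n has_real_derivative 0) (at b)" for b
  proof -
    define \<psi> where "\<psi> = Wop E F b \<phi>"
    have \<psi>: "\<psi> \<in> K1" unfolding \<psi>_def by (rule Wop_K1[OF \<phi>])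
    have L: "\<psi> \<in> L2T" "Bop \<psi> \<in> L2T" "Wop E F h \<psi> \<in> L2T" for h
      using K1_L2T[OF \<psi>] K0_L2T[OF Bop_K0[OF \<psi>]] K1_L2T[OF Wop_K1[OF \<psi>]] by auto
    define r where "r h = l2norm (\<lambda>k. (Wop E F h \<psi> k - \<psi> k) / (\<i> * complex_of_real h) - Aexpr E F \<psi> k)" for h
    have r0: "(r \<longlongrightarrow> 0) (at 0)" using generator_on_K1[OF \<psi>] by (simp add: generator_def r_def[abs_def])
    \<comment> \<open>Expanding the square of \<psi> + h q leaves 2 Re <\<psi>, q> and a term of
      order h. Here q differs from \<open>Bop \<psi>\<close> by r h in norm, and <\<psi>, Bop
      \<psi>> has real part 0.\<close>
    have le: "\<bar>(n (b + h) - n b) / h\<bar> \<le> 2 * (l2norm \<psi> * r h) + \<bar>h\<bar> * (r h + l2norm (Bop \<psi>))\<^sup>2" if h: "h \<noteq> 0" for h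
    proof -
      define q where "q k = (Wop E F h \<psi> k - \<psi> k) / of_real h" for k
      have qL: "q \<in> L2T" unfolding q_def[abs_def] by (intro L2T_divide L2T_diff L)
      have r: "r h = l2norm (\<lambda>k. q k - Bop \<psi> k)"
      proof -
        have "(\<lambda>k. (Wop E F h \<psi> k - \<psi> k) / (\<i> * complex_of_real h) - Aexpr E F \<psi> k) = (\<lambda>k. - \<i> * (q k - Bop \<psi> k))"
          by (auto simp: q_def Aexpr_Bop fun_eq_iff algebra_simps divide_inverse)
        then show ?thesis unfolding r_def by (simp only: l2norm_scale) simp
      qed
      have W: "Wop E F (b + h) \<phi> = (\<lambda>k. \<psi> k + of_real h * q k)"
        using Wop_add[of h b \<phi>] h by (auto simp: q_def \<psi>_def add.commute)
      have "n (b + h) = (l2norm \<psi>)\<^sup>2 + 2 * Re (l2inner \<psi> (\<lambda>k. of_real h * q k)) + (l2norm (\<lambda>k. of_real h * q k))\<^sup>2"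
        unfolding n_def W by (rule l2norm_power2_add[OF L(1) L2T_scale[OF qL]])
      also have "\<dots> = n b + h * (2 * Re (l2inner \<psi> q)) + h * (h * (l2norm q)\<^sup>2)"
        unfolding l2inner_scale_right[OF L(1) qL] l2norm_scale
        by (simp add: n_def \<psi>_def power_mult_distrib power2_eq_square)
      finally have "(n (b + h) - n b) / h = 2 * Re (l2inner \<psi> q) + h * (l2norm q)\<^sup>2"
        using h by (simp add: field_simps)
      moreover have "\<bar>Re (l2inner \<psi> q)\<bar> \<le> l2norm \<psi> * r h"
      proof -
        have "l2inner \<psi> (\<lambda>k. q k - Bop \<psi> k) = l2inner \<psi> q - l2inner \<psi> (Bop \<psi>)" by (rule l2inner_diff_right[OF L(1) qL L(2)])
        then have "Re (l2inner \<psi> q) = Re (l2inner \<psi> (\<lambda>k. q k - Bop \<psi> k))" using Bop_antisymmetric[OF \<psi>] by simp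
        also have "\<bar>\<dots>\<bar> \<le> cmod (l2inner \<psi> (\<lambda>k. q k - Bop \<psi> k))" by (rule abs_Re_le_cmod)
        also have "\<dots> \<le> l2norm \<psi> * r h" unfolding r by (rule l2_cauchy_schwarz[OF L(1) L2T_diff[OF qL L(2)]])
        finally show ?thesis by simp
      qed
      moreover have "\<bar>h * (l2norm q)\<^sup>2\<bar> \<le> \<bar>h\<bar> * (r h + l2norm (Bop \<psi>))\<^sup>2"
      proof -
        have "l2norm q \<le> r h + l2norm (Bop \<psi>)"
          using l2norm_triangle[OF L2T_diff[OF qL L(2)] L(2)] unfolding r by simp
        then show ?thesis by (simp add: abs_mult mult_left_mono power_mono l2norm_nonneg)
      qed
      ultimately show ?thesis by linarith
    qed
    have "((\<lambda>h. (n (b + h) - n b) / h) \<longlongrightarrow> 0) (at 0)"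
    proof (rule Lim_null_comparison)
      show "\<forall>\<^sub>F h in at 0. norm ((n (b + h) - n b) / h) \<le> 2 * (l2norm \<psi> * r h) + \<bar>h\<bar> * (r h + l2norm (Bop \<psi>))\<^sup>2"
        using le by (auto simp: eventually_at_filter)
      show "((\<lambda>h. 2 * (l2norm \<psi> * r h) + \<bar>h\<bar> * (r h + l2norm (Bop \<psi>))\<^sup>2) \<longlongrightarrow> 0) (at 0)"
        by (rule tendsto_eq_intros r0 refl | simp)+
    qed
    then show ?thesis by (simp add: DERIV_def)
  qed
  then have "n b = n 0" by (intro DERIV_isconst_all[rule_format]) blast
  moreover have "Wop E F 0 \<phi> = \<phi>"
    using Wop_0[of _ \<phi>] Wop_bad[of _ 0 \<phi>] vnear_zero[of \<phi>] \<phi> by (auto simp: K1_def fun_eq_iff) (metis)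
  ultimately show ?thesis unfolding n_def by (simp add: l2norm_nonneg power2_eq_iff_nonneg)
qed

end

section \<open>Density of the smooth functions vanishing near the bad set\<close>

lemma periodic_uniformly_continuous:
  fixes h :: "real^'d::finite \<Rightarrow> 'b::metric_space"
  assumes h: "periodic_T h" "continuous_on UNIV h" and \<eta>: "\<eta> > 0"
  obtains \<delta> where "\<delta> > 0" "\<And>x y. norm (x - y) < \<delta> \<Longrightarrow> dist (h x) (h y) < \<eta>"
proof -
  obtain R where R: "\<And>x. x \<in> (torus_box :: (real^'d) set) \<Longrightarrow> norm x \<le> R"
    using compact_imp_bounded[OF compact_torus_box] by (auto simp: bounded_iff)
  \<comment> \<open>The margin 1 keeps the second point in the compact set when the first has been
    translated into the box.\<close>
  define K where "K = (cball 0 (R + 1) :: (real^'d) set)"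
  have "uniformly_continuous_on K h"
    unfolding K_def by (rule compact_uniformly_continuous[OF continuous_on_subset[OF h(2)]]) auto
  then obtain d where d: "d > 0" "\<And>x y. x \<in> K \<Longrightarrow> y \<in> K \<Longrightarrow> dist y x < d \<Longrightarrow> dist (h y) (h x) < \<eta>"
    using \<eta> unfolding uniformly_continuous_on_def by metis
  have "dist (h x) (h y) < \<eta>" if xy: "norm (x - y) < min d 1" for x y
  proof -
    obtain n where n: "x + lattice_vec n \<in> torus_box" by (rule lattice_reduce)
    have nx: "norm (x + lattice_vec n) \<le> R" by (rule R[OF n])
    have "norm (y + lattice_vec n) \<le> norm (x + lattice_vec n) + norm (x - y)"
      using norm_triangle_ineq4[of "x + lattice_vec n" "x - y"] by (simp add: algebra_simps)
    then have "x + lattice_vec n \<in> K" "y + lattice_vec n \<in> K" using nx xy by (auto simp: K_def)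
    then have "dist (h (x + lattice_vec n)) (h (y + lattice_vec n)) < \<eta>" using xy by (intro d(2)) (auto simp: dist_norm)
    then show ?thesis using h(1) by (simp add: periodic_T_def)
  qed
  then show thesis using that[of "min d 1"] d(1) by auto
qed

lemma tconv_mker_uniform:
  fixes h :: "real^'d::finite \<Rightarrow> complex"
  assumes h: "periodic_T h" "continuous_on UNIV h" and \<eta>: "\<eta> > 0"
  shows "\<exists>e0>0. \<forall>e x. 0 < e \<longrightarrow> e \<le> e0 \<longrightarrow> cmod (tconv (mker e) h x - h x) \<le> \<eta>"
proof -
  obtain \<delta> where \<delta>: "\<delta> > 0" "\<And>x y. norm (x - y) < \<delta> \<Longrightarrow> dist (h x) (h y) < \<eta>"
    using periodic_uniformly_continuous[OF h \<eta>] by blast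
  obtain e0 where e0: "e0 > 0" "\<And>z::real^'d. cosdist z < e0 \<Longrightarrow> \<exists>n. norm (z - lattice_vec n) < \<delta>"
    using cosdist_small_near_lattice[OF \<delta>(1)] by blast
  have "cmod (tconv (mker e) h x - h x) \<le> \<eta>" if e: "0 < e" "e \<le> e0" for e x
  proof (rule tconv_mker_close[OF e(1)])
    show "continuous_on torus_box h" using h(2) continuous_on_subset by blast
    fix y :: "real^'d" assume "cosdist (x - y) < e"
    then obtain n where n: "norm (x - y - lattice_vec n) < \<delta>" using e0(2)[of "x - y"] e(2) by auto
    have "norm (y + lattice_vec n - x) < \<delta>" using n norm_minus_commute[of "x" "y + lattice_vec n"] by (simp add: algebra_simps)
    from \<delta>(2)[OF this] show "cmod (h y - h x) \<le> \<eta>" using h(1) by (simp add: periodic_T_def dist_norm)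
  qed
  with e0(1) show ?thesis by blast
qed

context morse_band
begin

section \<open>Mollification into the smooth domain with control of the generator\<close>

lemma Ogood_lattice': "k - lattice_vec n \<in> Ogood \<longleftrightarrow> k \<in> Ogood"
  using Ogood_lattice[of "k - lattice_vec n" n] by simp

lemma closed_bad: "closed (- Ogood)"
  using Ogood_open by (simp add: closed_def)

text \<open>The support in the box is compact and disjoint from the closed bad set, hence at
  positive distance from it; lattice invariance makes the distance uniform.\<close>

lemma vnear_uniform:
  assumes "periodic_T \<phi>" "vnear \<phi>"
  obtains \<delta> where "\<delta> > 0" "\<And>c k. c \<notin> Ogood \<Longrightarrow> norm (k - c) < \<delta> \<Longrightarrow> \<phi> k = 0"
proof -
  obtain U where U: "open U" "- Ogood \<subseteq> U" "\<And>k. k \<in> U \<Longrightarrow> \<phi> k = 0" using assms(2) by (auto simp: vnear_def)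
  define S where "S = (- U) \<inter> torus_box"
  have S: "compact S" unfolding S_def using U by (auto intro!: closed_Int_compact compact_torus_box)
  have "S \<inter> - Ogood = {}" using U by (auto simp: S_def)
  then obtain d where d: "d > 0" "\<And>x y. x \<in> S \<Longrightarrow> y \<in> - Ogood \<Longrightarrow> d \<le> dist x y"
    using separate_compact_closed[OF S closed_bad] by blast
  have "\<phi> k = 0" if c: "c \<notin> Ogood" "norm (k - c) < d" for c k
  proof (rule ccontr)
    assume nz: "\<phi> k \<noteq> 0"
    obtain n where n: "k + lattice_vec n \<in> torus_box" by (rule lattice_reduce)
    have "\<phi> (k + lattice_vec n) \<noteq> 0" using nz assms(1) by (simp add: periodic_T_def)
    then have "k + lattice_vec n \<in> S" using n U(3) by (auto simp: S_def)
    then have "d \<le> dist (k + lattice_vec n) (c + lattice_vec n)" using c(1) by (intro d(2)) (auto simp: Ogood_lattice)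
    then show False using c(2) by (simp add: dist_norm)
  qed
  then show thesis using that d(1) by blast
qed

lemma vnearI:
  assumes "\<delta> > 0" "\<And>c k. c \<notin> Ogood \<Longrightarrow> norm (k - c) < \<delta> \<Longrightarrow> \<phi> k = 0"
  shows "vnear \<phi>"
  unfolding vnear_def
proof (intro exI conjI ballI)
  show "open (\<Union>c\<in>- Ogood. ball c \<delta>)" by auto
  show "- Ogood \<subseteq> (\<Union>c\<in>- Ogood. ball c \<delta>)" using assms(1) by auto
  show "\<phi> k = 0" if "k \<in> (\<Union>c\<in>- Ogood. ball c \<delta>)" for k
    using that assms(2) by (auto simp: dist_norm norm_minus_commute)
qed

text \<open>If h vanishes at all points that the mollifier at x can see,
  \<open>tconv_mker_close\<close> with value 0 and tolerance 0 makes the convolution vanish at x. A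
  uniform such margin around the bad set puts it into the domain.\<close>

lemma tconv_Dset:
  assumes h: "continuous_on torus_box h" and \<delta>: "\<delta> > 0" and e: "e > 0"
    and z: "\<And>c x y. c \<notin> Ogood \<Longrightarrow> norm (x - c) < \<delta> \<Longrightarrow> y \<in> torus_box \<Longrightarrow> cosdist (x - y) < e \<Longrightarrow> h y = 0"
  shows "tconv (mker e) h \<in> Dset E F" "\<And>c x. c \<notin> Ogood \<Longrightarrow> norm (x - c) < \<delta> \<Longrightarrow> tconv (mker e) h x = 0"
proof -
  show 0: "tconv (mker e) h x = 0" if "c \<notin> Ogood" "norm (x - c) < \<delta>" for c x
    using tconv_mker_close[OF e h, of x 0 0] z[OF that] by simp
  have "vnear (tconv (mker e) h)" by (rule vnearI[OF \<delta> 0])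
  then show "tconv (mker e) h \<in> Dset E F"
    using tconv_smooth[OF h mker_trigbump] tconv_periodic[OF mker_periodic] by (auto simp: Dset_def vnear_def CM_eq)
qed

lemma Xfield_bounded_away:
  assumes "\<delta> > 0"
  obtains M where "M > 0" "\<And>k. (\<And>c. c \<notin> Ogood \<Longrightarrow> \<delta> \<le> norm (k - c)) \<Longrightarrow> norm (Xfield E F k) \<le> M \<and> \<bar>divergence (Xfield E F) k / 2\<bar> \<le> M"
proof -
  define S where "S = torus_box - (\<Union>c\<in>- Ogood. ball c \<delta>)"
  have S: "compact S" unfolding S_def by (intro compact_diff compact_torus_box open_UN) auto
  have SO: "S \<subseteq> Ogood" unfolding S_def using assms by (auto simp: subset_iff) (metis ComplI dist_self)
  have "continuous_on S (\<lambda>k. (Xfield E F k, divergence (Xfield E F) k / 2)) \<longleftrightarrow> continuous_on S (\<lambda>k. (gg k *\<^sub>R G k, divX k / 2))"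
    using SO Ogood_noncrit by (intro continuous_on_cong) (auto simp: Xfield_eq divergence_Xfield)
  moreover have "continuous_on S (\<lambda>k. (gg k *\<^sub>R G k, divX k / 2))"
    using SO Ogood_noncrit by (intro continuous_intros continuous_on_gg continuous_on_divX continuous_on_id) auto
  ultimately have "compact ((\<lambda>k. (Xfield E F k, divergence (Xfield E F) k / 2)) ` S)"
    using compact_continuous_image[OF _ S] by blast
  then have "\<exists>M>0. \<forall>x\<in>(\<lambda>k. (Xfield E F k, divergence (Xfield E F) k / 2)) ` S. norm x \<le> M"
    using compact_imp_bounded bounded_pos by blast
  then obtain M where M: "M > 0" "\<And>k. k \<in> S \<Longrightarrow> norm (Xfield E F k, divergence (Xfield E F) k / 2) \<le> M"
    by (auto simp del: norm_Pair)
  have "norm (Xfield E F k) \<le> M \<and> \<bar>divergence (Xfield E F) k / 2\<bar> \<le> M"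
    if k: "\<And>c. c \<notin> Ogood \<Longrightarrow> \<delta> \<le> norm (k - c)" for k
  proof -
    obtain n where n: "k + lattice_vec n \<in> torus_box" by (rule lattice_reduce)
    have "k + lattice_vec n \<in> S"
    proof -
      have "\<delta> \<le> dist c (k + lattice_vec n)" if "c \<notin> Ogood" for c
        using k[of "c - lattice_vec n"] that by (simp add: Ogood_lattice' dist_norm norm_minus_commute algebra_simps)
      then show ?thesis using n by (auto simp: S_def not_less)
    qed
    from M(2)[OF this] show ?thesis
      using norm_fst_le[of "Xfield E F k" "divergence (Xfield E F) k / 2"] norm_snd_le[of "divergence (Xfield E F) k / 2" "Xfield E F k"]
      by (auto simp: Xfield_lattice divergence_lattice)
  qed
  then show thesis using that M(1) by blast
qed

text \<open>The singular coefficients of the generator are bounded outside a fixed neighbourhood of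
  the bad set, and inside it both \<phi> and its mollification vanish. Uniform convergence of the
  function and of its coordinate derivatives therefore controls the generator as well.\<close>

lemma K1_approx:
  assumes \<phi>: "\<phi> \<in> K1" and \<epsilon>: "\<epsilon> > 0"
  obtains \<phi>' where "\<phi>' \<in> Dset E F" "l2norm (\<lambda>k. \<phi>' k - \<phi> k) < \<epsilon>" "l2norm (\<lambda>k. Aexpr E F \<phi>' k - Aexpr E F \<phi> k) < \<epsilon>"
proof -
  have per: "periodic_T \<phi>" and vn: "vnear \<phi>" and dif: "\<And>x. \<phi> differentiable (at x)"
    and cd: "\<And>v. continuous_on UNIV (\<lambda>x. frechet_derivative \<phi> (at x) v)" using \<phi> by (auto simp: K1_def)
  have \<phi>c: "continuous_on A \<phi>" for A using K1_K0[OF \<phi>] continuous_on_subset by (fastforce simp: K0_def)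
  have pd: "periodic_T (\<lambda>x. frechet_derivative \<phi> (at x) v)" for v
    unfolding periodic_T_def by (simp add: periodic_frechet_derivative[OF per])
  obtain \<delta> where \<delta>: "\<delta> > 0" "\<And>c k. c \<notin> Ogood \<Longrightarrow> norm (k - c) < \<delta> \<Longrightarrow> \<phi> k = 0" using vnear_uniform[OF per vn] by blast
  have \<delta>2: "\<delta> / 2 > 0" using \<delta> by simp
  obtain M where M: "M > 0" "\<And>k. (\<And>c. c \<notin> Ogood \<Longrightarrow> \<delta> / 2 \<le> norm (k - c)) \<Longrightarrow> norm (Xfield E F k) \<le> M \<and> \<bar>divergence (Xfield E F) k / 2\<bar> \<le> M"
    using Xfield_bounded_away[OF \<delta>2] by blast
  define vol where "vol = sqrt (measure TM (torus_box :: (real^'d) set))"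
  have vol0: "vol \<ge> 0" by (simp add: vol_def)
  \<comment> \<open>One M for each coordinate of the transport term, one for the divergence term,
    and 1 to have C >= 1.\<close>
  define C where "C = (real CARD('d) * M + M + 1)"
  have C: "C > 0" "C \<ge> 1" using M(1) by (auto simp: C_def intro: add_nonneg_pos)
  define \<eta> where "\<eta> = \<epsilon> / (2 * C * (vol + 1))"
  have \<eta>: "\<eta> > 0" using \<epsilon> C vol0 by (simp add: \<eta>_def)
  have small: "C * \<eta> * vol < \<epsilon>" "\<eta> * vol < \<epsilon>"
  proof -
    have "C * \<eta> * vol \<le> C * \<eta> * (vol + 1)" using C \<eta> by (intro mult_left_mono) auto
    also have "\<dots> = \<epsilon> / 2"
    proof -
      have "C * (vol + 1) \<noteq> 0" using C vol0 by auto
      then have "(C * (vol + 1)) * (\<epsilon> / (2 * (C * (vol + 1)))) = \<epsilon> / 2" by (simp only: times_divide_eq_right) simp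
      then show ?thesis by (simp add: \<eta>_def algebra_simps)
    qed
    finally show 1: "C * \<eta> * vol < \<epsilon>" using \<epsilon> by linarith
    have "1 * (\<eta> * vol) \<le> C * (\<eta> * vol)" using C \<eta> vol0 by (intro mult_right_mono) auto
    then show "\<eta> * vol < \<epsilon>" using 1 by (simp add: mult.assoc)
  qed
  obtain e1 where e1: "e1 > 0" "\<And>z::real^'d. cosdist z < e1 \<Longrightarrow> \<exists>n. norm (z - lattice_vec n) < \<delta> / 2"
    using cosdist_small_near_lattice[OF \<delta>2] by blast
  obtain e2 where e2: "e2 > 0" "\<And>e x. 0 < e \<Longrightarrow> e \<le> e2 \<Longrightarrow> cmod (tconv (mker e) \<phi> x - \<phi> x) \<le> \<eta>"
    using tconv_mker_uniform[OF per \<phi>c \<eta>] by blast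
  define P where "P i e0 \<longleftrightarrow> e0 > 0 \<and> (\<forall>e x. 0 < e \<longrightarrow> e \<le> e0 \<longrightarrow> cmod (tconv (mker e) (\<lambda>y. frechet_derivative \<phi> (at y) (axis i 1)) x - frechet_derivative \<phi> (at x) (axis i 1)) \<le> \<eta>)" for i e0
  have "\<exists>e0. P i e0" for i unfolding P_def using tconv_mker_uniform[OF pd cd \<eta>] by blast
  then obtain e3 where e3: "\<And>i. P i (e3 i)" by metis
  define e where "e = Min (insert e1 (insert e2 (range e3)))"
  have efin: "finite (insert e1 (insert e2 (range e3)))" by simp
  have e: "0 < e" using e1(1) e2(1) e3 unfolding e_def P_def by (subst Min_gr_iff[OF efin]) auto
  have e': "e \<le> e1" "e \<le> e2" "e \<le> e3 i" for i
    unfolding e_def by (rule Min_le[OF efin], blast)+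
  define \<phi>' where "\<phi>' = tconv (mker e) \<phi>"
  have z: "\<phi> y = 0" if c: "c \<notin> Ogood" and xc: "norm (x - c) < \<delta> / 2" and xy: "cosdist (x - y) < e" for c x y
  proof -
    obtain n where n: "norm (x - y - lattice_vec n) < \<delta> / 2" using e1(2)[of "x - y"] xy e'(1) by auto
    have "norm (y - (c - lattice_vec n)) \<le> norm (x - c) + norm (x - y - lattice_vec n)"
      using norm_triangle_ineq4[of "x - c" "x - y - lattice_vec n"] by (simp add: algebra_simps)
    then show ?thesis using n c xc by (intro \<delta>(2)[of "c - lattice_vec n"]) (auto simp: Ogood_lattice')
  qed
  have D: "\<phi>' \<in> Dset E F" and \<phi>'0: "\<And>c x. c \<notin> Ogood \<Longrightarrow> norm (x - c) < \<delta> / 2 \<Longrightarrow> \<phi>' x = 0"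
    unfolding \<phi>'_def by (rule tconv_Dset(1)[OF \<phi>c \<delta>2 e], blast intro: z) (rule tconv_Dset(2)[OF \<phi>c \<delta>2 e], (blast intro: z)+)
  have \<phi>'1: "\<phi>' \<in> K1" by (rule Dset_K1[OF D])
  have cl: "cmod (\<phi>' x - \<phi> x) \<le> \<eta>" for x unfolding \<phi>'_def by (rule e2(2)[OF e e'(2)])
  have fd': "frechet_derivative \<phi>' (at x) v = tconv (mker e) (\<lambda>y. frechet_derivative \<phi> (at y) v) x" for x v
    unfolding \<phi>'_def by (rule fun_cong[OF frechet_derivative_at[OF tconv_mker_has_derivative[OF per dif cd, of e x], symmetric]])
  have cld: "cmod (frechet_derivative \<phi>' (at x) (axis i 1) - frechet_derivative \<phi> (at x) (axis i 1)) \<le> \<eta>" for x i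
    unfolding fd' using e3[of i] e e'(3)[of i] unfolding P_def by blast
  have clB: "cmod (Bop \<phi>' k - Bop \<phi> k) \<le> C * \<eta>" for k
  proof (cases "\<exists>c. c \<notin> Ogood \<and> norm (k - c) < \<delta> / 2")
    case True
    then obtain c where c: "c \<notin> Ogood" "norm (k - c) < \<delta> / 2" by blast
    have "\<And>y. y \<in> ball c (\<delta> / 2) \<Longrightarrow> \<phi> y = 0" "\<And>y. y \<in> ball c (\<delta> / 2) \<Longrightarrow> \<phi>' y = 0"
      using \<delta>(2)[OF c(1)] \<phi>'0[OF c(1)] \<delta>(1) by (auto simp: dist_norm norm_minus_commute)
    moreover have "k \<in> ball c (\<delta> / 2)" using c(2) by (simp add: dist_norm norm_minus_commute)
    ultimately have "Bop \<phi> k = 0" "Bop \<phi>' k = 0"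
      using frechet_derivative_zero_open(2)[of "ball c (\<delta> / 2)" k \<phi>] frechet_derivative_zero_open(2)[of "ball c (\<delta> / 2)" k \<phi>']
      by (auto simp: Bop_def)
    then show ?thesis using C(1) \<eta> by simp
  next
    case False
    then have X: "norm (Xfield E F k) \<le> M" "\<bar>divergence (Xfield E F) k / 2\<bar> \<le> M" using M(2)[of k] by (auto simp: not_less)
    have dif': "\<phi>' differentiable (at k)" using \<phi>'1 by (simp add: K1_def)
    have "Bop \<phi>' k - Bop \<phi> k = (\<Sum>i\<in>UNIV. of_real (Xfield E F k $ i) * (frechet_derivative \<phi>' (at k) (axis i 1) - frechet_derivative \<phi> (at k) (axis i 1)))
      + of_real (divergence (Xfield E F) k / 2) * (\<phi>' k - \<phi> k)"
      unfolding Bop_def frechet_derivative_expand[OF dif', of "Xfield E F k"] frechet_derivative_expand[OF dif, of k "Xfield E F k"]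
      by (simp add: sum_subtractf right_diff_distrib)
    then have "cmod (Bop \<phi>' k - Bop \<phi> k) \<le> cmod (\<Sum>i\<in>UNIV. of_real (Xfield E F k $ i) * (frechet_derivative \<phi>' (at k) (axis i 1) - frechet_derivative \<phi> (at k) (axis i 1)))
       + cmod (of_real (divergence (Xfield E F) k / 2) * (\<phi>' k - \<phi> k))"
      by (simp only: norm_triangle_ineq)
    also have "\<dots> \<le> (\<Sum>i\<in>(UNIV::'d set). M * \<eta>) + M * \<eta>"
    proof (rule add_mono)
      show "cmod (\<Sum>i\<in>UNIV. of_real (Xfield E F k $ i) * (frechet_derivative \<phi>' (at k) (axis i 1) - frechet_derivative \<phi> (at k) (axis i 1))) \<le> (\<Sum>i\<in>(UNIV::'d set). M * \<eta>)"
      proof (rule sum_norm_le)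
        fix i :: 'd
        have "\<bar>Xfield E F k $ i\<bar> \<le> M" using component_le_norm_cart[of "Xfield E F k" i] X(1) by linarith
        then show "norm (of_real (Xfield E F k $ i) * (frechet_derivative \<phi>' (at k) (axis i 1) - frechet_derivative \<phi> (at k) (axis i 1))) \<le> M * \<eta>"
          unfolding norm_mult norm_of_real using cld M(1) by (intro mult_mono) auto
      qed
      show "cmod (of_real (divergence (Xfield E F) k / 2) * (\<phi>' k - \<phi> k)) \<le> M * \<eta>"
        unfolding norm_mult norm_of_real using X(2) cl M(1) by (intro mult_mono) auto
    qed
    also have "\<dots> = (real CARD('d) * M + M) * \<eta>" by (simp add: algebra_simps)
    also have "\<dots> \<le> C * \<eta>" unfolding C_def using \<eta> by (intro mult_right_mono) auto
    finally show ?thesis .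
  qed
  have "l2norm (\<lambda>k. \<phi>' k - \<phi> k) \<le> \<eta> * vol"
    unfolding vol_def by (rule l2norm_bounded[OF L2T_diff[OF K1_L2T[OF \<phi>'1] K1_L2T[OF \<phi>]]]) (rule cl)
  moreover have "l2norm (\<lambda>k. Aexpr E F \<phi>' k - Aexpr E F \<phi> k) \<le> C * \<eta> * vol"
  proof -
    have "cmod (Aexpr E F \<phi>' k - Aexpr E F \<phi> k) \<le> C * \<eta>" for k
    proof -
      have "Aexpr E F \<phi>' k - Aexpr E F \<phi> k = - \<i> * (Bop \<phi>' k - Bop \<phi> k)" by (simp add: Aexpr_Bop right_diff_distrib)
      then show ?thesis using clB[of k] by (simp add: norm_mult)
    qed
    then show ?thesis unfolding vol_def
      by (intro l2norm_bounded L2T_diff Aexpr_L2T \<phi>'1 \<phi>)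
  qed
  ultimately show thesis using that[OF D] small by linarith
qed

end

lemma negligible_AE_TM:
  assumes "negligible N"
  shows "AE k in TM. k \<notin> N"
proof -
  have "AE k in lebesgue. k \<notin> N"
    using assms unfolding negligible_iff_null_sets by (rule AE_not_in)
  then have "AE k in lborel. k \<notin> N" by (simp add: AE_completion_iff)
  then show ?thesis by (subst AE_restrict_space_iff) (auto intro: eventually_mono)
qed

text \<open>The flow leaves the box, so null sets must be handled in the whole space before they are
  pulled back. Countably many lattice translates of the exceptional set in the box cover the whole
  one.\<close>

lemma periodic_AE_TM_negligible:
  fixes P :: "real^'d::finite \<Rightarrow> bool"
  assumes ae: "AE k in TM. P k" and per: "periodic_T P"
  shows "negligible {k. \<not> P k}"
proof -
  define S where "S = {k \<in> torus_box. \<not> P k}"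
  have "AE k in lborel. k \<in> torus_box \<longrightarrow> P k" using ae by (subst (asm) AE_restrict_space_iff) auto
  then obtain N where N: "{k \<in> space lborel. \<not> (k \<in> torus_box \<longrightarrow> P k)} \<subseteq> N" "emeasure lborel N = 0" "N \<in> sets lborel"
    by (rule AE_E)
  then have "negligible N" unfolding negligible_iff_null_sets by (intro null_sets_completionI) auto
  moreover have "S \<subseteq> N" using N(1) by (auto simp: S_def)
  ultimately have "negligible S" by (rule negligible_subset)
  then have neg: "negligible ((\<lambda>k. - lattice_vec n + k) ` S)" for n by (rule negligible_translation)
  have "negligible (\<Union>n\<in>UNIV. (\<lambda>k. - lattice_vec n + k) ` S)"
  proof (rule negligible_countable_Union)
    show "countable (range (\<lambda>n. (\<lambda>k. - lattice_vec n + k) ` S))" using lattice_countable by (rule countable_image)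
  qed (use neg in auto)
  moreover have "{k. \<not> P k} \<subseteq> (\<Union>n\<in>UNIV. (\<lambda>k. - lattice_vec n + k) ` S)"
  proof
    fix k assume k: "k \<in> {k. \<not> P k}"
    obtain n where n: "k + lattice_vec n \<in> torus_box" by (rule lattice_reduce)
    have "k + lattice_vec n \<in> S" using n k per by (auto simp: S_def periodic_T_def)
    then show "k \<in> (\<Union>n\<in>UNIV. (\<lambda>k. - lattice_vec n + k) ` S)" by (auto intro!: exI[of _ n] image_eqI[of _ _ "k + lattice_vec n"])
  qed
  ultimately show ?thesis by (rule negligible_subset)
qed

text \<open>The radial retraction onto the disc of radius M. Being continuous, it truncates
  continuous approximants without spoiling them.\<close>

definition clamp_cplx :: "real \<Rightarrow> complex \<Rightarrow> complex" where
  "clamp_cplx M z = of_real (M / max M (cmod z)) * z"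

lemma clamp_cplx:
  assumes "M > 0"
  shows "cmod (clamp_cplx M z) \<le> M" "cmod z \<le> M \<Longrightarrow> clamp_cplx M z = z"
    "cmod (clamp_cplx M z - z) \<le> cmod z" "continuous_on A (clamp_cplx M)"
proof -
  have m: "max M (cmod z) > 0" using assms by auto
  have "cmod (clamp_cplx M z) = M * (cmod z / max M (cmod z))" using assms m
    by (simp add: clamp_cplx_def norm_mult norm_divide)
  also have "\<dots> \<le> M * 1" using assms m by (intro mult_left_mono) auto
  finally show "cmod (clamp_cplx M z) \<le> M" by simp
  show "clamp_cplx M z = z" if "cmod z \<le> M" using that assms by (simp add: clamp_cplx_def max_def)
  define t where "t = M / max M (cmod z)"
  have t: "0 \<le> t" "t \<le> 1" using assms m by (auto simp: t_def)
  have "clamp_cplx M z - z = of_real (t - 1) * z" by (simp add: clamp_cplx_def t_def algebra_simps)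
  then have "cmod (clamp_cplx M z - z) = \<bar>t - 1\<bar> * cmod z" by (simp only: norm_mult norm_of_real)
  also have "\<dots> \<le> 1 * cmod z" using t by (intro mult_right_mono) auto
  finally show "cmod (clamp_cplx M z - z) \<le> cmod z" by simp
  have "max M (cmod z) \<noteq> 0" for z using assms by (auto simp: max_def)
  then show "continuous_on A (clamp_cplx M)" unfolding clamp_cplx_def
    by (intro continuous_intros) auto
qed

lemma lattice_translate_leaves_open_box:
  fixes y :: "real^'d::finite"
  assumes "y \<in> torus_box" "lattice_vec n \<noteq> (0::real^'d)"
  shows "y + lattice_vec n \<notin> box 0 (\<chi> i. 2 * pi)"
proof
  assume *: "y + lattice_vec n \<in> box 0 (\<chi> i. 2 * pi)"
  obtain i where i: "n i \<noteq> 0" using assms(2) by (auto simp: vec_eq_iff)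
  have y: "0 \<le> y$i" "y$i \<le> 2 * pi" using assms(1) by (auto simp: torus_box_def)
  have b: "0 < y$i + 2 * pi * of_int (n i)" "y$i + 2 * pi * of_int (n i) < 2 * pi"
    using * by (auto simp: mem_box_cart)
  show False
  proof (cases "n i > 0")
    case True
    then have "2 * pi * 1 \<le> 2 * pi * real_of_int (n i)" by (intro mult_left_mono) auto
    then show ?thesis using b y by linarith
  next
    case False
    then have "2 * pi * real_of_int (n i) \<le> 2 * pi * (-1)" using i by (intro mult_left_mono) auto
    then show ?thesis using b y by linarith
  qed
qed

context morse_band
begin

text \<open>Good points in the interior of the box, almost all of the torus. Functions concentrated
  away from the complement can be mollified without matching values on opposite faces.\<close>

definition Ocell :: "(real^'d) set" where
  "Ocell = Ogood \<inter> box 0 (\<chi> i. 2 * pi)"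

lemma Ocell_open: "open Ocell"
  unfolding Ocell_def by (intro open_Int Ogood_open open_box)

lemma Ocell_AE: "AE k in TM. k \<in> Ocell"
proof -
  have "negligible (cbox 0 (\<chi> i. 2 * pi) - box 0 (\<chi> i. 2 * pi) :: (real^'d) set)"
    by (rule negligible_frontier_interval)
  then have "AE k in TM. k \<notin> (cbox 0 (\<chi> i. 2 * pi) - box 0 (\<chi> i. 2 * pi) :: (real^'d) set)"
    by (rule negligible_AE_TM)
  moreover have "AE k in TM. k \<notin> - Ogood" by (rule negligible_AE_TM[OF Ogood_complement_negligible])
  moreover have "AE k in TM. k \<in> (torus_box :: (real^'d) set)" by (rule AE_I2) (simp add: space_restrict_space)
  ultimately show ?thesis by eventually_elim (auto simp: Ocell_def torus_box_cbox)
qed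

text \<open>Here h is not periodic, while the mollifier connects points across opposite faces.
  Whenever that happens both points lie within \<rho> of the complement of the cell, where h is 0;
  otherwise uniform continuity on the box applies.\<close>

lemma approx_continuous_Dset:
  fixes h :: "real^'d \<Rightarrow> complex"
  assumes h: "continuous_on UNIV h" and \<rho>: "\<rho> > 0" and z: "\<And>y. infdist y (- Ocell) < \<rho> \<Longrightarrow> h y = 0" and \<eta>: "\<eta> > 0"
  shows "\<exists>\<phi>\<in>Dset E F. \<forall>x\<in>torus_box. cmod (\<phi> x - h x) \<le> \<eta>"
proof -
  have hc: "continuous_on torus_box h" using h continuous_on_subset by blast
  have "uniformly_continuous_on torus_box h" by (rule compact_uniformly_continuous[OF hc compact_torus_box])
  then obtain d where d: "d > 0" "\<And>x y. x \<in> torus_box \<Longrightarrow> y \<in> torus_box \<Longrightarrow> dist y x < d \<Longrightarrow> dist (h y) (h x) < \<eta>"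
    using \<eta> unfolding uniformly_continuous_on_def by metis
  \<comment> \<open>d serves uniform continuity; \<rho>/2 adds up with another \<rho>/2 to stay
    within the margin where h vanishes.\<close>
  define \<delta> where "\<delta> = min d (\<rho> / 2)"
  have \<delta>: "\<delta> > 0" using d \<rho> by (simp add: \<delta>_def)
  obtain e where e: "e > 0" "\<And>z::real^'d. cosdist z < e \<Longrightarrow> \<exists>n. norm (z - lattice_vec n) < \<delta>"
    using cosdist_small_near_lattice[OF \<delta>] by blast
  have hz: "h y = 0" if "t \<notin> Ocell" "norm (y - t) < \<rho>" for y t
    using infdist_le[of t "- Ocell" y] that by (intro z) (auto simp: dist_norm)
  define \<phi> where "\<phi> = tconv (mker e) h"
  have "\<phi> \<in> Dset E F" unfolding \<phi>_def
  proof (rule tconv_Dset(1)[OF hc _ e(1), of "\<rho> / 2"])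
    show "\<rho> / 2 > 0" using \<rho> by simp
    fix c x y :: "real^'d" assume c: "c \<notin> Ogood" and xc: "norm (x - c) < \<rho> / 2" and "cosdist (x - y) < e"
    then obtain n where n: "norm (x - y - lattice_vec n) < \<delta>" using e(2) by blast
    have "norm (y - (c - lattice_vec n)) \<le> norm (x - c) + norm (x - y - lattice_vec n)"
      using norm_triangle_ineq4[of "x - c" "x - y - lattice_vec n"] by (simp add: algebra_simps)
    then show "h y = 0" using n c xc by (intro hz[of "c - lattice_vec n"]) (auto simp: Ogood_lattice' Ocell_def \<delta>_def)
  qed
  moreover have "cmod (\<phi> x - h x) \<le> \<eta>" if x: "x \<in> torus_box" for x
    unfolding \<phi>_def
  proof (rule tconv_mker_close[OF e(1) hc])
    fix y :: "real^'d" assume y: "y \<in> torus_box" and "cosdist (x - y) < e"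
    then obtain n where n: "norm (x - y - lattice_vec n) < \<delta>" using e(2) by blast
    show "cmod (h y - h x) \<le> \<eta>"
    proof (cases "lattice_vec n = (0 :: real^'d)")
      case True
      then have "dist y x < d" using n by (simp add: dist_norm \<delta>_def norm_minus_commute)
      from d(2)[OF x y this] show ?thesis by (simp add: dist_norm)
    next
      \<comment> \<open>The mollifier wraps around: each of the two points is close to a nontrivial
        translate of the other, which lies outside the open box.\<close>
      case False
      have "h x = 0"
      proof (rule hz)
        show "y + lattice_vec n \<notin> Ocell" using lattice_translate_leaves_open_box[OF y False] by (simp add: Ocell_def)
        show "norm (x - (y + lattice_vec n)) < \<rho>" using n \<rho> by (simp add: \<delta>_def algebra_simps)
      qed
      moreover have "h y = 0"
      proof (rule hz)
        have "lattice_vec (\<lambda>i. - n i) \<noteq> (0 :: real^'d)" using False by (simp add: lattice_vec_uminus)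
        then show "x - lattice_vec n \<notin> Ocell" using lattice_translate_leaves_open_box[OF x, of "\<lambda>i. - n i"]
          by (simp add: Ocell_def lattice_vec_uminus)
        have "norm (y - (x - lattice_vec n)) = norm (x - y - lattice_vec n)"
          using norm_minus_commute[of y "x - lattice_vec n"] by (simp add: algebra_simps)
        then show "norm (y - (x - lattice_vec n)) < \<rho>" using n \<rho> by (simp add: \<delta>_def)
      qed
      ultimately show ?thesis using \<eta> by simp
    qed
  qed
  ultimately show ?thesis by blast
qed

lemma Dset_L2T: "\<phi> \<in> Dset E F \<Longrightarrow> \<phi> \<in> L2T"
  using Dset_K1 K1_L2T by blast

text \<open>A measurable function is almost everywhere a limit of continuous ones. Truncating these
  at height M and cutting them off near the complement of the cell keeps the limit, and the uniform
  bound turns it into L^2 convergence.\<close>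

lemma Dset_approx_bounded:
  assumes \<psi>: "\<psi> \<in> L2T" and M: "M > 0" "\<And>k. cmod (\<psi> k) \<le> M" and \<epsilon>: "\<epsilon> > 0"
  shows "\<exists>\<phi>\<in>Dset E F. l2norm (\<lambda>k. \<phi> k - \<psi> k) < \<epsilon>"
proof -
  have \<psi>m [measurable]: "\<psi> \<in> borel_measurable borel" using \<psi> by (simp add: L2T_iff)
  have "\<psi> \<in> borel_measurable (lebesgue_on UNIV)"
    using \<psi>m by (simp add: lebesgue_on_UNIV_eq measurable_completion)
  then have "\<psi> measurable_on UNIV" by (subst measurable_on_iff_borel_measurable) auto
  then obtain N g where N: "negligible N" and g: "\<And>n. continuous_on UNIV (g n)"
    "\<And>x. x \<notin> N \<Longrightarrow> (\<lambda>n. g n x) \<longlonglongrightarrow> \<psi> x"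
    unfolding measurable_on_def by auto
  \<comment> \<open>The cutoff is 0 within distance 1/(n+1) of the complement of the cell and 1 from
    distance 2/(n+1) on.\<close>
  define c where "c n x = min 1 (max 0 (real (Suc n) * infdist x (- Ocell) - 1))" for n x
  define h where "h n x = of_real (c n x) * clamp_cplx M (g n x)" for n x
  have c01: "0 \<le> c n x" "c n x \<le> 1" for n x by (auto simp: c_def)
  have hc: "continuous_on UNIV (h n)" for n
    unfolding h_def c_def
    by (intro continuous_intros continuous_on_compose2[OF clamp_cplx(4)[OF M(1), of UNIV] g(1)] continuous_on_infdist) auto
  have h0: "h n y = 0" if "infdist y (- Ocell) < 1 / real (Suc n)" for n y
  proof -
    have "real (Suc n) * infdist y (- Ocell) < 1" using that by (simp add: pos_less_divide_eq mult.commute)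
    then show ?thesis by (simp add: h_def c_def)
  qed
  have hM: "cmod (h n x) \<le> M" for n x
  proof -
    have "cmod (h n x) \<le> 1 * M" unfolding h_def norm_mult norm_of_real
      using c01[of n x] clamp_cplx(1)[OF M(1)] M(1) by (intro mult_mono) auto
    then show ?thesis by simp
  qed
  have "\<exists>\<phi>\<in>Dset E F. \<forall>x\<in>torus_box. cmod (\<phi> x - h n x) \<le> 1 / real (Suc n)" for n
    by (rule approx_continuous_Dset[OF hc _ h0]) auto
  then obtain \<phi> where \<phi>: "\<And>n. \<phi> n \<in> Dset E F" "\<And>n x. x \<in> torus_box \<Longrightarrow> cmod (\<phi> n x - h n x) \<le> 1 / real (Suc n)"
    by metis
  have "(\<lambda>n. l2norm (\<lambda>k. \<phi> n k - \<psi> k)) \<longlonglongrightarrow> 0"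
  proof (rule l2norm_dominated_tendsto_0[where w = "\<lambda>_. 2 * M + 1"])
    show "(\<lambda>k. \<phi> n k - \<psi> k) \<in> borel_measurable borel" for n
      using Dset_L2T[OF \<phi>(1)] by (intro borel_measurable_diff) (auto simp: L2T_iff)
    show "cmod (\<phi> n k - \<psi> k) \<le> 2 * M + 1" for n k
    proof -
      have "cmod (\<phi> n k) \<le> M + 1" for k
      proof (rule periodic_bounded_by_box[where P = "\<lambda>z. cmod z \<le> M + 1" and g = "\<phi> n"])
        show "periodic_T (\<phi> n)" using \<phi>(1)[of n] by (simp add: Dset_def)
        fix k :: "real^'d" assume "k \<in> torus_box"
        from \<phi>(2)[OF this, of n] have "cmod (\<phi> n k - h n k) \<le> 1" by (rule order_trans) simp
        then show "cmod (\<phi> n k) \<le> M + 1" using hM[of n k] norm_triangle_ineq2[of "\<phi> n k" "h n k"] by linarith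
      qed
      from this[of k] show ?thesis using M(2)[of k] norm_triangle_ineq4[of "\<phi> n k" "\<psi> k"] by linarith
    qed
    show "integrable TM (\<lambda>k :: real^'d. (2 * M + 1)\<^sup>2)" by (rule TM_integrable_bounded[where B = "(2 * M + 1)\<^sup>2"]) auto
    have "AE k in TM. k \<in> (torus_box :: (real^'d) set)" by (rule AE_I2) (simp add: space_restrict_space)
    with Ocell_AE negligible_AE_TM[OF N] show "AE k in TM. (\<lambda>n. \<phi> n k - \<psi> k) \<longlonglongrightarrow> 0"
    proof eventually_elim
      fix k assume k: "k \<in> Ocell" "k \<notin> N" "k \<in> torus_box"
      have pos: "infdist k (- Ocell) > 0"
      proof (rule infdist_pos_not_in_closed)
        have "(0 :: real^'d) \<in> - Ocell" by (auto simp: Ocell_def mem_box_cart)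
        then show "- Ocell \<noteq> {}" by blast
      qed (use Ocell_open k in \<open>auto simp: closed_def\<close>)
      have "(\<lambda>n. clamp_cplx M (g n k)) \<longlonglongrightarrow> clamp_cplx M (\<psi> k)"
        using clamp_cplx(4)[OF M(1), of UNIV] g(2)[OF k(2)]
        by (intro continuous_on_tendsto_compose[of UNIV "clamp_cplx M"]) auto
      moreover have "(\<lambda>n. c n k) \<longlonglongrightarrow> 1"
      proof (rule tendsto_eventually)
        obtain m where m: "real m > 2 / infdist k (- Ocell)" using reals_Archimedean2 by blast
        have "c n k = 1" if "n \<ge> m" for n
        proof -
          have "2 / infdist k (- Ocell) < real (Suc n)" using m that by linarith
          then have "2 < real (Suc n) * infdist k (- Ocell)" using pos by (simp add: pos_divide_less_eq)
          then show ?thesis by (simp add: c_def)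
        qed
        then show "\<forall>\<^sub>F n in sequentially. c n k = 1" by (auto simp: eventually_sequentially)
      qed
      ultimately have "(\<lambda>n. h n k) \<longlonglongrightarrow> of_real 1 * clamp_cplx M (\<psi> k)"
        unfolding h_def by (intro tendsto_mult tendsto_of_real)
      then have hl: "(\<lambda>n. h n k) \<longlonglongrightarrow> \<psi> k" using clamp_cplx(2)[OF M(1) M(2)[of k]] by simp
      have "(\<lambda>n. \<phi> n k - h n k) \<longlonglongrightarrow> 0"
        by (rule tendsto_0_le[OF LIMSEQ_Suc[OF lim_1_over_n[where 'a = real]], where K = 1]) (use \<phi>(2)[OF k(3)] in \<open>auto intro!: always_eventually simp: abs_of_nonneg\<close>)
      from tendsto_add[OF this hl] have "(\<lambda>n. \<phi> n k) \<longlonglongrightarrow> \<psi> k" by simp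
      then show "(\<lambda>n. \<phi> n k - \<psi> k) \<longlonglongrightarrow> 0" by (simp add: LIM_zero_iff)
    qed
  qed auto
  then have "\<forall>\<^sub>F n in sequentially. l2norm (\<lambda>k. \<phi> n k - \<psi> k) < \<epsilon>" using \<epsilon> by (rule order_tendstoD)
  then obtain n where "l2norm (\<lambda>k. \<phi> n k - \<psi> k) < \<epsilon>" by (auto simp: eventually_sequentially)
  with \<phi>(1) show ?thesis by blast
qed

lemma Dset_dense:
  assumes \<psi>: "\<psi> \<in> L2T" and \<epsilon>: "\<epsilon> > 0"
  shows "\<exists>\<phi>\<in>Dset E F. l2norm (\<lambda>k. \<phi> k - \<psi> k) < \<epsilon>"
proof -
  define \<psi>' where "\<psi>' n k = clamp_cplx (real (Suc n)) (\<psi> k)" for n k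
  have \<psi>m [measurable]: "\<psi> \<in> borel_measurable borel" using \<psi> by (simp add: L2T_iff)
  have m: "\<psi>' n \<in> borel_measurable borel" for n
    unfolding \<psi>'_def by (rule measurable_compose[OF \<psi>m borel_measurable_continuous_onI[OF clamp_cplx(4)]]) simp
  have L: "\<psi>' n \<in> L2T" for n
    by (rule L2T_bounded[OF _ m, of _ "real (Suc n)"])
      (use \<psi> in \<open>auto simp: \<psi>'_def periodic_T_def L2T_iff intro: clamp_cplx(1)\<close>)
  have "(\<lambda>n. l2norm (\<lambda>k. \<psi>' n k - \<psi> k)) \<longlonglongrightarrow> 0"
  proof (rule l2norm_dominated_tendsto_0[where w = "\<lambda>k. cmod (\<psi> k)"])
    show "(\<lambda>k. \<psi>' n k - \<psi> k) \<in> borel_measurable borel" for n using m by (intro borel_measurable_diff) auto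
    show "cmod (\<psi>' n k - \<psi> k) \<le> cmod (\<psi> k)" for n k unfolding \<psi>'_def by (rule clamp_cplx(3)) simp
    show "integrable TM (\<lambda>k. (cmod (\<psi> k))\<^sup>2)" using \<psi> by (simp add: L2T_iff)
    have "(\<lambda>n. \<psi>' n k - \<psi> k) \<longlonglongrightarrow> 0" for k
    proof (rule tendsto_eventually)
      obtain N where N: "real N > cmod (\<psi> k)" using reals_Archimedean2 by blast
      have "\<psi>' n k - \<psi> k = 0" if "n \<ge> N" for n
        unfolding \<psi>'_def using N that by (subst clamp_cplx(2)) auto
      then show "\<forall>\<^sub>F n in sequentially. \<psi>' n k - \<psi> k = 0" by (auto simp: eventually_sequentially)
    qed
    then show "AE k in TM. (\<lambda>n. \<psi>' n k - \<psi> k) \<longlonglongrightarrow> 0" by simp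
  qed simp
  then have "\<forall>\<^sub>F n in sequentially. l2norm (\<lambda>k. \<psi>' n k - \<psi> k) < \<epsilon> / 2" using \<epsilon> by (intro order_tendstoD) auto
  then obtain n where n: "l2norm (\<lambda>k. \<psi>' n k - \<psi> k) < \<epsilon> / 2" by (auto simp: eventually_sequentially)
  have "\<exists>\<phi>\<in>Dset E F. l2norm (\<lambda>k. \<phi> k - \<psi>' n k) < \<epsilon> / 2"
    by (rule Dset_approx_bounded[OF L, of "real (Suc n)"]) (use \<epsilon> in \<open>auto simp: \<psi>'_def intro: clamp_cplx(1)\<close>)
  then obtain \<phi> where \<phi>: "\<phi> \<in> Dset E F" "l2norm (\<lambda>k. \<phi> k - \<psi>' n k) < \<epsilon> / 2" by blast
  have "l2norm (\<lambda>k. \<phi> k - \<psi> k) < \<epsilon>"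
    using l2norm_diff_triangle[OF Dset_L2T[OF \<phi>(1)] L[of n] \<psi>] \<phi>(2) n by linarith
  with \<phi>(1) show ?thesis by blast
qed

end

section \<open>Extension to a unitary group\<close>

lemma l2norm_diff_abs_le:
  assumes "f \<in> L2T" "g \<in> L2T"
  shows "\<bar>l2norm f - l2norm g\<bar> \<le> l2norm (\<lambda>k. f k - g k)"
  using l2norm_diff_triangle[OF assms L2T_zero] l2norm_diff_triangle[OF assms(2,1) L2T_zero] l2norm_diff_commute[of f g]
  by (simp add: abs_le_iff)

lemma l2norm_zero_aeq:
  assumes "f \<in> L2T" "l2norm f = 0"
  shows "aeq f (\<lambda>_. 0)"
proof -
  have "(\<integral>k. (cmod (f k))\<^sup>2 \<partial>TM) = 0" using assms(2) by (simp add: l2norm_TM)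
  then have "AE k in TM. (cmod (f k))\<^sup>2 = 0"
    using assms(1) by (subst (asm) integral_nonneg_eq_0_iff_AE) (auto simp: L2T_iff)
  then show ?thesis unfolding aeq_TM by eventually_elim simp
qed

lemma l2norm_zero: "l2norm (\<lambda>_. 0) = 0"
  by (simp add: l2norm_TM)

lemma l2_AE_subseq:
  assumes \<phi>: "\<And>n. \<phi> n \<in> L2T" and g: "g \<in> L2T" and lim: "(\<lambda>n. l2norm (\<lambda>k. \<phi> n k - g k)) \<longlonglongrightarrow> 0"
  obtains r :: "nat \<Rightarrow> nat" where "strict_mono r" "AE k in TM. (\<lambda>n. \<phi> (r n) k) \<longlonglongrightarrow> g k"
proof -
  have i: "integrable TM (\<lambda>k. (cmod (\<phi> n k - g k))\<^sup>2)" for n using L2T_diff[OF \<phi> g, of n] by (simp add: L2T_iff)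
  have "(\<lambda>n. (l2norm (\<lambda>k. \<phi> n k - g k))\<^sup>2) \<longlonglongrightarrow> 0\<^sup>2" using lim by (rule tendsto_power)
  then have "(\<lambda>n. \<integral>k. norm ((cmod (\<phi> n k - g k))\<^sup>2) \<partial>TM) \<longlonglongrightarrow> 0" by (simp add: l2norm_power2)
  from tendsto_L1_AE_subseq[OF i this] obtain r :: "nat \<Rightarrow> nat"
    where r: "strict_mono r" "AE k in TM. (\<lambda>n. (cmod (\<phi> (r n) k - g k))\<^sup>2) \<longlonglongrightarrow> 0" by blast
  from r(2) have "AE k in TM. (\<lambda>n. \<phi> (r n) k) \<longlonglongrightarrow> g k"
  proof eventually_elim
    fix k assume "(\<lambda>n. (cmod (\<phi> (r n) k - g k))\<^sup>2) \<longlonglongrightarrow> 0"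
    from tendsto_real_sqrt[OF this] have "(\<lambda>n. cmod (\<phi> (r n) k - g k)) \<longlonglongrightarrow> 0" by simp
    then show "(\<lambda>n. \<phi> (r n) k) \<longlonglongrightarrow> g k" by (simp add: tendsto_norm_zero_iff LIM_zero_iff)
  qed
  with r(1) show thesis by (rule that)
qed

lemma L2T_nn_integral:
  assumes "g \<in> L2T"
  shows "(\<integral>\<^sup>+k. ennreal ((cmod (g k))\<^sup>2) \<partial>TM) = ennreal ((l2norm g)\<^sup>2)"
  unfolding l2norm_power2 using assms by (subst nn_integral_eq_integral) (auto simp: L2T_iff)

lemma L2T_nn_integral_bound:
  assumes "periodic_T g" "g \<in> borel_measurable borel"
    and le: "(\<integral>\<^sup>+k. ennreal ((cmod (g k))\<^sup>2) \<partial>TM) \<le> ennreal (B\<^sup>2)" and B: "B \<ge> 0"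
  shows "g \<in> L2T" "l2norm g \<le> B"
proof -
  have m: "(\<lambda>k. (cmod (g k))\<^sup>2) \<in> borel_measurable TM" using assms(2) by (intro TM_measurable) measurable
  have "integrable TM (\<lambda>k. (cmod (g k))\<^sup>2)"
    by (rule integrableI_bounded[OF m]) (use order_le_less_trans[OF le ennreal_less_top] in simp)
  then show g: "g \<in> L2T" using assms by (simp add: L2T_iff)
  have "(l2norm g)\<^sup>2 \<le> B\<^sup>2" using le unfolding L2T_nn_integral[OF g] by (simp add: ennreal_le_iff)
  then show "l2norm g \<le> B" by (rule power2_le_imp_le[OF _ B])
qed

context morse_band
begin

lemma Ogood_AE: "AE k in TM. k \<in> Ogood"
  using negligible_AE_TM[OF Ogood_complement_negligible] by simp

lemma Wop_measurable:
  assumes [measurable]: "g \<in> borel_measurable borel"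
  shows "Wop E F b g \<in> borel_measurable borel"
proof -
  define th where "th k = (if k \<in> Ogood then theta b k else 0)" for k
  define p where "p k = (if k \<in> Ogood then PP b k else 0)" for k
  have O [measurable]: "Ogood \<in> sets borel" using Ogood_open by (rule borel_open)
  have [measurable]: "th \<in> borel_measurable borel"
    unfolding th_def by (intro borel_measurable_continuous_on_if O theta_slice_continuous continuous_on_const)
  have [measurable]: "p \<in> borel_measurable borel"
    unfolding p_def by (intro borel_measurable_continuous_on_if O PP_slice_continuous continuous_on_const)
  have "Wop E F b g = (\<lambda>k. if k \<in> Ogood then of_real (exp (p k)) * g (th k) else 0)"
    by (auto simp: fun_eq_iff Wop_good Wop_bad th_def p_def)
  also have "\<dots> \<in> borel_measurable borel" by measurable
  finally show ?thesis .
qed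

text \<open>A preimage under theta at time b is an image under theta at time -b, and differentiable
  maps preserve null sets.\<close>

lemma theta_preimage_negligible:
  assumes "negligible N"
  shows "negligible {k \<in> Ogood. theta b k \<in> N}"
proof -
  have "negligible (theta (- b) ` (N \<inter> Ogood))"
  proof (rule negligible_differentiable_image_negligible)
    show "negligible (N \<inter> Ogood)" using assms by (rule negligible_subset) blast
    show "theta (- b) differentiable_on N \<inter> Ogood"
      unfolding differentiable_on_def
      using slice_has_derivative[OF theta_has_derivative] differentiableI has_derivative_at_withinI by blast
  qed simp
  moreover have "{k \<in> Ogood. theta b k \<in> N} \<subseteq> theta (- b) ` (N \<inter> Ogood)"
  proof
    fix k assume k: "k \<in> {k \<in> Ogood. theta b k \<in> N}"
    then have "k = theta (- b) (theta b k)" using theta_add[of k "- b" b] by (simp add: theta_0)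
    with k show "k \<in> theta (- b) ` (N \<inter> Ogood)" using theta_good by blast
  qed
  ultimately show ?thesis by (rule negligible_subset)
qed

lemma Dset_approx_sequence:
  assumes "g \<in> L2T"
  obtains \<phi> where "\<And>n. \<phi> n \<in> Dset E F" "(\<lambda>n. l2norm (\<lambda>k. \<phi> n k - g k)) \<longlonglongrightarrow> 0"
proof -
  have "\<exists>\<phi>. \<phi> \<in> Dset E F \<and> l2norm (\<lambda>k. \<phi> k - g k) < 1 / real (Suc n)" for n
    using Dset_dense[OF assms, of "1 / real (Suc n)"] by auto
  then obtain \<phi> where \<phi>: "\<And>n. \<phi> n \<in> Dset E F" "\<And>n. l2norm (\<lambda>k. \<phi> n k - g k) < 1 / real (Suc n)" by metis
  have "(\<lambda>n. l2norm (\<lambda>k. \<phi> n k - g k)) \<longlonglongrightarrow> 0"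
    by (rule tendsto_sandwich[OF _ _ tendsto_const LIMSEQ_Suc[OF lim_1_over_n]])
      (auto intro!: always_eventually l2norm_nonneg less_imp_le[OF \<phi>(2)] simp del: of_nat_Suc)
  with \<phi>(1) show thesis by (rule that)
qed

text \<open>Almost everywhere convergence of a subsequence from the domain survives the transport,
  because the exceptional set is periodic, null, and pulled back to a null set. Fatou then bounds
  the norm by the limit of the isometric norms. This yields one inequality only; equality comes from
  the inverse.\<close>

lemma Wop_contraction:
  assumes g: "g \<in> L2T"
  shows "Wop E F b g \<in> L2T" "l2norm (Wop E F b g) \<le> l2norm g"
proof -
  obtain \<phi>0 where \<phi>0: "\<And>n. \<phi>0 n \<in> Dset E F" "(\<lambda>n. l2norm (\<lambda>k. \<phi>0 n k - g k)) \<longlonglongrightarrow> 0"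
    by (rule Dset_approx_sequence[OF g]) blast
  obtain r :: "nat \<Rightarrow> nat" where r: "strict_mono r" "AE k in TM. (\<lambda>n. \<phi>0 (r n) k) \<longlonglongrightarrow> g k"
    by (rule l2_AE_subseq[OF Dset_L2T[OF \<phi>0(1)] g \<phi>0(2)]) blast
  define \<phi> where "\<phi> n = \<phi>0 (r n)" for n
  have \<phi>D: "\<phi> n \<in> Dset E F" for n by (simp add: \<phi>_def \<phi>0(1))
  have \<phi>L: "\<phi> n \<in> L2T" for n by (rule Dset_L2T[OF \<phi>D])
  have \<phi>l: "(\<lambda>n. l2norm (\<lambda>k. \<phi> n k - g k)) \<longlonglongrightarrow> 0"
    using LIMSEQ_subseq_LIMSEQ[OF \<phi>0(2) r(1)] by (simp add: o_def \<phi>_def)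
  have nl: "(\<lambda>n. l2norm (\<phi> n)) \<longlonglongrightarrow> l2norm g"
  proof (rule LIM_zero_cancel)
    show "(\<lambda>n. l2norm (\<phi> n) - l2norm g) \<longlonglongrightarrow> 0"
      by (rule tendsto_0_le[OF \<phi>l, where K = 1])
        (auto intro!: always_eventually order_trans[OF l2norm_diff_abs_le[OF \<phi>L g]] simp: l2norm_nonneg)
  qed
  have gp: "periodic_T g" and gm: "g \<in> borel_measurable borel" using g by (auto simp: L2T_iff)
  have \<phi>p: "periodic_T (\<phi> n)" for n using \<phi>L by (auto simp: L2T_iff)
  have neg: "negligible {k. \<not> (\<lambda>n. \<phi> n k) \<longlonglongrightarrow> g k}"
  proof (rule periodic_AE_TM_negligible)
    show "AE k in TM. (\<lambda>n. \<phi> n k) \<longlonglongrightarrow> g k" using r(2) by (simp add: \<phi>_def)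
    show "periodic_T (\<lambda>k. (\<lambda>n. \<phi> n k) \<longlonglongrightarrow> g k)" using gp \<phi>p by (simp add: periodic_T_def)
  qed
  have conv: "AE k in TM. (\<lambda>n. Wop E F b (\<phi> n) k) \<longlonglongrightarrow> Wop E F b g k"
    using negligible_AE_TM[OF theta_preimage_negligible[OF neg, of b]]
  proof eventually_elim
    fix k assume k: "k \<notin> {k \<in> Ogood. theta b k \<in> {k. \<not> (\<lambda>n. \<phi> n k) \<longlonglongrightarrow> g k}}"
    show "(\<lambda>n. Wop E F b (\<phi> n) k) \<longlonglongrightarrow> Wop E F b g k"
    proof (cases "k \<in> Ogood")
      case True
      with k have "(\<lambda>n. \<phi> n (theta b k)) \<longlonglongrightarrow> g (theta b k)" by blast
      then show ?thesis unfolding Wop_good[OF True] by (rule tendsto_mult_left)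
    qed (simp add: Wop_bad)
  qed
  have "(\<integral>\<^sup>+k. ennreal ((cmod (Wop E F b g k))\<^sup>2) \<partial>TM) = (\<integral>\<^sup>+k. liminf (\<lambda>n. ennreal ((cmod (Wop E F b (\<phi> n) k))\<^sup>2)) \<partial>TM)"
  proof (rule nn_integral_cong_AE)
    show "AE k in TM. ennreal ((cmod (Wop E F b g k))\<^sup>2) = liminf (\<lambda>n. ennreal ((cmod (Wop E F b (\<phi> n) k))\<^sup>2))"
      using conv
    proof eventually_elim
      fix k assume "(\<lambda>n. Wop E F b (\<phi> n) k) \<longlonglongrightarrow> Wop E F b g k"
      then have "(\<lambda>n. ennreal ((cmod (Wop E F b (\<phi> n) k))\<^sup>2)) \<longlonglongrightarrow> ennreal ((cmod (Wop E F b g k))\<^sup>2)"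
        by (intro tendsto_ennrealI tendsto_power tendsto_norm)
      then show "ennreal ((cmod (Wop E F b g k))\<^sup>2) = liminf (\<lambda>n. ennreal ((cmod (Wop E F b (\<phi> n) k))\<^sup>2))"
        using lim_imp_Liminf[OF sequentially_bot] by metis
    qed
  qed
  also have "\<dots> \<le> liminf (\<lambda>n. \<integral>\<^sup>+k. ennreal ((cmod (Wop E F b (\<phi> n) k))\<^sup>2) \<partial>TM)"
  proof (rule nn_integral_liminf)
    fix n
    have [measurable]: "Wop E F b (\<phi> n) \<in> borel_measurable TM"
      using Wop_measurable \<phi>L by (intro TM_measurable) (auto simp: L2T_iff)
    show "(\<lambda>k. ennreal ((cmod (Wop E F b (\<phi> n) k))\<^sup>2)) \<in> borel_measurable TM" by measurable
  qed
  also have "(\<lambda>n. \<integral>\<^sup>+k. ennreal ((cmod (Wop E F b (\<phi> n) k))\<^sup>2) \<partial>TM) = (\<lambda>n. ennreal ((l2norm (\<phi> n))\<^sup>2))"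
  proof
    fix n
    have "\<phi> n \<in> K1" by (rule Dset_K1[OF \<phi>D])
    then show "(\<integral>\<^sup>+k. ennreal ((cmod (Wop E F b (\<phi> n) k))\<^sup>2) \<partial>TM) = ennreal ((l2norm (\<phi> n))\<^sup>2)"
      by (subst L2T_nn_integral) (auto simp: Wop_isometry_K1 intro: K1_L2T Wop_K1)
  qed
  also have "liminf (\<lambda>n. ennreal ((l2norm (\<phi> n))\<^sup>2)) = ennreal ((l2norm g)\<^sup>2)"
    by (intro lim_imp_Liminf sequentially_bot tendsto_ennrealI tendsto_power nl)
  finally have le: "(\<integral>\<^sup>+k. ennreal ((cmod (Wop E F b g k))\<^sup>2) \<partial>TM) \<le> ennreal ((l2norm g)\<^sup>2)" .
  show "Wop E F b g \<in> L2T" "l2norm (Wop E F b g) \<le> l2norm g"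
    by (rule L2T_nn_integral_bound[OF Wop_periodic[OF gp] Wop_measurable[OF gm] le l2norm_nonneg])+
qed

lemma Wop_0_aeq: "aeq (Wop E F 0 g) g"
  unfolding aeq_TM using Ogood_AE by eventually_elim (rule Wop_0)

lemma Wop_inverse_aeq: "aeq (Wop E F (- b) (Wop E F b g)) g"
  using Wop_0_aeq[of g] Wop_add[of "- b" b g] by (simp add: aeq_TM)

text \<open>Both W_b and its inverse W_{-b} are contractions.\<close>

lemma Wop_isometry:
  assumes g: "g \<in> L2T"
  shows "l2norm (Wop E F b g) = l2norm g"
proof (rule antisym[OF Wop_contraction(2)[OF g]])
  have "l2norm g = l2norm (Wop E F (- b) (Wop E F b g))"
    using g Wop_inverse_aeq[of b g] Wop_contraction(1) by (intro l2norm_cong) (auto intro: aeq_sym)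
  also have "\<dots> \<le> l2norm (Wop E F b g)" using g Wop_contraction by blast
  finally show "l2norm g \<le> l2norm (Wop E F b g)" .
qed

lemma Wop_scale: "Wop E F b (\<lambda>k. c * f k) k = c * Wop E F b f k"
  using Wop_lin[of b c f "\<lambda>_. 0" k] Wop_lin[of b "-1" "\<lambda>_. 0" "\<lambda>_. 0" k] by simp

lemma Wop_diff: "Wop E F b (\<lambda>k. f k - g k) k = Wop E F b f k - Wop E F b g k"
  using Wop_lin[of b "-1" g f k] by simp

lemma Wop_sum: "Wop E F b (\<lambda>k. f k + g k) k = Wop E F b f k + Wop E F b g k"
  using Wop_lin[of b 1 f g k] by simp

text \<open>Polarisation: the norm of f + g gives the real part of the inner product, and replacing
  f by i f gives the imaginary part.\<close>

lemma Wop_inner: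
  assumes f: "f \<in> L2T" and g: "g \<in> L2T"
  shows "l2inner (Wop E F b f) (Wop E F b g) = l2inner f g"
proof -
  have re: "Re (l2inner (Wop E F b f) (Wop E F b g)) = Re (l2inner f g)" if f: "f \<in> L2T" for f
  proof -
    have "(l2norm (\<lambda>k. Wop E F b f k + Wop E F b g k))\<^sup>2 = (l2norm (\<lambda>k. f k + g k))\<^sup>2"
      using Wop_isometry[OF L2T_add[OF f g], of b] by (simp add: Wop_sum[abs_def])
    then show ?thesis
      using l2norm_power2_add[OF f g] l2norm_power2_add[OF Wop_contraction(1)[OF f] Wop_contraction(1)[OF g]]
      by (simp add: Wop_isometry f g)
  qed
  have "Re (l2inner (Wop E F b (\<lambda>k. \<i> * f k)) (Wop E F b g)) = Re (l2inner (\<lambda>k. \<i> * f k) g)"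
    by (rule re[OF L2T_scale[OF f]])
  then have "Im (l2inner (Wop E F b f) (Wop E F b g)) = Im (l2inner f g)"
    by (simp add: Wop_scale[abs_def] l2inner_scale_left Wop_contraction f g)
  with re[OF f] show ?thesis by (rule complex_eqI)
qed

lemma Wop_unitary: "unitary_L2 (Wop E F b)"
  unfolding unitary_L2_def
proof (intro conjI ballI allI impI)
  fix g h :: "real^'d \<Rightarrow> complex" assume g: "g \<in> L2T" and h: "h \<in> L2T"
  show "aeq (Wop E F b g) (Wop E F b h)" if "aeq g h"
  proof -
    have d: "(\<lambda>k. g k - h k) \<in> L2T" by (rule L2T_diff[OF g h])
    have "aeq (\<lambda>k. g k - h k) (\<lambda>_. 0)" using that by (auto simp: aeq_TM)
    then have "l2norm (\<lambda>k. g k - h k) = 0" using l2norm_cong[OF d L2T_zero] by (simp add: l2norm_zero)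
    then have "l2norm (Wop E F b (\<lambda>k. g k - h k)) = 0" by (simp add: Wop_isometry[OF d])
    from l2norm_zero_aeq[OF Wop_contraction(1)[OF d] this] show ?thesis by (auto simp: aeq_TM Wop_diff)
  qed
  show "aeq (Wop E F b (\<lambda>k. c * g k + h k)) (\<lambda>k. c * Wop E F b g k + Wop E F b h k)" for c
    by (rule aeq_refl) (rule Wop_lin)
  show "l2inner (Wop E F b g) (Wop E F b h) = l2inner g h" by (rule Wop_inner[OF g h])
next
  fix g :: "real^'d \<Rightarrow> complex" assume g: "g \<in> L2T"
  show "Wop E F b g \<in> L2T" by (rule Wop_contraction[OF g])
  show "\<exists>f\<in>L2T. aeq (Wop E F b f) g"
    using Wop_inverse_aeq[of "- b" g] Wop_contraction(1)[OF g, of "- b"] by auto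
qed

lemma Wop_strongly_continuous:
  assumes g: "g \<in> L2T"
  shows "((\<lambda>b. l2norm (\<lambda>k. Wop E F b g k - Wop E F b0 g k)) \<longlongrightarrow> 0) (at b0)"
proof (rule tendstoI)
  fix \<epsilon> :: real assume \<epsilon>: "\<epsilon> > 0"
  then obtain \<phi> where \<phi>: "\<phi> \<in> Dset E F" "l2norm (\<lambda>k. \<phi> k - g k) < \<epsilon> / 3" using Dset_dense[OF g, of "\<epsilon> / 3"] by auto
  have \<phi>L: "\<phi> \<in> L2T" by (rule Dset_L2T[OF \<phi>(1)])
  have c: "l2norm (\<lambda>k. Wop E F b \<phi> k - Wop E F b g k) < \<epsilon> / 3" for b
    using Wop_isometry[OF L2T_diff[OF \<phi>L g], of b] \<phi>(2) by (simp add: Wop_diff[abs_def])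
  have "((\<lambda>b. l2norm (\<lambda>k. Wop E F b \<phi> k - Wop E F b0 \<phi> k)) \<longlongrightarrow> 0) (at b0)"
    by (rule Wop_K0_strongly_continuous[OF K1_K0[OF Dset_K1[OF \<phi>(1)]]])
  then have "\<forall>\<^sub>F b in at b0. l2norm (\<lambda>k. Wop E F b \<phi> k - Wop E F b0 \<phi> k) < \<epsilon> / 3" using \<epsilon> by (intro order_tendstoD) auto
  then show "\<forall>\<^sub>F b in at b0. dist (l2norm (\<lambda>k. Wop E F b g k - Wop E F b0 g k)) 0 < \<epsilon>"
  proof eventually_elim
    fix b assume m: "l2norm (\<lambda>k. Wop E F b \<phi> k - Wop E F b0 \<phi> k) < \<epsilon> / 3"
    note L = Wop_contraction(1)[OF g] Wop_contraction(1)[OF \<phi>L]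
    show "dist (l2norm (\<lambda>k. Wop E F b g k - Wop E F b0 g k)) 0 < \<epsilon>"
      using l2norm_diff_triangle[OF L(1)[of b] L(2)[of b] L(1)[of b0]] l2norm_diff_triangle[OF L(2)[of b] L(2)[of b0] L(1)[of b0]]
        c[of b] c[of b0] m l2norm_diff_commute[of "Wop E F b \<phi>" "Wop E F b g"]
      by (simp add: l2norm_nonneg)
  qed
qed

theorem Wop_group: "strongly_continuous_unitary_group (Wop E F)"
  unfolding strongly_continuous_unitary_group_def
  using Wop_unitary Wop_0_aeq Wop_strongly_continuous Wop_add by (auto intro: aeq_refl)

end

section \<open>Self-adjointness of the generator\<close>

lemma l2inner_tendsto_left:
  assumes f: "\<And>b. f b \<in> L2T" and h: "h \<in> L2T" and \<psi>: "\<psi> \<in> L2T" and lim: "((\<lambda>b. l2norm (\<lambda>k. f b k - h k)) \<longlongrightarrow> 0) X"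
  shows "((\<lambda>b. l2inner (f b) \<psi>) \<longlongrightarrow> l2inner h \<psi>) X"
proof (rule LIM_zero_cancel)
  show "((\<lambda>b. l2inner (f b) \<psi> - l2inner h \<psi>) \<longlongrightarrow> 0) X"
  proof (rule tendsto_0_le[OF lim, where K = "l2norm \<psi>"], rule always_eventually, rule allI)
    fix b
    show "norm (l2inner (f b) \<psi> - l2inner h \<psi>) \<le> norm (l2norm (\<lambda>k. f b k - h k)) * l2norm \<psi>"
      using l2_cauchy_schwarz[OF L2T_diff[OF f h] \<psi>, of b] l2inner_diff_left[OF \<psi> f h, of b] by (simp add: l2norm_nonneg)
  qed
qed

lemma l2inner_tendsto_right:
  assumes "\<And>b. f b \<in> L2T" "h \<in> L2T" "\<psi> \<in> L2T" "((\<lambda>b. l2norm (\<lambda>k. f b k - h k)) \<longlongrightarrow> 0) X"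
  shows "((\<lambda>b. l2inner \<psi> (f b)) \<longlongrightarrow> l2inner \<psi> h) X"
  using tendsto_cnj[OF l2inner_tendsto_left[OF assms]] by (simp add: l2inner_cnj[of \<psi>])

lemma L2T_sum:
  assumes "finite A" "\<And>j. j \<in> A \<Longrightarrow> f j \<in> L2T"
  shows "(\<lambda>k. \<Sum>j\<in>A. f j k) \<in> L2T" "l2norm (\<lambda>k. \<Sum>j\<in>A. f j k) \<le> (\<Sum>j\<in>A. l2norm (f j))"
proof -
  have "(\<lambda>k. \<Sum>j\<in>A. f j k) \<in> L2T \<and> l2norm (\<lambda>k. \<Sum>j\<in>A. f j k) \<le> (\<Sum>j\<in>A. l2norm (f j))"
    using assms
  proof (induction A rule: finite_induct)
    case empty
    then show ?case by (simp add: L2T_zero l2norm_zero)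
  next
    case (insert a A)
    then have "f a \<in> L2T" "(\<lambda>k. \<Sum>j\<in>A. f j k) \<in> L2T" "l2norm (\<lambda>k. \<Sum>j\<in>A. f j k) \<le> (\<Sum>j\<in>A. l2norm (f j))" by auto
    then show ?case using insert.hyps L2T_add[of "f a" "\<lambda>k. \<Sum>j\<in>A. f j k"] l2norm_triangle[of "f a" "\<lambda>k. \<Sum>j\<in>A. f j k"] by simp
  qed
  then show "(\<lambda>k. \<Sum>j\<in>A. f j k) \<in> L2T" "l2norm (\<lambda>k. \<Sum>j\<in>A. f j k) \<le> (\<Sum>j\<in>A. l2norm (f j))" by auto
qed

lemma filterlim_uminus_at_0: "filterlim (\<lambda>b::real. - b) (at 0) (at 0)"
proof (rule filterlim_atI)
  show "((\<lambda>b::real. - b) \<longlongrightarrow> 0) (at 0)" by (rule tendsto_eq_intros | simp)+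
  show "\<forall>\<^sub>F b::real in at 0. - b \<noteq> 0" by (simp add: eventually_at_filter)
qed

context morse_band
begin

abbreviation U :: "real \<Rightarrow> (real^'d \<Rightarrow> complex) \<Rightarrow> real^'d \<Rightarrow> complex" where
  "U \<equiv> Wop E F"

definition quot :: "real \<Rightarrow> (real^'d \<Rightarrow> complex) \<Rightarrow> real^'d \<Rightarrow> complex" where
  "quot b g k = (U b g k - g k) / (\<i> * of_real b)"

lemma generator_iff:
  "generator U g h \<longleftrightarrow> g \<in> L2T \<and> h \<in> L2T \<and> ((\<lambda>b. l2norm (\<lambda>k. quot b g k - h k)) \<longlongrightarrow> 0) (at 0)"
  by (simp add: generator_def quot_def)

lemma quot_L2T: "g \<in> L2T \<Longrightarrow> quot b g \<in> L2T"
  unfolding quot_def by (intro L2T_divide L2T_diff Wop_contraction)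

lemma l2inner_U_left:
  assumes "f \<in> L2T" "g \<in> L2T"
  shows "l2inner (U b f) g = l2inner f (U (- b) g)"
proof -
  have "l2inner (U b f) g = l2inner (U (- b) (U b f)) (U (- b) g)"
    using Wop_inner[OF Wop_contraction(1)[OF assms(1), of b] assms(2), of "- b"] by simp
  also have "\<dots> = l2inner f (U (- b) g)"
    using assms by (intro l2inner_cong Wop_inverse_aeq Wop_contraction(1)) (auto simp: aeq_TM)
  finally show ?thesis .
qed

text \<open>The adjoint of U_b is U_{-b}, and the conjugate of 1/(i b) is 1/(i (-b)), so difference
  quotients pass to the other factor with b reversed.\<close>

lemma quot_symmetric:
  assumes g: "g \<in> L2T" and \<psi>: "\<psi> \<in> L2T"
  shows "l2inner (quot b g) \<psi> = l2inner g (quot (- b) \<psi>)"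
proof -
  have q: "quot b g = (\<lambda>k. inverse (\<i> * of_real b) * (U b g k - g k))" for b g
    by (simp add: quot_def fun_eq_iff field_simps)
  have c: "cnj (inverse (\<i> * of_real b)) = inverse (\<i> * of_real (- b))"
    by simp
  have "l2inner (quot b g) \<psi> = cnj (inverse (\<i> * of_real b)) * l2inner (\<lambda>k. U b g k - g k) \<psi>"
    unfolding q by (intro l2inner_scale_left L2T_diff Wop_contraction g \<psi>)
  also have "l2inner (\<lambda>k. U b g k - g k) \<psi> = l2inner (U b g) \<psi> - l2inner g \<psi>"
    by (intro l2inner_diff_left Wop_contraction g \<psi>)
  also have "\<dots> = l2inner g (U (- b) \<psi>) - l2inner g \<psi>" by (simp add: l2inner_U_left g \<psi>)
  also have "\<dots> = l2inner g (\<lambda>k. U (- b) \<psi> k - \<psi> k)"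
    by (intro l2inner_diff_right[symmetric] Wop_contraction g \<psi>)
  also have "cnj (inverse (\<i> * of_real b)) * l2inner g (\<lambda>k. U (- b) \<psi> k - \<psi> k) = l2inner g (quot (- b) \<psi>)"
    unfolding q c by (intro l2inner_scale_right[symmetric] L2T_diff Wop_contraction g \<psi>)
  finally show ?thesis .
qed

lemma generator_symmetric:
  assumes "generator U g h" "generator U \<psi> \<eta>"
  shows "l2inner h \<psi> = l2inner g \<eta>"
proof (rule tendsto_unique)
  have L: "g \<in> L2T" "h \<in> L2T" "\<psi> \<in> L2T" "\<eta> \<in> L2T" using assms by (auto simp: generator_iff)
  show "((\<lambda>b. l2inner (quot b g) \<psi>) \<longlongrightarrow> l2inner h \<psi>) (at 0)"
    using assms(1) by (intro l2inner_tendsto_left quot_L2T L) (simp add: generator_iff)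
  have "((\<lambda>b. l2inner g (quot b \<psi>)) \<longlongrightarrow> l2inner g \<eta>) (at 0)"
    using assms(2) by (intro l2inner_tendsto_right quot_L2T L) (simp add: generator_iff)
  from filterlim_compose[OF this filterlim_uminus_at_0]
  show "((\<lambda>b. l2inner (quot b g) \<psi>) \<longlongrightarrow> l2inner g \<eta>) (at 0)" by (simp add: quot_symmetric L)
qed simp

lemma generator_U:
  assumes "generator U f h"
  shows "generator U (U s f) (U s h)"
proof -
  have L: "f \<in> L2T" "h \<in> L2T" using assms by (auto simp: generator_iff)
  have "quot b (U s f) k - U s h k = U s (\<lambda>k. quot b f k - h k) k" for b k
  proof -
    have "U b (U s f) k = U s (U b f) k" using Wop_add[of b s f k] Wop_add[of s b f k] by (simp add: add.commute)
    then show ?thesis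
      using Wop_scale[of s "inverse (\<i> * of_real b)" "\<lambda>k. U b f k - f k" k]
      by (simp add: Wop_diff quot_def[abs_def] divide_inverse mult.commute)
  qed
  then have "l2norm (\<lambda>k. quot b (U s f) k - U s h k) = l2norm (\<lambda>k. quot b f k - h k)" for b
    using Wop_isometry[OF L2T_diff[OF quot_L2T[OF L(1)] L(2)], of s b] by simp
  then show ?thesis using assms by (simp add: generator_iff Wop_contraction)
qed

lemma generator_unique:
  assumes "generator U f h" "generator U f h'"
  shows "l2norm (\<lambda>k. h k - h' k) = 0"
proof -
  have L: "f \<in> L2T" "h \<in> L2T" "h' \<in> L2T" using assms by (auto simp: generator_iff)
  have "((\<lambda>b. l2norm (\<lambda>k. quot b f k - h k) + l2norm (\<lambda>k. quot b f k - h' k)) \<longlongrightarrow> 0 + 0) (at 0)"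
    using assms by (intro tendsto_add) (auto simp: generator_iff)
  moreover have "l2norm (\<lambda>k. h k - h' k) \<le> l2norm (\<lambda>k. quot b f k - h k) + l2norm (\<lambda>k. quot b f k - h' k)" for b
    using l2norm_diff_triangle[OF L(2) quot_L2T[OF L(1)] L(3), of b] l2norm_diff_commute[of h "quot b f"] by simp
  ultimately have "l2norm (\<lambda>k. h k - h' k) \<le> 0 + 0"
    by (intro tendsto_lowerbound[of _ "0 + 0" "at 0"]) auto
  then show ?thesis using l2norm_nonneg[of "\<lambda>k. h k - h' k"] by simp
qed

text \<open>Test elements approximating v itself turn the hypothesis into |v|^2 <= c |v|.\<close>

lemma l2norm_le_by_testing:
  assumes v: "v \<in> L2T" and c: "c \<ge> 0" and le: "\<And>g. g \<in> Dset E F \<Longrightarrow> cmod (l2inner g v) \<le> c * l2norm g"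
  shows "l2norm v \<le> c"
proof -
  obtain \<phi> where \<phi>: "\<And>n. \<phi> n \<in> Dset E F" "(\<lambda>n. l2norm (\<lambda>k. \<phi> n k - v k)) \<longlonglongrightarrow> 0"
    by (rule Dset_approx_sequence[OF v]) blast
  note L = Dset_L2T[OF \<phi>(1)]
  have "(\<lambda>n. l2norm (\<phi> n) - l2norm v) \<longlonglongrightarrow> 0"
    by (rule tendsto_0_le[OF \<phi>(2), where K = 1])
      (auto intro!: always_eventually order_trans[OF l2norm_diff_abs_le[OF L v]] simp: l2norm_nonneg)
  then have "(\<lambda>n. l2norm (\<phi> n)) \<longlonglongrightarrow> l2norm v" by (rule LIM_zero_cancel)
  then have 1: "(\<lambda>n. c * l2norm (\<phi> n)) \<longlonglongrightarrow> c * l2norm v" by (rule tendsto_mult_left)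
  have 2: "(\<lambda>n. cmod (l2inner (\<phi> n) v)) \<longlonglongrightarrow> cmod (l2inner v v)"
    by (intro tendsto_norm l2inner_tendsto_left L v \<phi>(2))
  have "cmod (l2inner v v) \<le> c * l2norm v"
    by (rule LIMSEQ_le[OF 2 1]) (use le[OF \<phi>(1)] in auto)
  then have "l2norm v * l2norm v \<le> c * l2norm v"
    unfolding l2inner_self norm_of_real by (simp add: power2_eq_square)
  then show ?thesis using c l2norm_nonneg[of v] by (cases "l2norm v = 0") auto
qed

text \<open>Nothing is known yet about differentiability of the orbit of \<psi>. Moving the group
  onto g keeps it in \<open>K1\<close>, hence in the domain of the generator, where the duality
  hypothesis can be applied at every time b.\<close>

lemma U_orbit_inner_derivative:
  assumes g: "g \<in> K1" and \<psi>: "\<psi> \<in> L2T" and \<eta>: "\<eta> \<in> L2T"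
    and dual: "\<And>g h. generator U g h \<Longrightarrow> l2inner h \<psi> = l2inner g \<eta>"
  shows "((\<lambda>b. l2inner g (U b \<psi>)) has_vector_derivative \<i> * l2inner g (U b \<eta>)) (at b)"
proof -
  have gL: "g \<in> L2T" by (rule K1_L2T[OF g])
  define gb where "gb = U (- b) g"
  have gb: "gb \<in> K1" unfolding gb_def by (rule Wop_K1[OF g])
  have gbL: "gb \<in> L2T" by (rule K1_L2T[OF gb])
  have gen: "generator U gb (Aexpr E F gb)" by (rule generator_on_K1[OF gb])
  have "l2inner (Aexpr E F gb) \<psi> = l2inner gb \<eta>" by (rule dual[OF gen])
  also have "\<dots> = l2inner g (U b \<eta>)" unfolding gb_def using l2inner_U_left[OF gL \<eta>, of "- b"] by simp
  finally have val: "l2inner (Aexpr E F gb) \<psi> = l2inner g (U b \<eta>)" .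
  have flip: "l2inner g (U t \<psi>) = l2inner (U (- t) g) \<psi>" for t using l2inner_U_left[OF gL \<psi>, of "- t"] by simp
  have "((\<lambda>t. l2inner (quot t gb) \<psi>) \<longlongrightarrow> l2inner g (U b \<eta>)) (at 0)"
    unfolding val[symmetric] using gen by (intro l2inner_tendsto_left quot_L2T gbL \<psi>) (auto simp: generator_iff)
  from filterlim_compose[OF this filterlim_uminus_at_0]
  have l: "((\<lambda>t. \<i> * l2inner (quot (- t) gb) \<psi>) \<longlongrightarrow> \<i> * l2inner g (U b \<eta>)) (at 0)" by (rule tendsto_mult_left)
  have q: "\<i> * l2inner (quot (- t) gb) \<psi> = (l2inner g (U (b + t) \<psi>) - l2inner g (U b \<psi>)) /\<^sub>R t" for t
  proof -
    have e: "\<i> * l2inner (quot (- t) gb) \<psi> = l2inner (\<lambda>k. - \<i> * quot (- t) gb k) \<psi>"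
      by (subst l2inner_scale_left[OF \<psi> quot_L2T[OF gbL]]) simp
    have "(\<lambda>k. - \<i> * quot (- t) gb k) = (\<lambda>k. of_real (inverse t) * (U (- (b + t)) g k - gb k))"
    proof
      fix k
      have "U (- t) gb k = U (- (b + t)) g k" unfolding gb_def using Wop_add[of "- t" "- b" g k] by (simp add: add.commute)
      moreover have "- \<i> * (D / (\<i> * of_real (- t))) = of_real (inverse t) * D" for D
        using mult_divide_mult_cancel_left[of \<i> D "of_real t"] by (simp add: divide_inverse mult.commute mult.left_commute)
      ultimately show "- \<i> * quot (- t) gb k = of_real (inverse t) * (U (- (b + t)) g k - gb k)"
        by (simp only: quot_def)
    qed
    then have "\<i> * l2inner (quot (- t) gb) \<psi> = of_real (inverse t) * (l2inner (U (- (b + t)) g) \<psi> - l2inner gb \<psi>)"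
      unfolding e using l2inner_scale_left[OF \<psi> L2T_diff[OF Wop_contraction(1)[OF gL] gbL], of "of_real (inverse t)" "- (b + t)"]
        l2inner_diff_left[OF \<psi> Wop_contraction(1)[OF gL] gbL, of "- (b + t)"] by simp
    then show ?thesis unfolding flip gb_def by (simp add: scaleR_conv_of_real)
  qed
  show ?thesis
    unfolding has_vector_derivative_def has_derivative_at
  proof (intro conjI bounded_linear_scaleR_left)
    have "((\<lambda>t. norm ((l2inner g (U (b + t) \<psi>) - l2inner g (U b \<psi>)) /\<^sub>R t - \<i> * l2inner g (U b \<eta>))) \<longlongrightarrow> 0) (at 0)"
      using l unfolding q by (intro tendsto_norm_zero LIM_zero)
    moreover have "\<forall>\<^sub>F t in at 0. norm ((l2inner g (U (b + t) \<psi>) - l2inner g (U b \<psi>)) /\<^sub>R t - \<i> * l2inner g (U b \<eta>))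
       = norm (l2inner g (U (b + t) \<psi>) - l2inner g (U b \<psi>) - t *\<^sub>R (\<i> * l2inner g (U b \<eta>))) / norm t"
      unfolding eventually_at_filter
    proof (intro always_eventually allI impI)
      fix t :: real assume t: "t \<noteq> 0"
      define D where "D = l2inner g (U (b + t) \<psi>) - l2inner g (U b \<psi>)"
      define w where "w = \<i> * l2inner g (U b \<eta>)"
      have "D /\<^sub>R t - w = (D - t *\<^sub>R w) /\<^sub>R t" using t by (simp add: scaleR_right_diff_distrib)
      then show "norm ((l2inner g (U (b + t) \<psi>) - l2inner g (U b \<psi>)) /\<^sub>R t - \<i> * l2inner g (U b \<eta>))
       = norm (l2inner g (U (b + t) \<psi>) - l2inner g (U b \<psi>) - t *\<^sub>R (\<i> * l2inner g (U b \<eta>))) / norm t"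
        unfolding D_def[symmetric] w_def[symmetric] by (simp add: divide_inverse mult.commute)
    qed
    ultimately show "(\<lambda>t. norm (l2inner g (U (b + t) \<psi>) - l2inner g (U b \<psi>) - t *\<^sub>R (\<i> * l2inner g (U b \<eta>))) / norm t) \<midarrow>0\<rightarrow> 0"
      by (simp add: tendsto_cong)
  qed
qed

text \<open>A weak form of U_b \<psi> - \<psi> = i times the integral of U_s \<eta> from 0 to b.
  Tested against g, the difference from i b \<eta> has derivative i <g, U_s \<eta> - \<eta>>, which
  the mean value inequality integrates; taking all g in the domain recovers the norm.\<close>

lemma U_increment_estimate:
  assumes \<psi>: "\<psi> \<in> L2T" and \<eta>: "\<eta> \<in> L2T"
    and dual: "\<And>g h. generator U g h \<Longrightarrow> l2inner h \<psi> = l2inner g \<eta>"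
    and \<epsilon>: "\<epsilon> \<ge> 0" and near: "\<And>s. \<bar>s\<bar> \<le> \<bar>b\<bar> \<Longrightarrow> l2norm (\<lambda>k. U s \<eta> k - \<eta> k) \<le> \<epsilon>"
  shows "l2norm (\<lambda>k. (U b \<psi> k - \<psi> k) - \<i> * of_real b * \<eta> k) \<le> \<epsilon> * \<bar>b\<bar>"
proof (rule l2norm_le_by_testing)
  note UL = Wop_contraction(1)[OF \<psi>] Wop_contraction(1)[OF \<eta>]
  show "(\<lambda>k. U b \<psi> k - \<psi> k - \<i> * of_real b * \<eta> k) \<in> L2T" by (intro L2T_diff L2T_scale UL \<psi> \<eta>)
  show "0 \<le> \<epsilon> * \<bar>b\<bar>" using \<epsilon> by simp
  fix g assume gD: "g \<in> Dset E F"
  have g: "g \<in> K1" by (rule Dset_K1[OF gD])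
  have gL: "g \<in> L2T" by (rule K1_L2T[OF g])
  define D where "D s = l2inner g (U s \<psi>) - s *\<^sub>R (\<i> * l2inner g \<eta>)" for s
  define S where "S = {- \<bar>b\<bar>..\<bar>b\<bar>}"
  have der: "(D has_derivative (\<lambda>t. t *\<^sub>R (\<i> * l2inner g (U s \<eta>)) - t *\<^sub>R (\<i> * l2inner g \<eta>))) (at s within S)" for s
  proof -
    have "((\<lambda>s. l2inner g (U s \<psi>)) has_derivative (\<lambda>t. t *\<^sub>R (\<i> * l2inner g (U s \<eta>)))) (at s within S)"
      using U_orbit_inner_derivative[OF g \<psi> \<eta> dual, of s] unfolding has_vector_derivative_def by (rule has_derivative_at_withinI)
    then show ?thesis unfolding D_def
      by (intro has_derivative_diff has_derivative_scaleR_left has_derivative_ident)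
  qed
  have on: "onorm (\<lambda>t. t *\<^sub>R (\<i> * l2inner g (U s \<eta>)) - t *\<^sub>R (\<i> * l2inner g \<eta>)) \<le> \<epsilon> * l2norm g" if s: "s \<in> S" for s
  proof (rule onorm_bound)
    show "0 \<le> \<epsilon> * l2norm g" using \<epsilon> by (simp add: l2norm_nonneg)
    fix t :: real
    have "cmod (l2inner g (U s \<eta>) - l2inner g \<eta>) \<le> l2norm g * l2norm (\<lambda>k. U s \<eta> k - \<eta> k)"
      using l2_cauchy_schwarz[OF gL L2T_diff[OF UL(2) \<eta>], of s] l2inner_diff_right[OF gL UL(2) \<eta>, of s] by simp
    also have "\<dots> \<le> l2norm g * \<epsilon>" using s near[of s] by (intro mult_left_mono l2norm_nonneg) (auto simp: S_def)
    finally have *: "cmod (l2inner g (U s \<eta>) - l2inner g \<eta>) \<le> \<epsilon> * l2norm g" by (simp add: mult.commute)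
    have "t *\<^sub>R (\<i> * l2inner g (U s \<eta>)) - t *\<^sub>R (\<i> * l2inner g \<eta>) = t *\<^sub>R (\<i> * (l2inner g (U s \<eta>) - l2inner g \<eta>))"
      by (simp add: algebra_simps)
    then have "norm (t *\<^sub>R (\<i> * l2inner g (U s \<eta>)) - t *\<^sub>R (\<i> * l2inner g \<eta>)) = \<bar>t\<bar> * cmod (l2inner g (U s \<eta>) - l2inner g \<eta>)"
      by (simp add: norm_mult)
    also have "\<dots> \<le> \<bar>t\<bar> * (\<epsilon> * l2norm g)" by (intro mult_left_mono * abs_ge_zero)
    finally show "norm (t *\<^sub>R (\<i> * l2inner g (U s \<eta>)) - t *\<^sub>R (\<i> * l2inner g \<eta>)) \<le> \<epsilon> * l2norm g * norm t"
      by (simp add: mult.commute)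
  qed
  have "norm (D b - D 0) \<le> \<epsilon> * l2norm g * norm (b - 0)"
    by (rule differentiable_bound[OF _ der on]) (auto simp: S_def)
  moreover have "D b - D 0 = l2inner g (\<lambda>k. U b \<psi> k - \<psi> k - \<i> * of_real b * \<eta> k)"
  proof -
    have "l2inner g (U 0 \<psi>) = l2inner g \<psi>"
      by (intro l2inner_cong gL UL \<psi> Wop_0_aeq) (simp add: aeq_TM)
    moreover have "l2inner g (\<lambda>k. U b \<psi> k - \<psi> k - \<i> * of_real b * \<eta> k) = l2inner g (\<lambda>k. U b \<psi> k - \<psi> k) - l2inner g (\<lambda>k. \<i> * of_real b * \<eta> k)"
      by (intro l2inner_diff_right gL L2T_diff L2T_scale UL \<psi> \<eta>)
    moreover have "l2inner g (\<lambda>k. U b \<psi> k - \<psi> k) = l2inner g (U b \<psi>) - l2inner g \<psi>"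
      by (intro l2inner_diff_right gL UL \<psi>)
    moreover have "l2inner g (\<lambda>k. \<i> * of_real b * \<eta> k) = \<i> * of_real b * l2inner g \<eta>"
      by (intro l2inner_scale_right gL \<eta>)
    ultimately show ?thesis by (simp add: D_def scaleR_conv_of_real)
  qed
  ultimately show "cmod (l2inner g (\<lambda>k. U b \<psi> k - \<psi> k - \<i> * of_real b * \<eta> k)) \<le> \<epsilon> * \<bar>b\<bar> * l2norm g"
    by (simp add: mult_ac)
qed

text \<open>The half of self-adjointness that goes beyond symmetry: an element of the domain of the
  adjoint lies in the domain of the generator. The increment estimate is divided by b, and strong
  continuity at \<eta> makes its constant small.\<close>

lemma generator_dual:
  assumes \<psi>: "\<psi> \<in> L2T" and \<eta>: "\<eta> \<in> L2T"
    and dual: "\<And>g h. generator U g h \<Longrightarrow> l2inner h \<psi> = l2inner g \<eta>"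
  shows "generator U \<psi> \<eta>"
  unfolding generator_iff
proof (intro conjI \<psi> \<eta>, rule tendstoI)
  fix \<epsilon> :: real assume \<epsilon>: "\<epsilon> > 0"
  have "((\<lambda>b. l2norm (\<lambda>k. U b \<eta> k - U 0 \<eta> k)) \<longlongrightarrow> 0) (at 0)" by (rule Wop_strongly_continuous[OF \<eta>])
  then have "\<forall>\<^sub>F b in at 0. l2norm (\<lambda>k. U b \<eta> k - U 0 \<eta> k) < \<epsilon> / 2" using \<epsilon> by (intro order_tendstoD) auto
  then obtain d where d: "d > 0" "\<And>b. b \<noteq> 0 \<Longrightarrow> \<bar>b\<bar> < d \<Longrightarrow> l2norm (\<lambda>k. U b \<eta> k - U 0 \<eta> k) < \<epsilon> / 2"
    unfolding eventually_at by (auto simp: dist_real_def)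
  have near: "l2norm (\<lambda>k. U s \<eta> k - \<eta> k) \<le> \<epsilon> / 2" if "\<bar>s\<bar> < d" for s
  proof -
    have "l2norm (\<lambda>k. U s \<eta> k - \<eta> k) = l2norm (\<lambda>k. U s \<eta> k - U 0 \<eta> k)"
      by (intro l2norm_cong L2T_diff Wop_contraction \<eta>) (use Wop_0_aeq[of \<eta>] in \<open>auto simp: aeq_TM\<close>)
    also have "\<dots> \<le> \<epsilon> / 2" using d(2)[of s] that \<epsilon> by (cases "s = 0") (auto simp: l2norm_zero)
    finally show ?thesis .
  qed
  show "\<forall>\<^sub>F b in at 0. dist (l2norm (\<lambda>k. quot b \<psi> k - \<eta> k)) 0 < \<epsilon>"
    unfolding eventually_at
  proof (intro exI conjI ballI impI)
    fix b :: real assume b: "b \<noteq> 0 \<and> dist b 0 < d"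
    have "l2norm (\<lambda>k. (U b \<psi> k - \<psi> k) - \<i> * of_real b * \<eta> k) \<le> \<epsilon> / 2 * \<bar>b\<bar>"
      using b \<epsilon> by (intro U_increment_estimate[OF \<psi> \<eta> dual] near) auto
    moreover have "(\<lambda>k. quot b \<psi> k - \<eta> k) = (\<lambda>k. ((U b \<psi> k - \<psi> k) - \<i> * of_real b * \<eta> k) / (\<i> * of_real b))"
      using b by (simp add: quot_def fun_eq_iff diff_divide_distrib)
    then have "l2norm (\<lambda>k. quot b \<psi> k - \<eta> k) = l2norm (\<lambda>k. (U b \<psi> k - \<psi> k) - \<i> * of_real b * \<eta> k) / \<bar>b\<bar>"
      using l2norm_divide[of "\<lambda>k. (U b \<psi> k - \<psi> k) - \<i> * of_real b * \<eta> k" "\<i> * of_real b"] by (simp add: norm_mult)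
    ultimately have "l2norm (\<lambda>k. quot b \<psi> k - \<eta> k) \<le> \<epsilon> / 2" using b by (simp add: pos_divide_le_eq)
    then show "dist (l2norm (\<lambda>k. quot b \<psi> k - \<eta> k)) 0 < \<epsilon>" using \<epsilon> by (simp add: l2norm_nonneg)
  qed (rule d(1))
qed

theorem generator_self_adjoint: "self_adjoint_L2 (generator U)"
  unfolding self_adjoint_L2_def
proof (intro conjI allI ballI impI iffI)
  show "g \<in> L2T" "h \<in> L2T" if "generator U g h" for g h using that by (auto simp: generator_iff)
  show "\<exists>g h. generator U g h \<and> l2norm (\<lambda>k. g k - \<psi> k) < \<epsilon>" if "\<psi> \<in> L2T" "\<epsilon> > 0" for \<psi> :: "real^'d \<Rightarrow> complex" and \<epsilon> :: real
    using Dset_dense[OF that] generator_on_K1[OF Dset_K1] by blast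
  show "l2inner h \<psi> = l2inner g \<eta>" if "generator U \<psi> \<eta>" "generator U g h" for \<psi> \<eta> g h
    by (rule generator_symmetric[OF that(2,1)])
  show "generator U \<psi> \<eta>" if "\<psi> \<in> L2T" "\<eta> \<in> L2T" "\<forall>g h. generator U g h \<longrightarrow> l2inner h \<psi> = l2inner g \<eta>" for \<psi> \<eta>
    by (rule generator_dual) (use that in blast)+
qed

end

section \<open>The core and the commutation relations\<close>

context morse_band
begin

lemma zero_K1: "(\<lambda>_. 0) \<in> K1"
  by (auto simp: K1_def periodic_T_def vnear_def)

lemma K1_sum:
  fixes n :: nat
  assumes "\<And>j. j < n \<Longrightarrow> f j \<in> K1"
  shows "(\<lambda>k. \<Sum>j<n. c * f j k) \<in> K1" "Aexpr E F (\<lambda>k. \<Sum>j<n. c * f j k) k = (\<Sum>j<n. c * Aexpr E F (f j) k)"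
proof -
  have "(\<lambda>k. \<Sum>j<n. c * f j k) \<in> K1 \<and> (\<forall>k. Bop (\<lambda>k. \<Sum>j<n. c * f j k) k = (\<Sum>j<n. c * Bop (f j) k))"
    using assms
  proof (induction n)
    case 0
    then show ?case using zero_K1 by (simp add: Bop_def)
  next
    case (Suc n)
    then have *: "f n \<in> K1" "(\<lambda>k. \<Sum>j<n. c * f j k) \<in> K1" "\<And>k. Bop (\<lambda>k. \<Sum>j<n. c * f j k) k = (\<Sum>j<n. c * Bop (f j) k)" by auto
    from K1_lin[OF *(1,2), of c] *(3) show ?case by (simp add: add.commute)
  qed
  then show "(\<lambda>k. \<Sum>j<n. c * f j k) \<in> K1" "Aexpr E F (\<lambda>k. \<Sum>j<n. c * f j k) k = (\<Sum>j<n. c * Aexpr E F (f j) k)"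
    by (auto simp: Aexpr_Bop sum_distrib_left mult.left_commute)
qed

lemma Aexpr_U:
  assumes "\<phi> \<in> K1"
  shows "l2norm (\<lambda>k. U s (Aexpr E F \<phi>) k - Aexpr E F (U s \<phi>) k) = 0"
  by (rule generator_unique[OF generator_U[OF generator_on_K1[OF assms]] generator_on_K1[OF Wop_K1[OF assms]]])

text \<open>The averages \<open>(1/n) \<Sum>\<^sub>j U\<^bsub>j\<tau>/n\<^esub> \<phi>\<close> stay in \<open>K1\<close>, and their images under the generator telescope
  to the difference quotient of the group at time \<open>\<tau>\<close>, up to the error of the difference quotient at time \<open>\<tau>/n\<close>.\<close>

lemma riemann_average_generator:
  fixes n :: nat
  assumes \<phi>: "\<phi> \<in> K1" and \<tau>: "\<tau> \<noteq> 0" and n: "n > 0"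
  defines "R \<equiv> (\<lambda>k. \<Sum>j<n. of_real (1 / n) * U (real j * (\<tau> / n)) \<phi> k)"
  shows "R \<in> K1" "l2norm (\<lambda>k. Aexpr E F R k - quot \<tau> \<phi> k) \<le> l2norm (\<lambda>k. quot (\<tau> / n) \<phi> k - Aexpr E F \<phi> k)"
proof -
  define t where "t = \<tau> / n"
  have t: "t \<noteq> 0" "\<tau> = n * t" using \<tau> n by (auto simp: t_def)
  have n0: "complex_of_real (real n) \<noteq> 0" using n by simp
  have \<phi>L: "\<phi> \<in> L2T" by (rule K1_L2T[OF \<phi>])
  have UK: "U s \<phi> \<in> K1" for s by (rule Wop_K1[OF \<phi>])
  show RK: "R \<in> K1" unfolding R_def by (intro K1_sum UK)
  have AL: "Aexpr E F \<phi> \<in> L2T" "Aexpr E F (U s \<phi>) \<in> L2T" for s by (intro Aexpr_L2T \<phi> UK)+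
  have dL: "(\<lambda>k. Aexpr E F \<phi> k - quot t \<phi> k) \<in> L2T" by (intro L2T_diff AL quot_L2T \<phi>L)
  have AR: "Aexpr E F R k = (\<Sum>j<n. of_real (1 / n) * Aexpr E F (U (real j * t) \<phi>) k)" for k
    unfolding R_def t_def[symmetric] by (rule K1_sum(2)) (rule UK)
  \<comment> \<open>By the group law each summand is a difference of consecutive orbit points, and
    the sum telescopes. Equality holds almost everywhere, as U 0 is the identity on the good set and
    0 off it.\<close>
  have q: "aeq (quot \<tau> \<phi>) (\<lambda>k. \<Sum>j<n. of_real (1 / n) * U (real j * t) (quot t \<phi>) k)"
    unfolding aeq_TM using Ogood_AE
  proof eventually_elim
    fix k assume k: "k \<in> Ogood"
    have "U (real j * t) (quot t \<phi>) k = (U (real (Suc j) * t) \<phi> k - U (real j * t) \<phi> k) / (\<i> * of_real t)" for j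
    proof -
      have "U (real j * t) (quot t \<phi>) k = inverse (\<i> * of_real t) * U (real j * t) (\<lambda>k. U t \<phi> k - \<phi> k) k"
        using Wop_scale[of "real j * t" "inverse (\<i> * of_real t)" "\<lambda>k. U t \<phi> k - \<phi> k" k]
        by (simp only: quot_def[abs_def] divide_inverse mult.commute[of _ "inverse (\<i> * complex_of_real t)"])
      also have "U (real j * t) (\<lambda>k. U t \<phi> k - \<phi> k) k = U (real (Suc j) * t) \<phi> k - U (real j * t) \<phi> k"
        using Wop_add[of "real j * t" t \<phi> k] by (simp add: Wop_diff algebra_simps)
      finally show ?thesis by (simp add: divide_inverse mult.commute)
    qed
    then have "(\<Sum>j<n. of_real (1 / n) * U (real j * t) (quot t \<phi>) k)
        = of_real (1 / n) * ((\<Sum>j<n. U (real (Suc j) * t) \<phi> k - U (real j * t) \<phi> k) / (\<i> * of_real t))"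
      by (simp only: sum_distrib_left sum_divide_distrib)
    also have "(\<Sum>j<n. U (real (Suc j) * t) \<phi> k - U (real j * t) \<phi> k) = U \<tau> \<phi> k - U 0 \<phi> k"
      using sum_lessThan_telescope[of "\<lambda>j. U (real j * t) \<phi> k" n] by (simp add: t(2))
    also have "of_real (1 / n) * ((U \<tau> \<phi> k - U 0 \<phi> k) / (\<i> * of_real t)) = quot \<tau> \<phi> k"
      using n0 by (simp add: quot_def t(2) Wop_0[OF k] mult_ac)
    finally show "quot \<tau> \<phi> k = (\<Sum>j<n. of_real (1 / n) * U (real j * t) (quot t \<phi>) k)" by simp
  qed
  define e where "e j k = of_real (1 / n) * (Aexpr E F (U (real j * t) \<phi>) k - U (real j * t) (quot t \<phi>) k)" for j k
  have eL: "e j \<in> L2T" for j unfolding e_def by (intro L2T_scale L2T_diff AL Wop_contraction(1) quot_L2T \<phi>L)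
  have en: "l2norm (e j) \<le> 1 / n * l2norm (\<lambda>k. Aexpr E F \<phi> k - quot t \<phi> k)" for j
  proof -
    define s where "s = real j * t"
    note L = AL(2)[of s] Wop_contraction(1)[OF AL(1), of s] Wop_contraction(1)[OF quot_L2T[OF \<phi>L], of s t]
    have "l2norm (\<lambda>k. Aexpr E F (U s \<phi>) k - U s (quot t \<phi>) k)
        \<le> l2norm (\<lambda>k. Aexpr E F (U s \<phi>) k - U s (Aexpr E F \<phi>) k) + l2norm (\<lambda>k. U s (Aexpr E F \<phi>) k - U s (quot t \<phi>) k)"
      by (rule l2norm_diff_triangle[OF L])
    also have "l2norm (\<lambda>k. Aexpr E F (U s \<phi>) k - U s (Aexpr E F \<phi>) k) = 0"
      by (subst l2norm_diff_commute) (rule Aexpr_U[OF \<phi>])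
    also have "l2norm (\<lambda>k. U s (Aexpr E F \<phi>) k - U s (quot t \<phi>) k) = l2norm (\<lambda>k. Aexpr E F \<phi> k - quot t \<phi> k)"
      using Wop_isometry[OF dL, of s] by (simp add: Wop_diff[abs_def])
    finally have "l2norm (\<lambda>k. Aexpr E F (U s \<phi>) k - U s (quot t \<phi>) k) \<le> l2norm (\<lambda>k. Aexpr E F \<phi> k - quot t \<phi> k)" by simp
    then have "1 / n * l2norm (\<lambda>k. Aexpr E F (U s \<phi>) k - U s (quot t \<phi>) k) \<le> 1 / n * l2norm (\<lambda>k. Aexpr E F \<phi> k - quot t \<phi> k)"
      by (intro mult_left_mono) auto
    then show ?thesis unfolding e_def s_def[symmetric] l2norm_scale by (simp add: norm_divide)
  qed
  have "l2norm (\<lambda>k. Aexpr E F R k - quot \<tau> \<phi> k) = l2norm (\<lambda>k. \<Sum>j<n. e j k)"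
  proof (rule l2norm_cong)
    show "(\<lambda>k. Aexpr E F R k - quot \<tau> \<phi> k) \<in> L2T" by (intro L2T_diff Aexpr_L2T RK quot_L2T \<phi>L)
    show "(\<lambda>k. \<Sum>j<n. e j k) \<in> L2T" by (rule L2T_sum) (auto intro: eL)
    show "aeq (\<lambda>k. Aexpr E F R k - quot \<tau> \<phi> k) (\<lambda>k. \<Sum>j<n. e j k)"
      using q unfolding aeq_TM by eventually_elim (simp add: AR e_def right_diff_distrib sum_subtractf)
  qed
  also have "\<dots> \<le> (\<Sum>j<n. l2norm (e j))" by (rule L2T_sum) (auto intro: eL)
  also have "\<dots> \<le> (\<Sum>j<n. 1 / n * l2norm (\<lambda>k. Aexpr E F \<phi> k - quot t \<phi> k))" by (intro sum_mono en)
  also have "\<dots> = l2norm (\<lambda>k. quot (\<tau> / n) \<phi> k - Aexpr E F \<phi> k)"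
    using n by (simp add: t_def l2norm_diff_commute)
  finally show "l2norm (\<lambda>k. Aexpr E F R k - quot \<tau> \<phi> k) \<le> l2norm (\<lambda>k. quot (\<tau> / n) \<phi> k - Aexpr E F \<phi> k)" .
qed

lemma riemann_average_close:
  fixes n :: nat
  assumes \<phi>: "\<phi> \<in> L2T" and g: "g \<in> L2T" and n: "n > 0" and \<tau>: "\<tau> > 0"
    and near: "\<And>s. 0 \<le> s \<Longrightarrow> s \<le> \<tau> \<Longrightarrow> l2norm (\<lambda>k. U s g k - g k) \<le> \<epsilon>"
  shows "l2norm (\<lambda>k. (\<Sum>j<n. of_real (1 / n) * U (real j * (\<tau> / n)) \<phi> k) - g k) \<le> l2norm (\<lambda>k. \<phi> k - g k) + \<epsilon>"
proof -
  define e where "e j k = of_real (1 / n) * (U (real j * (\<tau> / n)) \<phi> k - g k)" for j k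
  have UL: "U s \<phi> \<in> L2T" "U s g \<in> L2T" for s by (intro Wop_contraction \<phi> g)+
  have eL: "e j \<in> L2T" for j unfolding e_def by (intro L2T_scale L2T_diff UL g)
  have "l2norm (e j) \<le> 1 / n * (l2norm (\<lambda>k. \<phi> k - g k) + \<epsilon>)" if j: "j < n" for j
  proof -
    define s where "s = real j * (\<tau> / n)"
    have "s \<le> real n * (\<tau> / n)" unfolding s_def using j \<tau> by (intro mult_right_mono) auto
    then have s: "0 \<le> s" "s \<le> \<tau>" using n \<tau> by (auto simp: s_def)
    have "l2norm (\<lambda>k. U s \<phi> k - g k) \<le> l2norm (\<lambda>k. U s \<phi> k - U s g k) + l2norm (\<lambda>k. U s g k - g k)"
      by (rule l2norm_diff_triangle[OF UL g])
    also have "l2norm (\<lambda>k. U s \<phi> k - U s g k) = l2norm (\<lambda>k. \<phi> k - g k)"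
      using Wop_isometry[OF L2T_diff[OF \<phi> g], of s] by (simp add: Wop_diff[abs_def])
    finally have "l2norm (\<lambda>k. U s \<phi> k - g k) \<le> l2norm (\<lambda>k. \<phi> k - g k) + \<epsilon>" using near[OF s] by simp
    then have "1 / n * l2norm (\<lambda>k. U s \<phi> k - g k) \<le> 1 / n * (l2norm (\<lambda>k. \<phi> k - g k) + \<epsilon>)" by (intro mult_left_mono) auto
    then show ?thesis unfolding e_def s_def[symmetric] l2norm_scale by (simp add: norm_divide)
  qed
  then have "(\<Sum>j<n. l2norm (e j)) \<le> (\<Sum>j<n. 1 / n * (l2norm (\<lambda>k. \<phi> k - g k) + \<epsilon>))" by (intro sum_mono) auto
  also have "\<dots> = l2norm (\<lambda>k. \<phi> k - g k) + \<epsilon>" using n by simp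
  finally have "l2norm (\<lambda>k. \<Sum>j<n. e j k) \<le> l2norm (\<lambda>k. \<phi> k - g k) + \<epsilon>"
    using L2T_sum(2)[of "{..<n}" e] eL by fastforce
  moreover have "(\<Sum>j<n. e j k) = (\<Sum>j<n. of_real (1 / n) * U (real j * (\<tau> / n)) \<phi> k) - g k" for k
    using n by (simp add: e_def right_diff_distrib sum_subtractf)
  ultimately show ?thesis by simp
qed

text \<open>The order of choices matters: \<tau> is fixed by g and h alone, then \<phi> is taken
  close to g relative to \<tau>, then n so large that the difference quotient of \<phi> at \<tau>/n
  has converged, and the average is mollified last. In this way h is approached through difference
  quotients of g, although \<phi> is close to g in L^2 only.\<close>

lemma generator_approx_Dset:
  assumes gen: "generator U g h" and \<epsilon>: "\<epsilon> > 0"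
  shows "\<exists>\<phi>\<in>Dset E F. l2norm (\<lambda>k. \<phi> k - g k) < \<epsilon> \<and> l2norm (\<lambda>k. Aexpr E F \<phi> k - h k) < \<epsilon>"
proof -
  have g: "g \<in> L2T" and h: "h \<in> L2T" and lim: "((\<lambda>b. l2norm (\<lambda>k. quot b g k - h k)) \<longlongrightarrow> 0) (at 0)"
    using gen by (auto simp: generator_iff)
  have "((\<lambda>b. l2norm (\<lambda>k. U b g k - U 0 g k)) \<longlongrightarrow> 0) (at 0)" by (rule Wop_strongly_continuous[OF g])
  then have "\<forall>\<^sub>F b in at 0. l2norm (\<lambda>k. U b g k - U 0 g k) < \<epsilon> / 4" using \<epsilon> by (intro order_tendstoD) auto
  moreover have "\<forall>\<^sub>F b in at 0. l2norm (\<lambda>k. quot b g k - h k) < \<epsilon> / 4" using lim \<epsilon> by (intro order_tendstoD) auto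
  ultimately have "\<forall>\<^sub>F b in at 0. l2norm (\<lambda>k. U b g k - U 0 g k) < \<epsilon> / 4 \<and> l2norm (\<lambda>k. quot b g k - h k) < \<epsilon> / 4"
    by (rule eventually_conj)
  then obtain d where d: "d > 0" "\<And>b. b \<noteq> 0 \<Longrightarrow> \<bar>b\<bar> < d \<Longrightarrow> l2norm (\<lambda>k. U b g k - U 0 g k) < \<epsilon> / 4 \<and> l2norm (\<lambda>k. quot b g k - h k) < \<epsilon> / 4"
    unfolding eventually_at by (auto simp: dist_real_def)
  define \<tau> where "\<tau> = d / 2"
  have \<tau>: "\<tau> > 0" "\<tau> < d" using d(1) by (auto simp: \<tau>_def)
  have near: "l2norm (\<lambda>k. U s g k - g k) \<le> \<epsilon> / 4" if s: "0 \<le> s" "s \<le> \<tau>" for s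
  proof -
    have "l2norm (\<lambda>k. U s g k - g k) = l2norm (\<lambda>k. U s g k - U 0 g k)"
      by (intro l2norm_cong L2T_diff Wop_contraction g) (use Wop_0_aeq[of g] in \<open>auto simp: aeq_TM\<close>)
    also have "\<dots> \<le> \<epsilon> / 4" using d(2)[of s] s \<tau>(2) \<epsilon> by (cases "s = 0") (auto simp: l2norm_zero)
    finally show ?thesis .
  qed
  have qh: "l2norm (\<lambda>k. quot \<tau> g k - h k) < \<epsilon> / 4" using d(2)[of \<tau>] \<tau> by auto
  \<comment> \<open>The difference quotient at \<tau> multiplies an L^2 error by up to 2 / \<tau>,
    so the second bound leaves \<epsilon>/4.\<close>
  define \<delta> where "\<delta> = min (\<epsilon> / 8) (\<epsilon> * \<tau> / 8)"
  have \<delta>: "\<delta> > 0" using \<epsilon> \<tau> by (simp add: \<delta>_def)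
  obtain \<phi> where \<phi>: "\<phi> \<in> Dset E F" "l2norm (\<lambda>k. \<phi> k - g k) < \<delta>" using Dset_dense[OF g \<delta>] by blast
  have \<phi>K: "\<phi> \<in> K1" by (rule Dset_K1[OF \<phi>(1)])
  have \<phi>L: "\<phi> \<in> L2T" by (rule K1_L2T[OF \<phi>K])
  have "(\<lambda>n. \<tau> / real (Suc n)) \<longlonglongrightarrow> 0" by (rule LIMSEQ_Suc[OF lim_const_over_n])
  then have "filterlim (\<lambda>n. \<tau> / real (Suc n)) (at 0) sequentially"
    by (rule filterlim_atI) (use \<tau> in simp)
  moreover have "((\<lambda>b. l2norm (\<lambda>k. quot b \<phi> k - Aexpr E F \<phi> k)) \<longlongrightarrow> 0) (at 0)"
    using generator_on_K1[OF \<phi>K] by (simp add: generator_iff)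
  ultimately have "(\<lambda>n. l2norm (\<lambda>k. quot (\<tau> / real (Suc n)) \<phi> k - Aexpr E F \<phi> k)) \<longlonglongrightarrow> 0" by (rule filterlim_compose[rotated])
  then have "\<forall>\<^sub>F n in sequentially. l2norm (\<lambda>k. quot (\<tau> / real (Suc n)) \<phi> k - Aexpr E F \<phi> k) < \<epsilon> / 4" using \<epsilon> by (intro order_tendstoD) auto
  then obtain n0 where n0: "l2norm (\<lambda>k. quot (\<tau> / real (Suc n0)) \<phi> k - Aexpr E F \<phi> k) < \<epsilon> / 4"
    unfolding eventually_sequentially by blast
  define n where "n = Suc n0"
  have n: "n > 0" by (simp add: n_def)
  define R where "R k = (\<Sum>j<n. of_real (1 / n) * U (real j * (\<tau> / n)) \<phi> k)" for k
  have RK: "R \<in> K1" and R1: "l2norm (\<lambda>k. Aexpr E F R k - quot \<tau> \<phi> k) \<le> l2norm (\<lambda>k. quot (\<tau> / n) \<phi> k - Aexpr E F \<phi> k)"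
    using riemann_average_generator[OF \<phi>K _ n, of \<tau>] \<tau> unfolding R_def[abs_def] by auto
  have "l2norm (\<lambda>k. R k - g k) \<le> l2norm (\<lambda>k. \<phi> k - g k) + \<epsilon> / 4"
    unfolding R_def by (rule riemann_average_close[OF \<phi>L g n \<tau>(1) near])
  then have Rg: "l2norm (\<lambda>k. R k - g k) < \<epsilon> / 2" using \<phi>(2) \<epsilon> by (simp add: \<delta>_def)
  have qq: "l2norm (\<lambda>k. quot \<tau> \<phi> k - quot \<tau> g k) \<le> \<epsilon> / 4"
  proof -
    have "(\<lambda>k. quot \<tau> \<phi> k - quot \<tau> g k) = (\<lambda>k. ((U \<tau> \<phi> k - U \<tau> g k) - (\<phi> k - g k)) / (\<i> * of_real \<tau>))"
      by (simp add: quot_def fun_eq_iff flip: diff_divide_distrib)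
    then have "l2norm (\<lambda>k. quot \<tau> \<phi> k - quot \<tau> g k) = l2norm (\<lambda>k. (U \<tau> \<phi> k - U \<tau> g k) - (\<phi> k - g k)) / \<tau>"
      using \<tau> l2norm_divide[of "\<lambda>k. (U \<tau> \<phi> k - U \<tau> g k) - (\<phi> k - g k)" "\<i> * of_real \<tau>"] by (simp add: norm_mult)
    also have "\<dots> \<le> (l2norm (\<lambda>k. U \<tau> \<phi> k - U \<tau> g k) + l2norm (\<lambda>k. \<phi> k - g k)) / \<tau>"
      using \<tau> by (intro divide_right_mono l2norm_diff_le L2T_diff Wop_contraction \<phi>L g) auto
    also have "l2norm (\<lambda>k. U \<tau> \<phi> k - U \<tau> g k) = l2norm (\<lambda>k. \<phi> k - g k)"
      using Wop_isometry[OF L2T_diff[OF \<phi>L g], of \<tau>] by (simp add: Wop_diff[abs_def])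
    also have "(l2norm (\<lambda>k. \<phi> k - g k) + l2norm (\<lambda>k. \<phi> k - g k)) / \<tau> \<le> (\<epsilon> * \<tau> / 8 + \<epsilon> * \<tau> / 8) / \<tau>"
      using \<phi>(2) \<tau> by (intro divide_right_mono add_mono) (auto simp: \<delta>_def)
    also have "\<dots> = \<epsilon> / 4" using \<tau> by (simp add: field_simps)
    finally show ?thesis .
  qed
  have Rh: "l2norm (\<lambda>k. Aexpr E F R k - h k) < 3 * \<epsilon> / 4"
    using l2norm_diff_triangle[OF Aexpr_L2T[OF RK] quot_L2T[OF \<phi>L] h, of \<tau>]
      l2norm_diff_triangle[OF quot_L2T[OF \<phi>L] quot_L2T[OF g] h, of \<tau> \<tau>] R1 n0 qq qh unfolding n_def by linarith
  have \<epsilon>4: "\<epsilon> / 4 > 0" using \<epsilon> by simp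
  obtain \<phi>' where \<phi>': "\<phi>' \<in> Dset E F" "l2norm (\<lambda>k. \<phi>' k - R k) < \<epsilon> / 4" "l2norm (\<lambda>k. Aexpr E F \<phi>' k - Aexpr E F R k) < \<epsilon> / 4"
    by (rule K1_approx[OF RK \<epsilon>4]) blast
  have "l2norm (\<lambda>k. \<phi>' k - g k) < \<epsilon>"
    using l2norm_diff_triangle[OF Dset_L2T[OF \<phi>'(1)] K1_L2T[OF RK] g] \<phi>'(2) Rg \<epsilon> by linarith
  moreover have "l2norm (\<lambda>k. Aexpr E F \<phi>' k - h k) < \<epsilon>"
    using l2norm_diff_triangle[OF Aexpr_L2T[OF Dset_K1[OF \<phi>'(1)]] Aexpr_L2T[OF RK] h] \<phi>'(3) Rh by linarith
  ultimately show ?thesis using \<phi>'(1) by blast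
qed

theorem Dset_core: "is_core (generator U) (Dset E F)"
  unfolding is_core_def
proof (intro conjI ballI allI impI)
  show "\<exists>h. generator U \<phi> h" if "\<phi> \<in> Dset E F" for \<phi> using generator_on_K1[OF Dset_K1[OF that]] by blast
  fix g h assume gen: "generator U g h"
  have "\<exists>\<phi>. \<phi> \<in> Dset E F \<and> l2norm (\<lambda>k. \<phi> k - g k) < 1 / real (Suc n) \<and> l2norm (\<lambda>k. Aexpr E F \<phi> k - h k) < 1 / real (Suc n)" for n
    using generator_approx_Dset[OF gen, of "1 / real (Suc n)"] by auto
  then obtain \<phi> where \<phi>: "\<And>n. \<phi> n \<in> Dset E F" "\<And>n. l2norm (\<lambda>k. \<phi> n k - g k) < 1 / real (Suc n)"
    "\<And>n. l2norm (\<lambda>k. Aexpr E F (\<phi> n) k - h k) < 1 / real (Suc n)" by metis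
  have s: "a \<longlonglongrightarrow> 0" if "\<And>n. 0 \<le> a n" "\<And>n. a n < 1 / real (Suc n)" for a :: "nat \<Rightarrow> real"
    by (rule tendsto_sandwich[OF _ _ tendsto_const LIMSEQ_Suc[OF lim_1_over_n]])
      (auto intro!: always_eventually that(1) less_imp_le[OF that(2)] simp del: of_nat_Suc)
  show "\<exists>\<phi>s hs. (\<forall>n. \<phi>s n \<in> Dset E F \<and> generator U (\<phi>s n) (hs n)) \<and>
        (\<lambda>n. l2norm (\<lambda>k. \<phi>s n k - g k)) \<longlonglongrightarrow> 0 \<and> (\<lambda>n. l2norm (\<lambda>k. hs n k - h k)) \<longlonglongrightarrow> 0"
    using \<phi>(1) generator_on_K1[OF Dset_K1[OF \<phi>(1)]] s[OF l2norm_nonneg \<phi>(2)] s[OF l2norm_nonneg \<phi>(3)]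
    by (intro exI[of _ \<phi>] exI[of _ "\<lambda>n. Aexpr E F (\<phi> n)"]) auto
qed

text \<open>Half the divergence acts by multiplication and commutes with u, so the commutator
  retains only the derivative of u along X. The witness h is the generator applied to the
  product.\<close>

lemma commutator_multiplication:
  assumes \<phi>: "\<phi> \<in> Dset E F" and u: "periodic_T u" and du: "\<And>k. k \<in> Ogood \<Longrightarrow> (u has_derivative du k) (at k)"
    and cdu: "\<And>v. continuous_on Ogood (\<lambda>k. du k v)"
    and w: "\<And>k. k \<in> Ogood \<Longrightarrow> du k (Xfield E F k) = w k"
  shows "\<exists>h. generator U (\<lambda>k. of_real (u k) * \<phi> k) h \<and>
     aeq (\<lambda>k. \<i> * (h k - of_real (u k) * Aexpr E F \<phi> k)) (\<lambda>k. of_real (w k) * \<phi> k)"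
proof (intro exI conjI)
  note K = K1_multiply[OF Dset_K1[OF \<phi>] u du cdu]
  show "generator U (\<lambda>k. of_real (u k) * \<phi> k) (Aexpr E F (\<lambda>k. of_real (u k) * \<phi> k))"
    by (rule generator_on_K1[OF K(1)])
  show "aeq (\<lambda>k. \<i> * (Aexpr E F (\<lambda>k. of_real (u k) * \<phi> k) k - of_real (u k) * Aexpr E F \<phi> k)) (\<lambda>k. of_real (w k) * \<phi> k)"
    unfolding aeq_TM using Ogood_AE
  proof eventually_elim
    fix k assume k: "k \<in> Ogood"
    have "\<i> * (- \<i> * (a * B + c * p) - a * (- \<i> * B)) = c * p" for a B c p :: complex
      by (simp add: algebra_simps)
    then show "\<i> * (Aexpr E F (\<lambda>k. of_real (u k) * \<phi> k) k - of_real (u k) * Aexpr E F \<phi> k) = of_real (w k) * \<phi> k"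
      by (simp only: Aexpr_Bop K(2)[OF _ k] w[OF k])
  qed
qed

lemma gradient_Xfield: "k \<in> Ogood \<Longrightarrow> G k \<bullet> Xfield E F k = F (E k)"
  using Ogood_noncrit[of k] by (simp add: Xfield_def crit_def dot_square_norm)

theorem energy_commutator:
  assumes "\<phi> \<in> Dset E F"
  shows "\<exists>h. generator U (\<lambda>k. of_real (E k) * \<phi> k) h \<and>
     aeq (\<lambda>k. \<i> * (h k - of_real (E k) * Aexpr E F \<phi> k)) (\<lambda>k. of_real (F (E k)) * \<phi> k)"
proof (rule commutator_multiplication[OF assms E_periodic E_has_derivative])
  show "continuous_on Ogood (\<lambda>k. G k \<bullet> v)" for v by (intro continuous_intros)
qed (rule gradient_Xfield)

text \<open>All energies on the open good set are interior, so f coincides there with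
  \<open>fF\<close> and shares its derivative; its derivative along X is F(E) / F(E) = 1.\<close>

theorem time_commutator:
  assumes \<phi>: "\<phi> \<in> Dset E F" and f: "\<And>e. Emin < e \<Longrightarrow> e < Emax \<Longrightarrow> f e = fF e"
  shows "\<exists>h. generator U (\<lambda>k. of_real (f (E k)) * \<phi> k) h \<and>
     aeq (\<lambda>k. \<i> * (h k - of_real (f (E k)) * Aexpr E F \<phi> k)) \<phi>"
proof -
  have "\<exists>h. generator U (\<lambda>k. of_real (f (E k)) * \<phi> k) h \<and>
     aeq (\<lambda>k. \<i> * (h k - of_real (f (E k)) * Aexpr E F \<phi> k)) (\<lambda>k. of_real 1 * \<phi> k)"
  proof (rule commutator_multiplication[OF \<phi>])
    show "periodic_T (\<lambda>k. f (E k))" using E_periodic by (simp add: periodic_T_def)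
    fix k assume k: "k \<in> Ogood"
    show "((\<lambda>k. f (E k)) has_derivative (\<lambda>h. (G k \<bullet> h) / F (E k))) (at k)"
    proof (rule has_derivative_transform_within_open[OF fF_E_has_derivative[OF Ogood_noncrit[OF k]] Ogood_open k])
      show "fF (E x) = f (E x)" if "x \<in> Ogood" for x using E_noncrit[OF Ogood_noncrit[OF that]] by (simp add: f)
    qed
    show "(G k \<bullet> Xfield E F k) / F (E k) = 1"
      using gradient_Xfield[OF k] F_E_pos[OF Ogood_noncrit[OF k]] by simp
  next
    show "continuous_on Ogood (\<lambda>k. (G k \<bullet> v) / F (E k))" for v
      by (intro continuous_intros) (use F_E_pos[OF Ogood_noncrit] in force)+
  qed
  then show ?thesis by simp
qed

end

theorem mainTheorem2:
  fixes E :: "real^'d::finite \<Rightarrow> real"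
    and F :: "real \<Rightarrow> real"
    and kmin kmax :: "real^'d"
    and Emin Emax Er :: real
    and f :: "real \<Rightarrow> real"
  assumes E_periodic: "periodic_T E"
    and E_analytic: "real_analytic_Rd E"
    and E_morse: "morse E"
    and Emin_def: "E kmin = Emin" and Emax_def: "E kmax = Emax"
    and E_range: "\<And>k. Emin \<le> E k \<and> E k \<le> Emax"
    and Emin_lt: "Emin < Emax"
    and crit_def: "\<And>k. k \<in> crit E \<Longrightarrow>
        (definite (hessian E k) \<longrightarrow> lat_eq kmin k \<or> lat_eq kmax k)"
    and crit_indef: "\<And>k. k \<in> crit E \<Longrightarrow> \<not> definite (hessian E k) \<Longrightarrow> Emin < E k \<and> E k < Emax"
    and F_analytic: "real_analytic_R F {Emin..Emax}"
    and F_nonneg: "\<And>e. e \<in> {Emin..Emax} \<Longrightarrow> F e \<ge> 0"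
    and F_zero: "\<And>e. e \<in> {Emin..Emax} \<Longrightarrow> F e = 0 \<longleftrightarrow> e = Emin \<or> e = Emax"
    and F_linear: "\<exists>C. \<forall>e\<in>{Emin..Emax}. F e \<le> C * \<bar>e - Emin\<bar> \<and> F e \<le> C * \<bar>Emax - e\<bar>"
    and Er_in: "Emin < Er" "Er < Emax"
    and f_def: "\<And>e. e \<in> {Emin<..<Emax} \<Longrightarrow> f e = (LBINT x=Er..e. 1 / F x)"
  shows "\<exists>U :: real \<Rightarrow> (real^'d \<Rightarrow> complex) \<Rightarrow> (real^'d \<Rightarrow> complex).
     (\<forall>b. \<forall>\<phi>\<in>Dset E F. aeq (U b \<phi>) (Wop E F b \<phi>)) \<and>
     strongly_continuous_unitary_group U \<and>
     self_adjoint_L2 (generator U) \<and>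
     is_core (generator U) (Dset E F) \<and>
     (\<forall>\<phi>\<in>Dset E F. generator U \<phi> (Aexpr E F \<phi>)) \<and>
     (\<forall>\<phi>\<in>Dset E F. \<exists>h. generator U (\<lambda>k. complex_of_real (E k) * \<phi> k) h \<and>
         aeq (\<lambda>k. \<i> * (h k - complex_of_real (E k) * Aexpr E F \<phi> k))
             (\<lambda>k. complex_of_real (F (E k)) * \<phi> k)) \<and>
     (\<forall>\<phi>\<in>Dset E F. \<exists>h. generator U (\<lambda>k. complex_of_real (f (E k)) * \<phi> k) h \<and>
         aeq (\<lambda>k. \<i> * (h k - complex_of_real (f (E k)) * Aexpr E F \<phi> k)) \<phi>)"
proof -
  interpret morse_band E F kmin kmax Emin Emax Er
    by unfold_locales (use assms in auto)
  have f: "f e = fF e" if "Emin < e" "e < Emax" for e using f_def[of e] that by (simp add: fF_def)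
  show ?thesis
  \<comment> \<open>The pointwise formula makes sense for every representative of an L^2 function,
    so the operator itself serves as its own extension.\<close>
  proof (intro exI[of _ "Wop E F"] conjI allI ballI)
    show "aeq (Wop E F b \<phi>) (Wop E F b \<phi>)" for b \<phi> by (rule aeq_refl) simp
    show "generator (Wop E F) \<phi> (Aexpr E F \<phi>)" if "\<phi> \<in> Dset E F" for \<phi> by (rule generator_on_K1[OF Dset_K1[OF that]])
  qed (rule Wop_group generator_self_adjoint Dset_core energy_commutator time_commutator f | assumption)+
qed

end
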